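(* Let $\Gamma\subset\mathbb{Q}^*$ be finitely generated of positive rank. For each prime $p$ let $S_p=A_p\setminus\ker\varphi_p$, and $S=\prod_pS_p\subset A$. Then $$\frac{\nu(S)}{\nu(A)}=\prod_p\Bigl(1-\frac{1}{[M_p:\mathbb{Q}]}\Bigr)=\prod_p\Bigl(1-\frac{1}{(p-1)\#\overline\Gamma_p}\Bigr).$$ If moreover $\Gamma\not\subset(\mathbb{Q}^* )^2$, then $S$ is non-empty and $$\frac{\nu(G\cap S)}{\nu(G)}=\Biggl(1+\sum_{\substack{b\in\overline\Gamma_2\setminus\{1\}\\ d(b)\equiv1\bmod4}}\ \prod_{p\mid 2\cdot d(b)}\frac{-1}{[M_p:\mathbb{Q}]-1}\Biggr)\cdot\frac{\nu(S)}{\nu(A)}.$$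
   Context: Put $\Gamma_\infty=\{x\in\mathbb{C}^*: x^n\in\Gamma$ for some $n\ge1\}$, $\Gamma_{p^\infty}=\{x\in\mathbb{C}^*: x^{p^n}\in\Gamma$ for some $n\ge1\}$ and $\Gamma^{1/p}=\{x\in\mathbb{C}^*:x^p\in\Gamma\}$ for primes $p$. Let $A=\mathrm{Aut}_{\Gamma_\infty\cap\mathbb{Q}^*}(\Gamma_\infty)$ (group automorphisms fixing $\Gamma_\infty\cap\mathbb{Q}^*$ pointwise), $A_p=\mathrm{Aut}_{\Gamma_{p^\infty}\cap\mathbb{Q}^*}(\Gamma_{p^\infty})$, with the natural isomorphism $A\cong\prod_pA_p$ given by restriction. $G=\mathrm{Gal}(\mathbb{Q}(\Gamma_\infty)/\mathbb{Q})$ is viewed as a subgroup of $A$ by restricting field automorphisms to $\Gamma_\infty$. $\nu_p$ is the Haar measure on $A_p$ with $\nu_p(A_p)=1$ and $\nu=\prod_p\nu_p$. $\varphi_p:A_p\to\mathrm{Aut}_{\Gamma^{1/p}\cap\mathbb{Q}^*}(\Gamma^{1/p})$ is the restriction map. $M_p=\mathbb{Q}(\Gamma^{1/p})$, $\overline\Gamma_p=\mathrm{im}[\Gamma\to\mathbb{Q}^*/(\mathbb{Q}^* )^p]$, and for $b\in\mathbb{Q}^*/(\mathbb{Q}^* )^2$, $d(b)$ denotes the discriminant of the quadratic field $\mathbb{Q}(\sqrt b)$. *)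

theory Defs
  imports
    "HOL-Probability.Probability"
    "HOL-Library.Extended_Nat"
    "HOL-Algebra.Bij"
    "HOL-Algebra.Generated_Groups"
    "HOL-Algebra.Generated_Fields"
    "HOL-Algebra.Embedded_Algebras"
    "HOL-Algebra.QuotRing"
    "HOL-Algebra.Algebraic_Closure_Type"
begin

section \<open>Multiplicative groups of numbers\<close>

definition primes :: "nat set"
  where "primes = {p. Factorial_Ring.prime p}"

abbreviation complex_field :: "complex ring"
  where "complex_field \<equiv> ring_of_type_algebra"

definition rat_units :: "complex monoid"
  where "rat_units = (mult_of complex_field)\<lparr>carrier := \<rat> - {0}\<rparr>"

definition finitely_generated :: "complex set \<Rightarrow> bool"
  where "finitely_generated \<Gamma> \<longleftrightarrow>
    (\<exists>B. finite B \<and> B \<subseteq> \<Gamma> \<and> generate (mult_of complex_field) B = \<Gamma>)"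

definition mult_independent :: "complex set \<Rightarrow> bool"
  where "mult_independent B \<longleftrightarrow>
    (\<forall>k :: complex \<Rightarrow> int. (\<Prod>b\<in>B. b powi k b) = 1 \<longrightarrow> (\<forall>b\<in>B. k b = 0))"

definition mult_rank :: "complex set \<Rightarrow> enat"
  where "mult_rank \<Gamma> = (SUP B\<in>{B. B \<subseteq> \<Gamma> \<and> finite B \<and> mult_independent B}. enat (card B))"

definition root_closure :: "complex set \<Rightarrow> complex set"
  where "root_closure \<Gamma> = {x. x \<noteq> 0 \<and> (\<exists>n\<ge>1. x ^ n \<in> \<Gamma>)}"

definition p_root_closure :: "complex set \<Rightarrow> nat \<Rightarrow> complex set"
  where "p_root_closure \<Gamma> p = {x. x \<noteq> 0 \<and> (\<exists>n\<ge>1. x ^ (p ^ n) \<in> \<Gamma>)}"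

definition p_roots :: "complex set \<Rightarrow> nat \<Rightarrow> complex set"
  where "p_roots \<Gamma> p = {x. x \<noteq> 0 \<and> x ^ p \<in> \<Gamma>}"

definition rat_powers :: "nat \<Rightarrow> complex set"
  where "rat_powers p = (\<lambda>x. x ^ p) ` (\<rat> - {0})"

text \<open>The image of \<open>\<Gamma>\<close> in the quotient group \<open>rat_units Mod rat_powers p\<close>.\<close>

definition power_classes :: "complex set \<Rightarrow> nat \<Rightarrow> complex set set"
  where "power_classes \<Gamma> p = (\<lambda>x. rat_powers p #>\<^bsub>rat_units\<^esub> x) ` \<Gamma>"


section \<open>Subfields of the complex numbers\<close>

definition rat_adjoin :: "complex set \<Rightarrow> complex set"
  where "rat_adjoin B = generate_field complex_field (\<rat> \<union> B)"

definition degree_over_rat :: "complex set \<Rightarrow> nat"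
  where "degree_over_rat L = ring.dim complex_field \<rat> L"

text \<open>As in \<^const>\<open>auto\<close>, automorphisms are made extensional, so that each is counted once.\<close>

definition galois_group :: "complex set \<Rightarrow> (complex \<Rightarrow> complex) set"
  where "galois_group L = {restrict \<sigma> L | \<sigma>.
    \<sigma> \<in> ring_iso (complex_field\<lparr>carrier := L\<rparr>) (complex_field\<lparr>carrier := L\<rparr>) \<and>
    (\<forall>x\<in>\<rat>. \<sigma> x = x)}"

text \<open>
  The discriminant \<open>det (\<sigma>\<^sub>i \<omega>\<^sub>j)\<^sup>2\<close> of a quadratic field \<open>K\<close>, where \<open>\<omega>\<^sub>1 = \<alpha>\<close>, \<open>\<omega>\<^sub>2 = \<beta>\<close>
  is a basis of the ring of integers over the rational integers, \<open>\<sigma>\<^sub>1\<close> is the inclusion of \<open>K\<close>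
  in the complex numbers and \<open>\<sigma>\<^sub>2 = \<tau>\<close> the other embedding.
\<close>

definition quadratic_disc :: "complex set \<Rightarrow> int"
  where "quadratic_disc K = (THE d. \<exists>\<alpha> \<beta> \<tau>.
    {x \<in> K. algebraic_int x} = {of_int m * \<alpha> + of_int n * \<beta> | m n. True} \<and>
    \<tau> \<in> galois_group K \<and> \<tau> \<noteq> (\<lambda>x\<in>K. x) \<and>
    of_int d = (\<alpha> * \<tau> \<beta> - \<beta> * \<tau> \<alpha>)\<^sup>2)"

text \<open>
  Here \<open>b\<close> is a coset of \<open>rat_powers 2\<close>. The square roots of all its elements generate the same
  field as those of a single representative.
\<close>

definition class_disc :: "complex set \<Rightarrow> int"
  where "class_disc b = quadratic_disc (rat_adjoin {x. x\<^sup>2 \<in> b})"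


section \<open>Automorphism groups fixing the rational elements\<close>

definition rat_aut_group :: "complex set \<Rightarrow> (complex \<Rightarrow> complex) monoid"
  where "rat_aut_group D =
    (let H = (mult_of complex_field)\<lparr>carrier := D\<rparr>
     in (AutoGroup H)\<lparr>carrier := {\<sigma> \<in> auto H. \<forall>x\<in>D \<inter> \<rat>. \<sigma> x = x}\<rparr>)"

text \<open>The profinite topology is that of pointwise convergence on the discrete set \<open>D\<close>.\<close>

definition rat_aut_topology :: "complex set \<Rightarrow> (complex \<Rightarrow> complex) topology"
  where "rat_aut_topology D =
    subtopology (product_topology (\<lambda>_. discrete_topology D) D) (carrier (rat_aut_group D))"

definition borel_on :: "'a topology \<Rightarrow> 'a measure"
  where "borel_on T = sigma (topspace T) {U. openin T U}"

definition haar_measure :: "('a, 'b) monoid_scheme \<Rightarrow> 'a topology \<Rightarrow> 'a measure \<Rightarrow> bool"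
  where "haar_measure G T \<mu> \<longleftrightarrow>
    sets \<mu> = sets (borel_on T) \<and>
    (\<forall>g\<in>carrier G. \<forall>B\<in>sets \<mu>. emeasure \<mu> (g <#\<^bsub>G\<^esub> B) = emeasure \<mu> B) \<and>
    emeasure \<mu> (topspace T) \<noteq> 0 \<and>
    (\<forall>K. compactin T K \<longrightarrow> emeasure \<mu> K < \<infinity>) \<and>
    (\<forall>B\<in>sets \<mu>. emeasure \<mu> B = (INF U\<in>{U. openin T U \<and> B \<subseteq> U}. emeasure \<mu> U)) \<and>
    (\<forall>U. openin T U \<longrightarrow> emeasure \<mu> U = (SUP K\<in>{K. compactin T K \<and> K \<subseteq> U}. emeasure \<mu> K))"

definition A_group :: "complex set \<Rightarrow> (complex \<Rightarrow> complex) monoid"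
  where "A_group \<Gamma> = rat_aut_group (root_closure \<Gamma>)"

definition Ap_group :: "complex set \<Rightarrow> nat \<Rightarrow> (complex \<Rightarrow> complex) monoid"
  where "Ap_group \<Gamma> p = rat_aut_group (p_root_closure \<Gamma> p)"

text \<open>The natural isomorphism from \<open>A_group \<Gamma>\<close> to the product of the \<open>Ap_group \<Gamma> p\<close>.\<close>

definition A_to_product :: "complex set \<Rightarrow> (complex \<Rightarrow> complex) \<Rightarrow> nat \<Rightarrow> complex \<Rightarrow> complex"
  where "A_to_product \<Gamma> \<sigma> = (\<lambda>p\<in>primes. restrict \<sigma> (p_root_closure \<Gamma> p))"

text \<open>The product measure, transported along the inverse of that isomorphism.\<close>

definition A_measure ::
  "complex set \<Rightarrow> (nat \<Rightarrow> (complex \<Rightarrow> complex) measure) \<Rightarrow> (complex \<Rightarrow> complex) measure"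
  where "A_measure \<Gamma> \<nu>\<^sub>p =
    distr (\<Pi>\<^sub>M p\<in>primes. \<nu>\<^sub>p p)
      (borel_on (rat_aut_topology (root_closure \<Gamma>)))
      (the_inv_into (carrier (A_group \<Gamma>)) (A_to_product \<Gamma>))"

definition G_subgroup :: "complex set \<Rightarrow> (complex \<Rightarrow> complex) set"
  where "G_subgroup \<Gamma> =
    (\<lambda>\<sigma>. restrict \<sigma> (root_closure \<Gamma>)) ` galois_group (rat_adjoin (root_closure \<Gamma>))"

definition restriction_map :: "complex set \<Rightarrow> nat \<Rightarrow> (complex \<Rightarrow> complex) \<Rightarrow> complex \<Rightarrow> complex"
  where "restriction_map \<Gamma> p \<sigma> = restrict \<sigma> (p_roots \<Gamma> p)"

definition Sp_set :: "complex set \<Rightarrow> nat \<Rightarrow> (complex \<Rightarrow> complex) set"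
  where "Sp_set \<Gamma> p = carrier (Ap_group \<Gamma> p) -
    kernel (Ap_group \<Gamma> p) (rat_aut_group (p_roots \<Gamma> p)) (restriction_map \<Gamma> p)"

definition S_set :: "complex set \<Rightarrow> (complex \<Rightarrow> complex) set"
  where "S_set \<Gamma> = {\<sigma> \<in> carrier (A_group \<Gamma>). A_to_product \<Gamma> \<sigma> \<in> (\<Pi>\<^sub>E p\<in>primes. Sp_set \<Gamma> p)}"

definition M_degree :: "complex set \<Rightarrow> nat \<Rightarrow> nat"
  where "M_degree \<Gamma> p = degree_over_rat (rat_adjoin (p_roots \<Gamma> p))"

end

theory Submission
  imports Defs "HOL-Number_Theory.Number_Theory"
begin

text \<open>
 An automorphism \<open>\<xi>\<close> in \<open>A\<close> comes from the Galois group if and only if it respects every expression of a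
 square root \<open>x\<close> of a rational number, \<open>x\<close> in \<open>\<Gamma>\<^sub>\<infinity>\<close>, by roots of unity; these are the only relations
 between radicals besides the obvious ones (Kummer theory over the abelian field generated by the
 roots of unity). Hence the indicator function of \<open>G\<close> is the average of finitely many quadratic characters of
 \<open>A\<close>, indexed by square classes. Writing the squarefree part of a class as \<open>\<plusminus>1\<close> or \<open>\<plusminus>2\<close> times a product of the
 numbers \<open>(-1)^((p-1)/2) p\<close>, whose square roots are Gauss products in the \<open>p\<close>-th cyclotomic field,
 each such character is a product of characters of the \<open>A\<^sub>p\<close>. Its integral over \<open>S\<close> is therefore an Euler
 product, whose local factors follow from the orthogonality relations.
\<close>

text \<open>The obstacle: a square root of a rational number is a radical and also a sum of roots of
  unity, and a group automorphism need not treat the two alike. \<open>chi\<close> is the product of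
  both signs. Field automorphisms arise as rational linear extensions (\<open>lext\<close>) of maps
  on a multiplicative group; \<open>relpres\<close> says that such an extension exists.
  Orthogonality needs many group automorphisms. They exist because the group of nonzero complex
  numbers is divisible: a homomorphism on a subgroup extends to it and can be made to move any
  element outside the subgroup. Over S_p, a nontrivial character that is trivial on the kernel of
  phi_p integrates to -1/[M_p:Q]; dividing by the mass 1 - 1/[M_p:Q] of S_p gives the factor
  -1/([M_p:Q] - 1). Characters involving the square root of 2 are nontrivial on the kernel of phi_2
  and integrate to 0, which leaves the discriminants congruent to 1 modulo 4. The classes of m and
  -m have equal integrals over S, and the classes of 1 and -1 are the only ones with nonzero
  integral over A, so numerator and denominator acquire the same factor 2.\<close>

definition mgrp :: "complex set \<Rightarrow> bool"
 where "mgrp B \<longleftrightarrow> 1 \<in> B \<and> 0 \<notin> B \<and> (\<forall>x\<in>B. \<forall>y\<in>B. x * y \<in> B) \<and> (\<forall>x\<in>B. inverse x \<in> B)"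

text \<open>The target is the group of all nonzero complex numbers, which is divisible; values
  outside \<open>B\<close> are arbitrary.\<close>

definition mhom :: "complex set \<Rightarrow> (complex \<Rightarrow> complex) \<Rightarrow> bool"
 where "mhom B h \<longleftrightarrow> (\<forall>x\<in>B. h x ~= 0) \<and> (\<forall>x\<in>B. \<forall>y\<in>B. h (x * y) = h x * h y)"

lemma mgrp_one: "mgrp B ==> 1 \<in> B"
 and mgrp_nonzero: "mgrp B ==> x \<in> B ==> x ~= 0"
 and mgrp_mult: "mgrp B ==> x \<in> B ==> y \<in> B ==> x * y \<in> B"
 and mgrp_inverse: "mgrp B ==> x \<in> B ==> inverse x \<in> B" by (auto simp: mgrp_def)

lemma mgrp_divide: "mgrp B ==> x \<in> B ==> y \<in> B ==> x / y \<in> B"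
 by (simp add: divide_inverse mgrp_mult mgrp_inverse)

lemma mgrp_power: "mgrp B ==> x \<in> B ==> x ^ n \<in> B" by (induction n) (auto simp: mgrp_one mgrp_mult)

lemma mgrp_powi: "mgrp B ==> x \<in> B ==> x powi k \<in> B"
 by (cases "k \<ge> 0") (auto simp: power_int_def mgrp_power mgrp_inverse)

lemma mgrp_prod: "mgrp B ==> (\<And>i. i \<in> I ==> f i \<in> B) ==> prod f I \<in> B"
 by (induction I rule: infinite_finite_induct) (auto simp: mgrp_one mgrp_mult)

lemma mgrp_Int: "mgrp B ==> mgrp C ==> mgrp (B \<inter> C)" by (auto simp: mgrp_def)

lemma mgrp_Rats: "mgrp (\<rat> - {0})" by (auto simp: mgrp_def)

lemma mhom_nonzero: "mhom B h ==> x \<in> B ==> h x ~= 0"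
 and mhom_mult: "mhom B h ==> x \<in> B ==> y \<in> B ==> h (x * y) = h x * h y" by (auto simp: mhom_def)

lemma mhom_one: "mgrp B ==> mhom B h ==> h 1 = 1"
 using mhom_mult[of B h 1 1] mhom_nonzero[of B h 1] mgrp_one[of B] by auto

lemma mhom_inverse:
 assumes "mgrp B" "mhom B h" "x \<in> B" shows "h (inverse x) = inverse (h x)"
proof -
 have "h x * h (inverse x) = 1" using assms mhom_mult[OF assms(2), of x "inverse x"] mhom_one[of B h] by (simp add: mgrp_inverse mgrp_nonzero)
 then show ?thesis by (metis inverse_unique)
qed

lemma mhom_divide:
 "mgrp B ==> mhom B h ==> x \<in> B ==> y \<in> B ==> h (x / y) = h x / h y"
 by (simp add: divide_inverse mhom_mult mgrp_inverse mhom_inverse)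

lemma mhom_power: "mgrp B ==> mhom B h ==> x \<in> B ==> h (x ^ n) = h x ^ n"
 by (induction n) (auto simp: mhom_one mhom_mult mgrp_power)

lemma mhom_powi: "mgrp B ==> mhom B h ==> x \<in> B ==> h (x powi k) = h x powi k"
 by (cases "k \<ge> 0") (auto simp: power_int_def mhom_power mgrp_power mhom_inverse mgrp_inverse)

lemma mhom_prod:
 "mgrp B ==> mhom B h ==> (\<And>i. i \<in> I ==> f i \<in> B) ==> h (prod f I) = (\<Prod>i\<in>I. h (f i))"
 by (induction I rule: infinite_finite_induct) (auto simp: mhom_one mhom_mult mgrp_prod)

lemma mhom_subset: "mhom B h ==> C \<subseteq> B ==> mhom C h" by (auto simp: mhom_def)

lemma mhom_id: "mgrp B ==> mhom B (\<lambda>x. x)" by (auto simp: mhom_def mgrp_nonzero)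

section \<open>Extension of homomorphisms into the divisible group of nonzero complex numbers\<close>

text \<open>The hypothesis \<open>agree\<close> is what makes
  \<open>b * x powi k \<mapsto> h b * c powi k\<close> independent of the way an element is
  written.\<close>

lemma mhom_extend_adjoin:
 assumes B: "mgrp B" and h: "mhom B h" and x: "x ~= 0" and c: "c ~= 0"
  and agree: "\<And>k::int. x powi k \<in> B ==> h (x powi k) = c powi k"
 obtains C h' where "mgrp C" "mhom C h'" "B \<subseteq> C" "x \<in> C" "\<And>b. b \<in> B ==> h' b = h b" "h' x = c"
proof -
 define C where "C = {b * x powi k | b k. b \<in> B}"
 define h' where "h' y = (SOME z. \<exists>b k. b \<in> B \<and> y = b * x powi k \<and> z = h b * c powi k)" for y
 have uniq: "h b * c powi k = h b' * c powi k'"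
  if "b \<in> B" "b' \<in> B" "b * x powi k = b' * x powi k'" for b b' k k'
 proof -
  have nz: "b ~= 0" "b' ~= 0" using that B mgrp_nonzero by auto
  have eq: "x powi (k - k') = b' / b" using that(3) nz x by (simp add: power_int_diff field_simps)
  then have "x powi (k - k') \<in> B" using that B by (simp add: mgrp_divide)
  then have "h (b' / b) = c powi (k - k')" using agree eq by metis
  then have "h b' / h b = c powi (k - k')" using B h that by (simp add: mhom_divide)
  then show ?thesis using mhom_nonzero[OF h] that c by (simp add: power_int_diff field_simps)
 qed
 have h'_eq: "h' (b * x powi k) = h b * c powi k" if "b \<in> B" for b k unfolding h'_def
 proof (rule some_equality)
  show "\<exists>b' k'. b' \<in> B \<and> b * x powi k = b' * x powi k' \<and> h b * c powi k = h b' * c powi k'" using that by blast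
 qed (metis uniq that)
 show ?thesis
 proof
  show "mgrp C" unfolding mgrp_def
  proof (intro conjI ballI)
   show "1 \<in> C" unfolding C_def using mgrp_one[OF B] by (intro CollectI exI[of _ 1] exI[of _ "0::int"]) auto
   show "0 \<notin> C" using x mgrp_nonzero[OF B] by (auto simp: C_def)
  next
   fix y z assume "y \<in> C" "z \<in> C"
   then obtain b k b' k' where "b \<in> B" "b' \<in> B" "y = b * x powi k" "z = b' * x powi k'" by (auto simp: C_def)
   then have "y * z = (b * b') * x powi (k + k')" "b * b' \<in> B" using x B by (auto simp: power_int_add mgrp_mult)
   then show "y * z \<in> C" by (auto simp: C_def)
  next
   fix y assume "y \<in> C"
   then obtain b k where "b \<in> B" "y = b * x powi k" by (auto simp: C_def)
   then have "inverse y = inverse b * x powi (- k)" "inverse b \<in> B" using B by (auto simp: power_int_minus mgrp_inverse)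
   then show "inverse y \<in> C" by (auto simp: C_def)
  qed
  show "mhom C h'" unfolding mhom_def
  proof (intro conjI ballI)
   fix y assume "y \<in> C"
   then show "h' y ~= 0" using h'_eq mhom_nonzero[OF h] c by (auto simp: C_def)
  next
   fix y z assume "y \<in> C" "z \<in> C"
   then obtain b k b' k' where *: "b \<in> B" "b' \<in> B" "y = b * x powi k" "z = b' * x powi k'" by (auto simp: C_def)
   then have bb: "y * z = (b * b') * x powi (k + k')" "b * b' \<in> B" using x B by (auto simp: power_int_add mgrp_mult)
   have "h' (y * z) = h (b * b') * c powi (k + k')" unfolding bb(1) by (rule h'_eq[OF bb(2)])
   then show "h' (y * z) = h' y * h' z" using * c h by (simp add: h'_eq mhom_mult power_int_add)
  qed
  show "B \<subseteq> C"
  proof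
   fix b assume "b \<in> B" then show "b \<in> C" unfolding C_def by (intro CollectI exI[of _ b] exI[of _ "0::int"]) auto
  qed
  show "x \<in> C" unfolding C_def using mgrp_one[OF B] by (intro CollectI exI[of _ 1] exI[of _ "1::int"]) auto
  show "h' b = h b" if "b \<in> B" for b using h'_eq[OF that, of 0] by simp
  show "h' x = c" using h'_eq[OF mgrp_one[OF B], of 1] mhom_one[OF B h] by simp
 qed
qed

text \<open>If no positive power of \<open>x\<close> lies in \<open>B\<close>, every nonzero value
  is admissible. Otherwise let \<open>n\<close> be the least exponent with
  \<open>x ^ n \<in> B\<close>: the admissible values are the \<open>n\<close>-th roots of
  \<open>h (x ^ n)\<close>, and \<open>x \<notin> B\<close> gives \<open>n \<ge> 2\<close>, hence at
  least two candidates.\<close>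

lemma ex_mhom_value_avoiding:
 assumes B: "mgrp B" and h: "mhom B h" and x: "x ~= 0" "x \<notin> B"
 obtains c where "c ~= 0" "c ~= z" "\<And>k::int. x powi k \<in> B ==> h (x powi k) = c powi k"
proof (cases "\<exists>n\<ge>1. x ^ n \<in> B")
 case False
 have zero: "k = 0" if "x powi k \<in> B" for k :: int
 proof (rule ccontr)
  assume "k ~= 0"
  have "x ^ nat \<bar>k\<bar> \<in> B"
  proof (cases "k \<ge> 0")
   case True then show ?thesis using that by (simp add: power_int_def)
  next
   case False
   then show ?thesis using mgrp_inverse[OF B that] by (simp add: power_int_def flip: power_inverse)
  qed
  moreover have "nat \<bar>k\<bar> \<ge> 1" using \<open>k ~= 0\<close> by simp
  ultimately show False using False by blast
 qed
 obtain c :: complex where "c ~= 0" "c ~= z" using ex_new_if_finite[of "{0, z}"] infinite_UNIV_char_0 by auto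
 then show ?thesis using zero that[of c] mhom_one[OF B h] by fastforce
next
 case True
 define n where "n = (LEAST n. n \<ge> 1 \<and> x ^ n \<in> B)"
 have n: "n \<ge> 1" "x ^ n \<in> B" using LeastI_ex[OF True] unfolding n_def by auto
 have n_min: "n \<le> m" if "m \<ge> 1" "x ^ m \<in> B" for m unfolding n_def using that by (auto intro: Least_le)
 have "n ~= 1" using n x by auto
 then have n2: "n \<ge> 2" using n by simp
 have nz: "h (x ^ n) ~= 0" using h n mhom_nonzero by blast
 have "card {c. c ^ n = h (x ^ n)} = n" using card_nth_roots[OF nz] n by simp
 then obtain c where c: "c ^ n = h (x ^ n)" "c ~= z"
 proof -
  have "\<not> {c. c ^ n = h (x ^ n)} \<subseteq> {z}"
  proof
   assume "{c. c ^ n = h (x ^ n)} \<subseteq> {z}"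
   then have "card {c. c ^ n = h (x ^ n)} \<le> card {z}" by (intro card_mono) auto
   then show False using n2 \<open>card {c. c ^ n = h (x ^ n)} = n\<close> by simp
  qed
  then show thesis using that by auto
 qed
 have c0: "c ~= 0" using c nz n by (metis not_one_le_zero power_0_left)
 show ?thesis
 proof (rule that[OF c0 c(2)])
  fix k :: int assume k: "x powi k \<in> B"
  define q r where "q = k div int n" and "r = k mod int n"
  have kqr: "k = int n * q + r" by (simp add: q_def r_def)
  have r: "0 \<le> r" "r < int n" using n by (auto simp: r_def)
  \<comment> \<open>With \<open>x powi k\<close> also the remaining factor \<open>x powi r\<close>
    lies in \<open>B\<close>, so minimality of \<open>n\<close> forces \<open>r = 0\<close>.\<close>
  have e: "x powi k = (x ^ n) powi q * x powi r" using x by (simp add: kqr power_int_add power_int_mult)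
  then have "x powi r = x powi k / (x ^ n) powi q" using x by simp
  then have "x powi r \<in> B" using k n B by (simp add: mgrp_divide mgrp_powi)
  then have "x ^ nat r \<in> B" using r by (simp add: power_int_def)
  then have "\<not> nat r \<ge> 1" using n_min[of "nat r"] r by linarith
  then have "r = 0" using r by linarith
  then have "x powi k = (x ^ n) powi q" "c powi k = (c ^ n) powi q" using e by (auto simp: kqr power_int_mult)
  then show "h (x powi k) = c powi k" using mhom_powi[OF B h n(2)] c by simp
 qed
qed

text \<open>Zorn's lemma on graphs of partial homomorphisms. \<open>P\<close> describes a graph as a
  group of pairs; single-valuedness is then the one condition that 1 is paired with 1 only. A
  maximal graph is total, since a missing \<open>x\<close> could be adjoined.\<close>

theorem mhom_extend:
 assumes B: "mgrp B" and h: "mhom B h"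
 obtains h' where "mhom (- {0}) h'" "\<And>x. x \<in> B ==> h' x = h x"
proof -
 define P :: "(complex \<times> complex) set \<Rightarrow> bool" where
  "P g \<longleftrightarrow> (1, 1) \<in> g \<and> (\<forall>x a. (x, a) \<in> g --> x ~= 0 \<and> a ~= 0) \<and>
   (\<forall>x a y b. (x, a) \<in> g --> (y, b) \<in> g --> (x * y, a * b) \<in> g) \<and>
   (\<forall>x a. (x, a) \<in> g --> (inverse x, inverse a) \<in> g) \<and>
   (\<forall>a. (1, a) \<in> g --> a = 1)" for g
 have P1: "(1, 1) \<in> g" if "P g" for g using that by (simp add: P_def)
 have P2: "x ~= 0" "a ~= 0" "(inverse x, inverse a) \<in> g" if "P g" "(x, a) \<in> g" for g x a using that by (simp_all add: P_def)
 have P3: "(x * y, a * b) \<in> g" if "P g" "(x, a) \<in> g" "(y, b) \<in> g" for g x a y b using that by (simp add: P_def)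
 have P4: "a = 1" if "P g" "(1, a) \<in> g" for g a using that by (simp add: P_def)
 define gr :: "complex set \<Rightarrow> (complex \<Rightarrow> complex) \<Rightarrow> (complex \<times> complex) set"
  where "gr C k = (\<lambda>x. (x, k x)) ` C" for C k
 have P_gr: "P (gr C k)" if "mgrp C" "mhom C k" for C k unfolding P_def gr_def using that mgrp_nonzero[of C 0]
  by (auto simp: mgrp_one mgrp_mult mgrp_inverse mgrp_nonzero mhom_one mhom_mult mhom_inverse mhom_nonzero
    intro!: image_eqI)
 define \<A> where "\<A> = {g. P g \<and> gr B h \<subseteq> g}"
 have "\<exists>M\<in>\<A>. \<forall>N\<in>\<A>. M \<subseteq> N --> N = M"
 proof (rule subset_Zorn_nonempty)
  show "\<A> ~= {}" using P_gr[OF B h] by (auto simp: \<A>_def)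
  fix \<C> assume ne: "\<C> ~= {}" and ch: "subset.chain \<A> \<C>"
  then have PC: "P g" "gr B h \<subseteq> g" if "g \<in> \<C>" for g using that by (auto simp: \<A>_def subset.chain_def)
  have dir: "\<exists>g\<in>\<C>. u \<in> g \<and> v \<in> g" if "u \<in> \<Union>\<C>" "v \<in> \<Union>\<C>" for u v
  proof -
   obtain g g' where g: "g \<in> \<C>" "u \<in> g" "g' \<in> \<C>" "v \<in> g'" using \<open>u \<in> _\<close> \<open>v \<in> _\<close> by blast
   then have "g \<subseteq> g' \<or> g' \<subseteq> g" using ch by (simp add: subset.chain_def) blast
   then show ?thesis using g by blast
  qed
  have "P (\<Union>\<C>)" unfolding P_def
  proof (intro conjI allI impI)
   show "(1, 1) \<in> \<Union>\<C>" using ne PC(1) P1 by blast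
   fix x a assume xa: "(x, a) \<in> \<Union>\<C>"
   then obtain g where "g \<in> \<C>" "(x, a) \<in> g" by blast
   then show "x ~= 0" "a ~= 0" "(inverse x, inverse a) \<in> \<Union>\<C>" using P2[OF PC(1)[OF \<open>g \<in> \<C>\<close>]] by blast+
   fix y b assume "(y, b) \<in> \<Union>\<C>"
   then obtain g where "g \<in> \<C>" "(x, a) \<in> g" "(y, b) \<in> g" using dir xa by blast
   then show "(x * y, a * b) \<in> \<Union>\<C>" using P3[OF PC(1)] by blast
  next
   fix a assume "(1, a) \<in> \<Union>\<C>" then show "a = 1" using PC(1) P4 by blast
  qed
  then show "\<Union>\<C> \<in> \<A>" using ne PC(2) by (auto simp: \<A>_def)
 qed
 then obtain M where "M \<in> \<A>" and M_max: "\<forall>N\<in>\<A>. M \<subseteq> N --> N = M" ..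
 then have M: "P M" "gr B h \<subseteq> M" by (simp_all add: \<A>_def)
 have max: "N = M" if "P N" "M \<subseteq> N" for N using M_max that M(2) by (simp add: \<A>_def)
 define D where "D = fst ` M"
 define k where "k x = (SOME a. (x, a) \<in> M)" for x
 have sv: "a = b" if "(x, a) \<in> M" "(x, b) \<in> M" for x a b
 proof -
  have "(x * inverse x, a * inverse b) \<in> M" "x ~= 0" "b ~= 0"
   by (fact P3[OF M(1) that(1) P2(3)[OF M(1) that(2)]] P2[OF M(1) that(2)])+
  then have "(1, a / b) \<in> M" by (simp add: divide_inverse)
  then have "a / b = 1" using P4 M(1) by blast
  then show ?thesis using \<open>b ~= 0\<close> by simp
 qed
 have kM: "(x, k x) \<in> M" if "x \<in> D" for x unfolding k_def using that by (intro someI_ex[of "\<lambda>a. (x, a) \<in> M"]) (auto simp: D_def)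
 have k_eq: "k x = a" "x \<in> D" if "(x, a) \<in> M" for x a
 proof -
  show "x \<in> D" using that by (force simp: D_def)
  then show "k x = a" using sv[OF kM that] by blast
 qed
 have Dg: "mgrp D" unfolding mgrp_def
 proof (intro conjI ballI)
  show "1 \<in> D" using P1[OF M(1)] k_eq(2) by blast
  show "0 \<notin> D" using P2(1)[OF M(1) kM] by blast
  fix x assume x: "x \<in> D"
  then show "inverse x \<in> D" using P2(3)[OF M(1) kM] k_eq(2) by blast
  fix y assume "y \<in> D"
  then show "x * y \<in> D" using P3[OF M(1) kM kM] k_eq(2) x by blast
 qed
 have Dh: "mhom D k" unfolding mhom_def
 proof (intro conjI ballI)
  fix x assume x: "x \<in> D"
  then show "k x ~= 0" using P2(2)[OF M(1) kM] by blast
  fix y assume "y \<in> D"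
  then have "(x * y, k x * k y) \<in> M" using P3[OF M(1) kM kM] x by blast
  then show "k (x * y) = k x * k y" using k_eq(1) by blast
 qed
 have "x \<in> D" if x0: "x ~= 0" for x
 proof (rule ccontr)
  assume "x \<notin> D"
  obtain c where c: "c ~= 0" "\<And>j::int. x powi j \<in> D ==> k (x powi j) = c powi j"
   using ex_mhom_value_avoiding[OF Dg Dh x0 \<open>x \<notin> D\<close>] by metis
  obtain C h' where C: "mgrp C" "mhom C h'" "D \<subseteq> C" "x \<in> C" "\<And>b. b \<in> D ==> h' b = k b"
   using mhom_extend_adjoin[OF Dg Dh x0 c] by metis
  have "M \<subseteq> gr C h'"
  proof
   fix u assume "u \<in> M"
   then show "u \<in> gr C h'" using k_eq[of "fst u" "snd u"] C by (cases u) (auto simp: gr_def image_iff)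
  qed
  then have "gr C h' = M" by (rule max[OF P_gr[OF C(1,2)]])
  then have "(x, h' x) \<in> M" using C(4) by (auto simp: gr_def)
  then show False using k_eq(2) \<open>x \<notin> D\<close> by blast
 qed
 then have "- {0} \<subseteq> D" by auto
 then have "mhom (- {0}) k" by (rule mhom_subset[OF Dh])
 moreover have "k x = h x" if "x \<in> B" for x using k_eq M(2) that by (auto simp: gr_def)
 ultimately show thesis using that by blast
qed

text \<open>Source of the automorphisms that fix a given subgroup and move a given element, as
  needed to see that a character is nontrivial.\<close>

corollary mhom_extend_avoiding:
 assumes B: "mgrp B" and h: "mhom B h" and x: "x ~= 0" "x \<notin> B"
 obtains h' where "mhom (- {0}) h'" "\<And>b. b \<in> B ==> h' b = h b" "h' x ~= z"
proof -
 obtain c where c: "c ~= 0" "c ~= z" "\<And>j::int. x powi j \<in> B ==> h (x powi j) = c powi j"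
  using ex_mhom_value_avoiding[OF B h x] by metis
 obtain C h' where C: "mgrp C" "mhom C h'" "B \<subseteq> C" "x \<in> C" "\<And>b. b \<in> B ==> h' b = h b" "h' x = c"
  using mhom_extend_adjoin[OF B h x(1) c(1,3)] by metis
 obtain h'' where h'': "mhom (- {0}) h''" "\<And>y. y \<in> C ==> h'' y = h' y" using mhom_extend[OF C(1,2)] by metis
 show thesis
 proof (rule that[OF h''(1)])
  show "h'' b = h b" if "b \<in> B" for b using that C h'' by auto
  show "h'' x ~= z" using C h'' c by simp
 qed
qed

corollary mhom_extend_value:
 assumes B: "mgrp B" and h: "mhom B h" and x: "x ~= 0" and c: "c ~= 0"
  and agree: "\<And>k::int. x powi k \<in> B ==> h (x powi k) = c powi k"
 obtains h' where "mhom (- {0}) h'" "\<And>b. b \<in> B ==> h' b = h b" "h' x = c"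
proof -
 obtain C h' where C: "mgrp C" "mhom C h'" "B \<subseteq> C" "x \<in> C" "\<And>b. b \<in> B ==> h' b = h b" "h' x = c"
  using mhom_extend_adjoin[OF assms] by metis
 obtain h'' where h'': "mhom (- {0}) h''" "\<And>y. y \<in> C ==> h'' y = h' y" using mhom_extend[OF C(1,2)] by metis
 show thesis
 proof (rule that[OF h''(1)])
  show "h'' b = h b" if "b \<in> B" for b using that C h'' by auto
  show "h'' x = c" using C h'' by simp
 qed
qed

section \<open>Rational linear relations\<close>

definition qspan :: "complex set \<Rightarrow> complex set"
 where "qspan W = {\<Sum>x\<in>A. c x * x | A c. finite A \<and> A \<subseteq> W \<and> (\<forall>x\<in>A. c x \<in> \<rat>)}"

text \<open>The exact condition for \<open>s\<close> to have a rational linear extension to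
  \<open>qspan W\<close>: a relation between elements of \<open>W\<close> persists between their
  images.\<close>

definition relpres :: "complex set \<Rightarrow> (complex \<Rightarrow> complex) \<Rightarrow> bool"
 where "relpres W s \<longleftrightarrow> (\<forall>A c. finite A --> A \<subseteq> W --> (\<forall>x\<in>A. c x \<in> \<rat>) -->
  (\<Sum>x\<in>A. c x * x) = 0 --> (\<Sum>x\<in>A. c x * s x) = 0)"

text \<open>The linear extension of \<open>s\<close>, evaluated on some representation of
  \<open>y\<close>; under \<open>relpres\<close> the choice does not matter, by
  \<open>lext_family\<close>.\<close>

definition lext :: "complex set \<Rightarrow> (complex \<Rightarrow> complex) \<Rightarrow> complex \<Rightarrow> complex"
 where "lext W s y = (SOME v. \<exists>A c. finite A \<and> A \<subseteq> W \<and> (\<forall>x\<in>A. c x \<in> \<rat>) \<and>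
  y = (\<Sum>x\<in>A. c x * x) \<and> v = (\<Sum>x\<in>A. c x * s x))"

lemma sum_by_image:
 fixes c :: "'i \<Rightarrow> complex"
 assumes "finite I" shows "(\<Sum>i\<in>I. c i * g (w i)) = (\<Sum>x\<in>w ` I. (\<Sum>i | i \<in> I \<and> w i = x. c i) * g x)"
proof -
 have "(\<Sum>i\<in>I. c i * g (w i)) = (\<Sum>x\<in>w ` I. \<Sum>i | i \<in> I \<and> w i = x. c i * g (w i))" by (rule sum.image_gen[OF assms])
 also have "... = (\<Sum>x\<in>w ` I. (\<Sum>i | i \<in> I \<and> w i = x. c i) * g x)" by (auto simp: sum_distrib_right intro!: sum.cong)
 finally show ?thesis .
qed

lemma relpresD:
 "relpres W s ==> finite A ==> A \<subseteq> W ==> (\<forall>x\<in>A. c x \<in> \<rat>) ==> (\<Sum>x\<in>A. c x * x) = 0 ==>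
  (\<Sum>x\<in>A. c x * s x) = 0" by (simp add: relpres_def)

lemma relpres_family:
 assumes "relpres W s" "finite I" "\<And>i. i \<in> I ==> w i \<in> W" "\<And>i. i \<in> I ==> c i \<in> \<rat>"
  and "(\<Sum>i\<in>I. c i * w i) = 0" shows "(\<Sum>i\<in>I. c i * s (w i)) = 0"
proof -
 let ?c = "\<lambda>x. \<Sum>i | i \<in> I \<and> w i = x. c i"
 have "(\<Sum>x\<in>w ` I. ?c x * x) = 0" using sum_by_image[OF assms(2), of c "\<lambda>x. x" w] assms(5) by simp
 moreover have "\<forall>x\<in>w ` I. ?c x \<in> \<rat>" using assms(4) by (auto intro!: Rats_sum)
 moreover have "finite (w ` I)" "w ` I \<subseteq> W" using assms by auto
 ultimately have "(\<Sum>x\<in>w ` I. ?c x * s x) = 0" by (intro relpresD[OF assms(1)])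
 then show ?thesis using sum_by_image[OF assms(2), of c s w] by simp
qed

lemma relpres_subset: "relpres W s ==> V \<subseteq> W ==> (\<And>x. x \<in> V ==> t x = s x) ==> relpres V t"
 unfolding relpres_def
proof (intro allI impI)
 fix A c
 assume *: "\<forall>A c. finite A --> A \<subseteq> W --> (\<forall>x\<in>A. c x \<in> \<rat>) -->
  (\<Sum>x\<in>A. c x * x) = 0 --> (\<Sum>x\<in>A. c x * s x) = 0"
  "V \<subseteq> W" "\<And>x. x \<in> V ==> t x = s x" "finite A" "A \<subseteq> V" "\<forall>x\<in>A. c x \<in> \<rat>" "(\<Sum>x\<in>A. c x * x) = 0"
 then have "(\<Sum>x\<in>A. c x * t x) = (\<Sum>x\<in>A. c x * s x)" using *(2,3,5) by (intro sum.cong refl) (simp add: subset_iff)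
 then show "(\<Sum>x\<in>A. c x * t x) = 0" using * by auto
qed

lemma qspanE:
 assumes "y \<in> qspan W"
 obtains A c where "finite A" "A \<subseteq> W" "\<And>x. x \<in> A ==> c x \<in> \<rat>" "y = (\<Sum>x\<in>A. c x * x)"
 using assms unfolding qspan_def by blast

lemma qspan_family:
 assumes "finite I" "\<And>i. i \<in> I ==> w i \<in> W" "\<And>i. i \<in> I ==> c i \<in> \<rat>"
 shows "(\<Sum>i\<in>I. c i * w i) \<in> qspan W" unfolding qspan_def using sum_by_image[OF assms(1), of c "\<lambda>x. x" w] assms
 by (intro CollectI exI[of _ "w ` I"] exI[of _ "\<lambda>x. \<Sum>i | i \<in> I \<and> w i = x. c i"])
   (auto intro!: Rats_sum)

text \<open>The difference of two representations of one element is a rational relation, which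
  \<open>s\<close> preserves. Families with repetitions are allowed, so that sums and products of
  representations need no regrouping.\<close>

lemma lext_family:
 assumes rp: "relpres W s" and I: "finite I" "\<And>i. i \<in> I ==> w i \<in> W" "\<And>i. i \<in> I ==> c i \<in> \<rat>"
 shows "lext W s (\<Sum>i\<in>I. c i * w i) = (\<Sum>i\<in>I. c i * s (w i))"
proof -
 let ?y = "\<Sum>i\<in>I. c i * w i"
 have "?y \<in> qspan W" using I by (rule qspan_family)
 then have "\<exists>v A c. finite A \<and> A \<subseteq> W \<and> (\<forall>x\<in>A. c x \<in> \<rat>) \<and>
  ?y = (\<Sum>x\<in>A. c x * x) \<and> v = (\<Sum>x\<in>A. c x * s x)" unfolding qspan_def by blast
 then have "\<exists>A c. finite A \<and> A \<subseteq> W \<and> (\<forall>x\<in>A. c x \<in> \<rat>) \<and>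
  ?y = (\<Sum>x\<in>A. c x * x) \<and> lext W s ?y = (\<Sum>x\<in>A. c x * s x)" unfolding lext_def by (rule someI_ex)
 then obtain A d where A: "finite A" "A \<subseteq> W" "\<And>x. x \<in> A ==> d x \<in> \<rat>"
  "?y = (\<Sum>x\<in>A. d x * x)" "lext W s ?y = (\<Sum>x\<in>A. d x * s x)" by blast
 \<comment> \<open>The two representations are merged into a single relation over the disjoint union
   of the index sets.\<close>
 define e where "e = case_sum c (\<lambda>x. - d x)"
 define v where "v = case_sum w (\<lambda>x. x)"
 have "(\<Sum>i\<in>I <+> A. e i * v i) = 0" using I A by (simp add: sum.Plus e_def v_def sum_negf)
 then have "(\<Sum>i\<in>I <+> A. e i * s (v i)) = 0" by (rule relpres_family[OF rp, rotated 3]) (use I A in \<open>auto simp: e_def v_def\<close>)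
 then show ?thesis using I A by (simp add: sum.Plus e_def v_def sum_negf)
qed

lemma qspan_base: "w \<in> W ==> w \<in> qspan W" using qspan_family[of "{()}" "\<lambda>_. w" W "\<lambda>_. 1"] by simp

lemma qspan_mono: "V \<subseteq> W ==> qspan V \<subseteq> qspan W" unfolding qspan_def by blast

lemma qspan_add: "x \<in> qspan W ==> y \<in> qspan W ==> x + y \<in> qspan W"
proof (elim qspanE)
 fix A c B d
 assume A: "finite A" "A \<subseteq> W" "\<And>x. x \<in> A ==> c x \<in> \<rat>" "x = (\<Sum>x\<in>A. c x * x)"
  and B: "finite B" "B \<subseteq> W" "\<And>x. x \<in> B ==> d x \<in> \<rat>" "y = (\<Sum>x\<in>B. d x * x)"
 have "(\<Sum>i\<in>A <+> B. case_sum c d i * case_sum (\<lambda>x. x) (\<lambda>x. x) i) \<in> qspan W" by (rule qspan_family) (use A B in auto)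
 then show ?thesis using A B by (simp add: sum.Plus)
qed

lemma qspan_smult: "q \<in> \<rat> ==> x \<in> qspan W ==> q * x \<in> qspan W"
proof (elim qspanE)
 fix A c
 assume A: "finite A" "A \<subseteq> W" "\<And>x. x \<in> A ==> c x \<in> \<rat>" "x = (\<Sum>x\<in>A. c x * x)" and q: "q \<in> \<rat>"
 have "(\<Sum>x\<in>A. (q * c x) * x) \<in> qspan W" by (rule qspan_family) (use A q in auto)
 then show ?thesis using A by (simp add: sum_distrib_left mult.assoc)
qed

lemma qspan_uminus: "x \<in> qspan W ==> - x \<in> qspan W" using qspan_smult[of "-1" x W] by simp

lemma qspan_diff: "x \<in> qspan W ==> y \<in> qspan W ==> x - y \<in> qspan W"
 using qspan_add[of x W "- y"] qspan_uminus by simp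

lemma qspan_zero: "0 \<in> qspan W" using qspan_family[of "{}" undefined W undefined] by simp

lemma qspan_sum: "(\<And>i. i \<in> I ==> f i \<in> qspan W) ==> sum f I \<in> qspan W"
 by (induction I rule: infinite_finite_induct) (auto simp: qspan_zero qspan_add)

lemma qspan_Rats: "mgrp W ==> q \<in> \<rat> ==> q \<in> qspan W"
 using qspan_smult[OF _ qspan_base[OF mgrp_one], of q W] by simp

lemma product_of_sums:
 fixes c d :: "complex \<Rightarrow> complex"
 assumes "finite A" "finite B"
 shows "(\<Sum>x\<in>A. c x * f x) * (\<Sum>x\<in>B. d x * g x) = (\<Sum>(x, y)\<in>A \<times> B. (c x * d y) * (f x * g y))"
 by (simp add: sum_product sum.cartesian_product case_prod_beta mult_ac)

lemma qspan_mult: "mgrp W ==> x \<in> qspan W ==> y \<in> qspan W ==> x * y \<in> qspan W"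
proof (elim qspanE)
 fix A c B d
 assume A: "finite A" "A \<subseteq> W" "\<And>x. x \<in> A ==> c x \<in> \<rat>" "x = (\<Sum>x\<in>A. c x * x)"
  and B: "finite B" "B \<subseteq> W" "\<And>x. x \<in> B ==> d x \<in> \<rat>" "y = (\<Sum>x\<in>B. d x * x)" and W: "mgrp W"
 have "(\<Sum>i\<in>A \<times> B. (c (fst i) * d (snd i)) * (fst i * snd i)) \<in> qspan W"
  by (rule qspan_family) (use A B W in \<open>auto simp: mgrp_mult subset_iff\<close>)
 then show ?thesis using A B by (simp add: product_of_sums case_prod_beta)
qed

lemma qspan_power: "mgrp W ==> x \<in> qspan W ==> x ^ n \<in> qspan W"
 by (induction n) (auto simp: qspan_mult qspan_Rats)

lemma qspan_prod: "mgrp W ==> (\<And>i. i \<in> I ==> f i \<in> qspan W) ==> prod f I \<in> qspan W"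
 by (induction I rule: infinite_finite_induct) (auto simp: qspan_mult qspan_Rats)

lemma lext_base: "relpres W s ==> w \<in> W ==> lext W s w = s w"
 using lext_family[of W s "{()}" "\<lambda>_. w" "\<lambda>_. 1"] by simp

lemma lext_add:
 assumes rp: "relpres W s" and "x \<in> qspan W" "y \<in> qspan W" shows "lext W s (x + y) = lext W s x + lext W s y" using assms(2,3)
proof (elim qspanE)
 fix A c B d
 assume A: "finite A" "A \<subseteq> W" "\<And>x. x \<in> A ==> c x \<in> \<rat>" "x = (\<Sum>x\<in>A. c x * x)"
  and B: "finite B" "B \<subseteq> W" "\<And>x. x \<in> B ==> d x \<in> \<rat>" "y = (\<Sum>x\<in>B. d x * x)"
 have "lext W s (\<Sum>i\<in>A <+> B. case_sum c d i * case_sum (\<lambda>x. x) (\<lambda>x. x) i) =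
  (\<Sum>i\<in>A <+> B. case_sum c d i * s (case_sum (\<lambda>x. x) (\<lambda>x. x) i))" by (rule lext_family[OF rp]) (use A B in auto)
 moreover have "lext W s x = (\<Sum>x\<in>A. c x * s x)" "lext W s y = (\<Sum>x\<in>B. d x * s x)"
  using lext_family[OF rp, of A "\<lambda>x. x" c] lext_family[OF rp, of B "\<lambda>x. x" d] A B by auto
 ultimately show ?thesis using A B by (simp add: sum.Plus)
qed

lemma lext_mult:
 assumes rp: "relpres W s" and W: "mgrp W" "mhom W s" and "x \<in> qspan W" "y \<in> qspan W" shows "lext W s (x * y) = lext W s x * lext W s y"
 using assms(4,5)
proof (elim qspanE)
 fix A c B d
 assume A: "finite A" "A \<subseteq> W" "\<And>x. x \<in> A ==> c x \<in> \<rat>" "x = (\<Sum>x\<in>A. c x * x)"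
  and B: "finite B" "B \<subseteq> W" "\<And>x. x \<in> B ==> d x \<in> \<rat>" "y = (\<Sum>x\<in>B. d x * x)"
 have "lext W s (\<Sum>i\<in>A \<times> B. (c (fst i) * d (snd i)) * (fst i * snd i)) =
  (\<Sum>i\<in>A \<times> B. (c (fst i) * d (snd i)) * s (fst i * snd i))"
  by (rule lext_family[OF rp]) (use A B W in \<open>auto simp: mgrp_mult subset_iff\<close>)
 also have "... = (\<Sum>i\<in>A \<times> B. (c (fst i) * d (snd i)) * (s (fst i) * s (snd i)))"
  by (intro sum.cong refl arg_cong2[of _ _ _ _ "(*)"] mhom_mult[OF W(2)]) (use A B in auto)
 finally have "lext W s (x * y) = (\<Sum>x\<in>A. c x * s x) * (\<Sum>x\<in>B. d x * s x)" using A B by (simp add: product_of_sums case_prod_beta)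
 moreover have "lext W s x = (\<Sum>x\<in>A. c x * s x)" "lext W s y = (\<Sum>x\<in>B. d x * s x)"
  using lext_family[OF rp, of A "\<lambda>x. x" c] lext_family[OF rp, of B "\<lambda>x. x" d] A B by auto
 ultimately show ?thesis by simp
qed

lemma lext_Rats: "relpres W s ==> mgrp W ==> mhom W s ==> q \<in> \<rat> ==> lext W s q = q"
 using lext_family[of W s "{()}" "\<lambda>_. 1" "\<lambda>_. q"] by (simp add: mgrp_one mhom_one)

lemma lext_smult:
 "relpres W s ==> mgrp W ==> mhom W s ==> q \<in> \<rat> ==> x \<in> qspan W ==> lext W s (q * x) = q * lext W s x"
 by (simp add: lext_mult qspan_Rats lext_Rats)

lemma lext_sum:
 "relpres W s ==> mgrp W ==> mhom W s ==> (\<And>i. i \<in> I ==> f i \<in> qspan W) ==>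
  lext W s (sum f I) = (\<Sum>i\<in>I. lext W s (f i))" by (induction I rule: infinite_finite_induct) (auto simp: lext_Rats lext_add qspan_sum)

lemma lext_prod:
 "relpres W s ==> mgrp W ==> mhom W s ==> (\<And>i. i \<in> I ==> f i \<in> qspan W) ==>
  lext W s (prod f I) = (\<Prod>i\<in>I. lext W s (f i))" by (induction I rule: infinite_finite_induct) (auto simp: lext_Rats lext_mult qspan_prod)

lemma lext_power:
 "relpres W s ==> mgrp W ==> mhom W s ==> x \<in> qspan W ==> lext W s (x ^ n) = lext W s x ^ n"
 by (induction n) (auto simp: lext_Rats lext_mult qspan_power)

text \<open>Lets a computation inside one \<open>mu n\<close> be read in the full cyclotomic
  field.\<close>

lemma lext_subset:
 assumes "relpres W s" "V \<subseteq> W" "\<And>x. x \<in> V ==> t x = s x" "y \<in> qspan V" shows "lext V t y = lext W s y"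
proof -
 obtain A c where A: "finite A" "A \<subseteq> V" "\<And>x. x \<in> A ==> c x \<in> \<rat>" "y = (\<Sum>x\<in>A. c x * x)"
  using assms(4) by (rule qspanE) blast
 have "lext V t y = (\<Sum>x\<in>A. c x * t x)" unfolding A(4) using A relpres_subset[OF assms(1-3)] by (intro lext_family) auto
 also have "... = (\<Sum>x\<in>A. c x * s x)" using A assms(3) by (intro sum.cong) auto
 also have "... = lext W s y" unfolding A(4) using A assms by (intro lext_family[symmetric]) auto
 finally show ?thesis .
qed

section \<open>Irreducibility of cyclotomic polynomials, in Landau's form\<close>

definition mu :: "nat \<Rightarrow> complex set"
 where "mu n = {z. z ^ n = 1}"

definition mu_inf :: "complex set"
 where "mu_inf = {z. \<exists>n\<ge>1. z ^ n = 1}"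

definition zeta :: "nat \<Rightarrow> complex"
 where "zeta n = cis (2 * pi / real n)"

lemma zeta_nonzero: "zeta n ~= 0" by (simp add: zeta_def)

lemma zeta_power: "n \<ge> 1 ==> zeta n ^ n = 1" using Complex.DeMoivre[of "2 * pi / real n" n] by (simp add: zeta_def)

lemma mu_zeta:
 assumes "n \<ge> 1" "z \<in> mu n"
 obtains k where "k < n" "z = zeta n ^ k"
proof -
 have "bij_betw (\<lambda>k. cis (2 * pi * real k / real n)) {..<n} {z. z ^ n = 1}" using assms(1) by (intro Complex.bij_betw_roots_unity) simp
 then obtain k where "k < n" "z = cis (2 * pi * real k / real n)" using assms(2) unfolding mu_def bij_betw_def by blast
 then show thesis using that by (simp add: zeta_def Complex.DeMoivre mult_ac)
qed

lemma zeta_power_eq_1_iff: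
 assumes "n \<ge> 1" shows "zeta n ^ k = 1 \<longleftrightarrow> n dvd k"
proof
 assume *: "zeta n ^ k = 1"
 have inj: "inj_on (\<lambda>k. cis (2 * pi * real k / real n)) {..<n}" using Complex.bij_betw_roots_unity[of n] assms by (auto simp: bij_betw_def)
 have "zeta n ^ k = zeta n ^ (n * (k div n) + k mod n)" by simp
 also have "... = zeta n ^ (k mod n)" using zeta_power[OF assms] by (simp only: power_add power_mult power_one mult_1)
 finally have "zeta n ^ (k mod n) = zeta n ^ 0" using * by simp
 then have "cis (2 * pi * real (k mod n) / real n) = cis (2 * pi * real 0 / real n)" by (simp add: zeta_def Complex.DeMoivre mult_ac)
 then have "k mod n = 0" using inj_onD[OF inj, of "k mod n" 0] assms by simp
 then show "n dvd k" by auto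
next
 assume "n dvd k" then show "zeta n ^ k = 1" using zeta_power[OF assms] by (auto simp: power_mult)
qed

lemma mgrp_mu: "n \<ge> 1 ==> mgrp (mu n)" by (auto simp: mgrp_def mu_def power_mult_distrib power_0_left power_inverse)

lemma mgrp_mu_inf: "mgrp mu_inf" unfolding mgrp_def
proof (intro conjI ballI)
 show "1 \<in> mu_inf" by (auto simp: mu_inf_def)
 show "0 \<notin> mu_inf" by (auto simp: mu_inf_def power_0_left)
 fix x assume "x \<in> mu_inf"
 then obtain n where n: "n \<ge> 1" "x ^ n = 1" by (auto simp: mu_inf_def)
 then show "inverse x \<in> mu_inf" by (auto simp: mu_inf_def power_inverse)
 fix y assume "y \<in> mu_inf"
 then obtain m where m: "m \<ge> 1" "y ^ m = 1" by (auto simp: mu_inf_def)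
 have "(x * y) ^ (n * m) = (x ^ n) ^ m * (y ^ m) ^ n" by (simp add: power_mult_distrib mult.commute flip: power_mult)
 then show "x * y \<in> mu_inf" using n m unfolding mu_inf_def by (intro CollectI exI[of _ "n * m"]) auto
qed

lemma mu_subset_mu_inf: "n \<ge> 1 ==> mu n \<subseteq> mu_inf" by (auto simp: mu_def mu_inf_def)

lemma finite_subset_mu_inf:
 assumes "finite A" "A \<subseteq> mu_inf"
 obtains n where "n \<ge> 1" "A \<subseteq> mu n"
proof -
 have "\<forall>z\<in>A. \<exists>n\<ge>1. z ^ n = 1" using assms(2) by (auto simp: mu_inf_def)
 then obtain f where f: "\<And>z. z \<in> A ==> f z \<ge> (1::nat) \<and> z ^ f z = 1" by metis
 show thesis
 proof (rule that)
  show "(\<Prod>z\<in>A. f z) \<ge> 1" using f by (simp add: Suc_le_eq prod_pos)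
  show "A \<subseteq> mu (\<Prod>z\<in>A. f z)"
  proof
   fix z assume z: "z \<in> A"
   have "z ^ (\<Prod>z\<in>A. f z) = (z ^ f z) ^ (\<Prod>z\<in>A - {z}. f z)" using assms(1) z by (simp add: prod.remove power_mult)
   then show "z \<in> mu (\<Prod>z\<in>A. f z)" using f[OF z] by (simp add: mu_def)
  qed
 qed
qed

text \<open>The ring Z[zeta_n]. For \<open>n > 1\<close> the \<open>n\<close> generators are
  linearly dependent; only the integrality of the coefficients counts.\<close>

definition zmod :: "nat \<Rightarrow> complex set"
 where "zmod n = {\<Sum>k<n. of_int (a k) * zeta n ^ k | a :: nat \<Rightarrow> int. True}"

lemma zmod_add: "x \<in> zmod n ==> y \<in> zmod n ==> x + y \<in> zmod n"
proof -
 assume "x \<in> zmod n" "y \<in> zmod n"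
 then obtain a b :: "nat \<Rightarrow> int" where "x = (\<Sum>k<n. of_int (a k) * zeta n ^ k)"
  "y = (\<Sum>k<n. of_int (b k) * zeta n ^ k)" by (auto simp: zmod_def)
 then have "x + y = (\<Sum>k<n. of_int (a k + b k) * zeta n ^ k)" by (simp add: sum.distrib distrib_right)
 then show ?thesis unfolding zmod_def by (intro CollectI exI[of _ "\<lambda>k. a k + b k"]) simp
qed

lemma zmod_smult: "x \<in> zmod n ==> of_int m * x \<in> zmod n"
proof -
 assume "x \<in> zmod n"
 then obtain a :: "nat \<Rightarrow> int" where "x = (\<Sum>k<n. of_int (a k) * zeta n ^ k)" by (auto simp: zmod_def)
 then have "of_int m * x = (\<Sum>k<n. of_int (m * a k) * zeta n ^ k)" by (simp add: sum_distrib_left mult.assoc)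
 then show ?thesis unfolding zmod_def by (intro CollectI exI[of _ "\<lambda>k. m * a k"]) simp
qed

lemma zmod_zero: "0 \<in> zmod n" unfolding zmod_def by (intro CollectI exI[of _ "\<lambda>_. 0"]) auto

lemma zmod_sum: "(\<And>i. i \<in> I ==> f i \<in> zmod n) ==> sum f I \<in> zmod n"
 by (induction I rule: infinite_finite_induct) (auto simp: zmod_zero zmod_add)

lemma zmod_mu:
 assumes "n \<ge> 1" "z \<in> mu n" shows "z \<in> zmod n"
proof -
 obtain k where "k < n" "z = zeta n ^ k" using mu_zeta[OF assms] by metis
 then show ?thesis unfolding zmod_def
  by (intro CollectI exI[of _ "\<lambda>j. if j = k then 1 else 0"]) (simp add: if_distrib[of of_int] if_distrib[of "\<lambda>x. x * _"] cong: if_cong)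
qed

lemma zmod_mult:
 assumes n: "n \<ge> 1" and "x \<in> zmod n" "y \<in> zmod n" shows "x * y \<in> zmod n"
proof -
 obtain a b :: "nat \<Rightarrow> int" where xy: "x = (\<Sum>k<n. of_int (a k) * zeta n ^ k)"
  "y = (\<Sum>k<n. of_int (b k) * zeta n ^ k)" using assms by (auto simp: zmod_def)
 have z: "zeta n \<in> mu n" using zeta_power[OF n] by (simp add: mu_def)
 have e: "x * y = (\<Sum>i<n. \<Sum>j<n. of_int (a i * b j) * (zeta n ^ i * zeta n ^ j))" by (simp add: xy sum_product mult_ac)
 show ?thesis unfolding e by (intro zmod_sum zmod_smult zmod_mu[OF n] mgrp_mult[OF mgrp_mu[OF n]] mgrp_power[OF mgrp_mu[OF n]] z)
qed

lemma zmod_power: "n \<ge> 1 ==> x \<in> zmod n ==> x ^ k \<in> zmod n"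
 using zmod_mu[of n 1] by (induction k) (auto intro: zmod_mult simp: mu_def)

section \<open>Congruences modulo a prime in Z[zeta_n]\<close>

lemma fermat_int:
 fixes c :: int
 assumes "Factorial_Ring.prime p" shows "int p dvd c ^ p - c"
proof (cases "int p dvd c")
 case True
 then show ?thesis using assms by (auto intro!: dvd_diff dvd_power_le[of "int p" c 1 p, simplified] dest: prime_gt_0_nat
   simp: dvd_power_iff intro: dvd_trans[OF _ dvd_power])
next
 case False
 define a where "a = nat (c mod int p)"
 have p0: "p > 0" using assms prime_gt_0_nat by blast
 have a: "int a = c mod int p" using p0 by (simp add: a_def)
 have "\<not> p dvd a" using False a by (metis dvd_mod_iff dvd_refl int_dvd_int_iff)
 then have "[a ^ (p - 1) = 1] (mod p)" using assms fermat_theorem by blast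
 then have "[int a ^ (p - 1) = 1] (mod int p)" by (metis cong_int_iff of_nat_1 of_nat_power)
 moreover have "[c = int a] (mod int p)" by (simp add: a cong_def)
 ultimately have "[c ^ (p - 1) = 1] (mod int p)" using cong_pow cong_trans by blast
 then have "[c * c ^ (p - 1) = c * 1] (mod int p)" by (rule cong_scalar_left)
 then have "[c ^ p = c] (mod int p)" using p0 by (simp flip: power_Suc)
 then show ?thesis by (simp add: cong_iff_dvd_diff)
qed

lemma frobenius_binomial:
 assumes n: "n \<ge> 1" and p: "Factorial_Ring.prime p" and u: "u \<in> zmod n" "v \<in> zmod n"
 obtains m where "m \<in> zmod n" "(u + v) ^ p = u ^ p + v ^ p + of_nat p * m"
proof -
 have p2: "p \<ge> 2" using p prime_ge_2_nat by blast
 have e: "(\<Sum>k\<le>p. of_nat (p choose k) * u ^ k * v ^ (p - k)) =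
  u ^ p + v ^ p + (\<Sum>k\<in>{1..<p}. of_nat (p choose k) * u ^ k * v ^ (p - k))"
 proof -
  have "{..p} = insert 0 (insert p {1..<p})" using p2 by auto
  then show ?thesis using p2 by (simp add: add_ac)
 qed
 define m where "m = (\<Sum>k\<in>{1..<p}. of_int (int ((p choose k) div p)) * (u ^ k * v ^ (p - k)))"
 have "of_nat (p choose k) * u ^ k * v ^ (p - k) =
  of_nat p * (of_int (int ((p choose k) div p)) * (u ^ k * v ^ (p - k)))" if "k \<in> {1..<p}" for k
 proof -
  have "p dvd (p choose k)" using that p by (intro dvd_choose_prime) auto
  then have "of_nat (p choose k) = (of_nat p * of_nat ((p choose k) div p) :: complex)" by (metis dvd_mult_div_cancel of_nat_mult)
  then show ?thesis by simp
 qed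
 then have "(\<Sum>k\<in>{1..<p}. of_nat (p choose k) * u ^ k * v ^ (p - k)) = of_nat p * m" unfolding m_def sum_distrib_left by (intro sum.cong refl)
 then have "(u + v) ^ p = u ^ p + v ^ p + of_nat p * m" unfolding binomial_ring e by simp
 moreover have "m \<in> zmod n" unfolding m_def using u n by (intro zmod_sum zmod_smult zmod_mult zmod_power) auto
 ultimately show thesis using that by blast
qed

text \<open>Raising to the \<open>p\<close>-th power is additive modulo \<open>p\<close>, and
  Fermat's theorem takes care of the integer coefficients.\<close>

lemma frobenius_sum:
 fixes c :: "'i \<Rightarrow> int"
 assumes n: "n \<ge> 1" and p: "Factorial_Ring.prime p" and I: "finite I" "\<And>i. i \<in> I ==> z i \<in> mu n"
 shows "\<exists>m\<in>zmod n. (\<Sum>i\<in>I. of_int (c i) * z i) ^ p = (\<Sum>i\<in>I. of_int (c i) * z i ^ p) + of_nat p * m" using I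
proof (induction I rule: finite_induct)
 case empty
 then show ?case using zmod_zero[of n] prime_gt_0_nat[OF p] by (intro bexI[of _ 0]) (auto simp: power_0_left)
next
 case (insert i I)
 then obtain m where m: "m \<in> zmod n"
  "(\<Sum>i\<in>I. of_int (c i) * z i) ^ p = (\<Sum>i\<in>I. of_int (c i) * z i ^ p) + of_nat p * m" by auto
 have zi: "z i \<in> mu n" using insert by auto
 have u: "of_int (c i) * z i \<in> zmod n" using zmod_smult zmod_mu[OF n] zi by blast
 have v: "(\<Sum>i\<in>I. of_int (c i) * z i) \<in> zmod n" using insert by (intro zmod_sum zmod_smult zmod_mu n) auto
 obtain m' where m': "m' \<in> zmod n" "(of_int (c i) * z i + (\<Sum>i\<in>I. of_int (c i) * z i)) ^ p =
  (of_int (c i) * z i) ^ p + (\<Sum>i\<in>I. of_int (c i) * z i) ^ p + of_nat p * m'" using frobenius_binomial[OF n p u v] by metis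
 obtain d where d: "c i ^ p - c i = int p * d" using fermat_int[OF p, of "c i"] by (auto elim: dvdE)
 have "of_int (c i ^ p) = (of_int (c i + int p * d) :: complex)" using d by (metis add.commute diff_add_cancel)
 then have c: "of_int (c i) ^ p = (of_int (c i) + of_nat p * of_int d :: complex)" by simp
 have "z i ^ p \<in> zmod n" using zi n by (intro zmod_mu mgrp_power mgrp_mu)
 then have "of_int d * z i ^ p + m + m' \<in> zmod n" using m m' by (intro zmod_add zmod_smult)
 moreover have "(\<Sum>i\<in>insert i I. of_int (c i) * z i) ^ p =
  (\<Sum>i\<in>insert i I. of_int (c i) * z i ^ p) + of_nat p * (of_int d * z i ^ p + m + m')"
  using insert(1,2) m(2) m'(2) c by (simp add: power_mult_distrib algebra_simps)
 ultimately show ?case by blast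
qed

text \<open>A coordinate function in a basis containing \<alpha>; it measures denominators without
  an integral basis.\<close>

lemma ex_rational_functional:
 fixes \<alpha> :: complex
 assumes "\<alpha> ~= 0"
 obtains g :: "complex \<Rightarrow> rat" where "g \<alpha> = 1" "\<And>x y. g (x + y) = g x + g y"
  "\<And>q x. g (of_rat q * x) = q * g x"
proof -
 interpret vector_space_pair "\<lambda>(q::rat) (x::complex). of_rat q * x" "(*) :: rat \<Rightarrow> rat \<Rightarrow> rat"
  by unfold_locales (auto simp: algebra_simps of_rat_add of_rat_mult)
 have "\<not> vs1.dependent {\<alpha>}" using assms by simp
 then obtain g where g: "Vector_Spaces.linear (\<lambda>(q::rat) (x::complex). of_rat q * x) (*) g" "g \<alpha> = 1"
  using linear_independent_extend[of "{\<alpha>}" "\<lambda>_. 1"] by auto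
 show thesis by (rule that[of g]) (use g in \<open>auto simp: linear_add linear_scale\<close>)
qed

lemma ex_common_denominator:
 assumes "finite I" "\<And>i. i \<in> I ==> c i \<in> (\<rat> :: 'a :: field_char_0 set)"
 obtains d :: int and a :: "'i \<Rightarrow> int" where "d > 0" "\<And>i. i \<in> I ==> of_int d * c i = of_int (a i)"
proof -
 have "\<exists>d a. d > (0::int) \<and> (\<forall>i\<in>I. of_int d * c i = of_int (a i))" using assms
 proof (induction I rule: finite_induct)
  case empty then show ?case by (intro exI[of _ 1]) auto
 next
  case (insert i I)
  then obtain d a where d: "d > 0" "\<And>j. j \<in> I ==> of_int d * c j = of_int (a j)" by auto
  obtain u v where v: "v > 0" "c i = of_int u / of_int v" using insert(4)[of i] by (auto elim: Rats_cases')
  have "of_int (d * v) * c j = of_int ((if j = i then d * u else v * a j))" if "j \<in> insert i I" for j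
   using that v d insert(2) by (auto simp: algebra_simps)
  then show ?case using d(1) v(1) by (intro exI[of _ "d * v"] exI[of _ "\<lambda>j. if j = i then d * u else v * a j"] conjI ballI) simp_all
 qed
 then show thesis using that by blast
qed

text \<open>Take a rational functional \<open>g\<close> with \<open>g \<alpha> = 1\<close>. On
  \<open>zmod n\<close> its values have a common denominator \<open>d\<close>, so \<alpha> = p
  \<beta> would make \<open>p\<close> a divisor of \<open>d\<close>.\<close>

lemma zmod_few_prime_divisors:
 assumes "\<alpha> ~= 0"
 obtains N :: nat where "\<And>p \<beta>. Factorial_Ring.prime p ==> p > N ==> \<beta> \<in> zmod n ==> \<alpha> ~= of_nat p * \<beta>"
proof -
 obtain g :: "complex \<Rightarrow> rat" where g: "g \<alpha> = 1" "\<And>x y. g (x + y) = g x + g y"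
  "\<And>q x. g (of_rat q * x) = q * g x" using ex_rational_functional[OF assms] by blast
 have gi: "g (of_int a * x) = of_int a * g x" for a x using g(3)[of "of_int a" x] by simp
 have g0: "g 0 = 0" using gi[of 0 0] by simp
 have gs: "g (sum f I) = (\<Sum>i\<in>I. g (f i))" for f :: "nat \<Rightarrow> complex" and I
  by (induction I rule: infinite_finite_induct) (auto simp: g0 g(2))
 obtain d :: int and a where d: "d > 0" "\<And>k. k \<in> {..<n} ==> of_int d * g (zeta n ^ k) = of_int (a k)"
  using ex_common_denominator[of "{..<n}" "\<lambda>k. g (zeta n ^ k)"] by (metis Rats_of_rat finite_lessThan id_apply of_rat_eq_id)
 have gz: "\<exists>m::int. of_int d * g \<beta> = of_int m" if "\<beta> \<in> zmod n" for \<beta>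
 proof -
  obtain b :: "nat \<Rightarrow> int" where "\<beta> = (\<Sum>k<n. of_int (b k) * zeta n ^ k)"
   using \<open>\<beta> \<in> zmod n\<close> by (auto simp: zmod_def)
  then have "of_int d * g \<beta> = (\<Sum>k<n. of_int (b k) * (of_int d * g (zeta n ^ k)))" by (simp add: gs gi sum_distrib_left mult_ac)
  also have "... = of_int (\<Sum>k<n. b k * a k)" using d by simp
  finally show ?thesis by blast
 qed
 show thesis
 proof (rule that[of "nat d"])
  fix p \<beta> assume p: "Factorial_Ring.prime p" "p > nat d" and \<beta>: "\<beta> \<in> zmod n"
  show "\<alpha> ~= of_nat p * \<beta>"
  proof
   assume "\<alpha> = of_nat p * \<beta>"
   then have "1 = of_nat p * g \<beta>" using g(1) gi[of "int p" \<beta>] by simp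
   moreover obtain m :: int where "of_int d * g \<beta> = of_int m" using gz[OF \<beta>] by blast
   ultimately have "of_int d = (of_int (int p * m) :: rat)" by (metis mult.left_commute mult.right_neutral of_int_mult of_int_of_nat_eq)
   then have "d = int p * m" using of_int_eq_iff by blast
   then have "int p dvd d" by simp
   then have "int p \<le> d" using d zdvd_imp_le by blast
   then show False using p by simp
  qed
 qed
qed

text \<open>Modulo a prime \<open>p\<close> the value at the \<open>p\<close>-th powers is the \<open>p\<close>-th power of the value. As only
 finitely many values occur, a vanishing value forces the next one to vanish when \<open>p\<close> is large,
 and \<open>k\<close> may be replaced by an integer congruent to it with large prime factors only.\<close>

lemma landau_int:
 fixes c :: "'i \<Rightarrow> int"
 assumes n: "n \<ge> 1" and I: "finite I" "\<And>i. i \<in> I ==> z i \<in> mu n"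
  and rel: "(\<Sum>i\<in>I. of_int (c i) * z i) = 0" and k: "Rings.coprime k n" shows "(\<Sum>i\<in>I. of_int (c i) * z i ^ k) = 0"
proof -
 define v where "v j = (\<Sum>i\<in>I. of_int (c i) * z i ^ j)" for j
 have v_mod: "v (j + n * m) = v j" for j m unfolding v_def using I(2) by (intro sum.cong) (auto simp: power_add power_mult mu_def)
 have v_mod': "v (j mod n) = v j" for j using v_mod[of "j mod n" "j div n"] by simp
 have "\<forall>j. \<exists>N::nat. v j ~= 0 --> (\<forall>p \<beta>. Factorial_Ring.prime p --> p > N --> \<beta> \<in> zmod n --> v j ~= of_nat p * \<beta>)"
  using zmod_few_prime_divisors by metis
 then obtain N where N: "\<And>j p \<beta>. v j ~= 0 ==> Factorial_Ring.prime p ==> p > N j ==> \<beta> \<in> zmod n ==>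
  v j ~= of_nat p * \<beta>" by metis
 define M where "M = Max (N ` {..<n})"
 have M: "N j \<le> M" if "j < n" for j using that by (auto simp: M_def)
 have step: "v (j * p) = 0" if p: "Factorial_Ring.prime p" "p > M" and j: "v j = 0" for j p
 proof (rule ccontr)
  assume nz: "v (j * p) ~= 0"
  have zj: "z i ^ j \<in> mu n" if "i \<in> I" for i using that I n by (intro mgrp_power mgrp_mu)
  obtain m where m: "m \<in> zmod n" "v j ^ p = v (j * p) + of_nat p * m"
   using frobenius_sum[OF n p(1) I(1), of "\<lambda>i. z i ^ j" c] zj unfolding v_def by (auto simp: power_mult)
  then have "v ((j * p) mod n) = of_nat p * (- m)" using j prime_gt_0_nat[OF p(1)] v_mod'[of "j * p"] by (simp add: power_0_left eq_neg_iff_add_eq_0)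
  moreover have "- m \<in> zmod n" using zmod_smult[OF m(1), of "-1"] by simp
  moreover have "p > N ((j * p) mod n)" using M[of "(j * p) mod n"] p n by simp
  moreover have "v ((j * p) mod n) ~= 0" using nz v_mod' by simp
  ultimately show False using N p by blast
 qed
 have all: "v m = 0" if "m > 0" "\<And>q. Factorial_Ring.prime q ==> q dvd m ==> q > M" for m :: nat using that
 proof (induction m rule: less_induct)
  case (less m)
  show ?case
  proof (cases "m = 1")
   case True then show ?thesis using rel by (simp add: v_def)
  next
   case False
   then obtain q where q: "Factorial_Ring.prime q" "q dvd m" using prime_factor_nat by blast
   then obtain m' where m': "m = m' * q" by (metis dvdE mult.commute)
   have "q > 1" using q prime_gt_1_nat by blast
   then have "m' < m" "m' > 0" using m' less.prems by auto
   then have "v m' = 0" using less.IH less.prems m' by auto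
   then show ?thesis using step q less.prems m' by auto
  qed
 qed
 \<comment> \<open>A prime up to \<open>M\<close> that divides \<open>k\<close> divides neither
   \<open>n\<close>, by coprimality, nor the product of \<open>P\<close>. A prime up to
   \<open>M\<close> that does not divide \<open>k\<close> divides that product. So neither kind
   divides \<open>k'\<close>.\<close>
 define P where "P = {q. Factorial_Ring.prime q \<and> q \<le> M \<and> \<not> q dvd k}"
 have P: "finite P" unfolding P_def by (rule finite_subset[of _ "{..M}"]) auto
 define k' where "k' = k + n * \<Prod>P"
 have "q > M" if q: "Factorial_Ring.prime q" "q dvd k'" for q
 proof (rule ccontr)
  assume "\<not> q > M"
  show False
  proof (cases "q dvd k")
   case True
   then have "q dvd n * \<Prod>P" using q unfolding k'_def using dvd_add_right_iff by blast
   then consider "q dvd n" | "q dvd \<Prod>P" using q prime_dvd_mult_iff by blast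
   then show False
   proof cases
    case 1
    then show False using True k q by (metis coprime_common_divisor not_prime_unit)
   next
    case 2
    then obtain r where "r \<in> P" "q dvd r" using prime_dvd_prod_iff[OF P q(1), of id] by auto
    then have "q = r" using q unfolding P_def using primes_dvd_imp_eq by blast
    then show False using \<open>r \<in> P\<close> True by (auto simp: P_def)
   qed
  next
   case False
   then have "q \<in> P" using q \<open>\<not> q > M\<close> by (auto simp: P_def)
   then have "q dvd n * \<Prod>P" using P by (simp add: dvd_prodI[of P q id, simplified])
   then show False using q False unfolding k'_def by (meson dvd_add_left_iff)
  qed
 qed
 moreover have "k' > 0"
 proof -
  have "\<Prod>P > 0" by (rule prod_pos) (auto simp: P_def prime_gt_0_nat)
  then show ?thesis using n by (simp add: k'_def)
 qed
 ultimately have "v k' = 0" using all by blast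
 then show ?thesis using v_mod[of k "\<Prod>P"] unfolding k'_def v_def by simp
qed

lemma landau:
 assumes n: "n \<ge> 1" and I: "finite I" "\<And>i. i \<in> I ==> z i \<in> mu n" "\<And>i. i \<in> I ==> c i \<in> \<rat>"
  and rel: "(\<Sum>i\<in>I. c i * z i) = 0" and k: "Rings.coprime k n" shows "(\<Sum>i\<in>I. c i * z i ^ k) = 0"
proof -
 obtain d a where d: "d > (0::int)" "\<And>i. i \<in> I ==> of_int d * c i = of_int (a i)"
  using ex_common_denominator[OF I(1), of c] I(3) by metis
 have e: "(\<Sum>i\<in>I. of_int (a i) * f i) = of_int d * (\<Sum>i\<in>I. c i * f i)" for f
  unfolding sum_distrib_left using d by (intro sum.cong) (auto simp flip: d(2))
 have "(\<Sum>i\<in>I. of_int (a i) * z i ^ k) = 0" by (rule landau_int[OF n I(1,2) _ k]) (use e[of z] rel in auto)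
 then show ?thesis using e[of "\<lambda>i. z i ^ k"] d by simp
qed

lemma relpres_mu_power: "n \<ge> 1 ==> Rings.coprime k n ==> relpres (mu n) (\<lambda>z. z ^ k)"
 unfolding relpres_def using landau[of n _ "\<lambda>x. x"] by blast

lemma mhom_power_map: "mgrp W ==> mhom W (\<lambda>z. z ^ k)" by (auto simp: mhom_def power_mult_distrib dest: mgrp_nonzero)

text \<open>The image of the generator \<open>zeta n\<close> determines \<open>s\<close>. A common
  divisor \<open>d > 1\<close> of the exponent and \<open>n\<close> would put the nontrivial element
  \<open>zeta n ^ (n div d)\<close> into the kernel.\<close>

lemma ex_power_on_mu:
 assumes n: "n \<ge> 1" and s: "mhom (mu n) s" "\<And>x. x \<in> mu n ==> s x = 1 ==> x = 1"
 obtains k where "Rings.coprime k n" "\<And>x. x \<in> mu n ==> s x = x ^ k"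
proof -
 have z: "zeta n \<in> mu n" using zeta_power[OF n] by (simp add: mu_def)
 note G = mgrp_mu[OF n]
 have "s (zeta n) ^ n = 1" using mhom_power[OF G s(1) z, of n] mhom_one[OF G s(1)] zeta_power[OF n] by simp
 then have "s (zeta n) \<in> mu n" by (simp add: mu_def)
 then obtain k where k: "k < n" "s (zeta n) = zeta n ^ k" using mu_zeta[OF n] by blast
 have "Rings.coprime k n"
 proof (rule ccontr)
  assume nc: "\<not> Rings.coprime k n"
  define d where "d = gcd k n"
  have "d ~= 1" using nc unfolding d_def coprime_iff_gcd_eq_1 .
  moreover have d0: "d ~= 0" using n by (simp add: d_def)
  ultimately have "d > 1" by linarith
  moreover have "d dvd k" "d dvd n" by (simp_all add: d_def)
  ultimately have d: "d dvd k" "d dvd n" "d > 1" by blast+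
  obtain m where m: "n = d * m" using d by (auto elim: dvdE)
  obtain l where l: "k = d * l" using d by (auto elim: dvdE)
  have "zeta n ^ m \<in> mu n" using z G mgrp_power by blast
  moreover have "s (zeta n ^ m) = (zeta n ^ n) ^ l" using mhom_power[OF G s(1) z, of m] k m l by (simp add: mult_ac flip: power_mult)
  ultimately have "zeta n ^ m = 1" using s(2) zeta_power[OF n] by simp
  then have "n dvd m" using zeta_power_eq_1_iff[OF n] by simp
  moreover have "m > 0" using m n by (cases m) auto
  ultimately have "n \<le> m" by (simp add: dvd_imp_le)
  then show False using m d \<open>m > 0\<close> by simp
 qed
 moreover have "s x = x ^ k" if "x \<in> mu n" for x
 proof -
  obtain j where "x = zeta n ^ j" using mu_zeta[OF n \<open>x \<in> mu n\<close>] by metis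
  then show ?thesis using mhom_power[OF G s(1) z, of j] k by (simp add: mult.commute flip: power_mult)
 qed
 ultimately show thesis using that by blast
qed

text \<open>Treats a single \<open>mu n\<close> and the union \<open>mu_inf\<close> of all of them
  at once.\<close>

definition cyclotomic_group :: "complex set \<Rightarrow> bool"
 where "cyclotomic_group W \<longleftrightarrow> mgrp W \<and>
  (\<forall>A. finite A --> A \<subseteq> W --> (\<exists>n\<ge>1. A \<subseteq> mu n \<and> mu n \<subseteq> W))"

lemma cyclotomic_group_mu_inf: "cyclotomic_group mu_inf"
 unfolding cyclotomic_group_def using finite_subset_mu_inf mu_subset_mu_inf mgrp_mu_inf by metis

text \<open>A relation involves finitely many roots of unity, on which an injective homomorphism is
  a power map with exponent coprime to the order, so \<open>landau\<close> applies. In this form the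
  Galois groups of the cyclotomic fields enter.\<close>

theorem relpres_cyclotomic:
 assumes W: "cyclotomic_group W" and s: "mhom W s" "\<And>x. x \<in> W ==> s x = 1 ==> x = 1" shows "relpres W s"
 unfolding relpres_def
proof (intro allI impI)
 fix A c assume A: "finite A" "A \<subseteq> W" "\<forall>x\<in>A. c x \<in> \<rat>" "(\<Sum>x\<in>A. c x * x) = 0"
 obtain n where n: "n \<ge> 1" "A \<subseteq> mu n" "mu n \<subseteq> W" using W A(1,2) unfolding cyclotomic_group_def by blast
 obtain k where k: "Rings.coprime k n" "\<And>x. x \<in> mu n ==> s x = x ^ k"
  using ex_power_on_mu[OF n(1) mhom_subset[OF s(1) n(3)]] s(2) n(3) by (metis subsetD)
 have "(\<Sum>x\<in>A. c x * s x) = (\<Sum>x\<in>A. c x * x ^ k)" using k n by (intro sum.cong) auto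
 also have "... = 0" using landau[OF n(1) A(1), of "\<lambda>x. x" c k] A n k by auto
 finally show "(\<Sum>x\<in>A. c x * s x) = 0" .
qed

section \<open>Rationality in cyclotomic fields\<close>

text \<open>Ramanujan sums. The complete sum over \<open>k < n\<close> is 0 or \<open>n\<close>;
  splitting it by \<open>gcd k n\<close> leaves the coprime part and the sums belonging to
  \<open>x ^ d\<close> and \<open>n div d\<close>, which are integers by induction.\<close>

lemma sum_primitive_powers_Ints:
 fixes x :: complex
 assumes "n \<ge> 1" "x ^ n = 1" shows "(\<Sum>k | k < n \<and> Rings.coprime k n. x ^ k) \<in> \<int>" using assms
proof (induction n arbitrary: x rule: less_induct)
 case (less n)
 define T where "T d = {k. k < n \<and> gcd k n = d}" for d
 have T: "(\<Sum>k\<in>T d. x ^ k) = (\<Sum>j | j < n div d \<and> Rings.coprime j (n div d). (x ^ d) ^ j)" if d: "d dvd n" for d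
 proof -
  obtain e where e: "n = d * e" using d by (auto elim: dvdE)
  have d0: "d > 0" "e > 0" using e less.prems by auto
  have "T d = (\<lambda>j. d * j) ` {j. j < e \<and> Rings.coprime j e}"
  proof (intro equalityI subsetI)
   fix k assume "k \<in> T d"
   then have k: "k < n" "gcd k n = d" by (auto simp: T_def)
   then obtain j where j: "k = d * j" by (metis dvdE gcd_dvd1)
   then have "d * gcd j e = d" by (metis gcd_mult_distrib_nat e k(2))
   then have "Rings.coprime j e" unfolding coprime_iff_gcd_eq_1 using d0 by simp
   moreover have "d * j < d * e" using k(1) j e by simp
   then have "j < e" by simp
   ultimately show "k \<in> (\<lambda>j. d * j) ` {j. j < e \<and> Rings.coprime j e}" using j by auto
  next
   fix k assume "k \<in> (\<lambda>j. d * j) ` {j. j < e \<and> Rings.coprime j e}"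
   then obtain j where j: "k = d * j" "j < e" "Rings.coprime j e" by auto
   then have "gcd j e = 1" by simp
   then have "gcd k n = d * 1" by (metis gcd_mult_distrib_nat e j(1))
   moreover have "d * j < d * e" using j(2) d0 by simp
   then have "k < n" by (simp only: j(1) e)
   ultimately show "k \<in> T d" by (simp add: T_def)
  qed
  moreover have "inj_on (\<lambda>j. d * j) {j. j < e \<and> Rings.coprime j e}" using d0 by (auto simp: inj_on_def)
  ultimately show ?thesis using e d0 by (simp add: sum.reindex power_mult)
 qed
 have fin: "finite {d. d dvd n}" using less.prems by (intro finite_divisors_nat) auto
 have "(\<Sum>k<n. x ^ k) = (\<Sum>d | d dvd n. \<Sum>k\<in>{k\<in>{..<n}. gcd k n = d}. x ^ k)" by (rule sum.group[symmetric]) (use fin in auto)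
 also have "... = (\<Sum>d | d dvd n. \<Sum>k\<in>T d. x ^ k)" by (simp add: T_def)
 also have "... = (\<Sum>k\<in>T 1. x ^ k) + (\<Sum>d\<in>{d. d dvd n} - {1}. \<Sum>k\<in>T d. x ^ k)" using fin by (intro sum.remove) auto
 finally have eq: "(\<Sum>k\<in>T 1. x ^ k) = (\<Sum>k<n. x ^ k) - (\<Sum>d\<in>{d. d dvd n} - {1}. \<Sum>k\<in>T d. x ^ k)" by simp
 have "(\<Sum>k<n. x ^ k) \<in> \<int>"
 proof (cases "x = 1")
  case False
  then have "(\<Sum>k<n. x ^ k) = 0" using geometric_sum[OF False, of n] less.prems by simp
  then show ?thesis by simp
 qed auto
 moreover have "(\<Sum>k\<in>T d. x ^ k) \<in> \<int>" if d: "d dvd n" "d ~= 1" for d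
 proof -
  obtain e where e: "n = d * e" using d by (auto elim: dvdE)
  have "e < n" "e \<ge> 1" "d > 0" using e d less.prems by (cases d; cases e; auto)+
  then show ?thesis unfolding T[OF d(1)] using e less.prems by (intro less.IH) (auto simp flip: power_mult)
 qed
 then have "(\<Sum>d\<in>{d. d dvd n} - {1}. \<Sum>k\<in>T d. x ^ k) \<in> \<int>" by (intro Ints_sum[where A = "_ - _"]) auto
 ultimately have "(\<Sum>k\<in>T 1. x ^ k) \<in> \<int>" unfolding eq by (rule Ints_diff)
 then show ?case unfolding T_def coprime_iff_gcd_eq_1 .
qed

text \<open>A fixed element equals the average of its images, and this average is a rational
  combination of Ramanujan sums.\<close>

lemma cyclotomic_fixed_Rats:
 assumes n: "n \<ge> 1" and y: "y \<in> qspan (mu n)"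
  and fixed: "\<And>k. k < n ==> Rings.coprime k n ==> lext (mu n) (\<lambda>z. z ^ k) y = y" shows "y \<in> \<rat>"
proof -
 obtain A c where A: "finite A" "A \<subseteq> mu n" "\<And>x. x \<in> A ==> c x \<in> \<rat>" "y = (\<Sum>x\<in>A. c x * x)"
  using y by (rule qspanE) blast
 define T where "T = {k. k < n \<and> Rings.coprime k n}"
 have T: "finite T" by (auto simp: T_def)
 have Tne: "T ~= {}"
 proof (cases "n = 1")
  case True then show ?thesis by (auto simp: T_def)
 next
  case False
  then have "1 \<in> T" using n by (auto simp: T_def)
  then show ?thesis by blast
 qed
 have "lext (mu n) (\<lambda>z. z ^ k) y = (\<Sum>x\<in>A. c x * x ^ k)" if "k \<in> T" for k unfolding A(4) using A that n
  by (intro lext_family relpres_mu_power) (auto simp: T_def)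
 then have "of_nat (card T) * y = (\<Sum>k\<in>T. \<Sum>x\<in>A. c x * x ^ k)"
  using fixed by (auto simp: T_def simp flip: sum_constant intro!: sum.cong)
 also have "... = (\<Sum>x\<in>A. c x * (\<Sum>k\<in>T. x ^ k))" unfolding sum_distrib_left by (rule sum.swap)
 also have "... \<in> \<rat>"
 proof (rule Rats_sum)
  fix x assume x: "x \<in> A"
  then have "(\<Sum>k\<in>T. x ^ k) \<in> \<int>" unfolding T_def using A n by (intro sum_primitive_powers_Ints) (auto simp: mu_def)
  then have "(\<Sum>k\<in>T. x ^ k) \<in> \<rat>" using Ints_subset_Rats by blast
  then show "c x * (\<Sum>k\<in>T. x ^ k) \<in> \<rat>" by (rule Rats_mult[OF A(3)[OF x]])
 qed
 finally have "of_nat (card T) * y / of_nat (card T) \<in> \<rat>" by (intro Rats_divide) auto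
 then show ?thesis using T Tne by simp
qed

lemma qspan_mu_infE:
 assumes "y \<in> qspan mu_inf"
 obtains n where "n \<ge> 1" "y \<in> qspan (mu n)"
proof -
 obtain A c where A: "finite A" "A \<subseteq> mu_inf" "\<And>x. x \<in> A ==> c x \<in> \<rat>" "y = (\<Sum>x\<in>A. c x * x)"
  using assms by (rule qspanE) blast
 obtain n where "n \<ge> 1" "A \<subseteq> mu n" using finite_subset_mu_inf[OF A(1,2)] .
 then show thesis using that A unfolding qspan_def by blast
qed

lemma cnj_mu: "n \<ge> 1 ==> z \<in> mu n ==> cnj z \<in> mu n" by (auto simp: mu_def simp flip: complex_cnj_power)

text \<open>The field generated by the roots of unity is abelian: its automorphisms commute with complex
 conjugation, so all conjugates of a real radical in it are real.\<close>

lemma real_radical_in_cyclotomic: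
 fixes r :: real
 assumes r: "r > 0" and m: "m \<ge> 1" "complex_of_real r ^ m \<in> \<rat>" and "of_real r \<in> qspan mu_inf"
 shows "complex_of_real r ^ 2 \<in> \<rat>"
proof -
 obtain n where n: "n \<ge> 1" and y: "of_real r \<in> qspan (mu n)" using qspan_mu_infE[OF assms(4)] .
 note G = mgrp_mu[OF n]
 show ?thesis
 proof (rule cyclotomic_fixed_Rats[OF n])
  show "complex_of_real r ^ 2 \<in> qspan (mu n)" using qspan_power[OF G y] .
  fix k assume k: "k < n" "Rings.coprime k n"
  let ?s = "\<lambda>z::complex. z ^ k"
  note rp = relpres_mu_power[OF n k(2)] and hom = mhom_power_map[OF G, of k]
  obtain A c where A: "finite A" "A \<subseteq> mu n" "\<And>x. x \<in> A ==> c x \<in> \<rat>" "of_real r = (\<Sum>x\<in>A. c x * x)"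
   using y by (rule qspanE) blast
  have cnjQ: "cnj q = q" if "q \<in> \<rat>" for q using that by (auto elim!: Rats_cases')
  have "of_real r = cnj (\<Sum>x\<in>A. c x * x)" using A(4) by (metis complex_cnj_complex_of_real)
  also have "... = (\<Sum>x\<in>A. c x * cnj x)" using A(3) cnjQ by simp
  finally have e2: "of_real r = (\<Sum>x\<in>A. c x * cnj x)" .
  define w where "w = lext (mu n) ?s (of_real r)"
  \<comment> \<open>As \<open>r\<close> is real, conjugating the roots of unity gives a second
    expansion of \<open>r\<close>. The power map sends both expansions to \<open>w\<close>, and the
    two results are conjugate to each other.\<close>
  have "w = (\<Sum>x\<in>A. c x * x ^ k)" unfolding w_def A(4) using A by (intro lext_family[OF rp]) auto
  moreover have "w = (\<Sum>x\<in>A. c x * cnj x ^ k)" unfolding w_def e2 using A n by (intro lext_family[OF rp]) (auto intro: cnj_mu)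
  ultimately have "cnj w = w" using A(3) cnjQ by simp
  then obtain t where t: "w = of_real t" by (metis Reals_cnj_iff Reals_cases)
  have "w ^ m = of_real r ^ m" unfolding w_def lext_power[OF rp G hom y, symmetric] using lext_Rats[OF rp G hom m(2)] .
  then have "t ^ m = r ^ m" using t by (metis of_real_eq_iff of_real_power)
  then have "\<bar>t\<bar> ^ m = r ^ m" using r by (metis abs_of_pos power_abs)
  \<comment> \<open>The sign of \<open>t\<close> stays open; hence only the square of
    \<open>r\<close> is shown to be fixed.\<close>
  then have "\<bar>t\<bar> = r" using r m by (intro power_eq_imp_eq_base[of "\<bar>t\<bar>" m r]) auto
  then have "w ^ 2 = of_real r ^ 2" unfolding t by (metis of_real_power power2_abs)
  then show "lext (mu n) ?s (complex_of_real r ^ 2) = complex_of_real r ^ 2" using lext_power[OF rp G hom y, of 2] by (simp add: w_def)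
 qed
qed

hide_const (open) up_ring.coeff up_ring.monom Polynomials.degree Polynomials.lead_coeff

section \<open>Kummer theory\<close>

definition subring_of_C :: "complex set \<Rightarrow> bool"
 where "subring_of_C R \<longleftrightarrow> 1 \<in> R \<and> (\<forall>x\<in>R. \<forall>y\<in>R. x - y \<in> R \<and> x * y \<in> R)"

definition subfield_of_C :: "complex set \<Rightarrow> bool"
 where "subfield_of_C E \<longleftrightarrow> subring_of_C E \<and> (\<forall>x\<in>E. inverse x \<in> E)"

text \<open>No subfield is prescribed as image; on a field, preservation of 1 and of products
  already prevents nonzero elements from going to 0.\<close>

definition embedding :: "complex set \<Rightarrow> (complex \<Rightarrow> complex) \<Rightarrow> bool"
 where "embedding E \<xi> \<longleftrightarrow> \<xi> 1 = 1 \<and>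
  (\<forall>x\<in>E. \<forall>y\<in>E. \<xi> (x + y) = \<xi> x + \<xi> y \<and> \<xi> (x * y) = \<xi> x * \<xi> y)"

text \<open>Polynomials keep complex coefficients and membership in \<open>E\<close> is carried
  along as a predicate, which is why division with remainder is redone in
  \<open>epoly_division\<close>.\<close>

definition epoly :: "complex set \<Rightarrow> complex poly \<Rightarrow> bool"
 where "epoly E p \<longleftrightarrow> (\<forall>i. coeff p i \<in> E)"

lemma subring_closed:
 assumes "subring_of_C R" shows "0 \<in> R" "1 \<in> R" "x \<in> R ==> - x \<in> R"
  "x \<in> R ==> y \<in> R ==> x + y \<in> R" "x \<in> R ==> y \<in> R ==> x - y \<in> R"
  "x \<in> R ==> y \<in> R ==> x * y \<in> R"
proof -
 show 1: "1 \<in> R" and m: "\<And>x y. x \<in> R ==> y \<in> R ==> x - y \<in> R" and "x \<in> R ==> y \<in> R ==> x * y \<in> R"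
  using assms by (simp_all add: subring_of_C_def)
 show 0: "0 \<in> R" using m[OF 1 1] by simp
 show u: "\<And>x. x \<in> R ==> - x \<in> R" using m[OF 0] by simp
 show "x \<in> R ==> y \<in> R ==> x + y \<in> R" using m[of x "- y"] u[of y] by simp
qed

lemma subring_power: "subring_of_C R ==> x \<in> R ==> x ^ n \<in> R" by (induction n) (auto simp: subring_closed)

lemma subring_sum: "subring_of_C R ==> (\<And>i. i \<in> I ==> f i \<in> R) ==> sum f I \<in> R"
 by (induction I rule: infinite_finite_induct) (auto simp: subring_closed)

lemma subfield_subring: "subfield_of_C E ==> subring_of_C E" by (simp add: subfield_of_C_def)

lemma subfield_divide: "subfield_of_C E ==> x \<in> E ==> y \<in> E ==> x / y \<in> E"
 by (simp add: subfield_of_C_def divide_inverse subring_closed)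

lemma embedding_facts:
 assumes E: "subring_of_C E" and \<xi>: "embedding E \<xi>"
 shows "\<xi> 1 = 1" "\<xi> 0 = 0" "x \<in> E ==> y \<in> E ==> \<xi> (x + y) = \<xi> x + \<xi> y"
  "x \<in> E ==> y \<in> E ==> \<xi> (x * y) = \<xi> x * \<xi> y" "x \<in> E ==> \<xi> (- x) = - \<xi> x"
  "x \<in> E ==> y \<in> E ==> \<xi> (x - y) = \<xi> x - \<xi> y" "x \<in> E ==> \<xi> (x ^ n) = \<xi> x ^ n"
  "(\<And>i. i \<in> I ==> f i \<in> E) ==> \<xi> (sum f I) = (\<Sum>i\<in>I. \<xi> (f i))"
proof -
 show 1: "\<xi> 1 = 1" and a: "\<And>x y. x \<in> E ==> y \<in> E ==> \<xi> (x + y) = \<xi> x + \<xi> y"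
  and m: "\<And>x y. x \<in> E ==> y \<in> E ==> \<xi> (x * y) = \<xi> x * \<xi> y"
  using \<xi> by (simp_all add: embedding_def)
 show 0: "\<xi> 0 = 0" using a[of 0 0] subring_closed[OF E] by simp
 show u: "\<And>x. x \<in> E ==> \<xi> (- x) = - \<xi> x"
  using a[of _ "- _"] 0 subring_closed[OF E] by (metis add.right_inverse eq_neg_iff_add_eq_0)
 show "x \<in> E ==> y \<in> E ==> \<xi> (x - y) = \<xi> x - \<xi> y"
  using a[of x "- y"] u[of y] subring_closed[OF E] by simp
 show "x \<in> E ==> \<xi> (x ^ n) = \<xi> x ^ n" by (induction n) (auto simp: 1 m subring_power[OF E])
 show "(\<And>i. i \<in> I ==> f i \<in> E) ==> \<xi> (sum f I) = (\<Sum>i\<in>I. \<xi> (f i))"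
  by (induction I rule: infinite_finite_induct) (auto simp: 0 a subring_sum[OF E])
qed

lemma embedding_nonzero:
 assumes E: "subfield_of_C E" and \<xi>: "embedding E \<xi>" and x: "x \<in> E" "x ~= 0" shows "\<xi> x ~= 0"
proof
 assume "\<xi> x = 0"
 moreover have "\<xi> (x * inverse x) = \<xi> x * \<xi> (inverse x)"
  using E x \<xi> by (intro embedding_facts(4)[OF subfield_subring[OF E]]) (auto simp: subfield_of_C_def)
 ultimately show False using x embedding_facts(1)[OF subfield_subring[OF E] \<xi>] by simp
qed

lemma embedding_divide:
 assumes E: "subfield_of_C E" and \<xi>: "embedding E \<xi>" and xy: "x \<in> E" "y \<in> E" "y ~= 0"
 shows "\<xi> (x / y) = \<xi> x / \<xi> y"
proof -
 have "\<xi> (x / y * y) = \<xi> (x / y) * \<xi> y"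
  by (rule embedding_facts(4)[OF subfield_subring[OF E] \<xi> subfield_divide[OF E xy(1,2)] xy(2)])
 then show ?thesis using xy embedding_nonzero[OF E \<xi> xy(2,3)] by (simp add: field_simps)
qed

lemma epoly_closed:
 assumes "subring_of_C E" shows "epoly E 0" "epoly E 1" "c \<in> E ==> epoly E [:c:]" "c \<in> E ==> epoly E (monom c n)"
  "epoly E p ==> epoly E q ==> epoly E (p + q)" "epoly E p ==> epoly E q ==> epoly E (p - q)"
  "epoly E p ==> epoly E q ==> epoly E (p * q)" using assms
 by (auto simp: epoly_def subring_closed coeff_mult coeff_pCons intro!: subring_sum split: nat.splits)

lemma epoly_poly: "subring_of_C R ==> epoly R p ==> x \<in> R ==> poly p x \<in> R"
 unfolding poly_altdef epoly_def by (intro subring_sum) (auto simp: subring_closed subring_power)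

lemma epoly_division:
 assumes E: "subfield_of_C E" and f: "epoly E f" "f ~= 0" and g: "epoly E g"
 obtains q r where "epoly E q" "epoly E r" "g = f * q + r" "r = 0 \<or> degree r < degree f"
proof -
 note R = subfield_subring[OF E]
 have "\<exists>q r. epoly E q \<and> epoly E r \<and> g = f * q + r \<and> (r = 0 \<or> degree r < degree f)"
  if "epoly E g" "\<And>i. i \<ge> n ==> coeff g i = 0" for n g using that
 proof (induction n arbitrary: g)
  case 0
  then have "g = 0" by (simp add: poly_eq_iff)
  then show ?case using epoly_closed(1)[OF R] by (intro exI[of _ 0]) auto
 next
  case (Suc n)
  show ?case
  proof (cases "n < degree f")
   case True
   have "degree g \<le> n" using Suc.prems(2) by (intro degree_le) auto
   then show ?thesis using True Suc.prems epoly_closed(1)[OF R] by (intro exI[of _ 0] exI[of _ g]) auto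
  next
   case False
   define c where "c = coeff g n / lead_coeff f"
   define u where "u = monom c (n - degree f)"
   have c: "c \<in> E" using Suc.prems(1) f by (auto simp: c_def epoly_def intro!: subfield_divide[OF E])
   then have u: "epoly E u" using epoly_closed(4)[OF R] by (simp add: u_def)
   have h: "epoly E (g - u * f)" using Suc.prems(1) u f epoly_closed[OF R] by blast
   have "coeff (g - u * f) i = 0" if "i \<ge> n" for i
   proof (cases "i = n")
    case True
    then show ?thesis using False f by (simp add: u_def coeff_monom_mult c_def)
   next
    case 2: False
    then have "coeff f (i - (n - degree f)) = 0" using that False by (intro coeff_eq_0) auto
    then show ?thesis using Suc.prems(2)[of i] that 2 by (simp add: u_def coeff_monom_mult)
   qed
   from Suc.IH[OF h this] obtain q r where qr: "epoly E q" "epoly E r" "g - u * f = f * q + r"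
    "r = 0 \<or> degree r < degree f" by blast
   then have "g = f * (q + u) + r" by (simp add: algebra_simps)
   then show ?thesis using qr epoly_closed(5)[OF R qr(1) u] by blast
  qed
 qed
 from this[OF g, of "Suc (degree g)"] show thesis using that by (auto simp: coeff_eq_0)
qed

lemma map_poly_embedding:
 assumes E: "subring_of_C E" and \<xi>: "embedding E \<xi>"
 shows "epoly E p ==> epoly E q ==> map_poly \<xi> (p + q) = map_poly \<xi> p + map_poly \<xi> q"
  "epoly E p ==> epoly E q ==> map_poly \<xi> (p - q) = map_poly \<xi> p - map_poly \<xi> q"
  "epoly E p ==> epoly E q ==> map_poly \<xi> (p * q) = map_poly \<xi> p * map_poly \<xi> q"
  "c \<in> E ==> map_poly \<xi> [:c:] = [:\<xi> c:]"
  "map_poly \<xi> (monom 1 1) = monom 1 1"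
proof -
 note F = embedding_facts[OF E \<xi>]
 have c: "coeff (map_poly \<xi> p) i = \<xi> (coeff p i)" for p i by (rule coeff_map_poly) (rule F(2))
 show "epoly E p ==> epoly E q ==> map_poly \<xi> (p + q) = map_poly \<xi> p + map_poly \<xi> q"
  by (simp add: poly_eq_iff c F epoly_def)
 show "epoly E p ==> epoly E q ==> map_poly \<xi> (p - q) = map_poly \<xi> p - map_poly \<xi> q"
  by (simp add: poly_eq_iff c F epoly_def)
 show "epoly E p ==> epoly E q ==> map_poly \<xi> (p * q) = map_poly \<xi> p * map_poly \<xi> q"
  by (simp add: poly_eq_iff c F epoly_def coeff_mult subring_closed[OF E])
 show "c \<in> E ==> map_poly \<xi> [:c:] = [:\<xi> c:]" by (simp add: poly_eq_iff c coeff_pCons F split: nat.splits)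
 show "map_poly \<xi> (monom 1 1) = monom 1 1" by (simp add: poly_eq_iff c F)
qed

text \<open>A minimal polynomial up to a scalar factor.\<close>

definition least_poly :: "complex set \<Rightarrow> complex \<Rightarrow> complex poly \<Rightarrow> bool"
 where "least_poly E \<alpha> f \<longleftrightarrow> epoly E f \<and> f ~= 0 \<and> poly f \<alpha> = 0 \<and>
  (\<forall>g. epoly E g --> g ~= 0 --> poly g \<alpha> = 0 --> degree f \<le> degree g)"

lemma least_poly_exists:
 assumes "epoly E g" "g ~= 0" "poly g \<alpha> = 0"
 obtains f where "least_poly E \<alpha> f"
proof -
 have "\<exists>f. (epoly E f \<and> f ~= 0 \<and> poly f \<alpha> = 0) \<and>
  (\<forall>g. (epoly E g \<and> g ~= 0 \<and> poly g \<alpha> = 0) --> degree f \<le> degree g)"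
  by (rule ex_has_least_nat) (use assms in blast)
 then show thesis using that unfolding least_poly_def by blast
qed

lemma least_poly_dvd:
 assumes E: "subfield_of_C E" and f: "least_poly E \<alpha> f" and g: "epoly E g" "poly g \<alpha> = 0"
 obtains q where "epoly E q" "g = f * q"
proof -
 have f': "epoly E f" "f ~= 0" "poly f \<alpha> = 0" using f by (auto simp: least_poly_def)
 obtain q r where qr: "epoly E q" "epoly E r" "g = f * q + r" "r = 0 \<or> degree r < degree f" using epoly_division[OF E f'(1,2) g(1)] .
 have "poly r \<alpha> = 0" using qr(3) g f' by simp
 then have "r = 0" using qr f unfolding least_poly_def by (metis not_le)
 then show thesis using qr that by simp
qed

lemma radical_poly:
 assumes E: "subring_of_C E" and n: "n \<ge> 1" "\<alpha> ^ n \<in> E"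
 shows "epoly E (monom 1 n - [:\<alpha> ^ n:])" "monom 1 n - [:\<alpha> ^ n:] ~= 0"
  "poly (monom 1 n - [:\<alpha> ^ n:]) \<alpha> = 0"
proof -
 show "epoly E (monom 1 n - [:\<alpha> ^ n:])" using n epoly_closed[OF E] subring_closed[OF E] by blast
 have "coeff (monom 1 n - [:\<alpha> ^ n:]) n = 1" using n by (cases n) auto
 then show "monom 1 n - [:\<alpha> ^ n:] ~= 0" by (metis coeff_0 zero_neq_one)
 show "poly (monom 1 n - [:\<alpha> ^ n:]) \<alpha> = 0" by (simp add: poly_monom)
qed

text \<open>\<open>E'\<close> consists of the values at \<alpha> of polynomials over
  \<open>E\<close>. Applying \<xi> to the coefficients and evaluating at \<beta> is well defined
  because \<open>f\<close> divides every polynomial over \<open>E\<close> that vanishes at \<alpha>.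
  The last conclusion makes \<open>E'\<close> the least ring containing \<open>E\<close> and
  \<alpha>.\<close>

lemma simple_extension:
 assumes E: "subfield_of_C E" and \<xi>: "embedding E \<xi>" and f: "least_poly E \<alpha> f"
  and \<beta>: "poly (map_poly \<xi> f) \<beta> = 0"
 obtains E' \<xi>' where "subfield_of_C E'" "embedding E' \<xi>'" "E \<subseteq> E'" "\<alpha> \<in> E'"
  "\<And>x. x \<in> E ==> \<xi>' x = \<xi> x" "\<xi>' \<alpha> = \<beta>"
  "\<And>R. subring_of_C R ==> E \<subseteq> R ==> \<alpha> \<in> R ==> E' \<subseteq> R"
proof -
 note R = subfield_subring[OF E]
 note M = map_poly_embedding[OF R \<xi>]
 note C = epoly_closed[OF R]
 have f': "epoly E f" "f ~= 0" "poly f \<alpha> = 0" using f by (auto simp: least_poly_def)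
 define E' where "E' = {poly g \<alpha> | g. epoly E g}"
 define \<xi>' where "\<xi>' y = (SOME z. \<exists>g. epoly E g \<and> y = poly g \<alpha> \<and> z = poly (map_poly \<xi> g) \<beta>)" for y
 have uniq: "poly (map_poly \<xi> g) \<beta> = poly (map_poly \<xi> h) \<beta>"
  if "epoly E g" "epoly E h" "poly g \<alpha> = poly h \<alpha>" for g h
 proof -
  have "epoly E (g - h)" "poly (g - h) \<alpha> = 0" using that C by auto
  then obtain q where q: "epoly E q" "g - h = f * q" using least_poly_dvd[OF E f] by metis
  have "map_poly \<xi> g - map_poly \<xi> h = map_poly \<xi> f * map_poly \<xi> q"
   using M(2)[OF that(1,2)] M(3)[OF f'(1) q(1)] q(2) by simp
  then have "poly (map_poly \<xi> g - map_poly \<xi> h) \<beta> = 0" using \<beta> by simp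
  then show ?thesis by simp
 qed
 have ev: "\<xi>' (poly g \<alpha>) = poly (map_poly \<xi> g) \<beta>" if "epoly E g" for g unfolding \<xi>'_def
 proof (rule some_equality)
  show "\<exists>h. epoly E h \<and> poly g \<alpha> = poly h \<alpha> \<and> poly (map_poly \<xi> g) \<beta> = poly (map_poly \<xi> h) \<beta>"
   using that by blast
 qed (metis uniq that)
 have ER: "subring_of_C E'" unfolding subring_of_C_def
 proof (intro conjI ballI)
  show "1 \<in> E'" unfolding E'_def using C(2) by (intro CollectI exI[of _ 1]) auto
  fix x y assume "x \<in> E'" "y \<in> E'"
  then obtain g h where gh: "epoly E g" "x = poly g \<alpha>" "epoly E h" "y = poly h \<alpha>" by (auto simp: E'_def)
  then have "x - y = poly (g - h) \<alpha>" "x * y = poly (g * h) \<alpha>" by auto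
  then show "x - y \<in> E'" "x * y \<in> E'" unfolding E'_def using C(6,7)[OF gh(1,3)] by blast+
 qed
 have inv: "inverse x \<in> E'" if "x \<in> E'" for x
 proof (cases "x = 0")
  case True then show ?thesis using subring_closed(1)[OF ER] by simp
 next
  case x0: False
  obtain g where g: "epoly E g" "x = poly g \<alpha>" using \<open>x \<in> E'\<close> by (auto simp: E'_def)
  \<comment> \<open>The Euclidean algorithm in ideal form: a nonzero element of least degree in the
    ideal generated by \<open>f\<close> and \<open>g\<close> divides both.\<close>
  define I where "I d \<longleftrightarrow> (\<exists>a b. epoly E a \<and> epoly E b \<and> d = a * f + b * g)" for d
  have Ie: "epoly E d" if "I d" for d using that C(5,7) f'(1) g(1) by (auto simp: I_def)
  have Imult: "I (d * q)" if "I d" "epoly E q" for d q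
  proof -
   obtain a b where "epoly E a" "epoly E b" "d = a * f + b * g" using \<open>I d\<close> by (auto simp: I_def)
   then have "d * q = (a * q) * f + (b * q) * g" "epoly E (a * q)" "epoly E (b * q)" using that C(7) by (simp_all add: algebra_simps)
   then show ?thesis unfolding I_def by blast
  qed
  have Idiff: "I (d - e)" if "I d" "I e" for d e
  proof -
   obtain a b where 1: "epoly E a" "epoly E b" "d = a * f + b * g" using \<open>I d\<close> by (auto simp: I_def)
   obtain a' b' where 2: "epoly E a'" "epoly E b'" "e = a' * f + b' * g" using \<open>I e\<close> by (auto simp: I_def)
   have "d - e = (a - a') * f + (b - b') * g" "epoly E (a - a')" "epoly E (b - b')" using 1 2 C(6) by (simp_all add: algebra_simps)
   then show ?thesis unfolding I_def by blast
  qed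
  have If: "I f" unfolding I_def using C(1,2) by (intro exI[of _ 1] exI[of _ 0]) simp
  have Ig: "I g" unfolding I_def using C(1,2) by (intro exI[of _ 0] exI[of _ 1]) simp
  have "\<exists>d. (I d \<and> d ~= 0) \<and> (\<forall>e. (I e \<and> e ~= 0) --> degree d \<le> degree e)"
   by (rule ex_has_least_nat[where k = f]) (use If f' in blast)
  then obtain d where d: "I d" "d ~= 0" and dmin: "\<And>e. I e ==> e ~= 0 ==> degree d \<le> degree e" by blast
  have dvd: "\<exists>q. epoly E q \<and> e = d * q" if "I e" for e
  proof -
   obtain q r where qr: "epoly E q" "epoly E r" "e = d * q + r" "r = 0 \<or> degree r < degree d"
    using epoly_division[OF E Ie[OF d(1)] d(2) Ie[OF \<open>I e\<close>]] .
   have "I r" using Idiff[OF that Imult[OF d(1) qr(1)]] qr(3) by simp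
   then have "r = 0" using dmin qr(4) by (meson not_le)
   then show ?thesis using qr by auto
  qed
  obtain q where q: "epoly E q" "f = d * q" using dvd[OF If] by blast
  obtain q' where q': "g = d * q'" using dvd[OF Ig] by blast
  \<comment> \<open>\<open>d\<close> divides \<open>g\<close>, so it does not vanish at \<alpha>.
    Then the cofactor of \<open>d\<close> in \<open>f\<close> does, and the minimality of
    \<open>f\<close> leaves \<open>d\<close> constant.\<close>
  have "poly d \<alpha> ~= 0" using x0 g q' by auto
  then have "poly q \<alpha> = 0" using f'(3) q(2) by simp
  moreover have "q ~= 0" using f'(2) q(2) by auto
  ultimately have "degree f \<le> degree q" using f q(1) by (auto simp: least_poly_def)
  then have "degree d = 0" using q(2) d(2) \<open>q ~= 0\<close> by (simp add: degree_mult_eq)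
  then obtain c where c: "d = [:c:]" by (rule degree_eq_zeroE)
  have c': "c \<in> E" "c ~= 0" using Ie[OF d(1)] d(2) c by (auto simp: epoly_def dest: spec[of _ 0])
  obtain a b where ab: "epoly E a" "epoly E b" "d = a * f + b * g" using d(1) by (auto simp: I_def)
  have "c = poly b \<alpha> * x" using arg_cong[OF ab(3), of "\<lambda>p. poly p \<alpha>"] c f'(3) g(2) by simp
  then have "inverse x = poly (b * [:inverse c:]) \<alpha>" using c' x0 by (simp add: field_simps)
  moreover have "epoly E (b * [:inverse c:])" by (intro C(3,7) ab(2)) (use c' E in \<open>simp add: subfield_of_C_def\<close>)
  ultimately show ?thesis unfolding E'_def by blast
 qed
 show thesis
 proof (rule that[of E' \<xi>'])
  show "subfield_of_C E'" using ER inv by (simp add: subfield_of_C_def)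
  show "embedding E' \<xi>'" unfolding embedding_def
  proof (intro conjI ballI)
   show "\<xi>' 1 = 1" using ev[of "[:1:]"] M(4)[of 1] C(3)[of 1] subring_closed[OF R]
    embedding_facts(1)[OF R \<xi>] by simp
   fix x y assume "x \<in> E'" "y \<in> E'"
   then obtain g h where gh: "epoly E g" "x = poly g \<alpha>" "epoly E h" "y = poly h \<alpha>" by (auto simp: E'_def)
   then have "x + y = poly (g + h) \<alpha>" "x * y = poly (g * h) \<alpha>" by auto
   then show "\<xi>' (x + y) = \<xi>' x + \<xi>' y" "\<xi>' (x * y) = \<xi>' x * \<xi>' y"
    using ev[OF C(5)[OF gh(1,3)]] ev[OF C(7)[OF gh(1,3)]] ev[OF gh(1)] ev[OF gh(3)]
     M(1,3)[OF gh(1,3)] gh(2,4) by simp_all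
  qed
  show "E \<subseteq> E'"
  proof
   fix x assume "x \<in> E"
   then show "x \<in> E'" using C(3) unfolding E'_def by (intro CollectI exI[of _ "[:x:]"]) auto
  qed
  have m: "epoly E (monom 1 1)" using C(4) subring_closed[OF R] by blast
  show "\<alpha> \<in> E'" unfolding E'_def using m by (intro CollectI exI[of _ "monom 1 1"]) (auto simp: poly_monom)
  show "\<xi>' x = \<xi> x" if "x \<in> E" for x using ev[of "[:x:]"] C(3)[OF that] M(4)[OF that] by simp
  show "\<xi>' \<alpha> = \<beta>" using ev[OF m] M(5) by (simp add: poly_monom)
  show "E' \<subseteq> R" if "subring_of_C R" "E \<subseteq> R" "\<alpha> \<in> R" for R
   using that epoly_poly[OF that(1) _ that(3)] by (auto simp: E'_def epoly_def)
 qed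
qed

text \<open>The leading coefficient is not sent to 0, so the degree does not drop and the
  fundamental theorem of algebra applies.\<close>

lemma map_poly_root_exists:
 assumes E: "subfield_of_C E" and \<xi>: "embedding E \<xi>" and f: "least_poly E \<alpha> f"
 obtains \<beta> where "poly (map_poly \<xi> f) \<beta> = 0"
proof -
 have f': "epoly E f" "f ~= 0" "poly f \<alpha> = 0" using f by (auto simp: least_poly_def)
 have "degree f ~= 0"
 proof
  assume "degree f = 0"
  then obtain c where "f = [:c:]" by (rule degree_eq_zeroE)
  then show False using f' by simp
 qed
 moreover have "coeff (map_poly \<xi> f) (degree f) ~= 0"
  using f' embedding_nonzero[OF E \<xi>] embedding_facts(2)[OF subfield_subring[OF E] \<xi>] by (simp add: coeff_map_poly epoly_def)
 then have "degree f \<le> degree (map_poly \<xi> f)" by (rule le_degree)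
 ultimately have "\<not> constant (poly (map_poly \<xi> f))" unfolding constant_degree by linarith
 then show thesis using fundamental_theorem_of_algebra that by blast
qed

text \<open>The radicals are adjoined one by one. The last conclusion bounds \<open>E'\<close> by
  any ring containing \<open>E\<close> and \<open>A\<close>; \<open>subfield_qspan\<close> obtains
  inverses from it.\<close>

lemma embedding_extends_to_radicals:
 assumes "finite A" and E: "subfield_of_C E" and \<xi>: "embedding E \<xi>"
  and A: "\<And>a. a \<in> A ==> \<exists>n\<ge>1. a ^ n \<in> E"
 obtains E' \<xi>' where "subfield_of_C E'" "embedding E' \<xi>'" "E \<subseteq> E'" "A \<subseteq> E'"
  "\<And>x. x \<in> E ==> \<xi>' x = \<xi> x" "\<And>R. subring_of_C R ==> E \<subseteq> R ==> A \<subseteq> R ==> E' \<subseteq> R"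
proof -
 have "\<exists>E' \<xi>'. subfield_of_C E' \<and> embedding E' \<xi>' \<and> E \<subseteq> E' \<and> A \<subseteq> E' \<and> (\<forall>x\<in>E. \<xi>' x = \<xi> x) \<and>
  (\<forall>R. subring_of_C R --> E \<subseteq> R --> A \<subseteq> R --> E' \<subseteq> R)"
  using assms(1) A
 proof (induction A rule: finite_induct)
  case empty
  then show ?case using E \<xi> by blast
 next
  case (insert a A)
  then obtain E1 \<xi>1 where 1: "subfield_of_C E1" "embedding E1 \<xi>1" "E \<subseteq> E1" "A \<subseteq> E1" "\<forall>x\<in>E. \<xi>1 x = \<xi> x"
   "\<forall>R. subring_of_C R --> E \<subseteq> R --> A \<subseteq> R --> E1 \<subseteq> R" by (metis insertCI)
  obtain n where n: "n \<ge> 1" "a ^ n \<in> E" using insert.prems by blast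
  then have "a ^ n \<in> E1" using 1 by blast
  note rad = radical_poly[OF subfield_subring[OF 1(1)] n(1) this]
  obtain f where f: "least_poly E1 a f" using least_poly_exists[OF rad] .
  obtain \<beta> where \<beta>: "poly (map_poly \<xi>1 f) \<beta> = 0" using map_poly_root_exists[OF 1(1,2) f] .
  obtain E2 \<xi>2 where 2: "subfield_of_C E2" "embedding E2 \<xi>2" "E1 \<subseteq> E2" "a \<in> E2"
   "\<And>x. x \<in> E1 ==> \<xi>2 x = \<xi>1 x" "\<xi>2 a = \<beta>"
   "\<And>R. subring_of_C R ==> E1 \<subseteq> R ==> a \<in> R ==> E2 \<subseteq> R"
   using simple_extension[OF 1(1,2) f \<beta>] by blast
  show ?case
  proof (intro exI[of _ E2] exI[of _ \<xi>2] conjI ballI allI impI)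
   fix R assume R: "subring_of_C R" "E \<subseteq> R" "insert a A \<subseteq> R"
   have "E1 \<subseteq> R" by (rule 1(6)[rule_format, OF R(1,2)]) (use R(3) in simp)
   then show "E2 \<subseteq> R" by (rule 2(7)[OF R(1)]) (use R(3) in simp)
  next
   show "subfield_of_C E2" "embedding E2 \<xi>2" by (fact 2)+
   show "E \<subseteq> E2" "insert a A \<subseteq> E2" using 1(3,4) 2(3,4) by blast+
   show "\<xi>2 x = \<xi> x" if "x \<in> E" for x using that 1(3,5) 2(5)[of x] by auto
  qed
 qed
 then show thesis
 proof (elim exE conjE)
  fix E' \<xi>'
  assume a: "subfield_of_C E'" "embedding E' \<xi>'" "E \<subseteq> E'" "A \<subseteq> E'" "\<forall>x\<in>E. \<xi>' x = \<xi> x"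
   "\<forall>R. subring_of_C R --> E \<subseteq> R --> A \<subseteq> R --> E' \<subseteq> R"
  show thesis by (rule that[OF a(1-4) bspec[OF a(5)] a(6)[rule_format]])
 qed
qed

text \<open>As \<alpha> is not in \<open>E\<close>, its minimal polynomial is not linear and has a
  further root \<beta>. It differs from \<alpha>, because \<alpha> is a simple root of the radical
  polynomial \<open>?P\<close>.\<close>

lemma embedding_moving_radical:
 assumes E: "subfield_of_C E" and \<alpha>: "\<alpha> \<notin> E" "n \<ge> 1" "\<alpha> ^ n \<in> E"
 obtains E' \<xi> where "subfield_of_C E'" "embedding E' \<xi>" "E \<subseteq> E'" "\<alpha> \<in> E'"
  "\<And>x. x \<in> E ==> \<xi> x = x" "\<xi> \<alpha> ~= \<alpha>"
proof -
 note R = subfield_subring[OF E]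
 let ?P = "monom 1 n - [:\<alpha> ^ n:]"
 note rad = radical_poly[OF R \<alpha>(2,3)]
 obtain f where f: "least_poly E \<alpha> f" using least_poly_exists[OF rad] .
 have f': "epoly E f" "f ~= 0" "poly f \<alpha> = 0" using f by (auto simp: least_poly_def)
 obtain q where q: "?P = f * q" using least_poly_dvd[OF E f rad(1,3)] by blast
 obtain g where g: "f = [:- \<alpha>, 1:] * g" using f'(3) by (auto simp: poly_eq_0_iff_dvd elim: dvdE)
 have g0: "g ~= 0" using f'(2) g by auto
 have "degree g ~= 0"
 proof
  assume "degree g = 0"
  then obtain c where "g = [:c:]" by (rule degree_eq_zeroE)
  then have "f = [:- \<alpha> * c, c:]" using g by simp
  then have "c \<in> E" "- \<alpha> * c \<in> E" "c ~= 0" using f' by (auto simp: epoly_def dest: spec[of _ 0] spec[of _ 1])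
  then have "- (- \<alpha> * c) / c \<in> E" using subfield_divide[OF E] subring_closed(3)[OF R] by blast
  then show False using \<alpha>(1) \<open>c ~= 0\<close> by simp
 qed
 then obtain \<beta> where \<beta>: "poly g \<beta> = 0" using fundamental_theorem_of_algebra[of g] by (auto simp: constant_degree)
 have "\<beta> ~= \<alpha>"
 proof
  assume "\<beta> = \<alpha>"
  then obtain h where "g = [:- \<alpha>, 1:] * h" using \<beta> by (auto simp: poly_eq_0_iff_dvd elim: dvdE)
  then have e: "?P = [:- \<alpha>, 1:] * ([:- \<alpha>, 1:] * (h * q))" using q g by (simp only: mult.assoc)
  have "poly (pderiv ?P) \<alpha> = 0" unfolding e by (simp only: pderiv_mult) simp
  moreover have "poly (pderiv ?P) \<alpha> = of_nat n * \<alpha> ^ (n - 1)" by (simp add: pderiv_diff pderiv_monom poly_monom pderiv_pCons)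
  moreover have "\<alpha> ~= 0" using \<alpha>(1) subring_closed(1)[OF R] by blast
  ultimately show False using \<alpha>(2) by simp
 qed
 have id: "embedding E (\<lambda>x. x)" by (simp add: embedding_def)
 have "poly (map_poly (\<lambda>x. x) f) \<beta> = 0" using g \<beta> by (simp add: map_poly_id')
 then obtain E' \<xi>' where "subfield_of_C E'" "embedding E' \<xi>'" "E \<subseteq> E'" "\<alpha> \<in> E'"
   "\<And>x. x \<in> E ==> \<xi>' x = x" "\<xi>' \<alpha> = \<beta>" using simple_extension[OF E id f] by metis
 then show thesis using that \<open>\<beta> ~= \<alpha>\<close> by metis
qed

text \<open>A relation is shortened as in the independence of characters. An embedding over
  \<open>K\<close> multiplies each \<open>w l\<close> by a root of unity \<open>\<epsilon> l\<close>
  in \<open>K\<close>; subtracting \<open>\<epsilon> i\<close> times the relation from its image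
  removes the term \<open>i\<close> and multiplies the coefficient of \<open>w j\<close> by the
  nonzero number \<open>\<epsilon> j - \<epsilon> i\<close>.\<close>

theorem kummer_independence:
 fixes w :: "'i \<Rightarrow> complex"
 assumes K: "subfield_of_C K" and N: "N \<ge> 1" "mu N \<subseteq> K"
  and "finite I" and w: "\<And>i. i \<in> I ==> w i ~= 0 \<and> w i ^ N \<in> K"
  and indep: "\<And>i j. i \<in> I ==> j \<in> I ==> i ~= j ==> w i / w j \<notin> K"
  and c: "\<And>i. i \<in> I ==> c i \<in> K" and rel: "(\<Sum>i\<in>I. c i * w i) = 0" and "j \<in> I" shows "c j = 0" using assms(4-)
proof (induction "card I" arbitrary: I c j rule: less_induct)
 case (less I c j)
 note R = subfield_subring[OF K]
 show ?case
 proof (cases "I = {j}")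
  case True
  then show ?thesis using less.prems by auto
 next
  case False
  then obtain i where i: "i \<in> I" "i ~= j" using less.prems by blast
  have "w j / w i \<notin> K" "(w j / w i) ^ N \<in> K" using less.prems i by (auto simp: power_divide intro!: subfield_divide[OF K])
  then obtain E1 \<xi>1 where 1: "subfield_of_C E1" "embedding E1 \<xi>1" "K \<subseteq> E1" "w j / w i \<in> E1"
   "\<And>x. x \<in> K ==> \<xi>1 x = x" "\<xi>1 (w j / w i) ~= w j / w i"
   using embedding_moving_radical[OF K _ N(1)] by metis
  have "\<exists>n\<ge>1. a ^ n \<in> E1" if "a \<in> w ` I" for a using that less.prems(2) 1(3) N(1) by blast
  \<comment> \<open>The embedding already moves the quotient \<open>w j / w i\<close>. Extending it
    to all radicals keeps this, whence \<open>\<epsilon> j\<close> and \<open>\<epsilon> i\<close>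
    differ.\<close>
  then obtain E \<xi> where E: "subfield_of_C E" "embedding E \<xi>" "E1 \<subseteq> E" "w ` I \<subseteq> E"
   "\<And>x. x \<in> E1 ==> \<xi> x = \<xi>1 x"
   using embedding_extends_to_radicals[of "w ` I", OF finite_imageI[OF less.prems(1)] 1(1,2)] by metis
  note F = embedding_facts[OF subfield_subring[OF E(1)] E(2)]
  have KE: "x \<in> E" "\<xi> x = x" if "x \<in> K" for x using that 1 E by auto
  define \<epsilon> where "\<epsilon> l = \<xi> (w l) / w l" for l
  have \<epsilon>: "\<xi> (w l) = \<epsilon> l * w l" if "l \<in> I" for l using less.prems(2)[OF that] by (simp add: \<epsilon>_def)
  have \<epsilon>K: "\<epsilon> l \<in> K" if "l \<in> I" for l
  proof -
   have "\<xi> (w l) ^ N = w l ^ N" using F(7)[of "w l" N] E(4) KE less.prems(2)[OF that] that by auto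
   then have "\<epsilon> l ^ N = 1" using less.prems(2)[OF that] by (simp add: \<epsilon>_def power_divide)
   then show ?thesis using N by (auto simp: mu_def)
  qed
  have ne: "\<epsilon> j ~= \<epsilon> i"
  proof
   assume "\<epsilon> j = \<epsilon> i"
   moreover have "\<xi> (w j / w i) = \<xi> (w j) / \<xi> (w i)" using E(4) i less.prems by (intro embedding_divide[OF E(1,2)]) auto
   moreover have "\<epsilon> i ~= 0" using embedding_nonzero[OF E(1,2), of "w i"] E(4) i less.prems(2) by (auto simp: \<epsilon>_def)
   ultimately have "\<xi> (w j / w i) = w j / w i" using \<epsilon> i less.prems(6) by simp
   then show False using 1(4,6) E(5) by simp
  qed
  have "\<xi> (\<Sum>l\<in>I. c l * w l) = (\<Sum>l\<in>I. \<xi> (c l * w l))"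
   using less.prems(4) KE E(4) by (intro F(8)) (auto intro!: subring_closed(6)[OF subfield_subring[OF E(1)]])
  also have "... = (\<Sum>l\<in>I. c l * (\<epsilon> l * w l))"
  proof (intro sum.cong refl)
   fix l assume l: "l \<in> I"
   have "\<xi> (c l * w l) = \<xi> (c l) * \<xi> (w l)" using l less.prems(4) KE E(4) by (intro F(4)) auto
   then show "\<xi> (c l * w l) = c l * (\<epsilon> l * w l)" using l KE less.prems(4) \<epsilon> by simp
  qed
  finally have "(\<Sum>l\<in>I. c l * (\<epsilon> l * w l)) = 0" using less.prems(5) F(2) by simp
  then have "(\<Sum>l\<in>I. c l * (\<epsilon> l * w l)) - \<epsilon> i * (\<Sum>l\<in>I. c l * w l) = 0" using less.prems(5) by simp
  then have "(\<Sum>l\<in>I. (c l * (\<epsilon> l - \<epsilon> i)) * w l) = 0" by (simp add: sum_distrib_left sum_subtractf algebra_simps)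
  then have "(\<Sum>l\<in>I - {i}. (c l * (\<epsilon> l - \<epsilon> i)) * w l) = 0" using i less.prems(1) by (simp add: sum.remove[of I i])
  moreover have "card (I - {i}) < card I" using i(1) less.prems(1) by (rule card_Diff1_less[rotated])
  ultimately have "c j * (\<epsilon> j - \<epsilon> i) = 0" using i less.prems \<epsilon>K
   by (intro less.hyps[of "I - {i}" "\<lambda>l. c l * (\<epsilon> l - \<epsilon> i)" j])
     (auto intro!: subring_closed[OF R])
  then show ?thesis using ne by simp
 qed
qed

section \<open>Fields generated by radicals\<close>

definition radical_group :: "complex set \<Rightarrow> bool"
 where "radical_group W \<longleftrightarrow> mgrp W \<and> (\<forall>x\<in>W. \<exists>n\<ge>1. x ^ n \<in> \<rat>)"

lemma subfield_Rats: "subfield_of_C \<rat>" by (auto simp: subfield_of_C_def subring_of_C_def)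

lemma subring_qspan: "mgrp W ==> subring_of_C (qspan W)" by (auto simp: subring_of_C_def qspan_Rats qspan_diff qspan_mult)

text \<open>An element of the ring \<open>qspan W\<close> involves finitely many radicals. The field
  they generate contains the inverse and lies in every ring containing \<rat> and these radicals, in
  particular in \<open>qspan W\<close>.\<close>

lemma subfield_qspan:
 assumes W: "radical_group W" shows "subfield_of_C (qspan W)" unfolding subfield_of_C_def
proof (intro conjI ballI)
 have G: "mgrp W" using W by (simp add: radical_group_def)
 show R: "subring_of_C (qspan W)" using subring_qspan[OF G] .
 fix u assume "u \<in> qspan W"
 then obtain A c where A: "finite A" "A \<subseteq> W" "\<And>x. x \<in> A ==> c x \<in> \<rat>" "u = (\<Sum>x\<in>A. c x * x)"
  by (rule qspanE) blast
 have id: "embedding \<rat> (\<lambda>x. x)" by (simp add: embedding_def)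
 have "\<exists>n\<ge>1. a ^ n \<in> \<rat>" if "a \<in> A" for a using that A(2) W unfolding radical_group_def by blast
 then obtain E where E: "subfield_of_C E" "\<rat> \<subseteq> E" "A \<subseteq> E"
  "\<And>R. subring_of_C R ==> \<rat> \<subseteq> R ==> A \<subseteq> R ==> E \<subseteq> R"
  using embedding_extends_to_radicals[OF A(1) subfield_Rats id] by metis
 have "u \<in> E" unfolding A(4) using A(3) E(2,3) by (intro subring_sum subring_closed(6) subfield_subring[OF E(1)]) auto
 then have "inverse u \<in> E" using E(1) by (auto simp: subfield_of_C_def)
 moreover have "E \<subseteq> qspan W" using E(4)[OF R] A(2) qspan_Rats[OF G] qspan_base by blast
 ultimately show "inverse u \<in> qspan W" by blast
qed

lemma radical_group_mu_inf: "radical_group mu_inf" unfolding radical_group_def mu_inf_def using mgrp_mu_inf by (auto simp: mu_inf_def)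

text \<open>Kummer independence over the cyclotomic field: a quotient \<open>y i / y j\<close> in
  that field would have a rational square by \<open>real_radical_in_cyclotomic\<close>.\<close>

lemma real_radicals_independent:
 fixes y :: "'i \<Rightarrow> real"
 assumes I: "finite I" and y: "\<And>i. i \<in> I ==> y i > 0"
  and rad: "\<And>i. i \<in> I ==> \<exists>n\<ge>1. complex_of_real (y i) ^ n \<in> \<rat>"
  and indep: "\<And>i j. i \<in> I ==> j \<in> I ==> i ~= j ==> complex_of_real (y i / y j) ^ 2 \<notin> \<rat>"
  and c: "\<And>i. i \<in> I ==> c i \<in> qspan mu_inf" and rel: "(\<Sum>i\<in>I. c i * of_real (y i)) = 0" and "j \<in> I"
 shows "c j = 0"
proof -
 obtain n where n: "\<And>i. i \<in> I ==> n i \<ge> (1::nat) \<and> complex_of_real (y i) ^ n i \<in> \<rat>" using rad by metis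
 define N where "N = (\<Prod>i\<in>I. n i)"
 have N: "N \<ge> 1" using n by (simp add: N_def Suc_le_eq prod_pos)
 have yN: "complex_of_real (y i) ^ N \<in> \<rat>" if "i \<in> I" for i
 proof -
  have "complex_of_real (y i) ^ N = (complex_of_real (y i) ^ n i) ^ (\<Prod>l\<in>I - {i}. n l)"
   using that I by (simp add: N_def prod.remove power_mult)
  then show ?thesis using n[OF that] by (simp add: Rats_power)
 qed
 show ?thesis
 proof (rule kummer_independence[OF subfield_qspan[OF radical_group_mu_inf] N _ I, where w = "\<lambda>i. of_real (y i)"])
  show "mu N \<subseteq> qspan mu_inf" using mu_subset_mu_inf[OF N] qspan_base by blast
  show "complex_of_real (y i) ~= 0 \<and> complex_of_real (y i) ^ N \<in> qspan mu_inf" if "i \<in> I" for i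
   using y[OF that] qspan_Rats[OF mgrp_mu_inf yN[OF that]] by auto
  fix i l assume il: "i \<in> I" "l \<in> I" "i ~= l"
  show "complex_of_real (y i) / complex_of_real (y l) \<notin> qspan mu_inf"
  proof
   assume "complex_of_real (y i) / complex_of_real (y l) \<in> qspan mu_inf"
   moreover have "complex_of_real (y i / y l) ^ N \<in> \<rat>" using yN il by (simp add: power_divide Rats_divide)
   ultimately have "complex_of_real (y i / y l) ^ 2 \<in> \<rat>" using y il N by (intro real_radical_in_cyclotomic[of _ N]) auto
   then show False using indep[OF il] by blast
  qed
 qed (use c rel \<open>j \<in> I\<close> in auto)
qed

section \<open>Square roots in cyclotomic fields\<close>

text \<open>Both sides are the derivative of the polynomial \<open>?P\<close> at 1.\<close>

lemma prod_one_minus_zeta: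
 assumes "p \<ge> 1" shows "(\<Prod>j\<in>{1..<p}. 1 - zeta p ^ j) = of_nat p"
proof -
 let ?P = "Polynomial.monom 1 p - 1 :: complex poly"
 have inj: "inj_on (\<lambda>j. zeta p ^ j) {..<p}"
 proof (rule inj_onI)
  fix i j assume ij: "i \<in> {..<p}" "j \<in> {..<p}" "zeta p ^ i = zeta p ^ j"
  have *: "i = j" if "i \<le> j" "zeta p ^ i = zeta p ^ j" "j < p" for i j
  proof -
   have "zeta p ^ j = zeta p ^ i * zeta p ^ (j - i)" using that(1) by (simp flip: power_add)
   then have "zeta p ^ (j - i) = 1" using that(2) zeta_nonzero[of p] by simp
   then have "p dvd j - i" using zeta_power_eq_1_iff[OF assms] by simp
   moreover have "j - i < p" using that(3) by linarith
   ultimately have "\<not> 0 < j - i" using nat_dvd_not_less by blast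
   then show "i = j" using that(1) by simp
  qed
  show "i = j"
  proof (cases "i \<le> j")
   case True
   show ?thesis by (rule *[OF True ij(3)]) (use ij(2) in simp)
  next
   case False
   then have "j \<le> i" by simp
   from *[OF this ij(3)[symmetric]] show ?thesis using ij(1) by simp
  qed
 qed
 have img: "(\<lambda>j. zeta p ^ j) ` {..<p} = mu p"
 proof
  show "(\<lambda>j. zeta p ^ j) ` {..<p} \<subseteq> mu p"
   using zeta_power[OF assms] by (auto simp: mu_def mult.commute[of _ p] power_mult simp flip: power_mult)
     (metis mult.commute power_mult power_one)
  show "mu p \<subseteq> (\<lambda>j. zeta p ^ j) ` {..<p}" using mu_zeta[OF assms] by (metis image_eqI lessThan_iff subsetI)
 qed
 have "{x. poly ?P x = 0} = mu p" by (auto simp: mu_def poly_monom)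
 moreover have "rsquarefree ?P"
 proof (rule rsquarefree_roots[THEN iffD2], intro allI notI)
  fix a assume a: "poly ?P a = 0 \<and> poly (pderiv ?P) a = 0"
  then have "a ^ p = 1" "of_nat p * a ^ (p - 1) = 0" by (auto simp: poly_monom pderiv_diff pderiv_monom)
  then show False using assms by (auto simp: power_0_left split: if_splits)
 qed
 moreover have "Polynomial.lead_coeff ?P = 1"
 proof -
  have "Polynomial.degree ?P = p" using assms by (subst diff_conv_add_uminus, subst degree_add_eq_left) (auto simp: degree_monom_eq)
  then show ?thesis using assms by (simp add: coeff_1)
 qed
 ultimately have "?P = (\<Prod>z\<in>mu p. [:- z, 1:])" using complex_poly_decompose_rsquarefree[of ?P] by simp
 also have "... = (\<Prod>j<p. [:- (zeta p ^ j), 1:])" unfolding img[symmetric] using inj by (simp add: prod.reindex)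
 also have "{..<p} = insert 0 {1..<p}" using assms by auto
 finally have P: "?P = [:- 1, 1:] * (\<Prod>j\<in>{1..<p}. [:- (zeta p ^ j), 1:])" by simp
 have "poly (pderiv ?P) 1 = (\<Prod>j\<in>{1..<p}. poly [:- (zeta p ^ j), 1:] 1)" unfolding P pderiv_mult by (simp add: pderiv_pCons poly_prod)
 then show ?thesis by (simp add: pderiv_diff pderiv_monom poly_monom)
qed

text \<open>For odd primes this is the quadratic Gauss sum up to sign; the product form makes its
  square a matter of pairing exponents.\<close>

definition gauss :: "nat \<Rightarrow> complex"
 where "gauss p = (\<Prod>k\<in>{1..(p - 1) div 2}. zeta p ^ k - inverse (zeta p ^ k))"

definition pstar :: "nat \<Rightarrow> int"
 where "pstar p = (- 1) ^ ((p - 1) div 2) * int p"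

lemma zeta_in_mu: "n \<ge> 1 ==> zeta n \<in> mu n" by (simp add: mu_def zeta_power)

lemma gauss_in_qspan: "p \<ge> 1 ==> gauss p \<in> qspan (mu p)" unfolding gauss_def
 by (intro qspan_prod mgrp_mu qspan_diff qspan_base mgrp_inverse mgrp_power zeta_in_mu)

text \<open>With \<open>u = zeta p ^ k\<close>, the square of \<open>u - inverse u\<close> is
  \<open>- ((1 - u ^ 2) * (1 - inverse u ^ 2))\<close>. The even exponents \<open>2 * k\<close> and
  the odd exponents \<open>p - 2 * k\<close> together run once through
  \<open>{1..<p}\<close>.\<close>

lemma gauss_square:
 assumes "odd p" shows "gauss p ^ 2 = of_int (pstar p)"
proof -
 have p: "p \<ge> 1" using assms by (cases p) auto
 define m where "m = (p - 1) div 2"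
 have pm: "p = 2 * m + 1" using assms by (auto simp: m_def elim!: oddE)
 let ?z = "zeta p"
 have z0: "?z ~= 0" using zeta_nonzero .
 have sq: "(?z ^ k - inverse (?z ^ k)) ^ 2 = - ((1 - ?z ^ (2 * k)) * (1 - ?z ^ (p - 2 * k)))"
  if "k \<in> {1..m}" for k
 proof -
  have "?z ^ (p - 2 * k) * ?z ^ (2 * k) = ?z ^ p" using that pm by (simp flip: power_add)
  moreover have e: "?z ^ (2 * k) = (?z ^ k) ^ 2" by (simp add: mult.commute flip: power_mult)
  ultimately have "(?z ^ k) ^ 2 * ?z ^ (p - 2 * k) = 1" using zeta_power[OF p] by (simp add: mult.commute)
  then have "?z ^ (p - 2 * k) = inverse ((?z ^ k) ^ 2)" by (metis inverse_unique)
  moreover note e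
  moreover have "?z ^ k ~= 0" using z0 by simp
  ultimately show ?thesis by (simp add: power2_eq_square field_simps)
 qed
 have U: "{1..<p} = (\<lambda>k. 2 * k) ` {1..m} \<union> (\<lambda>k. p - 2 * k) ` {1..m}"
 proof (intro equalityI subsetI)
  fix j assume j: "j \<in> {1..<p}"
  show "j \<in> (\<lambda>k. 2 * k) ` {1..m} \<union> (\<lambda>k. p - 2 * k) ` {1..m}"
  proof (cases "even j")
   case True
   then obtain k where "j = 2 * k" by (auto elim: evenE)
   then show ?thesis using j pm by auto
  next
   case False
   then obtain k where "j = 2 * k + 1" by (auto elim: oddE)
   then have "j = p - 2 * (m - k)" "m - k \<in> {1..m}" using j pm by auto
   then show ?thesis by blast
  qed
 qed (use pm in auto)
 have disj: "(\<lambda>k. 2 * k) ` {1..m} \<inter> (\<lambda>k. p - 2 * k) ` {1..m} = {}"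
 proof -
  have "2 * k ~= p - 2 * l" if "l \<in> {1..m}" for k l
  proof
   assume "2 * k = p - 2 * l"
   then have "2 * k + 2 * l = 2 * m + 1" using \<open>l \<in> {1..m}\<close> pm by auto
   then show False by presburger
  qed
  then show ?thesis by blast
 qed
 have inj: "inj_on (\<lambda>k. p - 2 * k) {1..m}" using pm by (auto simp: inj_on_def)
 have "(\<Prod>j\<in>{1..<p}. 1 - ?z ^ j) = (\<Prod>j\<in>(\<lambda>k. 2 * k) ` {1..m} \<union> (\<lambda>k. p - 2 * k) ` {1..m}. 1 - ?z ^ j)"
  by (rule arg_cong[OF U])
 also have "... = (\<Prod>j\<in>(\<lambda>k. 2 * k) ` {1..m}. 1 - ?z ^ j) * (\<Prod>j\<in>(\<lambda>k. p - 2 * k) ` {1..m}. 1 - ?z ^ j)"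
  by (rule prod.union_disjoint[OF _ _ disj]) auto
 also have "(\<Prod>j\<in>(\<lambda>k. 2 * k) ` {1..m}. 1 - ?z ^ j) = (\<Prod>k\<in>{1..m}. 1 - ?z ^ (2 * k))" by (simp add: prod.reindex inj_on_def)
 also have "(\<Prod>j\<in>(\<lambda>k. p - 2 * k) ` {1..m}. 1 - ?z ^ j) = (\<Prod>k\<in>{1..m}. 1 - ?z ^ (p - 2 * k))"
  by (rule prod.reindex[OF inj, unfolded o_def])
 finally have "of_nat p = (\<Prod>k\<in>{1..m}. (1 - ?z ^ (2 * k)) * (1 - ?z ^ (p - 2 * k)))"
  using prod_one_minus_zeta[OF p] by (simp add: prod.distrib)
 moreover have "gauss p ^ 2 = (\<Prod>k\<in>{1..m}. - ((1 - ?z ^ (2 * k)) * (1 - ?z ^ (p - 2 * k))))"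
  unfolding gauss_def m_def[symmetric] prod_power_distrib using sq by (intro prod.cong) auto
 moreover have "(\<Prod>k\<in>{1..m}. - f k) = (- 1) ^ m * (\<Prod>k\<in>{1..m}. f k)" for f :: "nat \<Rightarrow> complex"
  using prod.distrib[of "\<lambda>_. - 1" f "{1..m}"] by simp
 ultimately show ?thesis by (simp add: pstar_def m_def)
qed

text \<open>Written as a sum of roots of unity, so that the action of an automorphism can be read
  off from \<open>zeta 8\<close>.\<close>

definition sqrt_two :: complex
 where "sqrt_two = zeta 8 + inverse (zeta 8)"

lemma zeta_8_square: "zeta 8 ^ 2 = \<i>"
proof -
 have "zeta 8 ^ 2 = cis (real 2 * (2 * pi / real 8))" unfolding zeta_def by (rule Complex.DeMoivre)
 also have "real 2 * (2 * pi / real 8) = pi / 2" by simp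
 finally show ?thesis by simp
qed

lemma ii_in_mu_4: "\<i> \<in> mu 4" by (simp add: mu_def power4_eq_xxxx)

lemma sqrt_two_square: "sqrt_two ^ 2 = 2"
proof -
 have "sqrt_two ^ 2 = zeta 8 ^ 2 + 2 + inverse (zeta 8 ^ 2)" by (simp add: sqrt_two_def power2_sum power_inverse zeta_nonzero)
 then show ?thesis by (simp add: zeta_8_square)
qed

lemma Rats_imp_Reals: "q \<in> \<rat> ==> q \<in> (\<real> :: complex set)" by (auto elim!: Rats_cases')

lemma square_eq_square: "x ^ 2 = y ^ 2 ==> x = y \<or> x = - (y :: complex)" by (simp add: power2_eq_iff)

text \<open>Having a square root in the cyclotomic field is a multiplicative property of integers;
  it holds for -1, for 2 by \<open>sqrt_two\<close>, and for odd primes by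
  \<open>gauss\<close>.\<close>

lemma sqrt_Rats_cyclotomic:
 assumes "x ^ 2 \<in> \<rat>" shows "x \<in> qspan mu_inf"
proof -
 note G = mgrp_mu_inf
 have mu: "y \<in> qspan mu_inf" if "y \<in> qspan (mu n)" "n \<ge> 1" for y n using that qspan_mono[OF mu_subset_mu_inf] by blast
 have base: "y \<in> qspan mu_inf" if "y \<in> mu n" "n \<ge> 1" for y n using that mu_subset_mu_inf[OF that(2)] qspan_base by blast
 define P where "P a \<longleftrightarrow> (\<exists>y\<in>qspan mu_inf. y ^ 2 = complex_of_int a)" for a
 have P_mult: "P (a * b)" if "P a" "P b" for a b
 proof -
  obtain y z where "y \<in> qspan mu_inf" "z \<in> qspan mu_inf" "y ^ 2 = of_int a" "z ^ 2 = of_int b"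
   using \<open>P a\<close> \<open>P b\<close> by (auto simp: P_def)
  then show ?thesis using qspan_mult[OF G] unfolding P_def by (intro bexI[of _ "y * z"]) (auto simp: power_mult_distrib)
 qed
 have P_neg: "P (- 1)" unfolding P_def using base[OF ii_in_mu_4] by (intro bexI[of _ \<i>]) auto
 have P_prime: "P (int p)" if "Factorial_Ring.prime p" for p
 proof (cases "p = 2")
  case True
  have "zeta 8 \<in> mu 8" by (rule zeta_in_mu) simp
  then have "sqrt_two \<in> qspan mu_inf" unfolding sqrt_two_def by (intro qspan_add base[of _ 8] mgrp_inverse[OF mgrp_mu]) auto
  then show ?thesis using sqrt_two_square True by (auto simp: P_def)
 next
  case False
  then have p: "odd p" "p \<ge> 1" using that prime_odd_nat prime_ge_2_nat prime_ge_1_nat by (metis le_neq_implies_less, metis)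
  have "P (pstar p)" unfolding P_def using gauss_square[OF p(1)] mu[OF gauss_in_qspan[OF p(2)] p(2)] by blast
  moreover have "P ((- 1) ^ n)" for n
  proof (induction n)
   case 0
   then show ?case using qspan_Rats[OF G, of 1] by (auto simp: P_def intro!: bexI[of _ 1])
  next
   case (Suc n) then show ?case using P_mult[OF P_neg] by simp
  qed
  ultimately have "P ((- 1) ^ ((p - 1) div 2) * pstar p)" using P_mult by blast
  then show ?thesis by (simp add: pstar_def flip: power_mult_distrib mult.assoc)
 qed
 have P_nat: "P (int n)" for n
 proof (induction n rule: prime_divisors_induct)
  case zero
  then show ?case using qspan_zero by (auto simp: P_def intro!: bexI[of _ 0])
 next
  case (unit x)
  then show ?case using qspan_Rats[OF G, of 1] by (auto simp: P_def intro!: bexI[of _ 1])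
 next
  case (factor p x)
  then show ?case using P_mult[OF P_prime[of p]] by simp
 qed
 have P_int: "P a" for a using P_nat[of "nat \<bar>a\<bar>"] P_mult[OF P_neg P_nat[of "nat \<bar>a\<bar>"]] by (cases "a \<ge> 0") auto
 obtain a b where ab: "b > 0" "x ^ 2 = of_int a / of_int b" using assms by (auto elim: Rats_cases')
 obtain y where y: "y \<in> qspan mu_inf" "y ^ 2 = of_int (a * b)" using P_int[of "a * b"] by (auto simp: P_def)
 have "x ^ 2 = (y / of_int b) ^ 2" using ab y by (simp add: power_divide power2_eq_square)
 moreover have "y / of_int b \<in> qspan mu_inf" using qspan_smult[of "1 / of_int b" y] y by (simp add: Rats_divide)
 ultimately show ?thesis using square_eq_square[of x "y / of_int b"] qspan_uminus by auto
qed

section \<open>The groups of the statement\<close>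

lemma complex_field_simps [simp]:
 "carrier complex_field = (UNIV :: complex set)"
 "mult complex_field = ((*) :: complex \<Rightarrow> complex \<Rightarrow> complex)"
 "add complex_field = ((+) :: complex \<Rightarrow> complex \<Rightarrow> complex)"
 "zero complex_field = (0 :: complex)" "one complex_field = (1 :: complex)" by (simp_all add: ring_of_type_algebra_def)

lemma field_complex_field: "field (complex_field :: complex ring)" by (rule field_from_type_algebra)

abbreviation gp :: "complex set \<Rightarrow> complex monoid"
 where "gp D \<equiv> (mult_of complex_field)\<lparr>carrier := D\<rparr>"

lemma group_gp:
 assumes "mgrp D" shows "group (gp D)"
proof (rule groupI)
 fix x assume "x \<in> carrier (gp D)"
 then show "\<exists>y\<in>carrier (gp D). y \<otimes>\<^bsub>gp D\<^esub> x = \<one>\<^bsub>gp D\<^esub>"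
  using mgrp_inverse[OF assms] mgrp_nonzero[OF assms] by (intro bexI[of _ "inverse x"]) auto
qed (use assms in \<open>auto simp: mgrp_mult mgrp_one mult.assoc\<close>)

lemma rat_units_eq: "rat_units = gp (\<rat> - {0})" by (simp add: rat_units_def)

lemma mgrp_of_subgroup:
 assumes "subgroup \<Gamma> rat_units" shows "mgrp \<Gamma>" "\<Gamma> \<subseteq> \<rat>"
proof -
 interpret R: group rat_units unfolding rat_units_eq by (rule group_gp[OF mgrp_Rats])
 have inv: "inv\<^bsub>rat_units\<^esub> x = inverse x" if "x \<in> \<rat> - {0}" for x
  by (rule R.inv_equality) (use that in \<open>auto simp: rat_units_eq\<close>)
 have sub: "\<Gamma> \<subseteq> \<rat> - {0}" using subgroup.subset[OF assms] by (simp add: rat_units_eq)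
 show "\<Gamma> \<subseteq> \<rat>" using sub by blast
 show "mgrp \<Gamma>" unfolding mgrp_def
 proof (intro conjI ballI)
  show "1 \<in> \<Gamma>" using subgroup.one_closed[OF assms] by (simp add: rat_units_eq)
  show "0 \<notin> \<Gamma>" using sub by blast
  fix x assume x: "x \<in> \<Gamma>"
  have "x \<in> \<rat> - {0}" using x sub by blast
  from inv[OF this] show "inverse x \<in> \<Gamma>" using subgroup.m_inv_closed[OF assms x] by simp
  fix y assume "y \<in> \<Gamma>"
  then show "x * y \<in> \<Gamma>" using subgroup.m_closed[OF assms x] by (simp add: rat_units_eq)
 qed
qed

lemma rat_aut_carrier:
 assumes "mgrp D" shows "\<xi> \<in> carrier (rat_aut_group D) \<longleftrightarrow>
  \<xi> \<in> extensional D \<and> bij_betw \<xi> D D \<and> mhom D \<xi> \<and> (\<forall>x\<in>D \<inter> \<rat>. \<xi> x = x)"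
 using mgrp_nonzero[OF assms] by (auto simp: rat_aut_group_def auto_def hom_def Bij_def mhom_def bij_betw_def Let_def Pi_def)

lemma rat_aut_mult:
 assumes "mgrp D" "\<xi> \<in> carrier (rat_aut_group D)" "\<tau> \<in> carrier (rat_aut_group D)"
 shows "\<xi> \<otimes>\<^bsub>rat_aut_group D\<^esub> \<tau> = compose D \<xi> \<tau>" using assms rat_aut_carrier[OF assms(1)]
 by (simp add: rat_aut_group_def AutoGroup_def BijGroup_def Bij_def Let_def)

lemma rat_aut_closed:
 assumes D: "mgrp D" and "\<xi> \<in> carrier (rat_aut_group D)" "\<tau> \<in> carrier (rat_aut_group D)"
 shows "compose D \<xi> \<tau> \<in> carrier (rat_aut_group D)"
proof -
 have s: "bij_betw \<xi> D D" "mhom D \<xi>" "\<forall>x\<in>D \<inter> \<rat>. \<xi> x = x"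
  and t: "bij_betw \<tau> D D" "mhom D \<tau>" "\<forall>x\<in>D \<inter> \<rat>. \<tau> x = x" using assms rat_aut_carrier[OF D] by auto
 have tD: "\<tau> x \<in> D" if "x \<in> D" for x using t(1) that by (auto simp: bij_betw_def)
 show ?thesis unfolding rat_aut_carrier[OF D]
 proof (intro conjI ballI)
  show "compose D \<xi> \<tau> \<in> extensional D" by simp
  show "bij_betw (compose D \<xi> \<tau>) D D" using s(1) t(1) by (rule bij_betw_compose[rotated])
  show "mhom D (compose D \<xi> \<tau>)" using s(2) t(2) tD D by (auto simp: mhom_def compose_def mgrp_mult)
  show "compose D \<xi> \<tau> x = x" if "x \<in> D \<inter> \<rat>" for x using that s(3) t(3) by (auto simp: compose_def)
 qed
qed

text \<open>An endomorphism that fixes the rational elements maps the finite set of solutions of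
  \<open>y ^ n = x ^ n\<close> to itself, so on such a group injectivity gives surjectivity. The
  three root groups of the statement are of this kind.\<close>

definition saturated :: "complex set \<Rightarrow> bool"
 where "saturated D \<longleftrightarrow> mgrp D \<and> (\<forall>x\<in>D. \<exists>n\<ge>1. x ^ n \<in> \<rat> \<and> (\<forall>y. y ^ n = x ^ n --> y \<in> D))"

lemma saturated_mgrp: "saturated D ==> mgrp D" by (simp add: saturated_def)

lemma saturated_radical_group: "saturated D ==> radical_group D" unfolding saturated_def radical_group_def by blast

lemma ex_prime_order_power:
 fixes x :: complex
 assumes "x ^ n = 1" "n \<ge> 1" "x ~= 1"
 obtains q m where "Factorial_Ring.prime q" "(x ^ m) ^ q = 1" "x ^ m ~= 1" "q dvd n"
proof -
 have "\<exists>q m. Factorial_Ring.prime q \<and> (x ^ m) ^ q = 1 \<and> x ^ m ~= 1 \<and> q dvd n" using assms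
 proof (induction n arbitrary: x rule: less_induct)
  case (less n)
  then have "n ~= 1" by auto
  then obtain q where q: "Factorial_Ring.prime q" "q dvd n" using prime_factor_nat by blast
  obtain k where k: "n = q * k" using q by (auto elim: dvdE)
  show ?case
  proof (cases "x ^ q = 1")
   case True
   then show ?thesis using q less.prems(3) by (intro exI[of _ q] exI[of _ 1]) auto
  next
   case False
   have "k < n" "k \<ge> 1" using k q less.prems(2) prime_gt_1_nat[OF q(1)] by (auto simp: Suc_le_eq)
   moreover have "(x ^ q) ^ k = 1" using less.prems(1) k by (simp add: power_mult)
   ultimately obtain r m where "Factorial_Ring.prime r" "((x ^ q) ^ m) ^ r = 1" "(x ^ q) ^ m ~= 1" "r dvd k"
    using less.IH[of k "x ^ q"] False by blast
   then show ?thesis using k by (intro exI[of _ r] exI[of _ "q * m"]) (auto simp: power_mult)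
  qed
 qed
 then show thesis using that by blast
qed

text \<open>If \<open>s x = 1\<close> and \<open>x ^ n\<close> is rational, then
  \<open>x ^ n = s (x ^ n) = 1\<close>. So the kernel is torsion, and a nontrivial kernel would
  contain an element of prime order.\<close>

lemma saturated_aut_mono:
 assumes D: "saturated D" and s: "mhom D s" and fix_rat: "\<And>x. x \<in> D ==> x \<in> \<rat> ==> s x = x"
  and inj: "\<And>q z. Factorial_Ring.prime q ==> z \<in> D ==> z ^ q = 1 ==> s z = 1 ==> z = 1"
  and x: "x \<in> D" "s x = 1" shows "x = 1"
proof (rule ccontr)
 assume "x ~= 1"
 note G = saturated_mgrp[OF D]
 obtain n where n: "n \<ge> 1" "x ^ n \<in> \<rat>" using D x(1) unfolding saturated_def by blast
 have "x ^ n = s (x ^ n)" using fix_rat[OF mgrp_power[OF G x(1)] n(2)] by simp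
 also have "... = 1" using mhom_power[OF G s x(1)] x(2) by simp
 finally obtain q m where q: "Factorial_Ring.prime q" "(x ^ m) ^ q = 1" "x ^ m ~= 1"
  using ex_prime_order_power[OF _ n(1) \<open>x ~= 1\<close>] by metis
 have "s (x ^ m) = 1" using mhom_power[OF G s x(1)] x(2) by simp
 then show False using inj[OF q(1) mgrp_power[OF G x(1)] q(2)] q(3) by blast
qed

text \<open>The criterion by which automorphisms are recognized below: injectivity has to be checked
  only on elements of prime order, and surjectivity follows from finite invariant sets.\<close>

lemma saturated_aut:
 assumes D: "saturated D" and s: "mhom D s" and fix_rat: "\<And>x. x \<in> D ==> x \<in> \<rat> ==> s x = x"
  and inj: "\<And>q z. Factorial_Ring.prime q ==> z \<in> D ==> z ^ q = 1 ==> s z = 1 ==> z = 1"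
 shows "restrict s D \<in> carrier (rat_aut_group D)"
proof -
 note G = saturated_mgrp[OF D]
 have mono: "x = 1" if "x \<in> D" "s x = 1" for x by (rule saturated_aut_mono[OF D s _ _ that]) (use fix_rat inj in auto)
 have orbit: "\<exists>Z. finite Z \<and> x \<in> Z \<and> Z \<subseteq> D \<and> s ` Z \<subseteq> Z" if x: "x \<in> D" for x
 proof -
  obtain n where n: "n \<ge> 1" "x ^ n \<in> \<rat>" "\<And>y. y ^ n = x ^ n ==> y \<in> D" using D x unfolding saturated_def by blast
  have "x ~= 0" using mgrp_nonzero[OF G x] .
  then have "finite {y. y ^ n = x ^ n}" using n(1) by (intro finite_nth_roots) auto
  moreover have "s y ^ n = x ^ n" if "y ^ n = x ^ n" for y
  proof -
   have "s y ^ n = s (x ^ n)" using mhom_power[OF G s n(3)[OF that], of n] that by simp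
   then show ?thesis using fix_rat[OF mgrp_power[OF G x] n(2)] by simp
  qed
  ultimately show ?thesis using n(3) by (intro exI[of _ "{y. y ^ n = x ^ n}"]) auto
 qed
 have inj_s: "inj_on s D"
 proof (rule inj_onI)
  fix x y assume xy: "x \<in> D" "y \<in> D" "s x = s y"
  then have "s (x / y) = 1" using mhom_divide[OF G s] mhom_nonzero[OF s] by simp
  then have "x / y = 1" by (rule mono[OF mgrp_divide[OF G xy(1,2)]])
  then show "x = y" by simp
 qed
 have "s ` D = D"
 proof
  show "s ` D \<subseteq> D" using orbit by blast
  show "D \<subseteq> s ` D"
  proof
   fix x assume "x \<in> D"
   then obtain Z where Z: "finite Z" "x \<in> Z" "Z \<subseteq> D" "s ` Z \<subseteq> Z" using orbit by blast
   have "s ` Z = Z" using endo_inj_surj[OF Z(1,4)] inj_on_subset[OF inj_s Z(3)] by blast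
   then show "x \<in> s ` D" using Z by blast
  qed
 qed
 then have "bij_betw s D D" using inj_s by (simp add: bij_betw_def)
 then have "bij_betw (restrict s D) D D" by (simp cong: bij_betw_cong)
 moreover have "mhom D (restrict s D)" using s G by (auto simp: mhom_def mgrp_mult)
 ultimately show ?thesis using fix_rat unfolding rat_aut_carrier[OF G] by auto
qed

text \<open>\<open>N\<close> is a nonempty set of exponents directed by divisibility: all positive
  integers, the positive powers of \<open>p\<close>, or \<open>p\<close> alone.\<close>

lemma saturated_root_set:
 assumes G: "mgrp \<Gamma>" "\<Gamma> \<subseteq> \<rat>" and N: "1 \<notin> N ==> N ~= {}" "0 \<notin> N"
  and mult: "\<And>m n. m \<in> N ==> n \<in> N ==> \<exists>k\<in>N. m dvd k \<and> n dvd k"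
 shows "saturated {x. x ~= 0 \<and> (\<exists>n\<in>N. x ^ n \<in> \<Gamma>)}" (is "saturated ?D")
proof -
 have pw: "x ^ k \<in> \<Gamma>" if "x ^ m \<in> \<Gamma>" "m dvd k" for x m k
  using mgrp_power[OF G(1) that(1)] that(2) by (auto simp: power_mult elim!: dvdE)
 have "mgrp ?D" unfolding mgrp_def
 proof (intro conjI ballI)
  show "1 \<in> ?D" using N(1) mgrp_one[OF G(1)] by auto
  show "0 \<notin> ?D" by simp
  fix x assume x: "x \<in> ?D"
  then show "inverse x \<in> ?D" using mgrp_inverse[OF G(1)] by (auto simp: power_inverse)
  fix y assume y: "y \<in> ?D"
  obtain m n where "m \<in> N" "n \<in> N" "x ^ m \<in> \<Gamma>" "y ^ n \<in> \<Gamma>" using x y by blast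
  then obtain k where "k \<in> N" "x ^ k \<in> \<Gamma>" "y ^ k \<in> \<Gamma>" using mult pw by metis
  then show "x * y \<in> ?D" using x y mgrp_mult[OF G(1)] by (auto simp: power_mult_distrib)
 qed
 moreover have "\<exists>n\<ge>1. x ^ n \<in> \<rat> \<and> (\<forall>y. y ^ n = x ^ n --> y \<in> ?D)" if "x \<in> ?D" for x
 proof -
  obtain n where n: "n \<in> N" "x ^ n \<in> \<Gamma>" using \<open>x \<in> ?D\<close> by blast
  have n1: "n \<ge> 1" using n N(2) by (cases n) auto
  moreover have "y \<in> ?D" if "y ^ n = x ^ n" for y
  proof -
   have "y ~= 0" using that n1 mgrp_nonzero[OF G(1) n(2)] by (auto simp: power_0_left)
   moreover have "y ^ n \<in> \<Gamma>" using that n(2) by simp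
   ultimately show ?thesis using n(1) by blast
  qed
  ultimately show ?thesis using n G(2) by blast
 qed
 ultimately show ?thesis by (simp add: saturated_def)
qed

lemma saturated_closures:
 assumes G: "mgrp \<Gamma>" "\<Gamma> \<subseteq> \<rat>" and p: "p \<ge> 1"
 shows "saturated (root_closure \<Gamma>)" "saturated (p_root_closure \<Gamma> p)" "saturated (p_roots \<Gamma> p)"
proof -
 have "root_closure \<Gamma> = {x. x ~= 0 \<and> (\<exists>n\<in>{1..}. x ^ n \<in> \<Gamma>)}" by (auto simp: root_closure_def)
 moreover have "saturated {x. x ~= 0 \<and> (\<exists>n\<in>{1..}. x ^ n \<in> \<Gamma>)}"
 proof (rule saturated_root_set[OF G])
  show "\<exists>k\<in>{1..}. m dvd k \<and> n dvd k" if "m \<in> {1..}" "n \<in> {1..}" for m n :: nat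
   using that by (intro bexI[of _ "m * n"]) (auto simp: Suc_le_eq)
 qed auto
 ultimately show "saturated (root_closure \<Gamma>)" by simp
 have "p_root_closure \<Gamma> p = {x. x ~= 0 \<and> (\<exists>n\<in>(\<lambda>k. p ^ k) ` {1..}. x ^ n \<in> \<Gamma>)}"
  by (auto simp: p_root_closure_def)
 moreover have "saturated {x. x ~= 0 \<and> (\<exists>n\<in>(\<lambda>k. p ^ k) ` {1..}. x ^ n \<in> \<Gamma>)}"
 proof (rule saturated_root_set[OF G])
  show "\<exists>k\<in>(\<lambda>k. p ^ k) ` {1..}. m dvd k \<and> n dvd k"
   if mn: "m \<in> (\<lambda>k. p ^ k) ` {1..}" "n \<in> (\<lambda>k. p ^ k) ` {1..}" for m n
  proof -
   obtain i j where "m = p ^ i" "n = p ^ j" "i \<ge> 1" "j \<ge> 1" using mn by auto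
   then show ?thesis by (intro bexI[of _ "p ^ (i + j)"] conjI image_eqI[of _ _ "i + j"]) (simp_all add: power_add)
  qed
 qed (use p in auto)
 ultimately show "saturated (p_root_closure \<Gamma> p)" by simp
 have "p_roots \<Gamma> p = {x. x ~= 0 \<and> (\<exists>n\<in>{p}. x ^ n \<in> \<Gamma>)}" by (auto simp: p_roots_def)
 moreover have "saturated {x. x ~= 0 \<and> (\<exists>n\<in>{p}. x ^ n \<in> \<Gamma>)}" by (rule saturated_root_set[OF G]) (use p in auto)
 ultimately show "saturated (p_roots \<Gamma> p)" by simp
qed

lemma mu_inf_subset_root_closure: "mgrp \<Gamma> ==> mu_inf \<subseteq> root_closure \<Gamma>"
 using mgrp_one by (fastforce simp: mu_inf_def root_closure_def power_0_left)

section \<open>The Galois group inside the automorphism group\<close>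

text \<open>The span of a radical group is already a field.\<close>

lemma rat_adjoin_radical_group:
 assumes W: "radical_group W" shows "rat_adjoin W = qspan W"
proof
 have G: "mgrp W" using W by (simp add: radical_group_def)
 note F = subfield_qspan[OF W]
 note R = subfield_subring[OF F]
 interpret C: field "complex_field :: complex ring" by (rule field_complex_field)
 have ainv: "\<ominus>\<^bsub>complex_field\<^esub> x = - x" for x :: complex by (rule C.minus_equality) auto
 have minv: "inv\<^bsub>complex_field\<^esub> x = inverse x" if "x ~= 0" for x :: complex using that by (intro C.comm_inv_char) auto
 show "rat_adjoin W \<subseteq> qspan W"
 proof
  fix x assume "x \<in> rat_adjoin W"
  then have "x \<in> generate_field complex_field (\<rat> \<union> W)" by (simp add: rat_adjoin_def)
  then show "x \<in> qspan W"
  proof (induction rule: generate_field.induct)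
   case (incl h)
   then show ?case using qspan_Rats[OF G] qspan_base by auto
  next
   case (m_inv h)
   then show ?case using minv[of h] F by (auto simp: subfield_of_C_def)
  qed (use subring_closed[OF R] ainv in auto)
 qed
 let ?L = "generate_field complex_field (\<rat> \<union> W)"
 have add: "x + y \<in> ?L" if "x \<in> ?L" "y \<in> ?L" for x y using generate_field.eng_add[OF that] by simp
 have mult: "x * y \<in> ?L" if "x \<in> ?L" "y \<in> ?L" for x y using generate_field.eng_mult[OF that] by simp
 have base: "x \<in> ?L" if "x \<in> \<rat> \<union> W" for x using generate_field.incl[OF that] .
 have sums: "sum f I \<in> ?L" if "\<And>i. i \<in> I ==> f i \<in> ?L" for f and I :: "complex set"
  using that by (induction I rule: infinite_finite_induct) (auto simp: add base)
 show "qspan W \<subseteq> rat_adjoin W"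
 proof
  fix x assume "x \<in> qspan W"
  then obtain A c where A: "finite A" "A \<subseteq> W" "\<And>x. x \<in> A ==> c x \<in> \<rat>" "x = (\<Sum>x\<in>A. c x * x)"
   by (rule qspanE) blast
  show "x \<in> rat_adjoin W" unfolding A(4) rat_adjoin_def using A(2,3) by (intro sums mult base) auto
 qed
qed

text \<open>An automorphism of the radical group is a product of its values on roots of unity and on positive
 real radicals. By Kummer theory, relations only involve radicals whose quotient is the square root
 of a rational number, and these square roots lie in the cyclotomic field.\<close>

lemma relpres_of_sqrt_compatible:
 assumes D: "saturated D" "mu_inf \<subseteq> D" and norm_closed: "\<And>x. x \<in> D ==> of_real (norm x) \<in> D"
  and s: "mhom D s" "relpres mu_inf s"
  and compat: "\<And>x. x \<in> D ==> x ^ 2 \<in> \<rat> ==> s x = lext mu_inf s x" shows "relpres D s"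
 unfolding relpres_def
proof (intro allI impI)
 note G = saturated_mgrp[OF D(1)]
 have s': "mhom mu_inf s" using mhom_subset[OF s(1) D(2)] .
 fix A c assume A: "finite A" "A \<subseteq> D" "\<forall>x\<in>A. c x \<in> \<rat>" and rel: "(\<Sum>x\<in>A. c x * x) = 0"
 define y where "y x = complex_of_real (norm x)" for x :: complex
 define z where "z x = x / y x" for x
 have x0: "x ~= 0" if "x \<in> A" for x using mgrp_nonzero[OF G] A(2) that by blast
 have yD: "y x \<in> D" "y x ~= 0" if "x \<in> A" for x using norm_closed A(2) x0 that by (auto simp: y_def)
 have xzy: "x = z x * y x" if "x \<in> A" for x using yD[OF that] by (simp add: z_def)
 \<comment> \<open>A power \<open>x ^ n\<close> is a real number of either sign, so the phase
   \<open>z x\<close> has order dividing \<open>n * 2\<close>.\<close>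
 have z: "z x \<in> mu_inf" if "x \<in> A" for x
 proof -
  obtain n where n: "n \<ge> 1" "x ^ n \<in> \<rat>" using D(1) A(2) \<open>x \<in> A\<close> unfolding saturated_def by blast
  have "x ^ n \<in> \<real>" using n(2) Rats_imp_Reals by blast
  then obtain r where r: "x ^ n = of_real r" by (rule Reals_cases)
  have "norm x ^ n = \<bar>r\<bar>" using arg_cong[OF r, of norm] by (simp add: norm_power)
  then have "y x ^ n = of_real \<bar>r\<bar>" by (simp add: y_def flip: of_real_power)
  then have "z x ^ n = of_real (r / \<bar>r\<bar>)" using r by (simp add: z_def power_divide)
  then have "z x ^ (n * 2) = of_real ((r / \<bar>r\<bar>) ^ 2)" by (simp add: power_mult)
  moreover have "r ~= 0" using r x0[OF \<open>x \<in> A\<close>] by auto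
  ultimately have "z x ^ (n * 2) = 1" by (simp add: power_divide)
  then show ?thesis using n(1) unfolding mu_inf_def by (intro CollectI exI[of _ "n * 2"]) auto
 qed
 \<comment> \<open>Radicals are grouped together when the quotient of their absolute values is the
   square root of a rational number; relations over the cyclotomic field occur only inside a
   group.\<close>
 define E where "E = {(a, b). a \<in> A \<and> b \<in> A \<and> (y a / y b) ^ 2 \<in> \<rat>}"
 have "equiv A E"
 proof (rule equivI)
  show "E \<subseteq> A \<times> A" by (auto simp: E_def)
  show "refl_on A E" using yD by (auto simp: refl_on_def E_def)
  show "sym E"
  proof (rule symI)
   fix a b assume "(a, b) \<in> E"
   then have "inverse ((y a / y b) ^ 2) \<in> \<rat>" "a \<in> A" "b \<in> A" by (auto simp: E_def)
   then show "(b, a) \<in> E" by (simp add: E_def power_divide divide_inverse mult.commute flip: power_inverse)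
  qed
  show "trans E"
  proof (rule transI)
   fix a b d assume ab: "(a, b) \<in> E" "(b, d) \<in> E"
   then have "(y a / y b) ^ 2 * (y b / y d) ^ 2 \<in> \<rat>" by (auto simp: E_def)
   moreover have "(y a / y b) ^ 2 * (y b / y d) ^ 2 = (y a / y d) ^ 2" using ab yD by (auto simp: E_def power_divide)
   ultimately show "(a, d) \<in> E" using ab by (auto simp: E_def)
  qed
 qed
 note eq = this
 define Q where "Q = A // E"
 have fin: "finite Q" unfolding Q_def by (simp add: quotient_def A(1))
 define rep where "rep B = (SOME b. b \<in> B)" for B :: "complex set"
 have Q: "B \<subseteq> A" "rep B \<in> B" "\<And>a b. a \<in> B ==> b \<in> B ==> (y a / y b) ^ 2 \<in> \<rat>" if "B \<in> Q" for B
 proof -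
  show "B \<subseteq> A" using in_quotient_imp_subset[OF eq] that by (simp add: Q_def)
  have "B ~= {}" using in_quotient_imp_non_empty[OF eq] that by (simp add: Q_def)
  then show "rep B \<in> B" unfolding rep_def by (simp add: some_in_eq)
  fix a b assume "a \<in> B" "b \<in> B"
  then have "(a, b) \<in> E" using in_quotient_imp_in_rel[OF eq, of B] that by (simp add: Q_def)
  then show "(y a / y b) ^ 2 \<in> \<rat>" by (simp add: E_def)
 qed
 have split: "(\<Sum>x\<in>A. f x) = (\<Sum>B\<in>Q. \<Sum>x\<in>B. f x)" for f :: "complex \<Rightarrow> complex"
 proof -
  have "sum f (\<Union>Q) = (\<Sum>B\<in>Q. sum f B)"
  proof (rule sum.Union_disjoint[unfolded o_def])
   show "\<forall>B\<in>Q. finite B" using Q(1) A(1) finite_subset by blast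
   show "\<forall>B\<in>Q. \<forall>C\<in>Q. B ~= C --> B \<inter> C = {}" unfolding Q_def using quotient_disj[OF eq] by blast
  qed
  then show ?thesis using Union_quotient[OF eq] by (simp add: Q_def)
 qed
 define u where "u B x = z x * (y x / y (rep B))" for B x
 have yK: "y x / y (rep B) \<in> qspan mu_inf" if "B \<in> Q" "x \<in> B" for B x
  using Q(3)[OF that(1) that(2) Q(2)[OF that(1)]] by (rule sqrt_Rats_cyclotomic)
 have uK: "u B x \<in> qspan mu_inf" if "B \<in> Q" "x \<in> B" for B x unfolding u_def using z Q(1)[OF that(1)] that(2)
  by (intro qspan_mult[OF mgrp_mu_inf qspan_base yK[OF that]]) auto
 define \<kappa> where "\<kappa> B = (\<Sum>x\<in>B. c x * u B x)" for B
 have "(\<Sum>B\<in>Q. \<kappa> B * y (rep B)) = (\<Sum>B\<in>Q. \<Sum>x\<in>B. c x * x)" unfolding \<kappa>_def sum_distrib_right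
 proof (intro sum.cong refl)
  fix B x assume B: "B \<in> Q" "x \<in> B"
  then have "x \<in> A" "rep B \<in> A" using Q(1,2) by blast+
  then show "c x * u B x * y (rep B) = c x * x" using yD(2)[of "rep B"] xzy[of x] by (simp add: u_def)
 qed
 then have rel': "(\<Sum>B\<in>Q. \<kappa> B * y (rep B)) = 0" using rel split by simp
 \<comment> \<open>Each group has collapsed to one real radical with the cyclotomic coefficient
   \<open>\<kappa> B\<close>. The representatives of different groups are independent, so all
   coefficients vanish.\<close>
 have \<kappa>0: "\<kappa> B = 0" if "B \<in> Q" for B
 proof (rule real_radicals_independent[OF fin, where y = "\<lambda>B. norm (rep B)" and c = \<kappa>])
  fix B assume B: "B \<in> Q"
  then have rA: "rep B \<in> A" using Q(1,2) by blast
  show "norm (rep B) > 0" using x0[OF rA] by simp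
  show "\<exists>n\<ge>1. complex_of_real (norm (rep B)) ^ n \<in> \<rat>" using yD(1)[OF rA] D(1) unfolding saturated_def y_def by blast
  show "\<kappa> B \<in> qspan mu_inf" unfolding \<kappa>_def using uK[OF B] A(3) Q(1)[OF B] by (intro qspan_sum qspan_smult) auto
 next
  fix B C assume BC: "B \<in> Q" "C \<in> Q" "B ~= C"
  show "complex_of_real (norm (rep B) / norm (rep C)) ^ 2 \<notin> \<rat>"
  proof
   assume "complex_of_real (norm (rep B) / norm (rep C)) ^ 2 \<in> \<rat>"
   then have "(rep B, rep C) \<in> E" using BC Q(1,2) by (auto simp: E_def y_def)
   then have "B = C" using quotient_eqI[OF eq] BC Q(2) unfolding Q_def by blast
   then show False using BC(3) by blast
  qed
 next
  show "(\<Sum>B\<in>Q. \<kappa> B * complex_of_real (norm (rep B))) = 0" using rel' by (simp add: y_def)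
 qed (use that in auto)
 have "(\<Sum>x\<in>A. c x * s x) = (\<Sum>B\<in>Q. lext mu_inf s (\<kappa> B) * s (y (rep B)))" unfolding split
 proof (intro sum.cong refl)
  fix B assume B: "B \<in> Q"
  have rA: "rep B \<in> A" using Q(1,2) B by blast
  have "lext mu_inf s (\<kappa> B) = (\<Sum>x\<in>B. lext mu_inf s (c x * u B x))" unfolding \<kappa>_def using uK[OF B] A(3) Q(1)[OF B]
   by (intro lext_sum[OF s(2) mgrp_mu_inf s'] qspan_smult) auto
  also have "... * s (y (rep B)) = (\<Sum>x\<in>B. lext mu_inf s (c x * u B x) * s (y (rep B)))" by (rule sum_distrib_right)
  also have "... = (\<Sum>x\<in>B. c x * s x)"
  proof (intro sum.cong refl)
   fix x assume x: "x \<in> B"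
   have xA: "x \<in> A" using Q(1)[OF B] x by blast
   have q: "y x / y (rep B) \<in> D" using yD(1) xA rA mgrp_divide[OF G] by blast
   have "lext mu_inf s (c x * u B x) = c x * lext mu_inf s (u B x)" using A(3) xA uK[OF B x] by (intro lext_smult[OF s(2) mgrp_mu_inf s']) auto
   also have "lext mu_inf s (u B x) = lext mu_inf s (z x) * lext mu_inf s (y x / y (rep B))"
    unfolding u_def by (rule lext_mult[OF s(2) mgrp_mu_inf s' qspan_base[OF z[OF xA]] yK[OF B x]])
   also have "lext mu_inf s (z x) = s (z x)" using z[OF xA] by (rule lext_base[OF s(2)])
   \<comment> \<open>Here the hypothesis \<open>compat\<close> enters: \<open>s\<close> and its
     linear extension agree on the square root that links \<open>x\<close> to its
     representative.\<close>
   also have "lext mu_inf s (y x / y (rep B)) = s (y x / y (rep B))" using compat[OF q Q(3)[OF B x Q(2)[OF B]]] by simp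
   also have "... = s (y x) / s (y (rep B))" using yD(1) xA rA by (intro mhom_divide[OF G s(1)])
   finally have "lext mu_inf s (c x * u B x) * s (y (rep B)) = c x * (s (z x) * s (y x))" using mhom_nonzero[OF s(1) yD(1)[OF rA]] by simp
   also have "s (z x) * s (y x) = s x" using mhom_mult[OF s(1), of "z x" "y x"] z[OF xA] D(2) yD(1)[OF xA] xzy[OF xA] by auto
   finally show "lext mu_inf s (c x * u B x) * s (y (rep B)) = c x * s x" .
  qed
  finally show "(\<Sum>x\<in>B. c x * s x) = lext mu_inf s (\<kappa> B) * s (y (rep B))" by simp
 qed
 also have "... = 0" using \<kappa>0 lext_Rats[OF s(2) mgrp_mu_inf s', of 0] by simp
 finally show "(\<Sum>x\<in>A. c x * s x) = 0" .
qed

text \<open>On roots of unity a group automorphism always preserves rational relations; an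
  obstruction can only come from radicals.\<close>

lemma relpres_mu_inf_of_aut:
 assumes D: "mgrp D" "mu_inf \<subseteq> D" and s: "s \<in> carrier (rat_aut_group D)" shows "relpres mu_inf s"
proof (rule relpres_cyclotomic[OF cyclotomic_group_mu_inf])
 have s': "mhom D s" "bij_betw s D D" using s rat_aut_carrier[OF D(1)] by auto
 show "mhom mu_inf s" using mhom_subset[OF s'(1) D(2)] .
 fix x assume x: "x \<in> mu_inf" "s x = 1"
 then have "s x = s 1" using mhom_one[OF D(1) s'(1)] by simp
 then show "x = 1" using s'(2) x D(2) mgrp_one[OF D(1)] unfolding bij_betw_def inj_on_def by blast
qed

text \<open>A field automorphism is rational linear and so respects every expression by roots of
  unity. Conversely, by \<open>relpres_of_sqrt_compatible\<close> the condition makes \<xi> preserve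
  all rational relations, and its linear extension is an automorphism of the span, which is the
  field.\<close>

theorem G_subgroup_eq:
 assumes \<Gamma>: "mgrp \<Gamma>" "\<Gamma> \<subseteq> \<rat>" shows "G_subgroup \<Gamma> = {\<xi> \<in> carrier (A_group \<Gamma>).
  \<forall>x\<in>root_closure \<Gamma>. x ^ 2 \<in> \<rat> --> \<xi> x = lext mu_inf \<xi> x}"
proof -
 define D where "D = root_closure \<Gamma>"
 define L where "L = qspan D"
 have sat: "saturated D" unfolding D_def using saturated_closures(1)[OF \<Gamma>, of 1] by simp
 note G = saturated_mgrp[OF sat]
 note rad = saturated_radical_group[OF sat]
 have muD: "mu_inf \<subseteq> D" unfolding D_def by (rule mu_inf_subset_root_closure[OF \<Gamma>(1)])
 have L: "rat_adjoin (root_closure \<Gamma>) = L" using rat_adjoin_radical_group[OF rad] by (simp add: L_def D_def)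
 have DL: "D \<subseteq> L" unfolding L_def using qspan_base by blast
 have ratL: "\<rat> \<subseteq> L" unfolding L_def using qspan_Rats[OF G] by blast
 have Lsf: "subfield_of_C L" unfolding L_def by (rule subfield_qspan[OF rad])
 note LR = subfield_subring[OF Lsf]
 have muL: "qspan mu_inf \<subseteq> L" unfolding L_def by (rule qspan_mono[OF muD])
 \<comment> \<open>\<open>x ^ n\<close> may be negative and -1 need not lie in \<Gamma>; hence the
   exponent \<open>n * 2\<close>.\<close>
 have normD: "complex_of_real (norm x) \<in> D" if x: "x \<in> D" for x
 proof -
  obtain n where n: "n \<ge> 1" "x ^ n \<in> \<Gamma>" "x ~= 0" using x by (auto simp: D_def root_closure_def)
  have "x ^ n \<in> \<real>" using n(2) \<Gamma>(2) Rats_imp_Reals by blast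
  then obtain r where r: "x ^ n = of_real r" by (rule Reals_cases)
  have "norm x ^ n = \<bar>r\<bar>" using arg_cong[OF r, of norm] by (simp add: norm_power)
  then have "norm x ^ (n * 2) = r ^ 2" by (simp add: power_mult)
  then have "complex_of_real (norm x) ^ (n * 2) = (x ^ n) ^ 2" unfolding r by (simp flip: of_real_power)
  then have "complex_of_real (norm x) ^ (n * 2) \<in> \<Gamma>" using mgrp_power[OF \<Gamma>(1) n(2)] by simp
  moreover have "n * 2 \<ge> 1" using n(1) by simp
  ultimately show ?thesis using n(3) unfolding D_def root_closure_def by (intro CollectI conjI exI[of _ "n * 2"]) simp_all
 qed
 show ?thesis unfolding D_def[symmetric] A_group_def
 proof (intro equalityI subsetI)
  fix \<rho> assume "\<rho> \<in> G_subgroup \<Gamma>"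
  then obtain \<xi> where \<xi>: "\<xi> \<in> ring_iso (complex_field\<lparr>carrier := L\<rparr>) (complex_field\<lparr>carrier := L\<rparr>)"
   "\<forall>x\<in>\<rat>. \<xi> x = x" "\<rho> = restrict (restrict \<xi> L) D" unfolding G_subgroup_def L galois_group_def D_def by blast
  have \<rho>: "\<rho> = restrict \<xi> D" using \<xi>(3) DL by (simp add: restrict_restrict Int_absorb1)
  have emb: "embedding L \<xi>" and bij: "bij_betw \<xi> L L" using \<xi>(1) by (auto simp: ring_iso_def ring_hom_def embedding_def)
  note F = embedding_facts[OF LR emb]
  have hom: "mhom D \<xi>" unfolding mhom_def using DL F(4) embedding_nonzero[OF Lsf emb] mgrp_nonzero[OF G] by (meson subsetD)
  have \<rho>A: "\<rho> \<in> carrier (rat_aut_group D)" unfolding \<rho>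
  proof (rule saturated_aut[OF sat hom])
   show "\<xi> x = x" if "x \<in> \<rat>" for x using that \<xi>(2) by blast
   fix z assume "z \<in> D" "\<xi> z = 1"
   then show "z = 1" using bij DL F(1) subring_closed(2)[OF LR] unfolding bij_betw_def inj_on_def by (metis subsetD)
  qed
  note rp = relpres_mu_inf_of_aut[OF G muD \<rho>A]
  have "\<rho> x = lext mu_inf \<rho> x" if x: "x \<in> D" "x ^ 2 \<in> \<rat>" for x
  proof -
   have "x \<in> qspan mu_inf" using sqrt_Rats_cyclotomic[OF x(2)] .
   then obtain A c where A: "finite A" "A \<subseteq> mu_inf" "\<And>x. x \<in> A ==> c x \<in> \<rat>" "x = (\<Sum>x\<in>A. c x * x)"
    by (rule qspanE) blast
   have AL: "c a \<in> L" "a \<in> L" "a \<in> D" if "a \<in> A" for a using that A(2,3) ratL muD DL by blast+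
   have "\<rho> x = \<xi> x" using x by (simp add: \<rho>)
   also have "... = (\<Sum>a\<in>A. \<xi> (c a * a))" unfolding A(4) using AL by (intro F(8) subring_closed(6)[OF LR])
   also have "... = (\<Sum>a\<in>A. c a * \<rho> a)"
   proof (intro sum.cong refl)
    fix a assume a: "a \<in> A"
    show "\<xi> (c a * a) = c a * \<rho> a" using F(4)[OF AL(1,2)[OF a]] \<xi>(2) A(3)[OF a] AL(3)[OF a] by (simp add: \<rho>)
   qed
   also have "... = lext mu_inf \<rho> x" unfolding A(4) using A(1-3) by (intro lext_family[OF rp, symmetric]) auto
   finally show ?thesis .
  qed
  then show "\<rho> \<in> {\<xi> \<in> carrier (rat_aut_group D). \<forall>x\<in>D. x ^ 2 \<in> \<rat> --> \<xi> x = lext mu_inf \<xi> x}"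
   using \<rho>A by blast
 next
  fix \<xi> assume "\<xi> \<in> {\<xi> \<in> carrier (rat_aut_group D). \<forall>x\<in>D. x ^ 2 \<in> \<rat> --> \<xi> x = lext mu_inf \<xi> x}"
  then have \<xi>A: "\<xi> \<in> carrier (rat_aut_group D)"
   and compat: "\<And>x. x \<in> D ==> x ^ 2 \<in> \<rat> ==> \<xi> x = lext mu_inf \<xi> x" by auto
  have \<xi>: "\<xi> \<in> extensional D" "bij_betw \<xi> D D" "mhom D \<xi>" "\<And>x. x \<in> D \<inter> \<rat> ==> \<xi> x = x"
   using \<xi>A rat_aut_carrier[OF G] by auto
  have rp: "relpres D \<xi>" by (rule relpres_of_sqrt_compatible[OF sat muD normD \<xi>(3) relpres_mu_inf_of_aut[OF G muD \<xi>A] compat])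
  define F where "F = lext D \<xi>"
  have F_rat: "F x = x" if "x \<in> \<rat>" for x unfolding F_def by (rule lext_Rats[OF rp G \<xi>(3) that])
  have F_base: "F x = \<xi> x" if "x \<in> D" for x unfolding F_def by (rule lext_base[OF rp that])
  have F_add: "F (x + y) = F x + F y" and F_mult: "F (x * y) = F x * F y" if "x \<in> L" "y \<in> L" for x y
   using lext_add[OF rp] lext_mult[OF rp G \<xi>(3)] that unfolding F_def L_def by blast+
  have F_sum: "F (\<Sum>x\<in>A. c x * x) = (\<Sum>x\<in>A. c x * \<xi> x)"
   if "finite A" "A \<subseteq> D" "\<And>x. x \<in> A ==> c x \<in> \<rat>" for A c
   unfolding F_def using that by (intro lext_family[OF rp]) auto
  have emb: "embedding L F" using F_add F_mult F_rat[of 1] by (simp add: embedding_def)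
  have "inj_on F L"
  proof (rule inj_onI)
   fix x y assume xy: "x \<in> L" "y \<in> L" "F x = F y"
   then have "F (x - y) = 0" using embedding_facts(6)[OF LR emb] by simp
   then show "x = y" using embedding_nonzero[OF Lsf emb subring_closed(5)[OF LR xy(1,2)]] by auto
  qed
  moreover have "F ` L = L"
  proof
   show "F ` L \<subseteq> L"
   proof
    fix v assume "v \<in> F ` L"
    then obtain x where x: "x \<in> qspan D" "v = F x" by (auto simp: L_def)
    then obtain A c where A: "finite A" "A \<subseteq> D" "\<And>x. x \<in> A ==> c x \<in> \<rat>" "x = (\<Sum>x\<in>A. c x * x)"
     by (elim qspanE) blast
    have "v = (\<Sum>x\<in>A. c x * \<xi> x)" unfolding x(2) A(4) by (rule F_sum[OF A(1-3)])
    also have "... \<in> L" unfolding L_def using A(1-3) \<xi>(2) by (intro qspan_family) (auto simp: bij_betw_def)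
    finally show "v \<in> L" .
   qed
   show "L \<subseteq> F ` L"
   proof
    fix v assume "v \<in> L"
    then obtain A c where A: "finite A" "A \<subseteq> D" "\<And>x. x \<in> A ==> c x \<in> \<rat>" "v = (\<Sum>x\<in>A. c x * x)"
     unfolding L_def by (rule qspanE) blast
    let ?t = "inv_into D \<xi>"
    have t: "?t a \<in> D" "\<xi> (?t a) = a" if "a \<in> A" for a
    proof -
     have "a \<in> \<xi> ` D" using that A(2) \<xi>(2) unfolding bij_betw_def by blast
     then show "?t a \<in> D" "\<xi> (?t a) = a" by (rule inv_into_into, rule f_inv_into_f)
    qed
    have "F (\<Sum>a\<in>A. c a * ?t a) = (\<Sum>a\<in>A. c a * \<xi> (?t a))" unfolding F_def using A t by (intro lext_family[OF rp]) auto
    also have "... = v" unfolding A(4) using t by (intro sum.cong) auto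
    finally have "v = F (\<Sum>a\<in>A. c a * ?t a)" by simp
    moreover have "(\<Sum>a\<in>A. c a * ?t a) \<in> L" unfolding L_def using A t by (intro qspan_family) auto
    ultimately show "v \<in> F ` L" by blast
   qed
  qed
  ultimately have "F \<in> ring_iso (complex_field\<lparr>carrier := L\<rparr>) (complex_field\<lparr>carrier := L\<rparr>)"
   using F_add F_mult F_rat[of 1] by (auto simp: ring_iso_def ring_hom_def bij_betw_def)
  then have "restrict F L \<in> galois_group L" unfolding galois_group_def using F_rat by blast
  moreover have "\<xi> = restrict (restrict F L) D"
  proof
   fix x show "\<xi> x = restrict (restrict F L) D x" using F_base[of x] DL \<xi>(1) by (cases "x \<in> D") (auto simp: extensional_def)
  qed
  ultimately show "\<xi> \<in> G_subgroup \<Gamma>" unfolding G_subgroup_def L D_def by blast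
 qed
qed

section \<open>Decomposition into primary parts\<close>

lemma bezout_powi:
 fixes x :: complex and a b :: nat
 assumes "Rings.coprime a b" "x ~= 0"
 obtains u v :: int where "x = (x ^ a) powi u * (x ^ b) powi v"
proof -
 have "gcd (int a) (int b) = 1" using assms(1) by simp
 then obtain u v where "u * int a + v * int b = 1" using bezout_int[of "int a" "int b"] by metis
 then have "x powi (int a * u + int b * v) = x" by (simp add: mult.commute)
 moreover have "x powi (int a * u + int b * v) = (x ^ a) powi u * (x ^ b) powi v" using assms(2) by (simp add: power_int_add power_int_mult)
 ultimately show thesis using that by metis
qed

lemma mgrp_coprime_powers:
 assumes "mgrp B" "x ~= 0" "x ^ a \<in> B" "x ^ b \<in> B" "Rings.coprime a b" shows "x \<in> B"
proof -
 obtain u v :: int where "x = (x ^ a) powi u * (x ^ b) powi v" using bezout_powi[OF assms(5,2)] by metis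
 then show ?thesis using assms by (metis mgrp_mult mgrp_powi)
qed

text \<open>The exponent loses one prime power at a time by Bezout. Each component is even a power
  of \<open>x\<close>, which later shows that the components of a rational number are
  rational.\<close>

lemma primary_decomposition:
 assumes \<Gamma>: "mgrp \<Gamma>" and x: "x \<in> root_closure \<Gamma>"
 obtains J f where "finite J" "J \<subseteq> primes" "\<And>p. p \<in> J ==> f p \<in> p_root_closure \<Gamma> p"
  "x = (\<Prod>p\<in>J. f p)" "\<And>p. p \<in> J ==> \<exists>k::int. f p = x powi k"
proof -
 have "\<exists>J f. finite J \<and> J \<subseteq> primes \<and> (\<forall>p\<in>J. f p \<in> p_root_closure \<Gamma> p \<and> (\<exists>k::int. f p = x powi k)) \<and>
   x = (\<Prod>p\<in>J. f p)"
  if "n \<ge> 1" "x ^ n \<in> \<Gamma>" "x ~= 0" for n x using that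
 proof (induction n arbitrary: x rule: less_induct)
  case (less n)
  show ?case
  proof (cases "n = 1")
   case True
   \<comment> \<open>Elements of \<Gamma> lie in every primary part; the prime 2 is an arbitrary
     choice.\<close>
   then have "x \<in> p_root_closure \<Gamma> 2" using less.prems mgrp_power[OF \<Gamma>] by (auto simp: p_root_closure_def)
   then show ?thesis by (intro exI[of _ "{2}"] exI[of _ "\<lambda>_. x"]) (auto simp: primes_def intro!: exI[of _ 1])
  next
   case False
   then obtain q where q: "Factorial_Ring.prime q" "q dvd n" using prime_factor_nat by blast
   have "\<not> is_unit q" using q(1) not_prime_unit by blast
   moreover have "n ~= 0" using less.prems by simp
   ultimately obtain m where m: "n = q ^ multiplicity q n * m" "\<not> q dvd m" using multiplicity_decompose'[of n q] by metis
   define a where "a = multiplicity q n"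
   have a: "a \<ge> 1" "n = q ^ a * m"
   proof -
    show "n = q ^ a * m" using m(1) by (simp add: a_def)
    then show "a \<ge> 1" using q(2) m(2) by (cases a) auto
   qed
   have cop: "Rings.coprime (q ^ a) m" using q(1) m(2) by (simp add: prime_imp_coprime)
   obtain u v :: int where uv: "x = (x ^ (q ^ a)) powi u * (x ^ m) powi v" using bezout_powi[OF cop less.prems(3)] by metis
   define y where "y = (x ^ (q ^ a)) powi u"
   define z where "z = (x ^ m) powi v"
   have y_pow: "y = x powi (int (q ^ a) * u)" and z_pow: "z = x powi (int m * v)"
    unfolding y_def z_def by (simp_all only: power_int_mult power_int_of_nat)
   have nz: "y ~= 0" "z ~= 0" using less.prems(3) by (simp_all add: y_def z_def)
   have "y ^ m = (x ^ n) powi u"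
   proof -
    have "y ^ m = x powi (int (q ^ a) * u * int m)" unfolding y_pow by (simp only: power_int_mult power_int_of_nat)
    also have "int (q ^ a) * u * int m = int n * u" using a(2) by simp
    finally show ?thesis by (simp add: power_int_mult)
   qed
   then have ym: "y ^ m \<in> \<Gamma>" using less.prems(2) mgrp_powi[OF \<Gamma>] by simp
   have "z ^ (q ^ a) = (x ^ n) powi v"
   proof -
    have "z ^ (q ^ a) = x powi (int m * v * int (q ^ a))" unfolding z_pow by (simp only: power_int_mult power_int_of_nat)
    also have "int m * v * int (q ^ a) = int n * v" using a(2) by simp
    finally show ?thesis by (simp add: power_int_mult)
   qed
   then have "z ^ (q ^ a) \<in> \<Gamma>" using less.prems(2) mgrp_powi[OF \<Gamma>] by simp
   then have z: "z \<in> p_root_closure \<Gamma> q" using nz a(1) by (auto simp: p_root_closure_def)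
   have "q > 1" using q(1) prime_gt_1_nat by blast
   then have "q ^ a > 1" using a(1) by (intro one_less_power) auto
   moreover have "m \<ge> 1" using a(2) less.prems(1) by (cases m) auto
   ultimately have "m < n" using a(2) by simp
   then obtain J f where J: "finite J" "J \<subseteq> primes"
    "\<forall>p\<in>J. f p \<in> p_root_closure \<Gamma> p \<and> (\<exists>k::int. f p = y powi k)" "y = (\<Prod>p\<in>J. f p)"
    using less.IH[OF _ \<open>m \<ge> 1\<close> ym nz(1)] by metis
   have fx: "\<exists>k::int. f p = x powi k" if "p \<in> J" for p using J(3) that unfolding y_pow by (metis power_int_mult)
   \<comment> \<open>\<open>q\<close> may already occur in \<open>J\<close>, for instance through
     the default prime 2 of the base case; then the new part \<open>z\<close> is multiplied into the
     existing component.\<close>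
   define g where "g p = (if p = q then (if q \<in> J then f q * z else z) else f p)" for p
   have mq: "mgrp (p_root_closure \<Gamma> q)"
   proof -
    have "w \<in> p_root_closure \<Gamma> q \<longleftrightarrow> w ~= 0 \<and> (\<exists>n\<ge>1. w ^ (q ^ n) \<in> \<Gamma>)" for w
     by (simp add: p_root_closure_def)
    then show ?thesis using \<Gamma> unfolding mgrp_def
    proof (intro conjI ballI)
     assume eq: "\<And>w. w \<in> p_root_closure \<Gamma> q \<longleftrightarrow> w ~= 0 \<and> (\<exists>n\<ge>1. w ^ (q ^ n) \<in> \<Gamma>)"
     show "1 \<in> p_root_closure \<Gamma> q" "0 \<notin> p_root_closure \<Gamma> q" unfolding eq using mgrp_one[OF \<Gamma>] by auto
     fix w assume "w \<in> p_root_closure \<Gamma> q"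
     then obtain i where i: "w ~= 0" "i \<ge> 1" "w ^ (q ^ i) \<in> \<Gamma>" unfolding eq by blast
     then show "inverse w \<in> p_root_closure \<Gamma> q" unfolding eq using mgrp_inverse[OF \<Gamma>] by (auto simp: power_inverse)
     fix w' assume "w' \<in> p_root_closure \<Gamma> q"
     then obtain j where j: "w' ~= 0" "j \<ge> 1" "w' ^ (q ^ j) \<in> \<Gamma>" unfolding eq by blast
     have "w ^ (q ^ (i + j)) \<in> \<Gamma>" using mgrp_power[OF \<Gamma> i(3), of "q ^ j"] by (simp add: power_add power_mult)
     moreover have "w' ^ (q ^ (i + j)) \<in> \<Gamma>"
      using mgrp_power[OF \<Gamma> j(3), of "q ^ i"] by (simp add: power_add mult.commute flip: power_mult)
     ultimately have "(w * w') ^ (q ^ (i + j)) \<in> \<Gamma>" using mgrp_mult[OF \<Gamma>] by (simp add: power_mult_distrib)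
     then show "w * w' \<in> p_root_closure \<Gamma> q" unfolding eq using i j by (intro conjI exI[of _ "i + j"]) auto
    qed
   qed
   have "(\<Prod>p\<in>insert q J. g p) = x"
   proof (cases "q \<in> J")
    case True
    have "(\<Prod>p\<in>J. g p) = g q * (\<Prod>p\<in>J - {q}. g p)" using J(1) True by (rule prod.remove)
    also have "(\<Prod>p\<in>J - {q}. g p) = (\<Prod>p\<in>J - {q}. f p)" by (intro prod.cong) (auto simp: g_def)
    also have "g q = z * f q" using True by (simp add: g_def)
    also have "z * f q * (\<Prod>p\<in>J - {q}. f p) = z * (\<Prod>p\<in>J. f p)" using J(1) True by (simp add: prod.remove)
    finally show ?thesis using True J(4) uv by (simp add: insert_absorb y_def z_def mult.commute)
   next
    case False
    then have "(\<Prod>p\<in>J. g p) = (\<Prod>p\<in>J. f p)" by (intro prod.cong) (auto simp: g_def)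
    then show ?thesis using False J(1,4) uv by (simp add: g_def y_def z_def mult.commute)
   qed
   moreover have "g p \<in> p_root_closure \<Gamma> p \<and> (\<exists>k::int. g p = x powi k)" if "p \<in> insert q J" for p
   proof (cases "p = q")
    case True
    show ?thesis
    proof (cases "q \<in> J")
     case qJ: True
     obtain k where "f q = x powi k" using fx[OF qJ] by blast
     then have "f q * z = x powi (k + int m * v)" using z_pow less.prems(3) by (simp add: power_int_add)
     moreover have "f q * z \<in> p_root_closure \<Gamma> q" by (rule mgrp_mult[OF mq _ z]) (use J(3) qJ in blast)
     moreover have "g p = f q * z" using True qJ by (simp add: g_def)
     ultimately show ?thesis using True by metis
    next
     case False
     then show ?thesis using True z z_pow by (auto simp: g_def)
    qed
   next
    case False
    then show ?thesis using that J(3) fx by (auto simp: g_def)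
   qed
   moreover have "insert q J \<subseteq> primes" "finite (insert q J)" using J(1,2) q(1) by (auto simp: primes_def)
   ultimately show ?thesis by metis
  qed
 qed
 moreover obtain n where "n \<ge> 1" "x ^ n \<in> \<Gamma>" "x ~= 0" using x by (auto simp: root_closure_def)
 ultimately obtain J f where "finite J \<and> J \<subseteq> primes \<and>
   (\<forall>p\<in>J. f p \<in> p_root_closure \<Gamma> p \<and> (\<exists>k::int. f p = x powi k)) \<and> x = (\<Prod>p\<in>J. f p)" by metis
 then show thesis using that by metis
qed

text \<open>\<open>f p\<close> has a power in \<Gamma> whose exponent is a power of \<open>p\<close>
  and, being the inverse of the product of the other components, one whose exponent is prime to
  \<open>p\<close>. So primary components are unique up to elements of \<Gamma>.\<close>

lemma primary_independence:
 assumes \<Gamma>: "mgrp \<Gamma>" and J: "finite J" "J \<subseteq> primes" "\<And>p. p \<in> J ==> f p \<in> p_root_closure \<Gamma> p"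
  and prod1: "(\<Prod>p\<in>J. f p) = 1" and "p \<in> J" shows "f p \<in> \<Gamma>"
proof -
 have "\<forall>q\<in>J. \<exists>n. f q ~= 0 \<and> f q ^ (q ^ n) \<in> \<Gamma>" using J(3) by (fastforce simp: p_root_closure_def)
 then obtain a where a: "\<And>q. q \<in> J ==> f q ~= 0 \<and> f q ^ (q ^ a q) \<in> \<Gamma>" by metis
 define M where "M = (\<Prod>q\<in>J - {p}. q ^ a q)"
 have "(\<Prod>q\<in>J - {p}. f q) ^ M = (\<Prod>q\<in>J - {p}. (f q ^ (q ^ a q)) ^ (\<Prod>r\<in>J - {p} - {q}. r ^ a r))"
  unfolding prod_power_distrib
 proof (intro prod.cong refl)
  fix q assume "q \<in> J - {p}"
  then have "M = q ^ a q * (\<Prod>r\<in>J - {p} - {q}. r ^ a r)" unfolding M_def using J(1) by (intro prod.remove) auto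
  then show "f q ^ M = (f q ^ (q ^ a q)) ^ (\<Prod>r\<in>J - {p} - {q}. r ^ a r)" by (simp add: power_mult)
 qed
 also have "... \<in> \<Gamma>" by (rule mgrp_prod[OF \<Gamma>], rule mgrp_power[OF \<Gamma>]) (use a in auto)
 finally have "inverse ((\<Prod>q\<in>J - {p}. f q) ^ M) \<in> \<Gamma>" by (rule mgrp_inverse[OF \<Gamma>])
 moreover have "f p = inverse (\<Prod>q\<in>J - {p}. f q)"
  using prod1 J(1) \<open>p \<in> J\<close> by (simp add: prod.remove inverse_unique mult.commute)
 ultimately have fM: "f p ^ M \<in> \<Gamma>" by (simp add: power_inverse)
 have "Rings.coprime (p ^ a p) M" unfolding M_def using J(2) \<open>p \<in> J\<close>
  by (intro prod_coprime_right) (auto simp: primes_def intro!: primes_coprime)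
 then show ?thesis using mgrp_coprime_powers[OF \<Gamma> _ _ fM] a[OF \<open>p \<in> J\<close>] by blast
qed

lemma p_root_closure_subset: "p \<ge> 1 ==> p_root_closure \<Gamma> p \<subseteq> root_closure \<Gamma>"
 by (auto simp: p_root_closure_def root_closure_def Suc_le_eq intro!: exI[of _ "p ^ _"])

lemma rat_aut_restrict:
 assumes "saturated D" "saturated E" "E \<subseteq> D" "\<xi> \<in> carrier (rat_aut_group D)"
 shows "restrict \<xi> E \<in> carrier (rat_aut_group E)"
proof -
 note G = saturated_mgrp[OF assms(1)]
 have \<xi>: "bij_betw \<xi> D D" "mhom D \<xi>" "\<And>x. x \<in> D \<inter> \<rat> ==> \<xi> x = x"
  using assms(4) rat_aut_carrier[OF G] by auto
 show ?thesis
 proof (rule saturated_aut[OF assms(2) mhom_subset[OF \<xi>(2) assms(3)]])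
  show "\<xi> x = x" if "x \<in> E" "x \<in> \<rat>" for x using that \<xi>(3) assms(3) by blast
  fix z assume "z \<in> E" "\<xi> z = 1"
  then show "z = 1" using \<xi>(1) mhom_one[OF G \<xi>(2)] mgrp_one[OF G] assms(3) unfolding bij_betw_def inj_on_def by (metis subsetD)
 qed
qed

lemma rat_aut_inj:
 assumes "mgrp D" "\<xi> \<in> carrier (rat_aut_group D)" "x \<in> D" "y \<in> D" "\<xi> x = \<xi> y" shows "x = y"
 using assms rat_aut_carrier[OF assms(1)] by (auto simp: bij_betw_def inj_on_def)

text \<open>The value at \<open>x\<close> is the product of the values at its primary components.
  Components of two decompositions differ by elements of \<Gamma>, which every
  \<open>\<tau> p\<close> fixes because they are rational.\<close>

theorem glue_primary_automorphisms:
 assumes \<Gamma>: "mgrp \<Gamma>" "\<Gamma> \<subseteq> \<rat>"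
  and \<tau>: "\<And>p. p \<in> primes ==> \<tau> p \<in> carrier (Ap_group \<Gamma> p)"
 obtains \<xi> where "\<xi> \<in> carrier (A_group \<Gamma>)"
  "\<And>p x. p \<in> primes ==> x \<in> p_root_closure \<Gamma> p ==> \<xi> x = \<tau> p x"
proof -
 have p1: "p \<ge> 1" if "p \<in> primes" for p using that prime_ge_1_nat by (auto simp: primes_def)
 have satp: "saturated (p_root_closure \<Gamma> p)" if "p \<in> primes" for p using saturated_closures(2)[OF \<Gamma> p1[OF that]] .
 have sat: "saturated (root_closure \<Gamma>)" using saturated_closures(1)[OF \<Gamma>, of 1] by simp
 have \<tau>h: "mhom (p_root_closure \<Gamma> p) (\<tau> p)" "\<And>x. x \<in> p_root_closure \<Gamma> p ==> x \<in> \<rat> ==> \<tau> p x = x"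
  if "p \<in> primes" for p using \<tau>[OF that] rat_aut_carrier[OF saturated_mgrp[OF satp[OF that]]] by (auto simp: Ap_group_def)
 have \<Gamma>p: "x \<in> p_root_closure \<Gamma> p" if "x \<in> \<Gamma>" for x p
  using mgrp_power[OF \<Gamma>(1) that] mgrp_nonzero[OF \<Gamma>(1) that] by (auto simp: p_root_closure_def)
 \<comment> \<open>Components are 1 outside \<open>J\<close>, so that two decompositions can be
   compared on a common finite set of primes.\<close>
 define dec where "dec x J f \<longleftrightarrow> finite J \<and> J \<subseteq> primes \<and> (\<forall>p\<in>primes. f p \<in> p_root_closure \<Gamma> p) \<and>
  (\<forall>p. p \<notin> J --> f p = 1) \<and> x = (\<Prod>p\<in>J. f p)" for x J f
 have dec_ex: "\<exists>J f. dec x J f \<and> (\<forall>p\<in>J. \<exists>k::int. f p = x powi k)" if "x \<in> root_closure \<Gamma>" for x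
 proof -
  obtain J f where J: "finite J" "J \<subseteq> primes" "\<And>p. p \<in> J ==> f p \<in> p_root_closure \<Gamma> p"
   "x = (\<Prod>p\<in>J. f p)" "\<And>p. p \<in> J ==> \<exists>k::int. f p = x powi k"
   using primary_decomposition[OF \<Gamma>(1) \<open>x \<in> root_closure \<Gamma>\<close>] by blast
  have "dec x J (\<lambda>p. if p \<in> J then f p else 1)" unfolding dec_def using J \<Gamma>p[OF mgrp_one[OF \<Gamma>(1)]] by auto
  then show ?thesis using J(5) by (intro exI[of _ J] exI[of _ "\<lambda>p. if p \<in> J then f p else 1"]) auto
 qed
 have dec_mono: "dec x K f" if "dec x J f" "J \<subseteq> K" "finite K" "K \<subseteq> primes" for x J K f
 proof -
  have "(\<Prod>p\<in>J. f p) = (\<Prod>p\<in>K. f p)" using that by (intro prod.mono_neutral_left) (auto simp: dec_def)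
  then show ?thesis using that by (auto simp: dec_def)
 qed
 have val_mono: "(\<Prod>p\<in>J. \<tau> p (f p)) = (\<Prod>p\<in>K. \<tau> p (f p))"
  if "dec x J f" "J \<subseteq> K" "finite K" "K \<subseteq> primes" for x J K f
 proof (rule prod.mono_neutral_left[OF that(3,2)])
  show "\<forall>p\<in>K - J. \<tau> p (f p) = 1" using that mhom_one[OF saturated_mgrp[OF satp] \<tau>h(1)] by (auto simp: dec_def)
 qed
 have uniq: "(\<Prod>p\<in>J. \<tau> p (f p)) = (\<Prod>p\<in>J'. \<tau> p (f' p))" if d: "dec x J f" "dec x J' f'" for x J f J' f'
 proof -
  define K where "K = J \<union> J'"
  have K: "finite K" "K \<subseteq> primes" "J \<subseteq> K" "J' \<subseteq> K" using d by (auto simp: K_def dec_def)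
  have dK: "dec x K f" "dec x K f'" using dec_mono d K by blast+
  have mem: "f p \<in> p_root_closure \<Gamma> p" "f' p \<in> p_root_closure \<Gamma> p" "p \<in> primes" if "p \<in> K" for p
   using dK K(2) that unfolding dec_def by blast+
  have nz: "f' p ~= 0" "\<tau> p (f' p) ~= 0" if "p \<in> K" for p
   using mgrp_nonzero[OF saturated_mgrp[OF satp[OF mem(3)[OF that]]] mem(2)[OF that]]
    mhom_nonzero[OF \<tau>h(1)[OF mem(3)[OF that]] mem(2)[OF that]] by auto
  have "(\<Prod>p\<in>K. f p / f' p) = 1"
  proof -
   have "(\<Prod>p\<in>K. f p) = (\<Prod>p\<in>K. f' p)" using dK by (simp add: dec_def)
   moreover have "(\<Prod>p\<in>K. f' p) ~= 0" using nz(1) K(1) by simp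
   ultimately show ?thesis by (simp add: prod_dividef)
  qed
  then have g: "f p / f' p \<in> \<Gamma>" if "p \<in> K" for p using primary_independence[OF \<Gamma>(1) K(1,2), of "\<lambda>p. f p / f' p" p] that
    mem mgrp_divide[OF saturated_mgrp[OF satp]] by blast
  have "\<tau> p (f p) / \<tau> p (f' p) = f p / f' p" if "p \<in> K" for p
  proof -
   have "\<tau> p (f p / f' p) = f p / f' p" using \<tau>h(2)[OF mem(3)[OF that] \<Gamma>p[OF g[OF that]]] g[OF that] \<Gamma>(2) by blast
   then show ?thesis using mhom_divide[OF saturated_mgrp[OF satp[OF mem(3)[OF that]]] \<tau>h(1)[OF mem(3)[OF that]] mem(1,2)[OF that]] by simp
  qed
  then have "(\<Prod>p\<in>K. \<tau> p (f p) / \<tau> p (f' p)) = (\<Prod>p\<in>K. f p / f' p)" by (intro prod.cong) auto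
  then have "(\<Prod>p\<in>K. \<tau> p (f p) / \<tau> p (f' p)) = 1" using \<open>(\<Prod>p\<in>K. f p / f' p) = 1\<close> by simp
  moreover have "(\<Prod>p\<in>K. \<tau> p (f' p)) ~= 0" using nz(2) K(1) by simp
  ultimately have "(\<Prod>p\<in>K. \<tau> p (f p)) = (\<Prod>p\<in>K. \<tau> p (f' p))" by (simp add: prod_dividef)
  then show ?thesis using val_mono[OF d(1) K(3,1,2)] val_mono[OF d(2) K(4,1,2)] by simp
 qed
 define \<xi> where "\<xi> x = (SOME v. \<exists>J f. dec x J f \<and> v = (\<Prod>p\<in>J. \<tau> p (f p)))" for x
 have \<xi>_eq: "\<xi> x = (\<Prod>p\<in>J. \<tau> p (f p))" if "dec x J f" for x J f unfolding \<xi>_def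
 proof (rule some_equality)
  show "\<exists>J' f'. dec x J' f' \<and> (\<Prod>p\<in>J. \<tau> p (f p)) = (\<Prod>p\<in>J'. \<tau> p (f' p))" using that by blast
 qed (metis uniq that)
 have hom: "mhom (root_closure \<Gamma>) \<xi>" unfolding mhom_def
 proof (intro conjI ballI)
  fix x assume x: "x \<in> root_closure \<Gamma>"
  obtain J f where J: "dec x J f" using dec_ex[OF x] by blast
  show "\<xi> x ~= 0" unfolding \<xi>_eq[OF J] using J mhom_nonzero[OF \<tau>h(1)] by (auto simp: dec_def)
  fix y assume y: "y \<in> root_closure \<Gamma>"
  obtain J' f' where J': "dec y J' f'" using dec_ex[OF y] by blast
  define K where "K = J \<union> J'"
  have K: "finite K" "K \<subseteq> primes" "J \<subseteq> K" "J' \<subseteq> K" using J J' by (auto simp: K_def dec_def)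
  have dK: "dec x K f" "dec y K f'" using dec_mono J J' K by blast+
  have "dec (x * y) K (\<lambda>p. f p * f' p)" using dK K mgrp_mult[OF saturated_mgrp[OF satp]] by (auto simp: dec_def prod.distrib)
  then have "\<xi> (x * y) = (\<Prod>p\<in>K. \<tau> p (f p * f' p))" by (rule \<xi>_eq)
  also have "... = (\<Prod>p\<in>K. \<tau> p (f p) * \<tau> p (f' p))"
  proof (intro prod.cong refl)
   fix p assume "p \<in> K"
   then have "p \<in> primes" using K by blast
   then show "\<tau> p (f p * f' p) = \<tau> p (f p) * \<tau> p (f' p)" using dK by (intro mhom_mult[OF \<tau>h(1)]) (auto simp: dec_def)
  qed
  finally show "\<xi> (x * y) = \<xi> x * \<xi> y" by (simp add: \<xi>_eq[OF dK(1)] \<xi>_eq[OF dK(2)] prod.distrib)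
 qed
 have \<xi>\<tau>: "\<xi> x = \<tau> p x" if px: "p \<in> primes" "x \<in> p_root_closure \<Gamma> p" for p x
 proof -
  have "dec x {p} (\<lambda>q. if q = p then x else 1)" using px \<Gamma>p[OF mgrp_one[OF \<Gamma>(1)]] by (auto simp: dec_def)
  from \<xi>_eq[OF this] show ?thesis by simp
 qed
 have "restrict \<xi> (root_closure \<Gamma>) \<in> carrier (rat_aut_group (root_closure \<Gamma>))"
 proof (rule saturated_aut[OF sat hom])
  fix x assume x: "x \<in> root_closure \<Gamma>" "x \<in> \<rat>"
  obtain J f where J: "dec x J f" "\<forall>p\<in>J. \<exists>k::int. f p = x powi k" using dec_ex[OF x(1)] by blast
  have x0: "x ~= 0" using mgrp_nonzero[OF saturated_mgrp[OF sat] x(1)] .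
  have "\<xi> x = (\<Prod>p\<in>J. f p)" unfolding \<xi>_eq[OF J(1)]
  proof (intro prod.cong refl)
   fix p assume p: "p \<in> J"
   obtain k :: int where "f p = x powi k" using J(2) p by blast
   then have "f p \<in> \<rat>" using mgrp_powi[OF mgrp_Rats, of x k] x x0 by auto
   then show "\<tau> p (f p) = f p" using J(1) p by (intro \<tau>h(2)) (auto simp: dec_def)
  qed
  then show "\<xi> x = x" using J(1) by (simp add: dec_def)
 next
  \<comment> \<open>An element of prime order \<open>q\<close> lies in the \<open>q\<close>-primary
    part, where \<xi> is the injective map \<open>\<tau> q\<close>.\<close>
  fix q z assume z: "Factorial_Ring.prime q" "z ^ q = 1" "\<xi> z = 1"
  have q: "q \<in> primes" using z(1) by (simp add: primes_def)
  have "z ~= 0" using z(2) p1[OF q] by (auto simp: power_0_left)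
  then have zp: "z \<in> p_root_closure \<Gamma> q" using z(2) mgrp_one[OF \<Gamma>(1)] by (auto simp: p_root_closure_def intro!: exI[of _ 1])
  have "\<tau> q z = \<tau> q 1" using \<xi>\<tau>[OF q zp] z(3) mhom_one[OF saturated_mgrp[OF satp[OF q]] \<tau>h(1)[OF q]] by simp
  then show "z = 1" using rat_aut_inj[OF saturated_mgrp[OF satp[OF q]] \<tau>[OF q, unfolded Ap_group_def] zp
    mgrp_one[OF saturated_mgrp[OF satp[OF q]]]] by simp
 qed
 moreover have "restrict \<xi> (root_closure \<Gamma>) x = \<tau> p x" if "p \<in> primes" "x \<in> p_root_closure \<Gamma> p" for p x
  using \<xi>\<tau>[OF that] p_root_closure_subset[OF p1[OF that(1)], of \<Gamma>] that(2) by auto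
 ultimately show thesis using that[of "restrict \<xi> (root_closure \<Gamma>)"] unfolding A_group_def by blast
qed

lemma A_to_product_bij:
 assumes \<Gamma>: "mgrp \<Gamma>" "\<Gamma> \<subseteq> \<rat>"
 shows "bij_betw (A_to_product \<Gamma>) (carrier (A_group \<Gamma>)) (\<Pi>\<^sub>E p\<in>primes. carrier (Ap_group \<Gamma> p))"
proof -
 have p1: "p \<ge> 1" if "p \<in> primes" for p using that prime_ge_1_nat by (auto simp: primes_def)
 have satp: "saturated (p_root_closure \<Gamma> p)" if "p \<in> primes" for p using saturated_closures(2)[OF \<Gamma> p1[OF that]] .
 have sat: "saturated (root_closure \<Gamma>)" using saturated_closures(1)[OF \<Gamma>, of 1] by simp
 note G = saturated_mgrp[OF sat]
 show ?thesis unfolding bij_betw_def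
 proof
  show "inj_on (A_to_product \<Gamma>) (carrier (A_group \<Gamma>))"
  proof (rule inj_onI)
   fix \<xi> \<rho> assume a: "\<xi> \<in> carrier (A_group \<Gamma>)" "\<rho> \<in> carrier (A_group \<Gamma>)" "A_to_product \<Gamma> \<xi> = A_to_product \<Gamma> \<rho>"
   have s: "\<xi> \<in> extensional (root_closure \<Gamma>)" "mhom (root_closure \<Gamma>) \<xi>"
    "\<rho> \<in> extensional (root_closure \<Gamma>)" "mhom (root_closure \<Gamma>) \<rho>"
    using a(1,2) rat_aut_carrier[OF G] by (auto simp: A_group_def)
   have loc: "\<xi> x = \<rho> x" if "p \<in> primes" "x \<in> p_root_closure \<Gamma> p" for p x
    using fun_cong[OF fun_cong[OF a(3), of p], of x] that by (simp add: A_to_product_def)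
   show "\<xi> = \<rho>"
   proof (rule extensionalityI[OF s(1,3)])
    fix x assume x: "x \<in> root_closure \<Gamma>"
    obtain J f where J: "finite J" "J \<subseteq> primes" "\<And>p. p \<in> J ==> f p \<in> p_root_closure \<Gamma> p" "x = (\<Prod>p\<in>J. f p)"
     using primary_decomposition[OF \<Gamma>(1) x] by metis
    have mem: "f p \<in> root_closure \<Gamma>" if "p \<in> J" for p using J(2,3) that p_root_closure_subset[OF p1] by blast
    have "\<xi> x = (\<Prod>p\<in>J. \<xi> (f p))" unfolding J(4) by (rule mhom_prod[OF G s(2) mem])
    also have "... = (\<Prod>p\<in>J. \<rho> (f p))" using J(2,3) loc by (intro prod.cong) auto
    also have "... = \<rho> x" unfolding J(4) by (rule mhom_prod[OF G s(4) mem, symmetric])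
    finally show "\<xi> x = \<rho> x" .
   qed
  qed
  show "A_to_product \<Gamma> ` carrier (A_group \<Gamma>) = (\<Pi>\<^sub>E p\<in>primes. carrier (Ap_group \<Gamma> p))"
  proof (intro equalityI subsetI)
   fix \<tau> assume "\<tau> \<in> A_to_product \<Gamma> ` carrier (A_group \<Gamma>)"
   then obtain \<xi> where \<xi>: "\<xi> \<in> carrier (rat_aut_group (root_closure \<Gamma>))" "\<tau> = A_to_product \<Gamma> \<xi>"
    by (auto simp: A_group_def)
   have "restrict \<xi> (p_root_closure \<Gamma> p) \<in> carrier (Ap_group \<Gamma> p)" if "p \<in> primes" for p unfolding Ap_group_def
    by (rule rat_aut_restrict[OF sat satp[OF that] p_root_closure_subset[OF p1[OF that]] \<xi>(1)])
   then show "\<tau> \<in> (\<Pi>\<^sub>E p\<in>primes. carrier (Ap_group \<Gamma> p))" unfolding \<xi>(2) A_to_product_def by auto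
  next
   fix \<tau> assume \<tau>: "\<tau> \<in> (\<Pi>\<^sub>E p\<in>primes. carrier (Ap_group \<Gamma> p))"
   then have \<tau>p: "\<tau> p \<in> carrier (Ap_group \<Gamma> p)" if "p \<in> primes" for p using that by auto
   obtain \<xi> where \<xi>: "\<xi> \<in> carrier (A_group \<Gamma>)"
    "\<And>p x. p \<in> primes ==> x \<in> p_root_closure \<Gamma> p ==> \<xi> x = \<tau> p x"
    using glue_primary_automorphisms[OF \<Gamma>, of \<tau>] \<tau>p by metis
   have "A_to_product \<Gamma> \<xi> p = \<tau> p" for p
   proof (cases "p \<in> primes")
    case True
    have "\<tau> p \<in> extensional (p_root_closure \<Gamma> p)"
     using \<tau>p[OF True] rat_aut_carrier[OF saturated_mgrp[OF satp[OF True]]] by (auto simp: Ap_group_def)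
    then have "restrict \<xi> (p_root_closure \<Gamma> p) = \<tau> p"
     using \<xi>(2)[OF True] by (intro extensionalityI[of _ "p_root_closure \<Gamma> p"]) auto
    then show ?thesis using True by (simp add: A_to_product_def)
   next
    case False
    then show ?thesis using \<tau> by (auto simp: A_to_product_def)
   qed
   then have "A_to_product \<Gamma> \<xi> = \<tau>" by blast
   then show "\<tau> \<in> A_to_product \<Gamma> ` carrier (A_group \<Gamma>)" using \<xi>(1) by blast
  qed
 qed
qed

section \<open>Measurability and translation invariance\<close>

lemma rat_aut_values:
 assumes "mgrp D" "\<xi> \<in> carrier (rat_aut_group D)" "x \<in> D" shows "\<xi> x \<in> D"
 using assms rat_aut_carrier[OF assms(1)] by (auto simp: bij_betw_def)

lemma topspace_rat_aut:
 assumes "mgrp D" shows "topspace (rat_aut_topology D) = carrier (rat_aut_group D)" using rat_aut_values[OF assms] rat_aut_carrier[OF assms]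
 by (auto simp: rat_aut_topology_def topspace_product_topology PiE_def)

lemma sets_borel_on: "sets (borel_on T) = sigma_sets (topspace T) {U. openin T U}"
 and space_borel_on: "space (borel_on T) = topspace T" unfolding borel_on_def by (auto intro!: sets_measure_of space_measure_of dest: openin_subset)

lemma openin_eval:
 assumes D: "mgrp D" and x: "x \<in> D" shows "openin (rat_aut_topology D) {\<xi> \<in> carrier (rat_aut_group D). \<xi> x \<in> U}"
proof -
 let ?P = "product_topology (\<lambda>_. discrete_topology D) D"
 have "openin ?P {f \<in> topspace ?P. f x \<in> U \<inter> D}"
  by (rule openin_continuous_map_preimage[OF continuous_map_product_projection[OF x]]) auto
 then have "openin (rat_aut_topology D) (carrier (rat_aut_group D) \<inter> {f \<in> topspace ?P. f x \<in> U \<inter> D})"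
  unfolding rat_aut_topology_def by (rule openin_subtopology_Int2)
 moreover have "carrier (rat_aut_group D) \<inter> {f \<in> topspace ?P. f x \<in> U \<inter> D} =
   {\<xi> \<in> carrier (rat_aut_group D). \<xi> x \<in> U}"
  using topspace_rat_aut[OF D] rat_aut_values[OF D _ x] by (auto simp: rat_aut_topology_def)
 ultimately show ?thesis by simp
qed

lemma eval_measurable:
 assumes "mgrp D" "x \<in> D" "sets M = sets (borel_on (rat_aut_topology D))"
 shows "(\<lambda>\<xi>. \<xi> x) \<in> measurable M (count_space UNIV)"
proof (rule measurableI)
 fix U :: "complex set"
 have "space M = carrier (rat_aut_group D)" using sets_eq_imp_space_eq[OF assms(3)] topspace_rat_aut[OF assms(1)] by (simp add: space_borel_on)
 then have "(\<lambda>\<xi>. \<xi> x) -` U \<inter> space M = {\<xi> \<in> carrier (rat_aut_group D). \<xi> x \<in> U}" by auto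
 then show "(\<lambda>\<xi>. \<xi> x) -` U \<inter> space M \<in> sets M"
  unfolding assms(3) sets_borel_on using openin_eval[OF assms(1,2), of U] by auto
qed simp

text \<open>As \<open>D\<close> is countable, every open set is a countable union of sets
  \<open>B P\<close> that prescribe finitely many values. Hence measurable evaluations suffice,
  although the Borel sets are generated by all open sets.\<close>

lemma measurable_into_rat_aut:
 assumes D: "mgrp D" "countable D"
  and F: "\<And>\<omega>. \<omega> \<in> space M ==> F \<omega> \<in> carrier (rat_aut_group D)"
  and eval: "\<And>x. x \<in> D ==> (\<lambda>\<omega>. F \<omega> x) \<in> measurable M (count_space UNIV)"
 shows "F \<in> measurable M (borel_on (rat_aut_topology D))" unfolding borel_on_def
proof (rule measurable_measure_of)
 show "{U. openin (rat_aut_topology D) U} \<subseteq> Pow (topspace (rat_aut_topology D))" by (auto dest: openin_subset)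
 show "F \<in> space M \<rightarrow> topspace (rat_aut_topology D)" using F topspace_rat_aut[OF D(1)] by auto
 fix U assume "U \<in> {U. openin (rat_aut_topology D) U}"
 then have U: "openin (rat_aut_topology D) U" by simp
 let ?A = "carrier (rat_aut_group D)"
 define B where "B P = {\<xi> \<in> ?A. \<forall>(x, y)\<in>P. \<xi> x = y}" for P :: "(complex \<times> complex) set"
 define C where "C = {P. finite P \<and> P \<subseteq> D \<times> D \<and> B P \<subseteq> U}"
 have "countable {P. finite P \<and> P \<subseteq> D \<times> D}" using D(2) by (intro countable_Collect_finite_subset countable_SIGMA)
 then have C: "countable C" by (rule countable_subset[rotated]) (auto simp: C_def)
 have "U = (\<Union>P\<in>C. B P)"
 proof
  show "(\<Union>P\<in>C. B P) \<subseteq> U" by (auto simp: C_def)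
  show "U \<subseteq> (\<Union>P\<in>C. B P)"
  proof
   fix \<xi> assume \<xi>: "\<xi> \<in> U"
   let ?P = "product_topology (\<lambda>_. discrete_topology D) D"
   obtain W where W: "openin ?P W" "U = W \<inter> ?A" using U unfolding rat_aut_topology_def openin_subtopology by blast
   then have "\<xi> \<in> W" "\<xi> \<in> ?A" using \<xi> by auto
   then obtain V where V: "finite {i \<in> D. V i ~= topspace (discrete_topology D)}" "\<xi> \<in> Pi\<^sub>E D V" "Pi\<^sub>E D V \<subseteq> W"
    using W(1) unfolding openin_product_topology_alt by blast
   define N where "N = {i \<in> D. V i ~= D}"
   have N: "finite N" "N \<subseteq> D" using V(1) by (auto simp: N_def)
   define P where "P = (\<lambda>x. (x, \<xi> x)) ` N"
   have "B P \<subseteq> U"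
   proof
    fix \<rho> assume \<rho>: "\<rho> \<in> B P"
    then have \<rho>A: "\<rho> \<in> ?A" and \<rho>N: "\<And>x. x \<in> N ==> \<rho> x = \<xi> x" by (auto simp: B_def P_def)
    have "\<rho> \<in> Pi\<^sub>E D V"
    proof (rule PiE_I)
     fix x assume x: "x \<in> D"
     show "\<rho> x \<in> V x" using \<rho>N[of x] V(2) x rat_aut_values[OF D(1) \<rho>A x] by (cases "x \<in> N") (auto simp: N_def)
    next
     fix x assume "x \<notin> D"
     then show "\<rho> x = undefined" using \<rho>A rat_aut_carrier[OF D(1)] by (auto simp: extensional_def)
    qed
    then show "\<rho> \<in> U" using V(3) W(2) \<rho>A by blast
   qed
   moreover have "P \<subseteq> D \<times> D" using N rat_aut_values[OF D(1) \<open>\<xi> \<in> ?A\<close>] by (auto simp: P_def)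
   moreover have "finite P" using N by (simp add: P_def)
   ultimately have "P \<in> C" by (simp add: C_def)
   moreover have "\<xi> \<in> B P" using \<open>\<xi> \<in> ?A\<close> by (auto simp: B_def P_def)
   ultimately show "\<xi> \<in> (\<Union>P\<in>C. B P)" by blast
  qed
 qed
 then have "F -` U \<inter> space M = (\<Union>P\<in>C. {\<omega> \<in> space M. F \<omega> \<in> B P})" by auto
 also have "... \<in> sets M"
 proof (rule sets.countable_UN''[OF C])
  fix P assume P: "P \<in> C"
  have "{\<omega> \<in> space M. F \<omega> \<in> B P} = {\<omega> \<in> space M. \<forall>xy\<in>P. F \<omega> (fst xy) = snd xy}"
   using F by (auto simp: B_def)
  also have "... \<in> sets M"
  proof (rule sets.sets_Collect_finite_All)
   show "finite P" using P by (simp add: C_def)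
   fix xy assume "xy \<in> P"
   then have "fst xy \<in> D" using P by (auto simp: C_def)
   from eval[OF this] have "(\<lambda>\<omega>. F \<omega> (fst xy)) -` {snd xy} \<inter> space M \<in> sets M" by (rule measurable_sets) auto
   moreover have "(\<lambda>\<omega>. F \<omega> (fst xy)) -` {snd xy} \<inter> space M = {\<omega> \<in> space M. F \<omega> (fst xy) = snd xy}" by auto
   ultimately show "{\<omega> \<in> space M. F \<omega> (fst xy) = snd xy} \<in> sets M" by simp
  qed
  finally show "{\<omega> \<in> space M. F \<omega> \<in> B P} \<in> sets M" .
 qed
 finally show "F -` U \<inter> space M \<in> sets M" .
qed

lemma countable_root_closure:
 assumes "\<Gamma> \<subseteq> \<rat>" shows "countable (root_closure \<Gamma>)"
proof -
 have "countable (\<Union>n\<in>{1..}. \<Union>q\<in>\<rat> :: complex set. {x. x ~= 0 \<and> x ^ n = q})"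
 proof (intro countable_UN)
  fix n :: nat and q :: complex assume "n \<in> {1..}"
  have "{x. x ~= 0 \<and> x ^ n = q} \<subseteq> {x. x ^ n = q} - {0}" by auto
  moreover have "finite ({x. x ^ n = q} - {0})"
  proof (cases "q = 0")
   case True
   then have "{x. x ^ n = q} - {0} = {}" by auto
   then show ?thesis by (metis finite.emptyI)
  next
   case False
   then show ?thesis using \<open>n \<in> {1..}\<close> by (intro finite_Diff finite_nth_roots) auto
  qed
  ultimately show "countable {x. x ~= 0 \<and> x ^ n = q}" by (meson countable_finite finite_subset)
 qed (auto intro: countable_rat)
 then show ?thesis by (rule countable_subset[rotated]) (use assms in \<open>auto simp: root_closure_def\<close>)
qed

locale haar_aut =
 fixes D :: "complex set" and \<mu> :: "(complex \<Rightarrow> complex) measure"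
 assumes saturated: "saturated D" and countable: "countable D"
  and haar: "haar_measure (rat_aut_group D) (rat_aut_topology D) \<mu>"
  and total: "emeasure \<mu> (carrier (rat_aut_group D)) = 1"
begin

abbreviation A :: "(complex \<Rightarrow> complex) set"
 where "A \<equiv> carrier (rat_aut_group D)"

lemmas mgrp = saturated_mgrp[OF saturated]
lemmas carrier_iff = rat_aut_carrier[OF mgrp]
lemmas closed = rat_aut_closed[OF mgrp]
lemmas aut_values = rat_aut_values[OF mgrp]

lemma sets_eq: "sets \<mu> = sets (borel_on (rat_aut_topology D))" using haar by (simp add: haar_measure_def)

lemma space_eq: "space \<mu> = A" using sets_eq_imp_space_eq[OF sets_eq] topspace_rat_aut[OF mgrp] by (simp add: space_borel_on)

sublocale prob_space \<mu> by standard (simp add: space_eq total)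

lemma eval_measurable [measurable]: "x \<in> D ==> (\<lambda>\<xi>. \<xi> x) \<in> measurable \<mu> (count_space UNIV)"
 by (rule Submission.eval_measurable[OF mgrp _ sets_eq])

lemma eval_borel [measurable]: "x \<in> D ==> (\<lambda>\<xi>. \<xi> x) \<in> borel_measurable \<mu>"
 by (rule measurable_compose[OF eval_measurable]) simp_all

lemma inverse_exists:
 assumes g: "g \<in> A"
 obtains h where "h \<in> A" "\<And>b. b \<in> A ==> compose D g (compose D h b) = b"
proof -
 have g': "bij_betw g D D" "mhom D g" "\<And>x. x \<in> D \<inter> \<rat> ==> g x = x" using g carrier_iff by auto
 define h where "h = restrict (inv_into D g) D"
 have h: "h x \<in> D" "g (h x) = x" if "x \<in> D" for x
 proof -
  have "x \<in> g ` D" using that g'(1) by (simp add: bij_betw_def)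
  then show "h x \<in> D" "g (h x) = x" using that by (auto simp: h_def inv_into_into f_inv_into_f)
 qed
 have hg: "h (g x) = x" if "x \<in> D" for x using that g'(1) by (auto simp: h_def bij_betw_def)
 have "h \<in> A" unfolding carrier_iff
 proof (intro conjI ballI)
  show "h \<in> extensional D" by (simp add: h_def)
  show "bij_betw h D D" unfolding h_def using bij_betw_inv_into[OF g'(1)] by (simp cong: bij_betw_cong)
  show "mhom D h" unfolding mhom_def
  proof (intro conjI ballI)
   fix x assume x: "x \<in> D"
   then show "h x ~= 0" using h(1) mgrp_nonzero[OF mgrp] by blast
   fix y assume y: "y \<in> D"
   have "g (h x * h y) = x * y" using mhom_mult[OF g'(2) h(1)[OF x] h(1)[OF y]] h(2) x y by simp
   then have "h (x * y) = h (g (h x * h y))" by simp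
   then show "h (x * y) = h x * h y" using hg mgrp_mult[OF mgrp] h(1) x y by simp
  qed
  fix x assume "x \<in> D \<inter> \<rat>"
  then show "h x = x" using hg[of x] g'(3)[of x] by simp
 qed
 moreover have "compose D g (compose D h b) = b" if "b \<in> A" for b
 proof -
  have "b \<in> extensional D" using that carrier_iff by blast
  then show ?thesis using h aut_values[OF that] by (intro extensionalityI[of _ D]) (auto simp: compose_def)
 qed
 ultimately show thesis using that by blast
qed

lemma translation_measurable: "g \<in> A ==> compose D g \<in> measurable \<mu> \<mu>"
proof -
 assume g: "g \<in> A"
 have "compose D g \<in> measurable \<mu> (borel_on (rat_aut_topology D))"
 proof (rule measurable_into_rat_aut[OF mgrp countable])
  show "compose D g \<xi> \<in> A" if "\<xi> \<in> space \<mu>" for \<xi> using closed[OF g] that space_eq by simp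
  fix x assume x: "x \<in> D"
  have "(\<lambda>\<xi>. g (\<xi> x)) \<in> measurable \<mu> (count_space UNIV)" by (rule measurable_compose[OF eval_measurable[OF x]]) simp
  then show "(\<lambda>\<xi>. compose D g \<xi> x) \<in> measurable \<mu> (count_space UNIV)" using x by (simp add: compose_def)
 qed
 then show ?thesis using measurable_cong_sets[OF refl sets_eq] by blast
qed

text \<open>Turns the invariance of cosets into invariance of integrals: the coset of the preimage
  of \<open>B\<close> is \<open>B\<close> again, since translation is surjective.\<close>

lemma distr_translation:
 assumes g: "g \<in> A" shows "distr \<mu> \<mu> (compose D g) = \<mu>"
proof (rule measure_eqI)
 fix B assume "B \<in> sets (distr \<mu> \<mu> (compose D g))"
 then have B: "B \<in> sets \<mu>" by simp
 note meas = translation_measurable[OF g]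
 let ?Y = "compose D g -` B \<inter> space \<mu>"
 have Y: "?Y \<in> sets \<mu>" by (rule measurable_sets[OF meas B])
 obtain h where h: "h \<in> A" "\<And>b. b \<in> A ==> compose D g (compose D h b) = b" using inverse_exists[OF g] by metis
 have BA: "B \<subseteq> A" using sets.sets_into_space[OF B] space_eq by simp
 have "g <#\<^bsub>rat_aut_group D\<^esub> ?Y = compose D g ` ?Y" using rat_aut_mult[OF mgrp g] space_eq by (auto simp: l_coset_def image_def)
 also have "... = B"
 proof
  show "B \<subseteq> compose D g ` ?Y"
  proof
   fix b assume b: "b \<in> B"
   have "compose D h b \<in> ?Y" using h b BA closed[OF h(1)] space_eq by auto
   then show "b \<in> compose D g ` ?Y" using h(2)[of b] b BA by (metis image_eqI subsetD)
  qed
 qed auto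
 finally have "emeasure \<mu> ?Y = emeasure \<mu> B" using haar g Y unfolding haar_measure_def by metis
 then show "emeasure (distr \<mu> \<mu> (compose D g)) B = emeasure \<mu> B" by (simp add: emeasure_distr[OF meas B])
qed simp

lemma integral_translation:
 fixes f :: "(complex \<Rightarrow> complex) \<Rightarrow> complex"
 assumes g: "g \<in> A" and f: "f \<in> borel_measurable \<mu>"
 shows "(\<integral>\<xi>. f (compose D g \<xi>) \<partial>\<mu>) = (\<integral>\<xi>. f \<xi> \<partial>\<mu>)"
 using integral_distr[OF translation_measurable[OF g] f] distr_translation[OF g] by simp

text \<open>Translation by \<open>g\<close> leaves the integral unchanged and also multiplies it by
  \<open>c\<close>.\<close>

lemma character_integral_zero:
 fixes \<psi> :: "(complex \<Rightarrow> complex) \<Rightarrow> complex"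
 assumes H: "H \<in> sets \<mu>" and \<psi>: "\<psi> \<in> borel_measurable \<mu>" and g: "g \<in> A"
  and inv: "\<And>\<xi>. \<xi> \<in> A ==> compose D g \<xi> \<in> H \<longleftrightarrow> \<xi> \<in> H"
  and char: "\<And>\<xi>. \<xi> \<in> H ==> \<psi> (compose D g \<xi>) = c * \<psi> \<xi>" and c: "c ~= 1"
 shows "(\<integral>\<xi>. indicator H \<xi> * \<psi> \<xi> \<partial>\<mu>) = 0"
proof -
 let ?f = "\<lambda>\<xi>. indicator H \<xi> * \<psi> \<xi>"
 have "(\<integral>\<xi>. ?f \<xi> \<partial>\<mu>) = (\<integral>\<xi>. ?f (compose D g \<xi>) \<partial>\<mu>)"
  by (rule integral_translation[OF g, symmetric]) (use H \<psi> in measurable)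
 also have "... = (\<integral>\<xi>. c * ?f \<xi> \<partial>\<mu>)"
  by (rule Bochner_Integration.integral_cong) (use inv char space_eq in \<open>auto simp: indicator_def\<close>)
 also have "... = c * (\<integral>\<xi>. ?f \<xi> \<partial>\<mu>)" by simp
 finally show ?thesis using c by simp
qed

lemma measure_translation:
 assumes g: "g \<in> A" and H: "H \<in> sets \<mu>" "H' \<in> sets \<mu>"
  and inv: "\<And>\<xi>. \<xi> \<in> A ==> compose D g \<xi> \<in> H' \<longleftrightarrow> \<xi> \<in> H"
 shows "measure \<mu> H' = measure \<mu> H"
proof -
 have "measure \<mu> H' = measure (distr \<mu> \<mu> (compose D g)) H'" using distr_translation[OF g] by simp
 also have "... = measure \<mu> (compose D g -` H' \<inter> space \<mu>)" by (rule measure_distr[OF translation_measurable[OF g] H(2)])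
 also have "compose D g -` H' \<inter> space \<mu> = H" using inv sets.sets_into_space[OF H(1)] space_eq by auto
 finally show ?thesis .
qed

end

section \<open>Power classes\<close>

abbreviation pclass :: "nat \<Rightarrow> complex \<Rightarrow> complex set"
 where "pclass p x \<equiv> rat_powers p #>\<^bsub>rat_units\<^esub> x"

lemma pclass_eq: "pclass p x = (\<lambda>h. h * x) ` rat_powers p" by (auto simp: r_coset_def rat_units_eq)

lemma mgrp_rat_powers: "mgrp (rat_powers p)" unfolding mgrp_def rat_powers_def
proof (intro conjI ballI)
 show "1 \<in> (\<lambda>x. x ^ p) ` (\<rat> - {0 :: complex})" by (intro image_eqI[of _ _ 1]) auto
 show "0 \<notin> (\<lambda>x. x ^ p) ` (\<rat> - {0 :: complex})" by auto
 fix x :: complex assume "x \<in> (\<lambda>x. x ^ p) ` (\<rat> - {0})"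
 then obtain a where a: "a \<in> \<rat> - {0}" "x = a ^ p" by blast
 then show "inverse x \<in> (\<lambda>x. x ^ p) ` (\<rat> - {0})" by (intro image_eqI[of _ _ "inverse a"]) (auto simp: power_inverse)
 fix y :: complex assume "y \<in> (\<lambda>x. x ^ p) ` (\<rat> - {0})"
 then obtain b where b: "b \<in> \<rat> - {0}" "y = b ^ p" by blast
 then show "x * y \<in> (\<lambda>x. x ^ p) ` (\<rat> - {0})" using a by (intro image_eqI[of _ _ "a * b"]) (auto simp: power_mult_distrib)
qed

lemma pclass_self: "x \<in> pclass p x" unfolding pclass_eq using mgrp_one[OF mgrp_rat_powers] by (intro image_eqI[of _ _ 1]) auto

lemma pclass_eq_iff:
 assumes "x ~= 0" "y ~= 0" shows "pclass p x = pclass p y \<longleftrightarrow> x / y \<in> rat_powers p"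
proof
 assume "pclass p x = pclass p y"
 then have "x \<in> pclass p y" using pclass_self by blast
 then show "x / y \<in> rat_powers p" using assms by (auto simp: pclass_eq)
next
 note G = mgrp_rat_powers[of p]
 have *: "pclass p u \<subseteq> pclass p v" if "u / v \<in> rat_powers p" "v ~= 0" for u v
 proof
  fix z assume "z \<in> pclass p u"
  then obtain h where "h \<in> rat_powers p" "z = h * u" by (auto simp: pclass_eq)
  then have "z = (h * (u / v)) * v" "h * (u / v) \<in> rat_powers p" using that(2) by (simp, intro mgrp_mult[OF G] that(1))
  then show "z \<in> pclass p v" unfolding pclass_eq by blast
 qed
 assume a: "x / y \<in> rat_powers p"
 then have "inverse (x / y) \<in> rat_powers p" by (rule mgrp_inverse[OF G])
 then have "y / x \<in> rat_powers p" by simp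
 then show "pclass p x = pclass p y" using *[OF a assms(2)] *[OF _ assms(1), of y] by blast
qed

definition class_rep :: "complex set \<Rightarrow> nat \<Rightarrow> complex set \<Rightarrow> complex"
 where "class_rep D p v = (SOME d. d \<in> D \<and> pclass p d = v)"

lemma class_rep:
 assumes "v \<in> power_classes D p" shows "class_rep D p v \<in> D" "pclass p (class_rep D p v) = v"
proof -
 have "\<exists>d. d \<in> D \<and> pclass p d = v" using assms by (auto simp: power_classes_def)
 then have "class_rep D p v \<in> D \<and> pclass p (class_rep D p v) = v" unfolding class_rep_def by (rule someI_ex)
 then show "class_rep D p v \<in> D" "pclass p (class_rep D p v) = v" by auto
qed

text \<open>\<phi> is constant on classes, and multiplication by an element \<open>d0\<close> with
  \<open>\<phi> d0 ~= 1\<close> permutes them.\<close>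

lemma class_orthogonality:
 fixes \<phi> :: "complex \<Rightarrow> complex"
 assumes D: "mgrp D" and fin: "finite (power_classes D p)" and \<phi>: "mhom D \<phi>"
  and trivial: "\<And>d. d \<in> D ==> d \<in> rat_powers p ==> \<phi> d = 1"
 shows "(\<Sum>v\<in>power_classes D p. \<phi> (class_rep D p v)) =
  (if \<forall>d\<in>D. \<phi> d = 1 then of_nat (card (power_classes D p)) else 0)"
proof (cases "\<forall>d\<in>D. \<phi> d = 1")
 case True
 then show ?thesis using class_rep(1) by simp
next
 case False
 then obtain d0 where d0: "d0 \<in> D" "\<phi> d0 ~= 1" by blast
 let ?V = "power_classes D p"
 let ?r = "class_rep D p"
 define m where "m v = pclass p (d0 * ?r v)" for v
 have nz: "x ~= 0" if "x \<in> D" for x using mgrp_nonzero[OF D that] .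
 have well: "\<phi> (?r (pclass p d)) = \<phi> d" if d: "d \<in> D" for d
 proof -
  have v: "pclass p d \<in> ?V" using d by (auto simp: power_classes_def)
  have r: "?r (pclass p d) \<in> D" "pclass p (?r (pclass p d)) = pclass p d" using class_rep[OF v] by auto
  then have "?r (pclass p d) / d \<in> rat_powers p" using pclass_eq_iff[OF nz[OF r(1)] nz[OF d]] by blast
  then have "\<phi> (?r (pclass p d) / d) = 1" using trivial mgrp_divide[OF D r(1) d] by blast
  then show ?thesis using mhom_divide[OF D \<phi> r(1) d] mhom_nonzero[OF \<phi> d] by simp
 qed
 have mV: "m ` ?V \<subseteq> ?V" using class_rep(1) mgrp_mult[OF D d0(1)] by (auto simp: m_def power_classes_def)
 have "inj_on m ?V"
 proof (rule inj_onI)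
  fix v w assume vw: "v \<in> ?V" "w \<in> ?V" "m v = m w"
  have r: "?r v \<in> D" "?r w \<in> D" using class_rep(1) vw by auto
  then have "(d0 * ?r v) / (d0 * ?r w) \<in> rat_powers p" using vw(3) nz[OF d0(1)] nz[OF r(1)] nz[OF r(2)] by (simp add: m_def pclass_eq_iff)
  then have "?r v / ?r w \<in> rat_powers p" using nz[OF d0(1)] by simp
  then have "pclass p (?r v) = pclass p (?r w)" using pclass_eq_iff nz r by blast
  then show "v = w" using class_rep(2) vw by metis
 qed
 then have bij: "bij_betw m ?V ?V" using mV fin by (simp add: bij_betw_def endo_inj_surj)
 have "(\<Sum>v\<in>?V. \<phi> (?r v)) = (\<Sum>v\<in>?V. \<phi> (?r (m v)))" by (rule sum.reindex_bij_betw[OF bij, symmetric])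
 also have "... = (\<Sum>v\<in>?V. \<phi> d0 * \<phi> (?r v))"
 proof (intro sum.cong refl)
  fix v assume "v \<in> ?V"
  then have r: "?r v \<in> D" using class_rep(1) by blast
  then show "\<phi> (?r (m v)) = \<phi> d0 * \<phi> (?r v)" unfolding m_def well[OF mgrp_mult[OF D d0(1) r]] by (rule mhom_mult[OF \<phi> d0(1)])
 qed
 also have "... = \<phi> d0 * (\<Sum>v\<in>?V. \<phi> (?r v))" by (simp add: sum_distrib_left)
 finally have "(\<Sum>v\<in>?V. \<phi> (?r v)) = 0" using d0(2) by simp
 then show ?thesis unfolding if_not_P[OF False] .
qed

section \<open>Quadratic characters of cyclotomic type\<close>

lemma cyclotomic_group_mu: "n \<ge> 1 ==> cyclotomic_group (mu n)" unfolding cyclotomic_group_def using mgrp_mu by blast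

lemma relpres_mu_of_aut:
 assumes D: "mgrp D" and n: "n \<ge> 1" "mu n \<subseteq> D" and s: "s \<in> carrier (rat_aut_group D)"
 shows "relpres (mu n) s" "mhom (mu n) s" "\<And>x. x \<in> mu n ==> s x \<in> mu n"
proof -
 have s': "mhom D s" using s rat_aut_carrier[OF D] by auto
 show hom: "mhom (mu n) s" using mhom_subset[OF s' n(2)] .
 show "relpres (mu n) s"
 proof (rule relpres_cyclotomic[OF cyclotomic_group_mu[OF n(1)] hom])
  fix x assume "x \<in> mu n" "s x = 1"
  then show "x = 1" using rat_aut_inj[OF D s, of x 1] mhom_one[OF D s'] mgrp_one[OF D] n(2) by auto
 qed
 fix x assume "x \<in> mu n"
 then show "s x \<in> mu n" using mhom_power[OF mgrp_mu[OF n(1)] hom, of x n] mhom_one[OF mgrp_mu[OF n(1)] hom] by (simp add: mu_def)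
qed

text \<open>The sign by which \<xi> changes the square root \<open>z\<close> of a rational number
  when \<open>z\<close> is read as a combination of \<open>n\<close>-th roots of unity; as a
  radical, \<open>z\<close> may be moved differently.\<close>

definition qchar :: "nat \<Rightarrow> complex \<Rightarrow> (complex \<Rightarrow> complex) \<Rightarrow> complex"
 where "qchar n z \<xi> = lext (mu n) \<xi> z / z"

locale qchar_data =
 fixes D :: "complex set" and n :: nat and z :: complex
 assumes D: "mgrp D" and n: "n \<ge> 1" "mu n \<subseteq> D"
  and z: "z \<in> qspan (mu n)" "z ~= 0" "z ^ 2 \<in> \<rat>"
begin

lemma qchar_square: "s \<in> carrier (rat_aut_group D) ==> qchar n z s ^ 2 = 1"
proof -
 assume s: "s \<in> carrier (rat_aut_group D)"
 note R = relpres_mu_of_aut[OF D n s]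
 have "lext (mu n) s z ^ 2 = z ^ 2" using lext_power[OF R(1) mgrp_mu[OF n(1)] R(2) z(1), of 2] lext_Rats[OF R(1) mgrp_mu[OF n(1)] R(2) z(3)] by simp
 then show ?thesis using z(2) by (simp add: qchar_def power_divide)
qed

lemma qchar_values: "s \<in> carrier (rat_aut_group D) ==> qchar n z s = 1 \<or> qchar n z s = - 1"
 using qchar_square by (simp add: power2_eq_1_iff)

lemma lext_eq_qchar: "lext (mu n) s z = qchar n z s * z" using z(2) by (simp add: qchar_def)

lemma qchar_compose:
 assumes g: "g \<in> carrier (rat_aut_group D)" and s: "s \<in> carrier (rat_aut_group D)"
 shows "qchar n z (compose D g s) = qchar n z g * qchar n z s"
proof -
 note Rs = relpres_mu_of_aut[OF D n s] and Rg = relpres_mu_of_aut[OF D n g]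
  and Rgs = relpres_mu_of_aut[OF D n rat_aut_closed[OF D g s]]
 obtain A c where A: "finite A" "A \<subseteq> mu n" "\<And>x. x \<in> A ==> c x \<in> \<rat>" "z = (\<Sum>x\<in>A. c x * x)"
  using z(1) by (rule qspanE) blast
 have "lext (mu n) (compose D g s) z = (\<Sum>x\<in>A. c x * compose D g s x)" unfolding A(4) using A(1-3) by (intro lext_family[OF Rgs(1)]) auto
 also have "... = (\<Sum>x\<in>A. c x * g (s x))" using A(2) n(2) by (intro sum.cong) (auto simp: compose_def)
 also have "... = lext (mu n) g (\<Sum>x\<in>A. c x * s x)" using A(1-3) Rs(3) by (intro lext_family[OF Rg(1), symmetric]) auto
 also have "(\<Sum>x\<in>A. c x * s x) = lext (mu n) s z" unfolding A(4) using A(1-3) by (intro lext_family[OF Rs(1), symmetric]) auto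
 also have "lext (mu n) g (lext (mu n) s z) = qchar n z s * lext (mu n) g z" unfolding lext_eq_qchar[of s] using qchar_values[OF s] z(1)
  by (intro lext_smult[OF Rg(1) mgrp_mu[OF n(1)] Rg(2)]) auto
 finally show ?thesis using z(2) by (simp add: qchar_def)
qed

text \<open>The sign in the full cyclotomic field can be read off from any automorphism with the
  same action on \<open>mu n\<close>, in particular from one primary component.\<close>

lemma qchar_mu_inf:
 assumes D': "mgrp D'" "mu_inf \<subseteq> D'" "s \<in> carrier (rat_aut_group D')"
  and t: "t \<in> carrier (rat_aut_group D)" and agree: "\<And>x. x \<in> mu n ==> t x = s x" shows "lext mu_inf s z = qchar n z t * z"
 using lext_subset[OF relpres_mu_inf_of_aut[OF D'] mu_subset_mu_inf[OF n(1)] agree z(1)] lext_eq_qchar[of t] by simp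

end

lemma (in haar_aut) qchar_measurable:
 assumes n: "n \<ge> 1" "mu n \<subseteq> D" and z: "z \<in> qspan (mu n)" shows "qchar n z \<in> borel_measurable \<mu>"
proof -
 obtain B c where B: "finite B" "B \<subseteq> mu n" "\<And>x. x \<in> B ==> c x \<in> \<rat>" "z = (\<Sum>x\<in>B. c x * x)"
  using z by (rule qspanE) blast
 have "(\<lambda>\<xi>. (\<Sum>x\<in>B. c x * \<xi> x) / z) \<in> borel_measurable \<mu>"
  using B(2) n(2) by (intro borel_measurable_divide borel_measurable_sum borel_measurable_times eval_borel) auto
 moreover have "qchar n z \<xi> = (\<Sum>x\<in>B. c x * \<xi> x) / z" if "\<xi> \<in> space \<mu>" for \<xi>
 proof -
  have "\<xi> \<in> A" using that space_eq by simp
  note R = relpres_mu_of_aut[OF mgrp n this]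
  have "lext (mu n) \<xi> (\<Sum>x\<in>B. c x * x) = (\<Sum>x\<in>B. c x * \<xi> x)" using B(1-3) by (intro lext_family[OF R(1)]) auto
  then show ?thesis using B(4) by (simp add: qchar_def)
 qed
 ultimately show ?thesis by (simp cong: measurable_cong)
qed

lemma (in haar_aut) integral_indicator_complex:
 assumes "H \<in> sets \<mu>" shows "(\<integral>\<xi>. (indicator H \<xi> :: complex) \<partial>\<mu>) = complex_of_real (measure \<mu> H)"
proof -
 have "(\<lambda>\<xi>. indicator H \<xi> :: complex) = (\<lambda>\<xi>. complex_of_real (indicator H \<xi>))"
  by (auto simp: indicator_def)
 moreover have "(\<integral>\<xi>. (indicator H \<xi> :: real) \<partial>\<mu>) = measure \<mu> H"
  by (rule has_bochner_integral_integral_eq[OF has_bochner_integral_real_indicator[OF assms]])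
    (simp add: emeasure_finite less_top[symmetric])
 ultimately show ?thesis by simp
qed

text \<open>A rational square root of an integer is an integer, and a perfect square is squarefree
  only if it is 1.\<close>

lemma squarefree_rat_square:
 assumes "squarefree (m :: int)" "r \<in> \<rat>" "r ^ 2 = (of_int m :: complex)" shows "m = 1"
proof -
 have "algebraic_int r" by (rule algebraic_int.intros[of "[:- of_int m, 0, 1:]"])
    (use assms(3) in \<open>auto simp: coeff_pCons power2_eq_square split: nat.splits\<close>)
 then have "r \<in> \<int>" using assms(2) rational_algebraic_int_is_int by blast
 then obtain a where "r = of_int a" by (auto elim: Ints_cases)
 then have a: "m = a ^ 2" using assms(3) by (metis of_int_eq_iff of_int_power)
 then have "a dvd 1" using assms(1) by (auto simp: squarefree_def)
 then have "\<bar>a\<bar> = 1" by simp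
 then have "a ^ 2 = 1" by (metis power2_abs power_one)
 then show ?thesis using a by simp
qed

lemma squarefree_pstar:
 assumes "Factorial_Ring.prime p" shows "squarefree (pstar p)"
proof -
 have "squarefree (int p)" using assms by (intro squarefree_prime) simp
 moreover have "pstar p = int p \<or> pstar p = - int p" unfolding pstar_def by (cases "even ((p - 1) div 2)") auto
 ultimately show ?thesis by auto
qed

lemma gauss_not_Rats:
 assumes "Factorial_Ring.prime p" "odd p" shows "gauss p \<notin> \<rat>"
proof
 assume "gauss p \<in> \<rat>"
 then have "pstar p = 1" using squarefree_rat_square[OF squarefree_pstar[OF assms(1)]] gauss_square[OF assms(2)] by blast
 moreover have "\<bar>pstar p\<bar> = int p" by (simp add: pstar_def abs_mult power_abs)
 ultimately show False using prime_gt_1_nat[OF assms(1)] by simp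
qed

lemma Rats_root_of_unity:
 assumes "z \<in> \<rat>" "z ^ n = (1 :: complex)" "odd n" shows "z = 1"
proof -
 obtain r where r: "z = of_real r" using Rats_imp_Reals[OF assms(1)] by (rule Reals_cases)
 then have "r ^ n = 1" using assms(2) by (metis of_real_eq_1_iff of_real_power)
 then have "r ^ n = 1 ^ n" by simp
 then show ?thesis using r assms(3) by (metis of_real_1 odd_real_root_power_cancel)
qed

section \<open>The primary parts\<close>

locale primary_part =
 fixes \<Gamma> :: "complex set" and p :: nat and \<mu> :: "(complex \<Rightarrow> complex) measure"
 assumes \<Gamma>: "mgrp \<Gamma>" "\<Gamma> \<subseteq> \<rat>" and p: "Factorial_Ring.prime p"
  and finite_classes: "finite (power_classes \<Gamma> p)"
  and haar_Ap: "haar_measure (Ap_group \<Gamma> p) (rat_aut_topology (p_root_closure \<Gamma> p)) \<mu>"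
  and total_Ap: "emeasure \<mu> (carrier (Ap_group \<Gamma> p)) = 1"
begin

abbreviation D :: "complex set" where "D \<equiv> p_root_closure \<Gamma> p"

lemma p_ge: "p \<ge> 1" "p \<ge> 2" "p > 0" using prime_ge_2_nat[OF p] by simp_all

sublocale haar_aut D \<mu>
proof
 show "saturated D" by (rule saturated_closures(2)[OF \<Gamma> p_ge(1)])
 show "countable D" using countable_root_closure[OF \<Gamma>(2)] p_root_closure_subset[OF p_ge(1)] countable_subset by blast
qed (use haar_Ap total_Ap in \<open>simp_all add: Ap_group_def\<close>)

definition Ker :: "(complex \<Rightarrow> complex) set"
 where "Ker = {\<xi> \<in> A. \<forall>x\<in>p_roots \<Gamma> p. \<xi> x = x}"

lemma p_roots_subset: "p_roots \<Gamma> p \<subseteq> D" by (auto simp: p_roots_def p_root_closure_def intro!: exI[of _ 1])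

lemma mgrp_roots: "mgrp (p_roots \<Gamma> p)" by (rule saturated_mgrp[OF saturated_closures(3)[OF \<Gamma> p_ge(1)]])

lemma mu_roots: "mu p \<subseteq> p_roots \<Gamma> p" using mgrp_one[OF \<Gamma>(1)] p_ge(1) by (auto simp: mu_def p_roots_def power_0_left)

lemma mu_D: "mu (p ^ k) \<subseteq> D"
proof
 fix z assume "z \<in> mu (p ^ k)"
 then have "z ^ (p ^ k) = 1" by (simp add: mu_def)
 then have "z ~= 0" "z ^ (p ^ Suc k) = 1" using p_ge by (auto simp: power_0_left mult.commute[of p] power_mult)
 then show "z \<in> D" using mgrp_one[OF \<Gamma>(1)] unfolding p_root_closure_def by (intro CollectI conjI exI[of _ "Suc k"]) auto
qed

lemma mu_p_D: "mu p \<subseteq> D" using mu_D[of 1] by simp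

lemma zeta_D: "zeta p \<in> D" "zeta p \<in> mu p" using mu_p_D zeta_in_mu[OF p_ge(1)] by auto

lemma Sp_set_eq: "Sp_set \<Gamma> p = A - Ker"
proof -
 have one: "\<one>\<^bsub>rat_aut_group (p_roots \<Gamma> p)\<^esub> = (\<lambda>x\<in>p_roots \<Gamma> p. x)"
  by (simp add: rat_aut_group_def AutoGroup_def BijGroup_def Let_def)
 have "restrict \<xi> (p_roots \<Gamma> p) = (\<lambda>x\<in>p_roots \<Gamma> p. x) \<longleftrightarrow> (\<forall>x\<in>p_roots \<Gamma> p. \<xi> x = x)" for \<xi> :: "complex \<Rightarrow> complex"
  by (auto simp: fun_eq_iff restrict_def)
 then show ?thesis by (auto simp: Sp_set_def kernel_def restriction_map_def one Ker_def Ap_group_def)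
qed

lemma Ker_subset: "Ker \<subseteq> A" by (auto simp: Ker_def)

lemma eval_sets: "x \<in> D ==> {\<xi> \<in> A. \<xi> x = y} \<in> sets \<mu>"
 using measurable_sets[OF eval_measurable[of x], of "{y}"] space_eq by (simp add: vimage_def Int_def conj_commute)

lemma Ker_sets: "Ker \<in> sets \<mu>"
proof -
 have e: "Ker = space \<mu> - (\<Union>x\<in>p_roots \<Gamma> p. space \<mu> - {\<xi> \<in> A. \<xi> x = x})" by (auto simp: Ker_def space_eq)
 have m: "(\<Union>x\<in>p_roots \<Gamma> p. space \<mu> - {\<xi> \<in> A. \<xi> x = x}) \<in> sets \<mu>"
 proof (rule sets.countable_UN''[OF countable_subset[OF p_roots_subset countable]])
  fix x assume "x \<in> p_roots \<Gamma> p"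
  then have "x \<in> D" using p_roots_subset by blast
  then show "space \<mu> - {\<xi> \<in> A. \<xi> x = x} \<in> sets \<mu>" by (intro sets.compl_sets eval_sets)
 qed
 show ?thesis unfolding e by (rule sets.compl_sets[OF m])
qed

lemma Ker_translate:
 assumes "g \<in> Ker" "\<xi> \<in> A" shows "compose D g \<xi> \<in> Ker \<longleftrightarrow> \<xi> \<in> Ker"
proof -
 have g: "g \<in> A" "\<And>x. x \<in> p_roots \<Gamma> p ==> g x = x" using assms(1) by (auto simp: Ker_def)
 have "g (\<xi> x) = x \<longleftrightarrow> \<xi> x = x" if x: "x \<in> p_roots \<Gamma> p" for x
  using rat_aut_inj[OF mgrp g(1), of "\<xi> x" x] g(2)[OF x] aut_values[OF assms(2)] x p_roots_subset by auto
 then show ?thesis using closed[OF g(1) assms(2)] assms(2) p_roots_subset by (auto simp: Ker_def compose_def)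
qed

text \<open>An element of \<open>D\<close> of prime order \<open>q ~= p\<close> also has a power in
  \<Gamma> whose exponent is a power of \<open>p\<close>, so it is rational and fixed. Only
  \<open>mu p\<close> remains to be checked.\<close>

lemma aut_of_hom:
 assumes g: "mhom (- {0}) g" "\<And>x. x \<in> \<rat> - {0} ==> g x = x"
  and inj: "\<And>z. z \<in> mu p ==> g z = 1 ==> z = 1" shows "restrict g D \<in> A"
proof (rule saturated_aut[OF saturated])
 show "mhom D g" by (rule mhom_subset[OF g(1)]) (use mgrp_nonzero[OF mgrp] in auto)
 show "g x = x" if "x \<in> D" "x \<in> \<rat>" for x using that g(2) mgrp_nonzero[OF mgrp] by blast
 fix q z assume z: "Factorial_Ring.prime q" "z \<in> D" "z ^ q = 1" "g z = 1"
 have z0: "z ~= 0" using mgrp_nonzero[OF mgrp z(2)] .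
 show "z = 1"
 proof (cases "q = p")
  case True
  then show ?thesis using inj z by (simp add: mu_def)
 next
  case False
  obtain n where n: "z ^ (p ^ n) \<in> \<Gamma>" using z(2) by (auto simp: p_root_closure_def)
  have "Rings.coprime (p ^ n) q" using p z(1) False primes_coprime by auto
  moreover have "z ^ (p ^ n) \<in> \<rat> - {0}" using n \<Gamma>(2) mgrp_nonzero[OF \<Gamma>(1) n] by blast
  moreover have "z ^ q \<in> \<rat> - {0}" unfolding z(3) by simp
  ultimately have "z \<in> \<rat> - {0}" by (intro mgrp_coprime_powers[OF mgrp_Rats z0])
  then show ?thesis using g(2) z(4) by metis
 qed
qed

lemma mu_p_mult:
 assumes "z \<in> mu p"
 obtains k where "k < p" "z = zeta p ^ k" using mu_zeta[OF p_ge(1) assms] by metis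

text \<open>Sending \<open>zeta p\<close> to \<open>zeta p ^ k\<close> is compatible with fixing the
  rationals: for odd \<open>p\<close> the only rational power of \<open>zeta p\<close> is 1, and for
  \<open>p = 2\<close> only \<open>k = 1\<close> occurs.\<close>

lemma ex_aut_zeta_power:
 assumes k: "1 \<le> k" "k < p"
 obtains g where "g \<in> A" "\<And>z. z \<in> mu p ==> g z = z ^ k"
proof -
 have agree: "zeta p powi j = (zeta p ^ k) powi j" if j: "zeta p powi j \<in> \<rat> - {0}" for j :: int
 proof (cases "p = 2")
  case True
  then have "k = 1" using k by simp
  then show ?thesis by simp
 next
  case False
  then have "odd p" using p prime_odd_nat p_ge(2) by (metis le_neq_implies_less)
  moreover have "(zeta p powi j) ^ p = 1" using mgrp_powi[OF mgrp_mu[OF p_ge(1)] zeta_D(2), of j] by (simp add: mu_def)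
  ultimately have "zeta p powi j = 1" using Rats_root_of_unity j by blast
  moreover have "(zeta p ^ k) powi j = (zeta p powi j) ^ k" by (metis mult.commute power_int_mult power_int_of_nat)
  ultimately show ?thesis by simp
 qed
 obtain g where g: "mhom (- {0}) g" "\<And>b. b \<in> \<rat> - {0} ==> g b = b" "g (zeta p) = zeta p ^ k"
  using mhom_extend_value[OF mgrp_Rats mhom_id[OF mgrp_Rats] zeta_nonzero, of "zeta p ^ k" p] agree zeta_nonzero[of p] by (metis power_not_zero)
 have pw: "g z = z ^ k" if z: "z \<in> mu p" for z
 proof -
  obtain i where i: "z = zeta p ^ i" using mu_p_mult[OF z] by metis
  have "mgrp (- {0})" by (auto simp: mgrp_def)
  then have "g z = g (zeta p) ^ i" unfolding i using zeta_nonzero[of p] by (intro mhom_power[OF _ g(1)]) auto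
  then show ?thesis using g(3) i by (simp add: mult.commute flip: power_mult)
 qed
 have "restrict g D \<in> A"
 proof (rule aut_of_hom[OF g(1,2)])
  fix z assume z: "z \<in> mu p" "g z = 1"
  obtain i where i: "z = zeta p ^ i" using mu_p_mult[OF z(1)] by metis
  have "zeta p ^ (i * k) = 1" using pw[OF z(1)] z(2) i by (simp add: power_mult)
  then have "p dvd i * k" using zeta_power_eq_1_iff[OF p_ge(1)] by simp
  then have "p dvd i \<or> p dvd k" using p prime_dvd_mult_iff by blast
  then have "p dvd i" using k nat_dvd_not_less[of k p] by auto
  then show "z = 1" using zeta_power_eq_1_iff[OF p_ge(1)] i by simp
 qed
 then show thesis using pw mu_p_D that[of "restrict g D"] by (auto simp: subset_iff)
qed

section \<open>The measure of the kernel of the restriction map\<close>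

definition N :: "nat \<Rightarrow> (complex \<Rightarrow> complex) set"
 where "N k = {\<xi> \<in> A. \<xi> (zeta p) = zeta p ^ k}"

lemma N_sets: "N k \<in> sets \<mu>" unfolding N_def by (rule eval_sets[OF zeta_D(1)])

lemma aut_mu:
 assumes "\<xi> \<in> A" "z \<in> mu p" shows "\<xi> z \<in> mu p" using relpres_mu_of_aut(3)[OF mgrp p_ge(1) mu_p_D assms] .

lemma N_cover:
 assumes "\<xi> \<in> A"
 obtains k where "k \<in> {1..<p}" "\<xi> \<in> N k"
proof -
 obtain k where k: "k < p" "\<xi> (zeta p) = zeta p ^ k" using mu_p_mult[OF aut_mu[OF assms zeta_D(2)]] by metis
 have "k ~= 0"
 proof
  assume "k = 0"
  then have "\<xi> (zeta p) = \<xi> 1" using k mhom_one[OF mgrp] assms carrier_iff by auto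
  then have "zeta p = 1" using rat_aut_inj[OF mgrp assms zeta_D(1) mgrp_one[OF mgrp]] by blast
  then have "p dvd 1" using zeta_power_eq_1_iff[OF p_ge(1), of 1] by simp
  then show False using p by simp
 qed
 then show thesis using that[of k] k assms by (auto simp: N_def)
qed

text \<open>The sets \<open>N k\<close> with \<open>k \<in> {1..<p}\<close> partition
  \<open>A\<close>, and each is a translate of \<open>N 1\<close>.\<close>

lemma measure_N: "measure \<mu> (N 1) = 1 / (real p - 1)"
proof -
 have eq: "measure \<mu> (N k) = measure \<mu> (N 1)" if k: "k \<in> {1..<p}" for k
 proof -
  obtain g where g: "g \<in> A" "\<And>z. z \<in> mu p ==> g z = z ^ k" using ex_aut_zeta_power[of k] k by auto
  show ?thesis
  proof (rule measure_translation[OF g(1) N_sets N_sets])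
   fix \<xi> assume \<xi>: "\<xi> \<in> A"
   have "g (\<xi> (zeta p)) = zeta p ^ k \<longleftrightarrow> \<xi> (zeta p) = zeta p"
    using rat_aut_inj[OF mgrp g(1) aut_values[OF \<xi> zeta_D(1)] zeta_D(1)] g(2)[OF zeta_D(2)] by auto
   then show "compose D g \<xi> \<in> N k \<longleftrightarrow> \<xi> \<in> N 1"
    using closed[OF g(1) \<xi>] \<xi> zeta_D(1) by (simp add: N_def compose_def)
  qed
 qed
 have disj: "disjoint_family_on N {1..<p}"
 proof (unfold disjoint_family_on_def, intro ballI impI)
  fix i j assume ij: "i \<in> {1..<p}" "j \<in> {1..<p}" "i ~= j"
  have "zeta p ^ i ~= zeta p ^ j"
  proof
   assume e: "zeta p ^ i = zeta p ^ j"
   have *: False if "i < j" "j < p" "zeta p ^ i = zeta p ^ j" for i j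
   proof -
    have "zeta p ^ j = zeta p ^ i * zeta p ^ (j - i)" using that(1) by (simp flip: power_add)
    then have "zeta p ^ (j - i) = 1" using that(3) zeta_nonzero[of p] by simp
    then have "p dvd j - i" using zeta_power_eq_1_iff[OF p_ge(1)] by simp
    moreover have "0 < j - i" "j - i < p" using that by auto
    ultimately show False using nat_dvd_not_less by blast
   qed
   show False using *[of i j] *[of j i] e ij by (cases i j rule: linorder_cases) auto
  qed
  then show "N i \<inter> N j = {}" by (auto simp: N_def)
 qed
 have "A \<subseteq> (\<Union>k\<in>{1..<p}. N k)"
 proof
  fix \<xi> assume "\<xi> \<in> A"
  then obtain k where "k \<in> {1..<p}" "\<xi> \<in> N k" using N_cover by blast
  then show "\<xi> \<in> (\<Union>k\<in>{1..<p}. N k)" by blast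
 qed
 then have "A = (\<Union>k\<in>{1..<p}. N k)" by (auto simp: N_def)
 then have "1 = measure \<mu> (\<Union>k\<in>{1..<p}. N k)" using prob_space space_eq by simp
 also have "... = (\<Sum>k\<in>{1..<p}. measure \<mu> (N k))" using N_sets disj by (intro finite_measure_finite_Union) auto
 also have "... = (\<Sum>k\<in>{1..<p}. measure \<mu> (N 1))" by (intro sum.cong refl eq)
 also have "... = (real p - 1) * measure \<mu> (N 1)" using p_ge by (simp add: of_nat_diff)
 finally show ?thesis using p_ge by (simp add: field_simps)
qed

definition rt :: "complex \<Rightarrow> complex"
 where "rt \<gamma> = (SOME x. x ^ p = \<gamma>)"

lemma rt_power: "rt \<gamma> ^ p = \<gamma>"
proof -
 have "\<exists>x. x ^ p = \<gamma>"
 proof (cases "\<gamma> = 0")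
  case True
  then show ?thesis using p_ge by (intro exI[of _ 0]) (simp add: power_0_left)
 next
  case False
  have "card {x. x ^ p = \<gamma>} = p" by (rule card_nth_roots) (use False p_ge in auto)
  then have "{x. x ^ p = \<gamma>} ~= {}" using p_ge by (metis card.empty not_one_le_zero)
  then show ?thesis by blast
 qed
 then show ?thesis unfolding rt_def by (rule someI_ex)
qed

lemma rt_roots: "\<gamma> \<in> \<Gamma> ==> rt \<gamma> \<in> p_roots \<Gamma> p"
 using rt_power[of \<gamma>] mgrp_nonzero[OF \<Gamma>(1), of \<gamma>] p_ge by (auto simp: p_roots_def power_0_left)

text \<open>Such an \<open>x\<close> is a \<open>p\<close>-th root of unity times a rational
  number.\<close>

lemma N1_fixes:
 assumes \<xi>: "\<xi> \<in> N 1" and x: "x \<in> D" "x ^ p \<in> rat_powers p" shows "\<xi> x = x"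
proof -
 have \<xi>': "\<xi> \<in> A" "\<xi> (zeta p) = zeta p" using \<xi> by (auto simp: N_def)
 have hom: "mhom D \<xi>" "\<And>y. y \<in> D \<inter> \<rat> ==> \<xi> y = y" using \<xi>'(1) carrier_iff by auto
 obtain q where q: "q \<in> \<rat>" "q ~= 0" "x ^ p = q ^ p" using x(2) by (auto simp: rat_powers_def)
 have "x / q \<in> mu p" using q by (simp add: mu_def power_divide)
 then obtain k where k: "x / q = zeta p ^ k" using mu_p_mult by metis
 have "x / q \<in> D" using \<open>x / q \<in> mu p\<close> mu_p_D by blast
 then have "x / (x / q) \<in> D" by (rule mgrp_divide[OF mgrp x(1)])
 then have qD: "q \<in> D" using mgrp_nonzero[OF mgrp x(1)] q(2) by simp
 have "x = zeta p ^ k * q" using k q(2) by (simp add: field_simps)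
 then show ?thesis using mhom_mult[OF hom(1) mgrp_power[OF mgrp zeta_D(1)] qD] mhom_power[OF mgrp hom(1) zeta_D(1)]
   \<xi>'(2) hom(2)[of q] qD q(1) by simp
qed

lemma Ker_subset_N: "Ker \<subseteq> N 1" using mu_roots zeta_D(2) by (auto simp: Ker_def N_def)

text \<open>The Kummer pairing. The chosen roots \<open>rt\<close> are not multiplicative, but the
  defect \<open>rt (x * y) / (rt x * rt y)\<close> is a \<open>p\<close>-th root of unity, which
  elements of \<open>N 1\<close> fix.\<close>

lemma ratio_hom:
 assumes \<xi>: "\<xi> \<in> N 1" shows "mhom \<Gamma> (\<lambda>\<gamma>. \<xi> (rt \<gamma>) / rt \<gamma>)"
proof -
 have hom: "mhom D \<xi>" using \<xi> carrier_iff by (auto simp: N_def)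
 have rD: "rt \<gamma> \<in> D" "rt \<gamma> ~= 0" if "\<gamma> \<in> \<Gamma>" for \<gamma>
  using rt_roots[OF that] p_roots_subset mgrp_nonzero[OF mgrp] by blast+
 show ?thesis unfolding mhom_def
 proof (intro conjI ballI)
  fix x assume x: "x \<in> \<Gamma>"
  then show "\<xi> (rt x) / rt x ~= 0" using mhom_nonzero[OF hom] rD by auto
  fix y assume y: "y \<in> \<Gamma>"
  have xy: "x * y \<in> \<Gamma>" using mgrp_mult[OF \<Gamma>(1) x y] .
  let ?w = "rt (x * y) / (rt x * rt y)"
  have wD: "?w \<in> D" using rD x y xy by (intro mgrp_divide[OF mgrp] mgrp_mult[OF mgrp])
  have "?w ^ p = 1" using mgrp_nonzero[OF \<Gamma>(1)] x y by (simp add: power_divide power_mult_distrib rt_power)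
  then have "\<xi> ?w = ?w" using N1_fixes[OF \<xi> wD] mgrp_one[OF mgrp_rat_powers] by simp
  moreover have "\<xi> ?w = \<xi> (rt (x * y)) / (\<xi> (rt x) * \<xi> (rt y))"
   using rD x y xy by (simp add: mhom_divide[OF mgrp hom] mhom_mult[OF hom] mgrp_mult[OF mgrp])
  ultimately have "\<xi> (rt (x * y)) / (\<xi> (rt x) * \<xi> (rt y)) = ?w" by simp
  moreover have "\<xi> (rt x) ~= 0" "\<xi> (rt y) ~= 0" using mhom_nonzero[OF hom] rD x y by auto
  ultimately show "\<xi> (rt (x * y)) / rt (x * y) = \<xi> (rt x) / rt x * (\<xi> (rt y) / rt y)"
   using rD(2)[OF x] rD(2)[OF y] rD(2)[OF xy] by (simp add: field_simps)
 qed
qed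

lemma Ker_iff_ratio:
 assumes \<xi>: "\<xi> \<in> N 1"
 shows "\<xi> \<in> Ker \<longleftrightarrow> (\<forall>\<gamma>\<in>\<Gamma>. \<xi> (rt \<gamma>) / rt \<gamma> = 1)"
proof
 assume "\<xi> \<in> Ker"
 then show "\<forall>\<gamma>\<in>\<Gamma>. \<xi> (rt \<gamma>) / rt \<gamma> = 1"
  using rt_roots mgrp_nonzero[OF mgrp_roots] by (auto simp: Ker_def)
next
 assume *: "\<forall>\<gamma>\<in>\<Gamma>. \<xi> (rt \<gamma>) / rt \<gamma> = 1"
 have \<xi>': "\<xi> \<in> A" "mhom D \<xi>" using \<xi> carrier_iff by (auto simp: N_def)
 have "\<xi> x = x" if x: "x \<in> p_roots \<Gamma> p" for x
 proof -
  have g: "x ^ p \<in> \<Gamma>" "x ~= 0" "x \<in> D" using x p_roots_subset by (auto simp: p_roots_def)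
  have r: "rt (x ^ p) \<in> D" "rt (x ^ p) ~= 0" using rt_roots[OF g(1)] p_roots_subset mgrp_nonzero[OF mgrp] by blast+
  have "(x / rt (x ^ p)) ^ p = 1" using g(2) by (simp add: power_divide rt_power)
  then have "\<xi> (x / rt (x ^ p)) = x / rt (x ^ p)"
   using N1_fixes[OF \<xi> mgrp_divide[OF mgrp g(3) r(1)]] mgrp_one[OF mgrp_rat_powers] by simp
  moreover have "\<xi> (x / rt (x ^ p)) = \<xi> x / \<xi> (rt (x ^ p))" by (rule mhom_divide[OF mgrp \<xi>'(2) g(3) r(1)])
  moreover have "\<xi> (rt (x ^ p)) = rt (x ^ p)" using *[rule_format, OF g(1)] r(2) by simp
  ultimately show ?thesis using r(2) by simp
 qed
 then show "\<xi> \<in> Ker" using \<xi>'(1) by (simp add: Ker_def)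
qed

text \<open>The group \<open>B\<close> generated by \<open>zeta p\<close> and the rationals does not
  contain \<open>rt \<gamma>\<close>, so some automorphism fixes \<open>B\<close> and moves
  \<open>rt \<gamma>\<close>. Translation by it preserves \<open>N 1\<close> and multiplies the
  pairing by a constant other than 1.\<close>

lemma ratio_integral_zero:
 assumes \<gamma>: "\<gamma> \<in> \<Gamma>" "\<gamma> \<notin> rat_powers p"
 shows "(\<integral>\<xi>. indicator (N 1) \<xi> * (\<xi> (rt \<gamma>) / rt \<gamma>) \<partial>\<mu>) = 0"
proof -
 define B where "B = {zeta p ^ k * q | k q. q \<in> \<rat> - {0}}"
 have inv_zeta: "\<exists>j. inverse (zeta p ^ k) = zeta p ^ j" for k
 proof -
  have "inverse (zeta p ^ k) \<in> mu p" using mgrp_mu[OF p_ge(1)] zeta_D(2) mgrp_inverse mgrp_power by blast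
  then show ?thesis using mu_p_mult by metis
 qed
 have B: "mgrp B" unfolding mgrp_def
 proof (intro conjI ballI)
  show "1 \<in> B" unfolding B_def by (intro CollectI exI[of _ "0::nat"] exI[of _ 1]) auto
  show "0 \<notin> B" using zeta_nonzero[of p] by (auto simp: B_def)
  fix x assume "x \<in> B"
  then obtain k q where x: "x = zeta p ^ k * q" "q \<in> \<rat> - {0}" by (auto simp: B_def)
  obtain j where "inverse (zeta p ^ k) = zeta p ^ j" using inv_zeta by blast
  then have "inverse x = zeta p ^ j * inverse q" "inverse q \<in> \<rat> - {0}" using x by auto
  then show "inverse x \<in> B" unfolding B_def by blast
  fix y assume "y \<in> B"
  then obtain l r where y: "y = zeta p ^ l * r" "r \<in> \<rat> - {0}" by (auto simp: B_def)
  have "x * y = zeta p ^ (k + l) * (q * r)" "q * r \<in> \<rat> - {0}" using x y by (auto simp: power_add)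
  then show "x * y \<in> B" unfolding B_def by blast
 qed
 have ratB: "x \<in> B" if "x \<in> \<rat> - {0}" for x unfolding B_def using that by (intro CollectI exI[of _ "0::nat"] exI[of _ x]) auto
 have muB: "z \<in> B" if z: "z \<in> mu p" for z
 proof -
  obtain k where "z = zeta p ^ k" using mu_p_mult[OF z] by metis
  then show ?thesis unfolding B_def by (intro CollectI exI[of _ k] exI[of _ 1]) auto
 qed
 let ?x = "rt \<gamma>"
 have xD: "?x \<in> D" "?x ~= 0" using rt_roots[OF \<gamma>(1)] p_roots_subset mgrp_nonzero[OF mgrp] by blast+
 have "?x \<notin> B"
 proof
  assume "?x \<in> B"
  then obtain k q where x: "?x = zeta p ^ k * q" "q \<in> \<rat> - {0}" by (auto simp: B_def)
  have "\<gamma> = (zeta p ^ k) ^ p * q ^ p" using rt_power[of \<gamma>] x(1) by (metis power_mult_distrib)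
  also have "(zeta p ^ k) ^ p = 1" using zeta_power[OF p_ge(1)] by (metis mult.commute power_mult power_one)
  finally show False using \<gamma>(2) x(2) by (auto simp: rat_powers_def)
 qed
 then obtain g where g: "mhom (- {0}) g" "\<And>b. b \<in> B ==> g b = b" "g ?x ~= ?x"
  using mhom_extend_avoiding[OF B mhom_id[OF B] xD(2)] by metis
 have gA: "restrict g D \<in> A" by (rule aut_of_hom[OF g(1)]) (use g(2) ratB muB in auto)
 have hom: "mhom D (restrict g D)" using gA carrier_iff by blast
 show ?thesis
 proof (rule character_integral_zero[OF N_sets _ gA])
  show "(\<lambda>\<xi>. \<xi> ?x / ?x) \<in> borel_measurable \<mu>" by (intro borel_measurable_divide eval_borel[OF xD(1)]) simp
  fix \<xi>
  show "compose D (restrict g D) \<xi> \<in> N 1 \<longleftrightarrow> \<xi> \<in> N 1" if \<xi>: "\<xi> \<in> A"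
  proof -
   have "\<xi> (zeta p) \<in> mu p" by (rule aut_mu[OF \<xi> zeta_D(2)])
   then have "restrict g D (\<xi> (zeta p)) = \<xi> (zeta p)" using g(2) muB mu_p_D by auto
   then show ?thesis using closed[OF gA \<xi>] \<xi> zeta_D(1) by (simp add: N_def compose_def)
  qed
  assume \<xi>: "\<xi> \<in> N 1"
  then have \<xi>A: "\<xi> \<in> A" and \<xi>h: "mhom D \<xi>" "\<And>y. y \<in> D \<inter> \<rat> ==> \<xi> y = y" using carrier_iff by (auto simp: N_def)
  have "\<xi> ?x ^ p = \<xi> (?x ^ p)" using mhom_power[OF mgrp \<xi>h(1) xD(1)] by simp
  also have "... = ?x ^ p" using \<xi>h(2) mgrp_power[OF mgrp xD(1)] rt_power \<gamma>(1) \<Gamma>(2) by (metis IntI subsetD)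
  finally have w: "\<xi> ?x / ?x \<in> mu p" using xD(2) by (simp add: mu_def power_divide)
  have "\<xi> ?x = \<xi> ?x / ?x * ?x" using xD(2) by simp
  then have "restrict g D (\<xi> ?x) = restrict g D (\<xi> ?x / ?x) * restrict g D ?x"
   using mhom_mult[OF hom, of "\<xi> ?x / ?x" ?x] w mu_p_D xD(1) by (metis subsetD)
  also have "restrict g D (\<xi> ?x / ?x) = \<xi> ?x / ?x" using g(2) muB[OF w] w mu_p_D by auto
  finally show "compose D (restrict g D) \<xi> ?x / ?x = (g ?x / ?x) * (\<xi> ?x / ?x)" using xD(1) by (simp add: compose_def)
 next
  show "g ?x / ?x ~= 1" using g(3) xD(2) by simp
 qed
qed

text \<open>Orthogonality over the power classes makes the indicator of \<open>Ker\<close> an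
  average of Kummer pairings on \<open>N 1\<close>. Only the class of 1 has a nonzero integral,
  namely the measure of \<open>N 1\<close>.\<close>

theorem measure_Ker: "measure \<mu> Ker = 1 / ((real p - 1) * real (card (power_classes \<Gamma> p)))"
proof -
 let ?V = "power_classes \<Gamma> p"
 let ?r = "class_rep \<Gamma> p"
 let ?f = "\<lambda>v \<xi>. indicator (N 1) \<xi> * (\<xi> (rt (?r v)) / rt (?r v)) :: complex"
 have "pclass p 1 \<in> ?V" using mgrp_one[OF \<Gamma>(1)] by (auto simp: power_classes_def)
 then have card: "card ?V > 0" using finite_classes by (auto simp: card_gt_0_iff)
 have ind: "of_nat (card ?V) * indicator Ker \<xi> = (\<Sum>v\<in>?V. ?f v \<xi>)" if \<xi>: "\<xi> \<in> A" for \<xi>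
 proof (cases "\<xi> \<in> N 1")
  case True
  have triv: "\<xi> (rt d) / rt d = 1" if d: "d \<in> \<Gamma>" "d \<in> rat_powers p" for d
  proof -
   have "rt d \<in> D" "rt d ~= 0" using rt_roots[OF d(1)] p_roots_subset mgrp_nonzero[OF mgrp] by blast+
   then show ?thesis using N1_fixes[OF True] rt_power[of d] d(2) by simp
  qed
  have "(\<Sum>v\<in>?V. ?f v \<xi>) = (\<Sum>v\<in>?V. \<xi> (rt (?r v)) / rt (?r v))" using True by simp
  also have "... = (if \<forall>d\<in>\<Gamma>. \<xi> (rt d) / rt d = 1 then of_nat (card ?V) else 0)"
   by (rule class_orthogonality[OF \<Gamma>(1) finite_classes ratio_hom[OF True] triv])
  also have "... = of_nat (card ?V) * indicator Ker \<xi>" using Ker_iff_ratio[OF True] by (simp add: indicator_def)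
  finally show ?thesis by simp
 next
  case False
  then have "\<xi> \<notin> Ker" using Ker_subset_N by blast
  then show ?thesis using False by simp
 qed
 have meas: "(\<lambda>\<xi>. \<xi> (rt (?r v)) / rt (?r v)) \<in> borel_measurable \<mu>" if "v \<in> ?V" for v
  using rt_roots[OF class_rep(1)[OF that]] p_roots_subset by (intro borel_measurable_divide eval_borel) auto
 have int: "integrable \<mu> (?f v)" if v: "v \<in> ?V" for v
 proof (rule integrable_const_bound[where B = 1])
  show "?f v \<in> borel_measurable \<mu>" by (intro borel_measurable_times borel_measurable_indicator N_sets meas v)
  show "AE \<xi> in \<mu>. norm (?f v \<xi>) \<le> 1"
  proof (rule AE_I2)
   fix \<xi> assume "\<xi> \<in> space \<mu>"
   then have \<xi>: "\<xi> \<in> A" by (simp add: space_eq)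
   let ?x = "rt (?r v)"
   have g: "?r v \<in> \<Gamma>" using class_rep(1)[OF v] .
   have x: "?x \<in> D" "?x ~= 0" using rt_roots[OF g] p_roots_subset mgrp_nonzero[OF mgrp] by blast+
   have h: "mhom D \<xi>" "\<And>y. y \<in> D \<inter> \<rat> ==> \<xi> y = y" using \<xi> carrier_iff by auto
   have "\<xi> ?x ^ p = \<xi> (?x ^ p)" using mhom_power[OF mgrp h(1) x(1)] by simp
   also have "... = ?x ^ p" using h(2) mgrp_power[OF mgrp x(1)] rt_power g \<Gamma>(2) by (metis IntI subsetD)
   finally have "(\<xi> ?x / ?x) ^ p = 1" using x(2) by (simp add: power_divide)
   then have "norm (\<xi> ?x / ?x) ^ p = 1 ^ p" by (metis norm_one norm_power power_one)
   then have "norm (\<xi> ?x / ?x) = 1" using p_ge by (intro power_eq_imp_eq_base[of _ p 1]) auto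
   then show "norm (?f v \<xi>) \<le> 1" by (simp add: norm_mult indicator_def del: norm_divide)
  qed
 qed
 have "of_nat (card ?V) * complex_of_real (measure \<mu> Ker) = (\<integral>\<xi>. of_nat (card ?V) * indicator Ker \<xi> \<partial>\<mu>)"
  using integral_indicator_complex[OF Ker_sets] by simp
 also have "... = (\<integral>\<xi>. (\<Sum>v\<in>?V. ?f v \<xi>) \<partial>\<mu>)"
  by (rule Bochner_Integration.integral_cong) (use ind space_eq in auto)
 also have "... = (\<Sum>v\<in>?V. \<integral>\<xi>. ?f v \<xi> \<partial>\<mu>)" by (rule Bochner_Integration.integral_sum[OF int])
 also have "... = (\<Sum>v\<in>?V. if v = pclass p 1 then complex_of_real (measure \<mu> (N 1)) else 0)"
 proof (intro sum.cong refl)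
  fix v assume v: "v \<in> ?V"
  have g: "?r v \<in> \<Gamma>" "pclass p (?r v) = v" using class_rep[OF v] by auto
  have iff: "v = pclass p 1 \<longleftrightarrow> ?r v \<in> rat_powers p"
   using pclass_eq_iff[of "?r v" 1 p] g mgrp_nonzero[OF \<Gamma>(1) g(1)] by auto
  show "(\<integral>\<xi>. ?f v \<xi> \<partial>\<mu>) = (if v = pclass p 1 then complex_of_real (measure \<mu> (N 1)) else 0)"
  proof (cases "v = pclass p 1")
   case True
   have "(\<integral>\<xi>. ?f v \<xi> \<partial>\<mu>) = (\<integral>\<xi>. indicator (N 1) \<xi> \<partial>\<mu>)"
   proof (rule Bochner_Integration.integral_cong[OF refl])
    fix \<xi>
    have x: "rt (?r v) \<in> D" "rt (?r v) ~= 0" using rt_roots[OF g(1)] p_roots_subset mgrp_nonzero[OF mgrp] by blast+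
    have "\<xi> (rt (?r v)) = rt (?r v)" if "\<xi> \<in> N 1" using N1_fixes[OF that x(1)] rt_power[of "?r v"] iff True by simp
    then show "?f v \<xi> = indicator (N 1) \<xi>" using x(2) by (auto simp: indicator_def)
   qed
   also have "... = complex_of_real (measure \<mu> (N 1))" by (rule integral_indicator_complex[OF N_sets])
   finally show ?thesis using True by simp
  next
   case False
   then show ?thesis using ratio_integral_zero[OF g(1)] iff by simp
  qed
 qed
 also have "... = complex_of_real (measure \<mu> (N 1))" using \<open>pclass p 1 \<in> ?V\<close> finite_classes by simp
 finally have "complex_of_real (real (card ?V) * measure \<mu> Ker) = complex_of_real (measure \<mu> (N 1))" by simp
 then have "real (card ?V) * measure \<mu> Ker = 1 / (real p - 1)" unfolding of_real_eq_iff measure_N .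
 then have "measure \<mu> Ker = 1 / (real p - 1) / real (card ?V)" using card by (metis less_irrefl nonzero_mult_div_cancel_left of_nat_0_less_iff)
 then show ?thesis by (metis divide_divide_eq_left)
qed

section \<open>Integrals of characters over S_p\<close>

lemma measure_Sp: "measure \<mu> (Sp_set \<Gamma> p) = 1 - measure \<mu> Ker" unfolding Sp_set_eq using prob_compl[OF Ker_sets] space_eq by simp

lemma Sp_sets: "Sp_set \<Gamma> p \<in> sets \<mu>" unfolding Sp_set_eq using Ker_sets sets.top[of \<mu>] space_eq by (metis sets.Diff)

lemma bounded_integrable:
 assumes "\<psi> \<in> borel_measurable \<mu>" "\<And>\<xi>. \<xi> \<in> A ==> norm (\<psi> \<xi> :: complex) \<le> 1" "H \<in> sets \<mu>"
 shows "integrable \<mu> (\<lambda>\<xi>. indicator H \<xi> * \<psi> \<xi>)"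
proof (rule integrable_const_bound[where B = 1])
 show "(\<lambda>\<xi>. indicator H \<xi> * \<psi> \<xi>) \<in> borel_measurable \<mu>"
  by (intro borel_measurable_times borel_measurable_indicator assms)
 show "AE \<xi> in \<mu>. norm (indicator H \<xi> * \<psi> \<xi>) \<le> 1"
  using assms(2) space_eq by (intro AE_I2) (auto simp: norm_mult indicator_def)
qed

lemma integral_Sp:
 assumes "\<psi> \<in> borel_measurable \<mu>" "\<And>\<xi>. \<xi> \<in> A ==> norm (\<psi> \<xi> :: complex) \<le> 1"
 shows "(\<integral>\<xi>. indicator (Sp_set \<Gamma> p) \<xi> * \<psi> \<xi> \<partial>\<mu>) =
  (\<integral>\<xi>. indicator A \<xi> * \<psi> \<xi> \<partial>\<mu>) - (\<integral>\<xi>. indicator Ker \<xi> * \<psi> \<xi> \<partial>\<mu>)"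
proof -
 have "A \<in> sets \<mu>" using sets.top[of \<mu>] space_eq by simp
 have "(\<integral>\<xi>. indicator (Sp_set \<Gamma> p) \<xi> * \<psi> \<xi> \<partial>\<mu>) =
   (\<integral>\<xi>. indicator A \<xi> * \<psi> \<xi> - indicator Ker \<xi> * \<psi> \<xi> \<partial>\<mu>)"
  by (rule Bochner_Integration.integral_cong)
    (use Ker_subset in \<open>auto simp: Sp_set_eq indicator_def\<close>)
 then show ?thesis
  using Bochner_Integration.integral_diff[OF bounded_integrable[OF assms \<open>A \<in> sets \<mu>\<close>] bounded_integrable[OF assms Ker_sets]]
  by simp
qed

lemma integral_A_nontrivial:
 fixes \<psi> :: "(complex \<Rightarrow> complex) \<Rightarrow> complex"
 assumes "\<psi> \<in> borel_measurable \<mu>"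
  and hom: "\<And>g \<xi>. g \<in> A ==> \<xi> \<in> A ==> \<psi> (compose D g \<xi>) = \<psi> g * \<psi> \<xi>"
  and g: "g \<in> A" "\<psi> g ~= 1" shows "(\<integral>\<xi>. indicator A \<xi> * \<psi> \<xi> \<partial>\<mu>) = 0"
proof (rule character_integral_zero[OF _ assms(1) g(1) _ _ g(2)])
 show "A \<in> sets \<mu>" using sets.top[of \<mu>] space_eq by simp
qed (use closed[OF g(1)] hom[OF g(1)] in auto)

text \<open>Translation by \<open>g\<close> preserves both \<open>A\<close> and \<open>Ker\<close>,
  so neither contributes to the difference.\<close>

lemma integral_Sp_nontrivial_Ker:
 assumes "\<psi> \<in> borel_measurable \<mu>" "\<And>\<xi>. \<xi> \<in> A ==> norm (\<psi> \<xi> :: complex) \<le> 1"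
  and hom: "\<And>g \<xi>. g \<in> A ==> \<xi> \<in> A ==> \<psi> (compose D g \<xi>) = \<psi> g * \<psi> \<xi>"
  and g: "g \<in> Ker" "\<psi> g ~= 1"
 shows "(\<integral>\<xi>. indicator (Sp_set \<Gamma> p) \<xi> * \<psi> \<xi> \<partial>\<mu>) = 0"
proof -
 have gA: "g \<in> A" using g(1) Ker_subset by blast
 have "(\<integral>\<xi>. indicator Ker \<xi> * \<psi> \<xi> \<partial>\<mu>) = 0"
  by (rule character_integral_zero[OF Ker_sets assms(1) gA Ker_translate[OF g(1)] _ g(2)])
    (use hom[OF gA] Ker_subset in auto)
 then show ?thesis using integral_Sp[OF assms(1,2)] integral_A_nontrivial[where \<psi> = \<psi> and g = g, OF assms(1) hom gA g(2)] by simp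
qed

text \<open>The integral over all of \<open>A\<close> vanishes, and the removed kernel contributes
  its mass: this is the origin of the numerators -1 in the correction term.\<close>

lemma integral_Sp_trivial_Ker:
 assumes "\<psi> \<in> borel_measurable \<mu>" "\<And>\<xi>. \<xi> \<in> A ==> norm (\<psi> \<xi> :: complex) \<le> 1"
  and hom: "\<And>g \<xi>. g \<in> A ==> \<xi> \<in> A ==> \<psi> (compose D g \<xi>) = \<psi> g * \<psi> \<xi>"
  and g: "g \<in> A" "\<psi> g ~= 1" and triv: "\<And>\<xi>. \<xi> \<in> Ker ==> \<psi> \<xi> = 1"
 shows "(\<integral>\<xi>. indicator (Sp_set \<Gamma> p) \<xi> * \<psi> \<xi> \<partial>\<mu>) = - complex_of_real (measure \<mu> Ker)"
proof -
 have "(\<integral>\<xi>. indicator Ker \<xi> * \<psi> \<xi> \<partial>\<mu>) = (\<integral>\<xi>. indicator Ker \<xi> \<partial>\<mu>)"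
  by (rule Bochner_Integration.integral_cong) (use triv in \<open>auto simp: indicator_def\<close>)
 also have "... = complex_of_real (measure \<mu> Ker)" by (rule integral_indicator_complex[OF Ker_sets])
 finally show ?thesis using integral_Sp[OF assms(1,2)] integral_A_nontrivial[where \<psi> = \<psi> and g = g, OF assms(1) hom g] by simp
qed

end

section \<open>Finiteness of power classes\<close>

text \<open>Modulo \<open>p\<close>-th powers the exponents of the generators count modulo
  \<open>p\<close> only. The second claim keeps the generators at hand for the valuation argument of
  \<open>finite_power_classes_saturated\<close>.\<close>

lemma finite_power_classes_fg:
 assumes \<Gamma>: "mgrp \<Gamma>" "\<Gamma> \<subseteq> \<rat>" and fg: "finitely_generated \<Gamma>" and p: "p \<ge> 1"
 shows "finite (power_classes \<Gamma> p)"
  and "\<exists>B. finite B \<and> B \<subseteq> \<Gamma> \<and> (\<forall>x\<in>\<Gamma>. \<exists>k::complex \<Rightarrow> int. x = (\<Prod>b\<in>B. b powi k b))"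
proof -
 obtain B where B: "finite B" "B \<subseteq> \<Gamma>" "generate (mult_of complex_field) B = \<Gamma>" using fg by (auto simp: finitely_generated_def)
 have nz: "b ~= 0" if "b \<in> B" for b using that B(2) mgrp_nonzero[OF \<Gamma>(1)] by blast
 interpret U: group "mult_of (complex_field :: complex ring)"
 proof (rule groupI)
  fix x assume "x \<in> carrier (mult_of (complex_field :: complex ring))"
  then show "\<exists>y\<in>carrier (mult_of complex_field). y \<otimes>\<^bsub>mult_of complex_field\<^esub> x = \<one>\<^bsub>mult_of complex_field\<^esub>"
   by (intro bexI[of _ "inverse x"]) auto
 qed auto
 have inv: "inv\<^bsub>mult_of complex_field\<^esub> x = inverse x" if "x ~= 0" for x :: complex by (rule U.inv_equality) (use that in auto)
 have gen: "\<exists>k::complex \<Rightarrow> int. x = (\<Prod>b\<in>B. b powi k b)" if "x \<in> generate (mult_of complex_field) B" for x using that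
 proof (induction rule: generate.induct)
  case one
  then show ?case by (intro exI[of _ "\<lambda>_. 0"]) simp
 next
  case (incl h)
  have "(\<Prod>b\<in>B. b powi (if b = h then 1 else 0)) = (\<Prod>b\<in>B. if b = h then b else 1)" by (intro prod.cong) auto
  then show ?case using incl B(1) by (intro exI[of _ "\<lambda>b. if b = h then 1 else 0"]) simp
 next
  case (inv h)
  have "(\<Prod>b\<in>B. b powi (if b = h then - 1 else 0)) = (\<Prod>b\<in>B. if b = h then inverse b else 1)"
   by (intro prod.cong) (auto simp: power_int_minus)
  then show ?case using inv B(1) nz \<open>\<And>x. x ~= 0 ==> inv\<^bsub>mult_of complex_field\<^esub> x = inverse x\<close>
   by (intro exI[of _ "\<lambda>b. if b = h then - 1 else 0"]) simp
 next
  case (eng g h)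
  then obtain k l where "g = (\<Prod>b\<in>B. b powi k b)" "h = (\<Prod>b\<in>B. b powi l b)" by blast
  then have "g * h = (\<Prod>b\<in>B. b powi (k b + l b))" using nz by (simp add: power_int_add prod.distrib)
  then show ?case by (intro exI[of _ "\<lambda>b. k b + l b"]) simp
 qed
 have gen': "\<forall>x\<in>\<Gamma>. \<exists>k::complex \<Rightarrow> int. x = (\<Prod>b\<in>B. b powi k b)" using gen B(3) by blast
 then show "\<exists>B. finite B \<and> B \<subseteq> \<Gamma> \<and> (\<forall>x\<in>\<Gamma>. \<exists>k::complex \<Rightarrow> int. x = (\<Prod>b\<in>B. b powi k b))"
  using B(1,2) by blast
 have "power_classes \<Gamma> p \<subseteq> (\<lambda>k. pclass p (\<Prod>b\<in>B. b powi k b)) ` (B \<rightarrow>\<^sub>E {0..<int p})"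
 proof
  fix v assume "v \<in> power_classes \<Gamma> p"
  then obtain x where x: "x \<in> \<Gamma>" "v = pclass p x" by (auto simp: power_classes_def)
  obtain k where k: "x = (\<Prod>b\<in>B. b powi k b)" using gen' x(1) by blast
  define l where "l = (\<lambda>b\<in>B. k b mod int p)"
  have l: "l \<in> B \<rightarrow>\<^sub>E {0..<int p}" using p by (auto simp: l_def)
  let ?y = "\<Prod>b\<in>B. b powi l b"
  have y0: "?y ~= 0" using nz B(1) by simp
  have "x = (\<Prod>b\<in>B. b powi (k b div int p)) ^ p * ?y"
  proof -
   have "b powi k b = (b powi (k b div int p)) ^ p * b powi l b" if b: "b \<in> B" for b
   proof -
    have "b powi (k b div int p * int p + k b mod int p) = b powi (k b div int p * int p) * b powi (k b mod int p)"
     using nz[OF b] by (simp only: power_int_add simp_thms)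
    then show ?thesis using b by (simp add: l_def power_int_mult)
   qed
   then show ?thesis unfolding k by (simp add: prod.distrib prod_power_distrib)
  qed
  moreover have "(\<Prod>b\<in>B. b powi (k b div int p)) \<in> \<rat> - {0}"
   using B(2) \<Gamma>(2) nz by (intro mgrp_prod[OF mgrp_Rats] mgrp_powi[OF mgrp_Rats]) auto
  ultimately have "x / ?y \<in> rat_powers p" using y0 by (auto simp: rat_powers_def)
  then have "v = pclass p ?y" using pclass_eq_iff[OF mgrp_nonzero[OF \<Gamma>(1) x(1)] y0] x(2) by blast
  then show "v \<in> (\<lambda>k. pclass p (\<Prod>b\<in>B. b powi k b)) ` (B \<rightarrow>\<^sub>E {0..<int p})" using l by blast
 qed
 moreover have "finite (B \<rightarrow>\<^sub>E {0..<int p})" using B(1) by (intro finite_PiE) auto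
 ultimately show "finite (power_classes \<Gamma> p)" using finite_surj by blast
qed

section \<open>The q-adic valuation of rational numbers\<close>

definition rat_val :: "nat \<Rightarrow> complex \<Rightarrow> int"
 where "rat_val q x = (SOME v. \<exists>a b :: int. a ~= 0 \<and> b ~= 0 \<and> x = of_int a / of_int b \<and>
  v = int (multiplicity (int q) a) - int (multiplicity (int q) b))"

context
 fixes q :: nat
 assumes q: "Factorial_Ring.prime q"
begin

lemma prime_elem_q: "prime_elem (int q)" using q by simp

lemma rat_val_eq:
 assumes "a ~= 0" "b ~= 0" shows "rat_val q (of_int a / of_int b) = int (multiplicity (int q) a) - int (multiplicity (int q) b)"
 unfolding rat_val_def
proof (rule some_equality)
 fix v assume "\<exists>a' b' :: int. a' ~= 0 \<and> b' ~= 0 \<and> of_int a / of_int b = (of_int a' / of_int b' :: complex) \<and>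
  v = int (multiplicity (int q) a') - int (multiplicity (int q) b')"
 then obtain a' b' :: int where ab: "a' ~= 0" "b' ~= 0" "of_int a / of_int b = (of_int a' / of_int b' :: complex)"
  "v = int (multiplicity (int q) a') - int (multiplicity (int q) b')" by blast
 have "(of_int (a * b') :: complex) = of_int (a' * b)" using ab(1-3) assms by (simp add: field_simps)
 then have "a * b' = a' * b" using of_int_eq_iff by blast
 then have "multiplicity (int q) (a * b') = multiplicity (int q) (a' * b)" by simp
 then have "multiplicity (int q) a + multiplicity (int q) b' = multiplicity (int q) a' + multiplicity (int q) b"
  using ab assms by (simp add: prime_elem_multiplicity_mult_distrib[OF prime_elem_q])
 then show "v = int (multiplicity (int q) a) - int (multiplicity (int q) b)" using ab(4) by linarith
qed (use assms in blast)

lemma rat_fraction: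
 assumes "x \<in> \<rat> - {0 :: complex}"
 obtains a b :: int where "a ~= 0" "b ~= 0" "x = of_int a / of_int b"
proof -
 obtain a b where "b > 0" "x = of_int a / of_int b" using assms by (auto elim: Rats_cases')
 then show thesis using that[of a b] assms by auto
qed

lemma rat_val_mult:
 assumes "x \<in> \<rat> - {0}" "y \<in> \<rat> - {0}" shows "rat_val q (x * y) = rat_val q x + rat_val q y"
proof -
 obtain a b where x: "a ~= 0" "b ~= 0" "x = of_int a / of_int b" using rat_fraction[OF assms(1)] by metis
 obtain c d where y: "c ~= 0" "d ~= 0" "y = of_int c / of_int d" using rat_fraction[OF assms(2)] by metis
 have "x * y = of_int (a * c) / of_int (b * d)" using x y by simp
 then show ?thesis using x y by (simp add: rat_val_eq prime_elem_multiplicity_mult_distrib[OF prime_elem_q] del: of_int_mult)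
qed

lemma rat_val_one: "rat_val q 1 = 0" using rat_val_eq[of 1 1] by simp

lemma rat_val_power: "x \<in> \<rat> - {0} ==> rat_val q (x ^ n) = int n * rat_val q x"
proof (induction n)
 case (Suc n)
 then have "x ^ n \<in> \<rat> - {0}" by (simp add: Rats_power)
 then show ?case using Suc rat_val_mult[of x "x ^ n"] by (simp add: algebra_simps)
qed (simp add: rat_val_one)

lemma rat_val_inverse: "x \<in> \<rat> - {0} ==> rat_val q (inverse x) = - rat_val q x"
 using rat_val_mult[of x "inverse x"] rat_val_one by auto

lemma rat_val_powi: "x \<in> \<rat> - {0} ==> rat_val q (x powi k) = k * rat_val q x"
 by (cases "k \<ge> 0") (auto simp: power_int_def rat_val_power rat_val_inverse)

lemma rat_val_prod:
 "(\<And>i. i \<in> I ==> f i \<in> \<rat> - {0}) ==> rat_val q (prod f I) = (\<Sum>i\<in>I. rat_val q (f i))"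
proof (induction I rule: infinite_finite_induct)
 case (insert i I)
 have "prod f I \<in> \<rat> - {0}" by (rule mgrp_prod[OF mgrp_Rats]) (use insert in auto)
 then show ?case using insert rat_val_mult[of "f i" "prod f I"] by auto
qed (simp_all add: rat_val_one)

end

lemma finite_support_rat_val:
 assumes "x \<in> \<rat> - {0}" shows "finite {q. Factorial_Ring.prime q \<and> rat_val q x ~= 0}"
proof -
 obtain a b where x: "a ~= 0" "b ~= 0" "x = of_int a / of_int b" using rat_fraction[OF _ assms] two_is_prime_nat by metis
 have "{q. Factorial_Ring.prime q \<and> rat_val q x ~= 0} \<subseteq> {q. q dvd nat \<bar>a * b\<bar>}"
 proof safe
  fix q assume q: "Factorial_Ring.prime q" "rat_val q x ~= 0"
  then have "multiplicity (int q) a ~= 0 \<or> multiplicity (int q) b ~= 0" using rat_val_eq[OF q(1) x(1,2)] x(3) by auto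
  then have "int q dvd a \<or> int q dvd b"  using not_dvd_imp_multiplicity_0[of "int q" a] not_dvd_imp_multiplicity_0[of "int q" b] by metis
  then have "int q dvd a * b" by auto
  then show "q dvd nat \<bar>a * b\<bar>" by (simp add: nat_abs_dvd_iff int_dvd_int_iff flip: int_dvd_int_iff)
 qed
 moreover have "finite {q. q dvd nat \<bar>a * b\<bar>}" using x by (intro finite_divisors_nat) auto
 ultimately show ?thesis using finite_subset by blast
qed

lemma rat_val_zero_imp_unit:
 assumes "x \<in> \<rat> - {0}" "\<And>q. Factorial_Ring.prime q ==> rat_val q x = 0" shows "x ^ 2 = 1"
proof -
 obtain a b where x: "a ~= 0" "b ~= 0" "x = of_int a / of_int b" using rat_fraction[OF _ assms(1)] two_is_prime_nat by metis
 have "multiplicity r a = multiplicity r b" if r: "Factorial_Ring.prime r" for r :: int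
 proof -
  obtain q where q: "r = int q" using r by (metis prime_ge_0_int zero_le_imp_eq_int)
  then have "Factorial_Ring.prime q" using r by simp
  then show ?thesis using rat_val_eq[of q a b] assms(2) x q by simp
 qed
 then have "normalize a = normalize b" using x by (intro multiplicity_eq_imp_eq) auto
 then have "a = b \<or> a = - b" by (auto simp: abs_eq_iff)
 then show ?thesis using x by auto
qed

text \<open>If \<open>x ^ i\<close> and \<open>x ^ j\<close> had the same class, \<open>p\<close>
  would divide \<open>int (j - i) * rat_val q x\<close>, whose factors are nonzero and smaller than
  \<open>p\<close> in absolute value. The bound makes the Euler product converge.\<close>

lemma card_power_classes_ge:
 assumes \<Gamma>: "mgrp \<Gamma>" "\<Gamma> \<subseteq> \<rat>" and x: "x \<in> \<Gamma>" "Factorial_Ring.prime q" "rat_val q x ~= 0"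
  and p: "Factorial_Ring.prime p" "int p > \<bar>rat_val q x\<bar>" and fin: "finite (power_classes \<Gamma> p)"
 shows "card (power_classes \<Gamma> p) \<ge> p"
proof -
 have xr: "x \<in> \<rat> - {0}" using x(1) \<Gamma>(2) mgrp_nonzero[OF \<Gamma>(1)] by blast
 have "inj_on (\<lambda>i. pclass p (x ^ i)) {..<p}"
 proof (rule linorder_inj_onI')
  fix i j assume ij: "i \<in> {..<p}" "j \<in> {..<p}" "i < j"
  show "pclass p (x ^ i) ~= pclass p (x ^ j)"
  proof
   assume "pclass p (x ^ i) = pclass p (x ^ j)"
   then have "x ^ j / x ^ i \<in> rat_powers p" using xr pclass_eq_iff[of "x ^ j" "x ^ i" p] by auto
   moreover have "x ^ j / x ^ i = x ^ (j - i)" using ij(3) xr by (simp add: power_diff)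
   ultimately obtain r where r: "r \<in> \<rat> - {0}" "x ^ (j - i) = r ^ p" by (auto simp: rat_powers_def)
   have "int (j - i) * rat_val q x = int p * rat_val q r" using rat_val_power[OF x(2) xr, of "j - i"] rat_val_power[OF x(2) r(1), of p] r(2) by simp
   then have "int p dvd int (j - i) * rat_val q x" by simp
   moreover have "Factorial_Ring.prime (int p)" using p(1) by simp
   ultimately have "int p dvd int (j - i) \<or> int p dvd rat_val q x" using prime_dvd_mult_iff by blast
   then show False
   proof
    assume "int p dvd int (j - i)"
    then have "int p \<le> int (j - i)" using ij(3) by (intro zdvd_imp_le) auto
    then show False using ij by auto
   next
    assume "int p dvd rat_val q x"
    then have "\<bar>int p\<bar> \<le> \<bar>rat_val q x\<bar>" using x(3) dvd_imp_le_int by blast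
    then show False using p(2) by simp
   qed
  qed
 qed
 then have "card ((\<lambda>i. pclass p (x ^ i)) ` {..<p}) = p" by (simp add: card_image)
 moreover have "(\<lambda>i. pclass p (x ^ i)) ` {..<p} \<subseteq> power_classes \<Gamma> p"
  using mgrp_power[OF \<Gamma>(1) x(1)] by (auto simp: power_classes_def)
 ultimately show ?thesis using card_mono[OF fin] by metis
qed

text \<open>Positive rank gives an element \<open>b\<close> without multiplicative relation; if all
  its valuations vanished, \<open>b ^ 2 = 1\<close> would be one.\<close>

lemma ex_nontrivial_valuation:
 assumes \<Gamma>: "mgrp \<Gamma>" "\<Gamma> \<subseteq> \<rat>" and rank: "mult_rank \<Gamma> > 0"
 obtains x q where "x \<in> \<Gamma>" "Factorial_Ring.prime q" "rat_val q x ~= 0"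
proof -
 have "\<exists>B\<in>{B. B \<subseteq> \<Gamma> \<and> finite B \<and> mult_independent B}. enat (card B) > 0"
  using rank unfolding mult_rank_def less_SUP_iff .
 then obtain B where B: "B \<subseteq> \<Gamma>" "finite B" "mult_independent B" "card B > 0" by (auto simp: zero_enat_def)
 then obtain b where b: "b \<in> B" by (metis card.empty equals0I less_irrefl)
 have bG: "b \<in> \<Gamma>" "b \<in> \<rat> - {0}" using b B(1) \<Gamma>(2) mgrp_nonzero[OF \<Gamma>(1)] by blast+
 have "\<exists>q. Factorial_Ring.prime q \<and> rat_val q b ~= 0"
 proof (rule ccontr)
  assume "\<not> ?thesis"
  then have sq: "b ^ 2 = 1" using rat_val_zero_imp_unit[OF bG(2)] by blast
  define k where "k c = (if c = b then 2 else 0 :: int)" for c :: complex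
  have "(\<Prod>c\<in>B. c powi k c) = (\<Prod>c\<in>B. if c = b then b ^ 2 else 1)" by (intro prod.cong) (auto simp: k_def)
  then have "(\<Prod>c\<in>B. c powi k c) = 1" using sq B(2) by simp
  then have "k b = 0" using B(3) b unfolding mult_independent_def by blast
  then show False by (simp add: k_def)
 qed
 then show thesis using that bG(1) by blast
qed

section \<open>Squarefree representatives of square classes\<close>

lemma squarefree_representative:
 assumes "b \<in> \<rat> - {0 :: complex}"
 obtains m s where "squarefree (m :: int)" "s \<in> \<rat> - {0}" "b = of_int m * s ^ 2"
proof -
 obtain a d where x: "a ~= 0" "d ~= 0" "b = of_int a / of_int d" using rat_fraction[OF _ assms] two_is_prime_nat by metis
 let ?n = "a * d"
 have n: "?n ~= 0" using x by simp
 have "b = of_int ?n / of_int d ^ 2" using x by (simp add: power2_eq_square)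
 also have "(of_int ?n :: complex) = of_int (squarefree_part ?n * square_part ?n ^ 2)" using squarefree_decompose[of ?n] by metis
 finally have "b = of_int (squarefree_part ?n) * (of_int (square_part ?n) / of_int d) ^ 2" by (simp add: power_divide)
 moreover have "of_int (square_part ?n) / of_int d \<in> \<rat> - {0 :: complex}" using n x by simp
 ultimately show thesis using that squarefree_squarefree_part by blast
qed

lemma squarefree_ratio_unique:
 assumes "squarefree (m :: int)" "squarefree m'" "r \<in> \<rat>" "of_int m = (of_int m' * r ^ 2 :: complex)" shows "m = m'"
proof -
 obtain a b where r: "b > 0" "Rings.coprime a b" "r = of_int a / of_int b" using assms(3) by (auto elim: Rats_cases')
 have "(of_int (m * b ^ 2) :: complex) = of_int (m' * a ^ 2)" using assms(4) r(1,3) by (simp add: power_divide)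
 then have e: "m * b ^ 2 = m' * a ^ 2" using of_int_eq_iff by blast
 have cop: "Rings.coprime (a ^ 2) (b ^ 2)" using r(2) by simp
 have "a ^ 2 dvd m * b ^ 2" using e by simp
 then have "a ^ 2 dvd m" using cop coprime_dvd_mult_left_iff by blast
 then have "a dvd 1" using assms(1) squarefreeD by blast
 have "b ^ 2 dvd m' * a ^ 2" using e by (metis dvd_triv_right)
 then have "b ^ 2 dvd m'" using cop coprime_dvd_mult_left_iff coprime_commute by metis
 then have "b dvd 1" using assms(2) squarefreeD by blast
 then have "b ^ 2 = 1" "a ^ 2 = 1"  using \<open>a dvd 1\<close> \<open>b dvd 1\<close> by (auto simp: abs_square_eq_1)
 then show ?thesis using e by simp
qed

lemma pclass_squarefree:
 assumes "squarefree (m :: int)" "s \<in> \<rat> - {0}" "b = of_int m * s ^ 2" shows "pclass 2 b = pclass 2 (of_int m)"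
proof -
 have "m ~= 0" using assms(1) by auto
 then have "b ~= 0" "b / of_int m \<in> rat_powers 2" using assms by (auto simp: rat_powers_def)
 then show ?thesis using pclass_eq_iff[of b "of_int m" 2] \<open>m ~= 0\<close> by simp
qed

lemma pclass_squarefree_eq_iff:
 assumes "squarefree (m :: int)" "squarefree m'" shows "pclass 2 (of_int m) = pclass 2 (of_int m') \<longleftrightarrow> m = m'"
proof
 have nz: "m ~= 0" "m' ~= 0" using assms by auto
 assume "pclass 2 (of_int m) = pclass 2 (of_int m')"
 then have "of_int m / of_int m' \<in> rat_powers 2" using pclass_eq_iff nz by simp
 then obtain r :: complex where "r \<in> \<rat>" "of_int m / of_int m' = r ^ 2" unfolding rat_powers_def by blast
 then show "m = m'" using squarefree_ratio_unique[OF assms, of r] nz by (simp add: field_simps)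
qed simp

text \<open>A positive power of \<open>b\<close> is a product of generators of \<Gamma>, so the
  valuations of \<open>b\<close> vanish outside the finite set \<open>S\<close> of primes occurring
  in the generators. The primes of the squarefree part of \<open>b\<close> have odd valuation and
  hence lie in \<open>S\<close>.\<close>

lemma finite_power_classes_saturated:
 assumes \<Gamma>: "mgrp \<Gamma>" "\<Gamma> \<subseteq> \<rat>" and fg: "finitely_generated \<Gamma>"
  and H: "H \<subseteq> \<rat> - {0}" "\<And>b. b \<in> H ==> \<exists>n\<ge>1. b ^ n \<in> \<Gamma>" shows "finite (power_classes H 2)"
proof -
 obtain B where B: "finite B" "B \<subseteq> \<Gamma>" "\<forall>x\<in>\<Gamma>. \<exists>k::complex \<Rightarrow> int. x = (\<Prod>b\<in>B. b powi k b)"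
  using finite_power_classes_fg(2)[OF \<Gamma> fg, of 1] by auto
 have Br: "b \<in> \<rat> - {0}" if "b \<in> B" for b using that B(2) \<Gamma>(2) mgrp_nonzero[OF \<Gamma>(1)] by blast
 define S where "S = (\<Union>b\<in>B. {q. Factorial_Ring.prime q \<and> rat_val q b ~= 0})"
 have S: "finite S" unfolding S_def using B(1) finite_support_rat_val Br by blast
 have val0: "rat_val q b = 0" if q: "Factorial_Ring.prime q" "q \<notin> S" and b: "b \<in> H" for q b
 proof -
  obtain n where n: "n \<ge> 1" "b ^ n \<in> \<Gamma>" using H(2) b by blast
  obtain k where k: "b ^ n = (\<Prod>c\<in>B. c powi k c)" using B(3) n(2) by blast
  have "rat_val q (b ^ n) = (\<Sum>c\<in>B. rat_val q (c powi k c))"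
   unfolding k using Br by (intro rat_val_prod[OF q(1)] mgrp_powi[OF mgrp_Rats]) auto
  also have "... = (\<Sum>c\<in>B. k c * rat_val q c)" using rat_val_powi[OF q(1) Br] by (intro sum.cong) auto
  also have "... = 0" using q by (intro sum.neutral) (auto simp: S_def)
  finally have "int n * rat_val q b = 0" using rat_val_power[OF q(1), of b n] H(1) b by auto
  then show ?thesis using n(1) by simp
 qed
 have "power_classes H 2 \<subseteq> (\<lambda>m. pclass 2 (of_int m)) ` {m. m dvd int (\<Prod>S)}"
 proof
  fix v assume "v \<in> power_classes H 2"
  then obtain b where b: "b \<in> H" "v = pclass 2 b" by (auto simp: power_classes_def)
  have br: "b \<in> \<rat> - {0}" using b(1) H(1) by blast
  obtain m s where m: "squarefree m" "s \<in> \<rat> - {0}" "b = of_int m * s ^ 2" using squarefree_representative[OF br] by metis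
  have m0: "m ~= 0" using m(1) by auto
  have mr: "of_int m \<in> \<rat> - {0 :: complex}" using m0 by simp
  have inS: "q \<in> S" if q: "Factorial_Ring.prime q" "int q dvd m" for q
  proof (rule ccontr)
   assume "q \<notin> S"
   then have "0 = rat_val q (of_int m) + int 2 * rat_val q s"
    using val0[OF q(1) _ b(1)] rat_val_mult[OF q(1) mr, of "s ^ 2"] rat_val_power[OF q(1) m(2), of 2] m by auto
   moreover have "rat_val q (of_int m) = int (multiplicity (int q) m)" using rat_val_eq[OF q(1) m0, of 1] by simp
   moreover have "multiplicity (int q) m = 1"
   proof -
    have "Factorial_Ring.prime (int q)" using q(1) by simp
    then have "multiplicity (int q) m \<le> 1" using squarefree_factorial_semiring''[OF m0] m(1) by blast
    moreover have "multiplicity (int q) m ~= 0" using q m0 prime_multiplicity_gt_zero_iff[of "int q" m] by simp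
    ultimately show ?thesis by linarith
   qed
   ultimately show False by presburger
  qed
  have "m dvd int (\<Prod>S)"
  proof (rule multiplicity_le_imp_dvd[OF m0])
   fix r :: int assume r: "Factorial_Ring.prime r"
   obtain q where q: "r = int q" using r by (metis prime_ge_0_int zero_le_imp_eq_int)
   then have qp: "Factorial_Ring.prime q" using r by simp
   have P0: "int (\<Prod>S) ~= 0" using S by (auto simp: S_def)
   show "multiplicity r m \<le> multiplicity r (int (\<Prod>S))"
   proof (cases "int q dvd m")
    case True
    then have "q dvd \<Prod>S" using inS[OF qp True] S by (simp add: dvd_prodI[of S q id, simplified])
    then have "multiplicity r (int (\<Prod>S)) ~= 0"
     using q qp P0 prime_multiplicity_gt_zero_iff[of "int q" "int (\<Prod>S)"] int_dvd_int_iff[of q "\<Prod>S"] by simp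
    moreover have "multiplicity r m \<le> 1" using squarefree_factorial_semiring''[OF m0] m(1) r by blast
    ultimately show ?thesis by linarith
   next
    case False
    then show ?thesis using q by (simp add: not_dvd_imp_multiplicity_0)
   qed
  qed
  then show "v \<in> (\<lambda>m. pclass 2 (of_int m)) ` {m. m dvd int (\<Prod>S)}" using pclass_squarefree[OF m] b(2) by blast
 qed
 moreover have "finite {m. m dvd int (\<Prod>S)}" using S by (intro finite_divisors_int) (auto simp: S_def)
 ultimately show ?thesis using finite_surj by blast
qed

section \<open>Degrees\<close>

lemma subfield_Rats_complex: "subfield \<rat> (complex_field :: complex ring)"
proof -
 interpret C: field "complex_field :: complex ring" by (rule field_complex_field)
 have ainv: "\<ominus>\<^bsub>complex_field\<^esub> x = - x" for x :: complex by (rule C.minus_equality) auto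
 have minv: "inv\<^bsub>complex_field\<^esub> x = inverse x" if "x ~= 0" for x :: complex using that by (intro C.comm_inv_char) auto
 show ?thesis by (rule C.subfieldI', rule C.subringI) (auto simp: ainv minv)
qed

text \<open>Translates a basis indexed by a finite set into the list-based dimension behind
  \<open>degree_over_rat\<close>.\<close>

lemma degree_over_rat_basis:
 fixes e :: "'i \<Rightarrow> complex"
 assumes I: "finite I"
  and indep: "\<And>c. (\<And>i. i \<in> I ==> c i \<in> \<rat>) ==> (\<Sum>i\<in>I. c i * e i) = 0 ==> \<forall>i\<in>I. c i = 0"
  and span: "L = {\<Sum>i\<in>I. c i * e i | c. \<forall>i\<in>I. c i \<in> \<rat>}" shows "degree_over_rat L = card I"
proof -
 interpret C: field "complex_field :: complex ring" by (rule field_complex_field)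
 obtain xs where xs: "set xs = I" "distinct xs" using finite_distinct_list[OF I] by blast
 let ?Us = "map e xs"
 have comb: "C.combine Ks (map e ys) = (\<Sum>j<length ys. Ks ! j * e (ys ! j))"
  if "length Ks = length ys" for Ks and ys :: "'i list" using that
 proof (induction Ks ys rule: list_induct2)
  case (Cons k Ks y ys)
  then show ?case by (simp add: sum.lessThan_Suc_shift del: sum.lessThan_Suc)
 qed simp
 have reindex: "(\<Sum>j<length xs. f (xs ! j)) = (\<Sum>i\<in>I. f i)" for f :: "'i \<Rightarrow> complex"
  using sum.reindex_bij_betw[OF bij_betw_nth[OF xs(2) refl refl], of f] xs(1) by simp
 have "C.Span \<rat> ?Us = {C.combine Ks ?Us | Ks. length Ks = length ?Us \<and> set Ks \<subseteq> \<rat>}"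
  by (rule C.Span_eq_combine_set_length_version[OF subfield_Rats_complex]) simp
 also have "... = L"
 proof (intro equalityI subsetI)
  fix x assume "x \<in> {C.combine Ks ?Us | Ks. length Ks = length ?Us \<and> set Ks \<subseteq> \<rat>}"
  then obtain Ks where Ks: "length Ks = length xs" "set Ks \<subseteq> \<rat>" "x = C.combine Ks ?Us" by auto
  define c where "c i = Ks ! (THE j. j < length xs \<and> xs ! j = i)" for i
  have c: "c (xs ! j) = Ks ! j" if "j < length xs" for j
  proof -
   have "(THE l. l < length xs \<and> xs ! l = xs ! j) = j" using that xs(2) by (intro the_equality) (auto simp: nth_eq_iff_index_eq)
   then show ?thesis by (simp add: c_def)
  qed
  have "x = (\<Sum>j<length xs. c (xs ! j) * e (xs ! j))" unfolding Ks(3) comb[OF Ks(1)] using c by (intro sum.cong) auto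
  also have "... = (\<Sum>i\<in>I. c i * e i)" by (rule reindex)
  finally have "x = (\<Sum>i\<in>I. c i * e i)" .
  moreover have "c i \<in> \<rat>" if "i \<in> I" for i
  proof -
   obtain j where j: "j < length xs" "i = xs ! j" using \<open>i \<in> I\<close> xs(1) by (metis in_set_conv_nth)
   then show ?thesis using c Ks(1,2) by auto
  qed
  ultimately show "x \<in> L" unfolding span by blast
 next
  fix x assume "x \<in> L"
  then obtain c where c: "x = (\<Sum>i\<in>I. c i * e i)" "\<forall>i\<in>I. c i \<in> \<rat>" unfolding span by blast
  have "C.combine (map c xs) ?Us = x" unfolding c(1) using comb[of "map c xs" xs] reindex[of "\<lambda>i. c i * e i"] by simp
  moreover have "set (map c xs) \<subseteq> \<rat>" using c(2) xs(1) by auto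
  ultimately show "x \<in> {C.combine Ks ?Us | Ks. length Ks = length ?Us \<and> set Ks \<subseteq> \<rat>}"
   by (intro CollectI exI[of _ "map c xs"]) auto
 qed
 finally have Span: "C.Span \<rat> ?Us = L" .
 have "C.independent \<rat> ?Us"
 proof (rule C.trivial_combine_imp_independent[OF subfield_Rats_complex])
  fix Ks assume Ks: "set Ks \<subseteq> \<rat>" "C.combine Ks ?Us = \<zero>\<^bsub>complex_field\<^esub>"
  define d where "d j = (if j < length Ks then Ks ! j else 0)" for j
  have comb': "C.combine Ks (map e ys) = (\<Sum>j<length ys. (if j < length Ks then Ks ! j else 0) * e (ys ! j))"
   for Ks and ys :: "'i list"
  proof (induction ys arbitrary: Ks)
   case (Cons y ys)
   show ?case
   proof (cases Ks)
    case Ks: (Cons k Ks')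
    show ?thesis unfolding Ks using Cons.IH[of Ks'] by (simp add: sum.lessThan_Suc_shift del: sum.lessThan_Suc cong: if_cong)
   qed simp
  qed simp
  define c where "c i = d (THE j. j < length xs \<and> xs ! j = i)" for i
  have c: "c (xs ! j) = d j" if "j < length xs" for j
  proof -
   have "(THE l. l < length xs \<and> xs ! l = xs ! j) = j" using that xs(2) by (intro the_equality) (auto simp: nth_eq_iff_index_eq)
   then show ?thesis by (simp add: c_def)
  qed
  have cr: "c i \<in> \<rat>" if "i \<in> I" for i
  proof -
   obtain j where j: "j < length xs" "i = xs ! j" using \<open>i \<in> I\<close> xs(1) by (metis in_set_conv_nth)
   then show ?thesis using c Ks(1) by (auto simp: d_def)
  qed
  have "(\<Sum>i\<in>I. c i * e i) = (\<Sum>j<length xs. c (xs ! j) * e (xs ! j))" by (rule reindex[symmetric])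
  also have "... = C.combine Ks ?Us" unfolding comb' using c by (intro sum.cong) (auto simp: d_def)
  finally have "\<forall>i\<in>I. c i = 0" using indep cr Ks(2) by simp
  then have d0: "d j = 0" if "j < length xs" for j using c that xs(1) by (metis nth_mem)
  show "set (take (length ?Us) Ks) \<subseteq> {\<zero>\<^bsub>complex_field\<^esub>}"
  proof
   fix u assume "u \<in> set (take (length ?Us) Ks)"
   then obtain j where "j < length xs" "j < length Ks" "u = Ks ! j" by (auto simp: in_set_conv_nth)
   then show "u \<in> {\<zero>\<^bsub>complex_field\<^esub>}" using d0[of j] by (simp add: d_def)
  qed
 qed simp
 then have "C.dimension (length ?Us) \<rat> L" using C.dimension_independent[OF \<open>C.independent \<rat> ?Us\<close>] Span by simp
 then have "C.dim \<rat> L = length ?Us" using C.dimI[OF subfield_Rats_complex] by (simp add: over_def)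
 then show ?thesis using xs distinct_card[OF xs(2)] by (simp add: degree_over_rat_def)
qed

text \<open>By \<open>landau\<close>, a polynomial of degree at most \<open>p - 2\<close> with
  rational coefficients that vanishes at \<open>zeta p\<close> vanishes at \<open>zeta p ^ k\<close>
  for all \<open>k \<in> {1..<p}\<close>, which are too many roots.\<close>

lemma zeta_powers_independent:
 assumes p: "Factorial_Ring.prime p" and c: "\<And>i. i < p - 1 ==> c i \<in> \<rat>"
  and rel: "(\<Sum>i<p - 1. c i * zeta p ^ i) = 0" and j: "j < p - 1" shows "c j = (0 :: complex)"
proof -
 have p2: "p \<ge> 2" using prime_ge_2_nat[OF p] .
 define P where "P = (\<Sum>i<p - 1. Polynomial.monom (c i) i)"
 have coeff: "Polynomial.coeff P i = (if i < p - 1 then c i else 0)" for i by (simp add: P_def coeff_sum)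
 have root: "poly P (zeta p ^ k) = 0" if k: "1 \<le> k" "k < p" for k
 proof -
  have "\<not> p dvd k" using k nat_dvd_not_less by auto
  then have cop: "Rings.coprime k p" using prime_imp_coprime[OF p] coprime_commute by blast
  have "(\<Sum>i\<in>{..<p - 1}. c i * (zeta p ^ i) ^ k) = 0"
  proof (rule landau[OF _ _ _ _ _ cop])
   show "zeta p ^ i \<in> mu p" for i using mgrp_power[OF mgrp_mu zeta_in_mu, of p i] p2 by simp
  qed (use p2 c rel in auto)
  moreover have "poly P (zeta p ^ k) = (\<Sum>i<p - 1. c i * (zeta p ^ k) ^ i)" by (simp add: P_def poly_sum poly_monom)
  ultimately show ?thesis by (simp add: mult.commute flip: power_mult)
 qed
 have inj: "inj_on (\<lambda>k. zeta p ^ k) {1..<p}"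
 proof (rule linorder_inj_onI')
  fix a b assume ab: "a \<in> {1..<p}" "b \<in> {1..<p}" "a < b"
  show "zeta p ^ a ~= zeta p ^ b"
  proof
   assume e: "zeta p ^ a = zeta p ^ b"
   have "zeta p ^ b = zeta p ^ a * zeta p ^ (b - a)" using ab(3) by (simp flip: power_add)
   then have "zeta p ^ (b - a) = 1" using e zeta_nonzero[of p] by simp
   then have "p dvd b - a" using zeta_power_eq_1_iff[of p] p2 by simp
   moreover have "0 < b - a" "b - a < p" using ab by auto
   ultimately show False using nat_dvd_not_less by blast
  qed
 qed
 have "P = 0"
 proof (rule ccontr)
  assume P0: "P ~= 0"
  have "(\<lambda>k. zeta p ^ k) ` {1..<p} \<subseteq> {x. poly P x = 0}" using root by auto
  then have "card ((\<lambda>k. zeta p ^ k) ` {1..<p}) \<le> card {x. poly P x = 0}" by (rule card_mono[OF poly_roots_finite[OF P0]])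
  also have "... \<le> Polynomial.degree P" by (rule card_poly_roots_bound[OF P0])
  also have "... \<le> p - 2" by (rule degree_le) (use coeff p2 in auto)
  finally show False using inj p2 by (simp add: card_image)
 qed
 then show ?thesis using coeff[of j] j by simp
qed

lemma zeta_powers_span:
 assumes p: "p \<ge> 2" shows "\<exists>c. (\<forall>i. c i \<in> \<rat>) \<and> zeta p ^ k = (\<Sum>i<p - 1. c i * zeta p ^ i)"
proof -
 define j where "j = k mod p"
 have "zeta p ^ k = zeta p ^ (p * (k div p) + j)" by (simp add: j_def)
 also have "... = zeta p ^ j" using zeta_power[of p] p by (simp only: power_add power_mult) simp
 finally have kj: "zeta p ^ k = zeta p ^ j" .
 show ?thesis
 proof (cases "j < p - 1")
  case True
  have "(\<Sum>i<p - 1. (if i = j then 1 else 0) * zeta p ^ i) = (\<Sum>i<p - 1. if i = j then zeta p ^ i else 0)" by (intro sum.cong) auto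
  also have "... = zeta p ^ j" using True by simp
  finally show ?thesis using kj by (intro exI[of _ "\<lambda>i. if i = j then 1 else 0"]) auto
 next
  case False
  moreover have "j < p" using p by (simp add: j_def)
  ultimately have j: "j = p - 1" by simp
  have "zeta p ~= 1" using zeta_power_eq_1_iff[of p 1] p by auto
  then have "(\<Sum>i<p. zeta p ^ i) = 0" using geometric_sum[of "zeta p" p] zeta_power[of p] p by simp
  moreover have "{..<p} = insert (p - 1) {..<p - 1}" using p by auto
  ultimately have "zeta p ^ (p - 1) + (\<Sum>i<p - 1. zeta p ^ i) = 0" by simp
  then have "zeta p ^ (p - 1) = (\<Sum>i<p - 1. - 1 * zeta p ^ i)" by (simp add: sum_negf eq_neg_iff_add_eq_0)
  then show ?thesis using kj j by (intro exI[of _ "\<lambda>_. - 1"]) auto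
 qed
qed

text \<open>The base field must contain \<open>mu p\<close>, and a rational number may become a
  \<open>p\<close>-th power in it only if it was one before. The cyclotomic field serves for odd
  \<open>p\<close>; for \<open>p = 2\<close> it contains all square roots of rationals, so \<rat>
  itself is taken.\<close>

lemma kummer_p_roots:
 assumes \<Gamma>: "mgrp \<Gamma>" "\<Gamma> \<subseteq> \<rat>" and p: "Factorial_Ring.prime p"
  and V: "finite V" and x: "\<And>v. v \<in> V ==> x v \<in> p_roots \<Gamma> p"
  and distinct: "\<And>v w. v \<in> V ==> w \<in> V ==> v ~= w ==> x v ^ p / x w ^ p \<notin> rat_powers p"
  and c: "\<And>v i. v \<in> V ==> i < p - 1 ==> c v i \<in> \<rat>"
  and rel: "(\<Sum>v\<in>V. (\<Sum>i<p - 1. c v i * zeta p ^ i) * x v) = 0" and v: "v \<in> V" shows "(\<Sum>i<p - 1. c v i * zeta p ^ i) = 0"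
proof -
 have p2: "p \<ge> 2" using prime_ge_2_nat[OF p] .
 have x': "x v ~= 0" "x v ^ p \<in> \<rat> - {0}" if "v \<in> V" for v
  using x[OF that] \<Gamma>(2) mgrp_nonzero[OF \<Gamma>(1)] by (auto simp: p_roots_def)
 define K where "K = (if p = 2 then \<rat> else qspan mu_inf)"
 have K: "subfield_of_C K" using subfield_Rats subfield_qspan[OF radical_group_mu_inf] by (simp add: K_def)
 have ratK: "\<rat> \<subseteq> K" using qspan_Rats[OF mgrp_mu_inf] by (auto simp: K_def)
 have muK: "mu p \<subseteq> K"
 proof (cases "p = 2")
  case True
  have "z = 1 \<or> z = - 1" if "z \<in> mu 2" for z using that by (simp add: mu_def power2_eq_1_iff)
  then have "z \<in> \<rat>" if "z \<in> mu 2" for z using that by (metis Rats_1 Rats_minus_iff)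
  then show ?thesis using True by (auto simp: K_def)
 next
  case False
  then show ?thesis using mu_subset_mu_inf[of p] qspan_base p2 by (auto simp: K_def)
 qed
 have zK: "zeta p \<in> K" using muK zeta_in_mu[of p] p2 by auto
 show ?thesis
 proof (rule kummer_independence[OF K _ muK V, where w = x and c = "\<lambda>v. \<Sum>i<p - 1. c v i * zeta p ^ i"])
  show "x v ~= 0 \<and> x v ^ p \<in> K" if "v \<in> V" for v using x'[OF that] ratK by blast
  show "(\<Sum>i<p - 1. c v i * zeta p ^ i) \<in> K" if "v \<in> V" for v using c[OF that] ratK zK subfield_subring[OF K]
   by (intro subring_sum subring_closed(6) subring_power) auto
  fix v w assume vw: "v \<in> V" "w \<in> V" "v ~= w"
  show "x v / x w \<notin> K"
  proof
   assume a: "x v / x w \<in> K"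
   define y where "y = x v / x w"
   have yp: "y ^ p \<in> \<rat> - {0}" using x'[OF vw(1)] x'[OF vw(2)] by (simp add: y_def power_divide)
   have "y ^ p \<in> rat_powers p"
   proof (cases "p = 2")
    case True
    then have "y \<in> \<rat> - {0}" using a x'(1)[OF vw(1)] x'(1)[OF vw(2)] by (auto simp: K_def y_def)
    then show ?thesis by (auto simp: rat_powers_def)
   next
    case False
    then have odd: "odd p" using prime_odd_nat[OF p] p2 by simp
    have yK: "y \<in> qspan mu_inf" using a False by (simp add: K_def y_def)
    have y0: "y ~= 0" using yp p2 by auto
    obtain r where r: "y ^ p = of_real r" using Rats_imp_Reals yp by (meson DiffD1 Reals_cases)
    \<comment> \<open>The absolute value of \<open>y\<close> is a real radical in the cyclotomic
      field, so its square is rational. Its \<open>p\<close>-th power is rational as well and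
      \<open>p\<close> is odd, hence so is \<open>t\<close>.\<close>
    define t where "t = norm y"
    have t: "t > 0" "t ^ p = \<bar>r\<bar>" using y0 arg_cong[OF r, of norm] by (auto simp: t_def norm_power)
    have tK: "complex_of_real t \<in> qspan mu_inf"
    proof -
     define z where "z = y / of_real t"
     have "z ^ (2 * p) = 1"
     proof -
      have "z ^ p = of_real (r / \<bar>r\<bar>)" using r t by (simp add: z_def power_divide flip: of_real_power)
      moreover have "r ~= 0" using t by auto
      ultimately have "z ^ p = 1 \<or> z ^ p = - 1" by (cases "r > 0") auto
      then show ?thesis by (auto simp: power_mult power2_eq_1_iff mult.commute[of 2])
     qed
     then have "z \<in> mu_inf" using p2 unfolding mu_inf_def by (intro CollectI exI[of _ "2 * p"]) auto
     then have "inverse z \<in> qspan mu_inf" using mgrp_inverse[OF mgrp_mu_inf] qspan_base by blast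
     then have "y * inverse z \<in> qspan mu_inf" by (rule qspan_mult[OF mgrp_mu_inf yK])
     moreover have "y * inverse z = of_real t" using y0 t(1) by (simp add: z_def)
     ultimately show ?thesis by simp
    qed
    have rr: "complex_of_real r \<in> \<rat>" using r yp by auto
    have absr: "complex_of_real \<bar>r\<bar> \<in> \<rat>" using rr by (cases "r \<ge> 0") auto
    have tp: "complex_of_real t ^ p \<in> \<rat>" using t(2) absr by (simp flip: of_real_power)
    have t2: "complex_of_real t ^ 2 \<in> \<rat>" by (rule real_radical_in_cyclotomic[OF t(1) _ tp tK]) (use p2 in simp)
    have "complex_of_real t \<in> \<rat> - {0}" by (rule mgrp_coprime_powers[OF mgrp_Rats, of _ 2 p]) (use t t2 tp odd in auto)
    then have tr: "complex_of_real t \<in> \<rat>" "complex_of_real t ~= 0" by auto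
    \<comment> \<open>A sign is its own \<open>p\<close>-th power for odd \<open>p\<close>, so it is
      absorbed into the rational root.\<close>
    have "y ^ p = (of_real (sgn r) * of_real t) ^ p"
    proof -
     have "r ~= 0" using t by auto
     then have "sgn r ^ p = sgn r" using odd by (cases "r > 0") auto
     then have "(sgn r * t) ^ p = sgn r * \<bar>r\<bar>" using t(2) by (simp add: power_mult_distrib)
     also have "... = r" by (simp add: sgn_mult_abs)
     finally show ?thesis unfolding r by (metis of_real_mult of_real_power)
    qed
    moreover have "of_real (sgn r) * of_real t \<in> \<rat> - {0 :: complex}"
    proof -
     have "r ~= 0" using t by auto
     then have "sgn r = 1 \<or> sgn r = - 1" by (cases "r > 0") auto
     then show ?thesis using tr by auto
    qed
    ultimately show ?thesis unfolding rat_powers_def by blast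
   qed
   then show False using distinct[OF vw] by (simp add: y_def power_divide)
  qed
 qed (use p2 rel v in auto)
qed

text \<open>A rational basis consists of the products of \<open>zeta p ^ i\<close>,
  \<open>i < p - 1\<close>, with one chosen \<open>p\<close>-th root for each power class.\<close>

theorem M_degree_eq:
 assumes \<Gamma>: "mgrp \<Gamma>" "\<Gamma> \<subseteq> \<rat>" and p: "Factorial_Ring.prime p" and fin: "finite (power_classes \<Gamma> p)"
 shows "M_degree \<Gamma> p = (p - 1) * card (power_classes \<Gamma> p)"
proof -
 have p2: "p \<ge> 2" "p \<ge> 1" using prime_ge_2_nat[OF p] by auto
 let ?V = "power_classes \<Gamma> p"
 let ?R = "p_roots \<Gamma> p"
 have sat: "saturated ?R" by (rule saturated_closures(3)[OF \<Gamma> p2(2)])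
 note G = saturated_mgrp[OF sat]
 have L: "rat_adjoin ?R = qspan ?R" by (rule rat_adjoin_radical_group[OF saturated_radical_group[OF sat]])
 have "\<exists>x. x \<in> ?R \<and> x ^ p = \<gamma>" if "\<gamma> \<in> \<Gamma>" for \<gamma>
 proof -
  have g0: "\<gamma> ~= 0" using mgrp_nonzero[OF \<Gamma>(1) that] .
  have "card {x. x ^ p = \<gamma>} = p" by (rule card_nth_roots) (use g0 p2 in auto)
  then have "{x. x ^ p = \<gamma>} ~= {}" using p2 by (metis card.empty not_one_le_zero)
  then obtain x where "x ^ p = \<gamma>" by blast
  moreover have "x ~= 0" using calculation g0 p2 by (auto simp: power_0_left)
  ultimately show ?thesis using \<open>\<gamma> \<in> \<Gamma>\<close> by (auto simp: p_roots_def)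
 qed
 then obtain root where root: "\<And>\<gamma>. \<gamma> \<in> \<Gamma> ==> root \<gamma> \<in> ?R \<and> root \<gamma> ^ p = \<gamma>" by metis
 define x where "x v = root (class_rep \<Gamma> p v)" for v
 have rep: "class_rep \<Gamma> p v \<in> \<Gamma>" "pclass p (class_rep \<Gamma> p v) = v" if "v \<in> ?V" for v using class_rep[OF that] by auto
 have x: "x v \<in> ?R" "x v ^ p = class_rep \<Gamma> p v" if "v \<in> ?V" for v using root[OF rep(1)[OF that]] by (auto simp: x_def)
 have zR: "zeta p \<in> ?R" using mgrp_one[OF \<Gamma>(1)] zeta_power[OF p2(2)] zeta_nonzero by (auto simp: p_roots_def)
 define I where "I = ?V \<times> {..<p - 1}"
 define e where "e vi = zeta p ^ snd vi * x (fst vi)" for vi :: "complex set \<times> nat"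
 have eR: "e vi \<in> ?R" if "vi \<in> I" for vi using that x(1) zR by (auto simp: e_def I_def intro!: mgrp_mult[OF G] mgrp_power[OF G])
 have finI: "finite I" using fin by (simp add: I_def)
 have "degree_over_rat (qspan ?R) = card I"
 proof (rule degree_over_rat_basis[OF finI])
  fix c :: "complex set \<times> nat \<Rightarrow> complex"
  assume c: "\<And>i. i \<in> I ==> c i \<in> \<rat>" and rel: "(\<Sum>i\<in>I. c i * e i) = 0"
  have "(\<Sum>i\<in>I. c i * e i) = (\<Sum>v\<in>?V. \<Sum>i<p - 1. c (v, i) * e (v, i))" unfolding I_def by (simp add: sum.cartesian_product)
  also have "... = (\<Sum>v\<in>?V. (\<Sum>i<p - 1. c (v, i) * zeta p ^ i) * x v)" by (simp add: e_def sum_distrib_right mult.assoc)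
  finally have rel': "(\<Sum>v\<in>?V. (\<Sum>i<p - 1. c (v, i) * zeta p ^ i) * x v) = 0" using rel by simp
  have inner: "(\<Sum>i<p - 1. c (v, i) * zeta p ^ i) = 0" if "v \<in> ?V" for v
  proof (rule kummer_p_roots[OF \<Gamma> p fin x(1) _ _ rel' that])
   fix v w assume vw: "v \<in> ?V" "w \<in> ?V" "v ~= w"
   show "x v ^ p / x w ^ p \<notin> rat_powers p" using pclass_eq_iff[of "class_rep \<Gamma> p v" "class_rep \<Gamma> p w" p] rep vw x(2)
     mgrp_nonzero[OF \<Gamma>(1)] by metis
  qed (use c in \<open>auto simp: I_def\<close>)
  show "\<forall>i\<in>I. c i = 0"
  proof
   fix vi assume "vi \<in> I"
   then obtain v i where vi: "vi = (v, i)" "v \<in> ?V" "i < p - 1" by (auto simp: I_def)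
   show "c vi = 0" unfolding vi(1) by (rule zeta_powers_independent[OF p, where c = "\<lambda>i. c (v, i)", OF _ inner[OF vi(2)] vi(3)])
      (use c vi(2) in \<open>auto simp: I_def\<close>)
  qed
 next
  show "qspan ?R = {\<Sum>i\<in>I. c i * e i | c. \<forall>i\<in>I. c i \<in> \<rat>}" (is "_ = ?S")
  proof
   show "?S \<subseteq> qspan ?R" using eR finI by (auto intro!: qspan_family)
   have add: "u + w \<in> ?S" if uw: "u \<in> ?S" "w \<in> ?S" for u w
   proof -
    obtain c d where "u = (\<Sum>i\<in>I. c i * e i)" "w = (\<Sum>i\<in>I. d i * e i)" "\<forall>i\<in>I. c i \<in> \<rat>" "\<forall>i\<in>I. d i \<in> \<rat>"
     using uw by blast
    then show ?thesis by (intro CollectI exI[of _ "\<lambda>i. c i + d i"]) (auto simp: distrib_right sum.distrib)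
   qed
   have zero: "0 \<in> ?S" by (intro CollectI exI[of _ "\<lambda>_. 0"]) auto
   have sums: "sum f B \<in> ?S" if "\<And>b. b \<in> B ==> f b \<in> ?S" for f and B :: "complex set"
    using that by (induction B rule: infinite_finite_induct) (simp_all add: zero add del: mem_Collect_eq)
   have base: "q * y \<in> ?S" if y: "y \<in> ?R" and q: "q \<in> \<rat>" for q y
   proof -
    have yp: "y ^ p \<in> \<Gamma>" "y ~= 0" using y by (auto simp: p_roots_def)
    define v where "v = pclass p (y ^ p)"
    have v: "v \<in> ?V" using yp(1) by (auto simp: v_def power_classes_def)
    have "y ^ p / x v ^ p \<in> rat_powers p"
     using rep[OF v] x(2)[OF v] pclass_eq_iff[of "y ^ p" "class_rep \<Gamma> p v" p] mgrp_nonzero[OF \<Gamma>(1)] yp by (metis v_def)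
    then obtain r where r: "r \<in> \<rat>" "r ~= 0" "y ^ p / x v ^ p = r ^ p" by (auto simp: rat_powers_def)
    have xv0: "x v ~= 0" using mgrp_nonzero[OF G x(1)[OF v]] .
    have "(y / (x v * r)) ^ p = 1" using r xv0 by (simp add: power_divide power_mult_distrib field_simps)
    then obtain k where k: "y / (x v * r) = zeta p ^ k" using mu_zeta[OF p2(2), of "y / (x v * r)"] by (auto simp: mu_def)
    obtain d where d: "\<forall>i. d i \<in> \<rat>" "zeta p ^ k = (\<Sum>i<p - 1. d i * zeta p ^ i)" using zeta_powers_span[OF p2(1)] by blast
    have "q * y = q * r * (zeta p ^ k * x v)" using k xv0 r(2) by (simp add: field_simps)
    also have "... = (\<Sum>i<p - 1. (q * r * d i) * e (v, i))" unfolding d(2) by (simp add: e_def sum_distrib_left sum_distrib_right mult_ac)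
    also have "... = (\<Sum>u\<in>?V. if u = v then (\<Sum>i<p - 1. (q * r * d i) * e (u, i)) else 0)" using v fin by simp
    also have "... = (\<Sum>u\<in>?V. \<Sum>i<p - 1. (if u = v then q * r * d i else 0) * e (u, i))" by (intro sum.cong) auto
    also have "... = (\<Sum>ui\<in>I. (if fst ui = v then q * r * d (snd ui) else 0) * e ui)"
     unfolding I_def by (simp add: sum.cartesian_product case_prod_beta)
    finally show ?thesis using q r(1) d(1) by (intro CollectI exI[of _ "\<lambda>ui. if fst ui = v then q * r * d (snd ui) else 0"]) auto
   qed
   show "qspan ?R \<subseteq> ?S"
   proof
    fix y assume "y \<in> qspan ?R"
    then obtain B c where B: "finite B" "B \<subseteq> ?R" "\<And>x. x \<in> B ==> c x \<in> \<rat>" "y = (\<Sum>x\<in>B. c x * x)"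
     by (rule qspanE) blast
    show "y \<in> ?S" unfolding B(4) by (rule sums, rule base) (use B in auto)
   qed
  qed
 qed
 then show ?thesis by (simp add: M_degree_def L I_def card_cartesian_product)
qed

section \<open>Discriminants of quadratic fields\<close>

text \<open>Every power of the denominator of \<open>t\<close> divides \<open>d\<close>.\<close>

lemma rat_bounded_powers_int:
 assumes t: "t \<in> \<rat>" and d: "d > (0::int)" and pw: "\<And>k. of_int d * t ^ k \<in> (\<int> :: complex set)" shows "t \<in> \<int>"
proof -
 obtain u v where uv: "v > 0" "Rings.coprime u v" "t = of_int u / of_int v" using t by (auto elim: Rats_cases')
 have "v ^ k dvd d" for k
 proof -
  obtain j where j: "of_int d * t ^ k = (of_int j :: complex)" using pw[of k] by (auto elim: Ints_cases)
  then have "(of_int (d * u ^ k) :: complex) = of_int (j * v ^ k)" using uv(1,3) by (simp add: power_divide field_simps)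
  then have "d * u ^ k = j * v ^ k" using of_int_eq_iff by blast
  then have "v ^ k dvd d * u ^ k" by simp
  moreover have "Rings.coprime (v ^ k) (u ^ k)" using uv(2) by (simp add: coprime_commute)
  ultimately show ?thesis using coprime_dvd_mult_left_iff by blast
 qed
 then have le: "v ^ k \<le> d" for k using d zdvd_imp_le by blast
 have "v = 1"
 proof (rule ccontr)
  assume "v ~= 1"
  then have "v \<ge> 2" using uv(1) by simp
  then have "(2::int) ^ nat d \<le> v ^ nat d" by (intro power_mono) auto
  moreover have "int (nat d) < 2 ^ nat d" by (metis of_nat_less_two_power)
  ultimately show False using le[of "nat d"] d by simp
 qed
 then show ?thesis using uv(3) by simp
qed

locale quadratic_field =
 fixes m :: int and w :: complex
 assumes squarefree: "squarefree m" and not1: "m ~= 1" and w: "w ^ 2 = of_int m"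
begin

definition K :: "complex set"
 where "K = {a + b * w | a b. a \<in> \<rat> \<and> b \<in> \<rat>}"

lemma m0: "m ~= 0" using squarefree by auto

lemma w0: "w ~= 0" using w m0 by auto

lemma w_irrational: "w \<notin> \<rat>" using squarefree_rat_square[OF squarefree _ w] not1 by blast

lemma coords_unique:
 assumes "a \<in> \<rat>" "b \<in> \<rat>" "a' \<in> \<rat>" "b' \<in> \<rat>" "a + b * w = a' + b' * w" shows "a = a'" "b = b'"
proof -
 show "b = b'"
 proof (rule ccontr)
  assume "b ~= b'"
  then have "w = (a' - a) / (b - b')" using assms(5) by (simp add: field_simps)
  then show False using w_irrational assms by auto
 qed
 then show "a = a'" using assms(5) by simp
qed

definition conj :: "complex \<Rightarrow> complex"
 where "conj y = (THE z. \<exists>a b. a \<in> \<rat> \<and> b \<in> \<rat> \<and> y = a + b * w \<and> z = a - b * w)"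

lemma conj_eq: "a \<in> \<rat> ==> b \<in> \<rat> ==> conj (a + b * w) = a - b * w" unfolding conj_def
proof (rule the_equality)
 fix z assume "a \<in> \<rat>" "b \<in> \<rat>"
  and "\<exists>a' b'. a' \<in> \<rat> \<and> b' \<in> \<rat> \<and> a + b * w = a' + b' * w \<and> z = a' - b' * w"
 then show "z = a - b * w" using coords_unique[of a b] by metis
qed blast

lemma KE:
 assumes "x \<in> K"
 obtains a b where "a \<in> \<rat>" "b \<in> \<rat>" "x = a + b * w" using assms by (auto simp: K_def)

lemma KI: "a \<in> \<rat> ==> b \<in> \<rat> ==> a + b * w \<in> K" by (auto simp: K_def)

lemma mult_coords: "(a + b * w) * (c + d * w) = (a * c + b * d * of_int m) + (a * d + b * c) * w"
 using w by (simp add: algebra_simps power2_eq_square)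

lemma K_closed:
 "x \<in> K ==> y \<in> K ==> x + y \<in> K" "x \<in> K ==> y \<in> K ==> x * y \<in> K" "x \<in> \<rat> ==> x \<in> K" "x \<in> K ==> conj x \<in> K"
proof -
 show "x \<in> \<rat> ==> x \<in> K" using KI[of x 0] by simp
 assume x: "x \<in> K"
 then obtain a b where ab: "a \<in> \<rat>" "b \<in> \<rat>" "x = a + b * w" by (rule KE)
 show "conj x \<in> K" using KI[of a "- b"] ab conj_eq[of a b] by simp
 assume "y \<in> K"
 then obtain c d where cd: "c \<in> \<rat>" "d \<in> \<rat>" "y = c + d * w" by (rule KE)
 have e: "x + y = (a + c) + (b + d) * w" using ab cd by (simp add: algebra_simps)
 show "x + y \<in> K" unfolding e by (rule KI) (use ab cd in auto)
 show "x * y \<in> K" unfolding ab(3) cd(3) mult_coords using ab cd by (intro KI) auto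
qed

lemma conj_hom:
 assumes "x \<in> K" "y \<in> K" shows "conj (x + y) = conj x + conj y" "conj (x * y) = conj x * conj y" "conj (conj x) = x"
proof -
 obtain a b where ab: "a \<in> \<rat>" "b \<in> \<rat>" "x = a + b * w" using assms(1) by (rule KE)
 obtain c d where cd: "c \<in> \<rat>" "d \<in> \<rat>" "y = c + d * w" using assms(2) by (rule KE)
 have e: "x + y = (a + c) + (b + d) * w" using ab cd by (simp add: algebra_simps)
 have "conj (x + y) = (a + c) - (b + d) * w" unfolding e by (rule conj_eq) (use ab cd in auto)
 then show "conj (x + y) = conj x + conj y" unfolding ab(3) cd(3) conj_eq[OF ab(1,2)] conj_eq[OF cd(1,2)] by (simp add: algebra_simps)
 have "conj (x * y) = (a * c + b * d * of_int m) - (a * d + b * c) * w" unfolding ab(3) cd(3) mult_coords using ab cd by (intro conj_eq) auto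
 also have "... = (a + (- b) * w) * (c + (- d) * w)" unfolding mult_coords by (simp add: algebra_simps)
 finally show "conj (x * y) = conj x * conj y" using ab cd conj_eq by simp
 show "conj (conj x) = x" using ab conj_eq[of a b] conj_eq[of a "- b"] by simp
qed

lemma conj_Rats: "q \<in> \<rat> ==> conj q = q" using conj_eq[of q 0] by simp

lemma conj_power: "x \<in> K ==> x ^ n \<in> K \<and> conj (x ^ n) = conj x ^ n"
 by (induction n) (auto simp: K_closed conj_Rats conj_hom)

lemma galois_group_K: "\<tau> \<in> galois_group K \<and> \<tau> ~= (\<lambda>x\<in>K. x) \<longleftrightarrow> \<tau> = restrict conj K"
proof
 assume a: "\<tau> \<in> galois_group K \<and> \<tau> ~= (\<lambda>x\<in>K. x)"
 then obtain \<xi> where \<xi>: "\<tau> = restrict \<xi> K" "\<xi> \<in> ring_iso (complex_field\<lparr>carrier := K\<rparr>) (complex_field\<lparr>carrier := K\<rparr>)"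
  "\<forall>x\<in>\<rat>. \<xi> x = x" by (auto simp: galois_group_def)
 have hom: "\<xi> (x + y) = \<xi> x + \<xi> y" "\<xi> (x * y) = \<xi> x * \<xi> y" if "x \<in> K" "y \<in> K" for x y
  using \<xi>(2) that by (auto simp: ring_iso_def ring_hom_def)
 have wK: "w \<in> K" using KI[of 0 1] by simp
 have "\<xi> w ^ 2 = w ^ 2" using hom(2)[OF wK wK] \<xi>(3) w by (simp add: power2_eq_square)
 then have sw: "\<xi> w = w \<or> \<xi> w = - w" by (rule square_eq_square)
 have \<xi>x: "\<xi> (a + b * w) = a + b * \<xi> w" if "a \<in> \<rat>" "b \<in> \<rat>" for a b
  using hom(1)[of a "b * w"] hom(2)[of b w] that wK K_closed \<xi>(3) by simp
 have "\<xi> w ~= w"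
 proof
  assume "\<xi> w = w"
  then have "\<xi> x = x" if "x \<in> K" for x using \<xi>x that by (auto elim!: KE)
  then show False using a \<xi>(1) by (auto simp: restrict_def)
 qed
 then have "\<xi> x = conj x" if "x \<in> K" for x using sw \<xi>x conj_eq that by (auto elim!: KE)
 then show "\<tau> = restrict conj K" unfolding \<xi>(1) by (auto simp: restrict_def)
next
 assume t: "\<tau> = restrict conj K"
 have "bij_betw conj K K" by (rule bij_betw_byWitness[of _ conj]) (use conj_hom(3) K_closed(4) in auto)
 then have "conj \<in> ring_iso (complex_field\<lparr>carrier := K\<rparr>) (complex_field\<lparr>carrier := K\<rparr>)"
  using conj_hom conj_Rats[of 1] K_closed(4) by (auto simp: ring_iso_def ring_hom_def)
 then have "\<tau> \<in> galois_group K" unfolding galois_group_def t using conj_Rats by blast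
 moreover have "\<tau> ~= (\<lambda>x\<in>K. x)"
 proof
  assume "\<tau> = (\<lambda>x\<in>K. x)"
  moreover have "w \<in> K" using KI[of 0 1] by simp
  ultimately have "conj w = w" using t by (metis restrict_apply')
  then show False using conj_eq[of 0 1] w0 by (simp add: eq_neg_iff_add_eq_0)
 qed
 ultimately show "\<tau> \<in> galois_group K \<and> \<tau> ~= (\<lambda>x\<in>K. x)" by blast
qed

text \<open>The order Z[w], in general smaller than the ring of integers; denominators are measured
  against it.\<close>

definition O' :: "complex set"
 where "O' = {of_int a + of_int b * w | a b. True}"

lemma O'_closed: "x \<in> O' ==> y \<in> O' ==> x + y \<in> O'" "x \<in> O' ==> y \<in> O' ==> x * y \<in> O'" "of_int i \<in> O'"
proof -
 show "of_int i \<in> O'" unfolding O'_def by (intro CollectI exI[of _ i] exI[of _ 0]) simp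
 assume "x \<in> O'" "y \<in> O'"
 then obtain a b c d where "x = of_int a + of_int b * w" "y = of_int c + of_int d * w" by (auto simp: O'_def)
 then have "x + y = of_int (a + c) + of_int (b + d) * w"
  "x * y = of_int (a * c + b * d * m) + of_int (a * d + b * c) * w" by (simp add: algebra_simps, simp add: mult_coords)
 then show "x + y \<in> O'" "x * y \<in> O'" unfolding O'_def by blast+
qed

lemma O'_sum: "(\<And>i. i \<in> I ==> f i \<in> O') ==> sum f I \<in> O'"
 using O'_closed(3)[of 0] by (induction I rule: infinite_finite_induct) (auto intro: O'_closed)

lemma O'_Rats:
 assumes "x \<in> O'" "x \<in> \<rat>" shows "x \<in> \<int>"
proof -
 obtain a b where ab: "x = of_int a + of_int b * w" using assms(1) by (auto simp: O'_def)
 then have "of_int a + of_int b * w = x + 0 * w" by simp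
 then have "of_int b = (0 :: complex)" by (rule coords_unique(2)[rotated 4]) (use assms(2) in auto)
 then show ?thesis using ab by simp
qed

text \<open>The powers of an algebraic integer and of its conjugate have bounded denominators, so trace
 and norm are rational numbers all of whose powers have bounded denominators.\<close>

lemma integral_trace_norm:
 assumes a: "a \<in> \<rat>" "b \<in> \<rat>" and int: "algebraic_int (a + b * w)" shows "2 * a \<in> \<int>" "a ^ 2 - of_int m * b ^ 2 \<in> \<int>"
proof -
 let ?x = "a + b * w"
 have xK: "?x \<in> K" using KI a by blast
 obtain P where P: "Polynomial.lead_coeff P = 1" "\<forall>i. Polynomial.coeff P i \<in> \<int>" "poly P ?x = 0"
  using int by (auto simp: algebraic_int.simps)
 define n where "n = Polynomial.degree P"
 have "\<exists>u v. u \<in> \<rat> \<and> v \<in> \<rat> \<and> ?x ^ k = u + v * w" for k using conj_power[OF xK, of k] by (auto elim!: KE)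
 then obtain u v where uv: "\<And>k. u k \<in> \<rat>" "\<And>k. v k \<in> \<rat>" "\<And>k. ?x ^ k = u k + v k * w" by metis
 obtain d1 a1 where d1: "d1 > (0::int)" "\<And>k. k \<in> {..<n} ==> of_int d1 * u k = of_int (a1 k)"
  using ex_common_denominator[of "{..<n}" u] uv(1) by auto
 obtain d2 a2 where d2: "d2 > (0::int)" "\<And>k. k \<in> {..<n} ==> of_int d2 * v k = of_int (a2 k)"
  using ex_common_denominator[of "{..<n}" v] uv(2) by auto
 \<comment> \<open>\<open>d\<close> clears the denominators of the first \<open>n\<close> powers;
   the monic equation of degree \<open>n\<close> carries this over to all powers.\<close>
 define d where "d = d1 * d2"
 have d: "d > 0" using d1 d2 by (simp add: d_def)
 have O: "of_int d * ?x ^ k \<in> O'" for k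
 proof (induction k rule: less_induct)
  case (less k)
  show ?case
  proof (cases "k < n")
   case True
   have "of_int d * ?x ^ k = of_int d2 * (of_int d1 * u k) + of_int d1 * (of_int d2 * v k) * w" by (simp add: uv(3) d_def algebra_simps)
   also have "... = of_int (d2 * a1 k) + of_int (d1 * a2 k) * w" using d1(2) d2(2) True by simp
   finally show ?thesis unfolding O'_def by blast
  next
   case False
   have "0 = (\<Sum>i\<le>n. Polynomial.coeff P i * ?x ^ i)" using P(3) by (simp add: poly_altdef n_def)
   also have "... = ?x ^ n + (\<Sum>i<n. Polynomial.coeff P i * ?x ^ i)" using P(1) by (simp add: n_def lessThan_Suc_atMost[symmetric])
   finally have xn: "?x ^ n = - (\<Sum>i<n. Polynomial.coeff P i * ?x ^ i)" by (simp add: eq_neg_iff_add_eq_0)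
   have "of_int d * ?x ^ k = of_int d * ?x ^ (k - n) * ?x ^ n" using False by (simp flip: power_add mult.assoc)
   also have "... = (\<Sum>i<n. - Polynomial.coeff P i * (of_int d * ?x ^ (k - n + i)))"
    unfolding xn by (simp add: sum_distrib_left sum_negf power_add mult_ac)
   also have "... \<in> O'"
   proof (rule O'_sum, rule O'_closed(2))
    fix i assume i: "i \<in> {..<n}"
    show "of_int d * ?x ^ (k - n + i) \<in> O'" using i False by (intro less.IH) auto
    obtain j where "Polynomial.coeff P i = of_int j" using P(2) by (auto elim: Ints_cases)
    then show "- Polynomial.coeff P i \<in> O'" using O'_closed(3)[of "- j"] by simp
   qed
   finally show ?thesis .
  qed
 qed
 let ?y = "a - b * w"
 have y: "?y = conj ?x" using conj_eq[OF a] by simp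
 have Oc: "of_int d * ?y ^ k \<in> O'" for k
 proof -
  obtain i j where ij: "of_int d * ?x ^ k = of_int i + of_int j * w" using O[of k] by (auto simp: O'_def)
  have "of_int d * ?y ^ k = conj (of_int d * ?x ^ k)"
   using conj_hom(2)[of "of_int d" "?x ^ k"] conj_power[OF xK, of k] K_closed(3) conj_Rats y by simp
  also have "... = of_int i - of_int j * w" unfolding ij by (rule conj_eq) auto
  also have "... = of_int i + of_int (- j) * w" by simp
  finally show ?thesis unfolding O'_def by blast
 qed
 \<comment> \<open>One factor \<open>d\<close> for the powers of \<open>?x\<close>, one for the
   powers of its conjugate.\<close>
 have d2': "d * d > 0" using d by simp
 have sum2: "2 * a = ?x + ?y" by simp
 show "2 * a \<in> \<int>"
 proof (rule rat_bounded_powers_int[OF _ d2'])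
  fix k
  have "of_int (d * d) * (?x + ?y) ^ k =
    (\<Sum>j\<le>k. of_int (int (k choose j)) * ((of_int d * ?x ^ j) * (of_int d * ?y ^ (k - j))))"
   unfolding binomial_ring by (simp add: sum_distrib_left mult_ac)
  also have "... \<in> O'" by (rule O'_sum) (rule O'_closed(2)[OF O'_closed(3) O'_closed(2)[OF O Oc]])
  finally have "of_int (d * d) * (2 * a) ^ k \<in> O'" by (simp only: sum2)
  moreover have "of_int (d * d) * (2 * a) ^ k \<in> \<rat>" using a by auto
  ultimately show "of_int (d * d) * (2 * a) ^ k \<in> \<int>" using O'_Rats by blast
 qed (use a in auto)
 have nrm: "a ^ 2 - of_int m * b ^ 2 = ?x * ?y" using w by (simp add: algebra_simps power2_eq_square)
 show "a ^ 2 - of_int m * b ^ 2 \<in> \<int>"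
 proof (rule rat_bounded_powers_int[OF _ d2'])
  fix k
  have "of_int (d * d) * (?x * ?y) ^ k = (of_int d * ?x ^ k) * (of_int d * ?y ^ k)" by (simp add: power_mult_distrib mult_ac)
  also have "... \<in> O'" using O Oc by (rule O'_closed(2))
  finally have "of_int (d * d) * (a ^ 2 - of_int m * b ^ 2) ^ k \<in> O'" by (simp only: nrm)
  moreover have "of_int (d * d) * (a ^ 2 - of_int m * b ^ 2) ^ k \<in> \<rat>" using a by auto
  ultimately show "of_int (d * d) * (a ^ 2 - of_int m * b ^ 2) ^ k \<in> \<int>" using O'_Rats by blast
 qed (use a in auto)
qed

text \<open>The trace \<open>2 * a\<close> is an integer, and then so is
  \<open>of_int m * (2 * b) ^ 2\<close>; as \<open>m\<close> is squarefree, \<open>2 * b\<close> has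
  denominator 1. The divisibility by 4 expresses that the norm is an integer.\<close>

lemma integral_coords:
 assumes a: "a \<in> \<rat>" "b \<in> \<rat>" and int: "algebraic_int (a + b * w)"
 obtains i j where "2 * a = of_int i" "2 * b = of_int j" "4 dvd i ^ 2 - m * j ^ 2"
proof -
 obtain i where i: "2 * a = of_int i" using integral_trace_norm(1)[OF assms] by (auto elim: Ints_cases)
 obtain n where n: "a ^ 2 - of_int m * b ^ 2 = of_int n" using integral_trace_norm(2)[OF assms] by (auto elim: Ints_cases)
 have eq: "of_int m * (2 * b) ^ 2 = (of_int (i ^ 2 - 4 * n) :: complex)"
  using n arg_cong[OF i, of "\<lambda>z. z ^ 2"] by (simp add: power_mult_distrib algebra_simps)
 obtain r s where rs: "s > 0" "Rings.coprime r s" "2 * b = of_int r / of_int s"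
 proof -
  have "2 * b \<in> \<rat>" using a by simp
  then show thesis using that by (auto elim: Rats_cases')
 qed
 have "(of_int (m * r ^ 2) :: complex) = of_int ((i ^ 2 - 4 * n) * s ^ 2)" using eq rs(1) unfolding rs(3) by (simp add: power_divide field_simps)
 then have "m * r ^ 2 = (i ^ 2 - 4 * n) * s ^ 2" using of_int_eq_iff by blast
 then have "s ^ 2 dvd m * r ^ 2" by simp
 moreover have "Rings.coprime (s ^ 2) (r ^ 2)" using rs(2) by (simp add: coprime_commute)
 ultimately have "s ^ 2 dvd m" using coprime_dvd_mult_left_iff by blast
 then have "s dvd 1" using squarefree squarefreeD by blast
 then have "s = 1" using rs(1) by simp
 then have j: "2 * b = of_int r" using rs(3) by simp
 have "(of_int (m * r ^ 2) :: complex) = of_int (i ^ 2 - 4 * n)" using eq unfolding j by simp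
 then have "m * r ^ 2 = i ^ 2 - 4 * n" using of_int_eq_iff by blast
 then have "i ^ 2 - m * r ^ 2 = 4 * n" by simp
 then show thesis using that i j by (metis dvd_triv_left)
qed

definition \<omega> :: complex
 where "\<omega> = (if m mod 4 = 1 then (1 + w) / 2 else w)"

definition disc :: int
 where "disc = (if m mod 4 = 1 then m else 4 * m)"

lemma m_mod: "m mod 4 ~= 0"
proof
 assume "m mod 4 = 0"
 then have "4 dvd m" by presburger
 then have "2 ^ 2 dvd m" by simp
 then have "(2 :: int) dvd 1" by (rule squarefreeD[OF squarefree])
 then show False by simp
qed

lemma integers_eq: "{x \<in> K. algebraic_int x} = {of_int i * 1 + of_int j * \<omega> | i j. True}"
proof (intro equalityI subsetI)
 fix x assume "x \<in> {x \<in> K. algebraic_int x}"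
 then obtain a b where ab: "a \<in> \<rat>" "b \<in> \<rat>" "x = a + b * w" "algebraic_int (a + b * w)" by (auto elim!: KE)
 obtain i j where ij: "2 * a = of_int i" "2 * b = of_int j" "4 dvd i ^ 2 - m * j ^ 2" using integral_coords[OF ab(1,2,4)] by metis
 have a: "a = of_int i / 2" and b: "b = of_int j / 2" using ij by (auto simp: field_simps)
 show "x \<in> {of_int i * 1 + of_int j * \<omega> | i j. True}"
 proof (cases "m mod 4 = 1")
  case True
  have "even (i - j)"
  proof (rule ccontr)
   assume o: "odd (i - j)"
   have "even (i ^ 2 - m * j ^ 2)" using ij(3) by (meson dvd_trans even_numeral)
   moreover have "odd m" using True by presburger
   ultimately show False using o by auto
  qed
  then obtain k where k: "i - j = 2 * k" by (rule evenE)
  have "(of_int i :: complex) = of_int j + 2 * of_int k" using arg_cong[OF k, of "of_int :: int \<Rightarrow> complex"] by (simp add: algebra_simps)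
  moreover have "x = of_int i / 2 + of_int j / 2 * w" using ab(3) a b by simp
  moreover have "\<omega> = (1 + w) / 2" using True by (simp add: \<omega>_def)
  ultimately have "x = of_int k * 1 + of_int j * \<omega>" by (simp add: add_divide_distrib distrib_left)
  then show ?thesis by blast
 next
  case False
  have "even i \<and> even j"
  proof -
   have ij4: "(i ^ 2 - m * j ^ 2) mod 4 = 0" using ij(3) by auto
   have sq: "k ^ 2 mod 4 = (if even k then 0 else 1)" for k :: int
   proof (cases "even k")
    case True
    then show ?thesis by (auto elim!: evenE simp: power_mult_distrib)
   next
    case False
    then obtain l where "k = 2 * l + 1" by (auto elim: oddE)
    then have "k ^ 2 = 4 * (l ^ 2 + l) + 1" by (simp add: power2_eq_square algebra_simps)
    then show ?thesis using False by presburger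
   qed
   have "(i ^ 2 - m * j ^ 2) mod 4 = ((i ^ 2 mod 4) - (m mod 4) * (j ^ 2 mod 4)) mod 4"
    by (fold cong_def, intro cong_diff cong_mult) (simp_all add: cong_def)
   then have *: "((if even i then 0 else 1) - (m mod 4) * (if even j then 0 else 1)) mod 4 = 0" using ij4 sq by simp
   have m4: "m mod 4 = 2 \<or> m mod 4 = 3" using False m_mod by presburger
   show ?thesis
   proof (rule ccontr)
    assume "\<not> (even i \<and> even j)"
    then consider "odd i" "odd j" | "odd i" "even j" | "even i" "odd j" by blast
    then show False using * m4 by cases auto
   qed
  qed
  then obtain k l where "i = 2 * k" "j = 2 * l" by (auto elim!: evenE)
  then have "x = of_int k * 1 + of_int l * \<omega>" using False ab(3) a b by (simp add: \<omega>_def)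
  then show ?thesis by blast
 qed
next
 fix x assume "x \<in> {of_int i * 1 + of_int j * \<omega> | i j. True}"
 then obtain i j where x: "x = of_int i + of_int j * \<omega>" by auto
 have "x \<in> K"
 proof (cases "m mod 4 = 1")
  case True
  have "\<omega> = (1 + w) / 2" using True by (simp add: \<omega>_def)
  then have "x = (of_int i + of_int j / 2) + (of_int j / 2) * w" by (simp add: x add_divide_distrib distrib_left)
  moreover have "of_int i + of_int j / 2 \<in> (\<rat> :: complex set)" "of_int j / 2 \<in> (\<rat> :: complex set)" by auto
  ultimately show ?thesis using KI by metis
 next
  case False
  then show ?thesis using KI[of "of_int i" "of_int j"] by (simp add: x \<omega>_def)
 qed
 moreover have "algebraic_int x"
 proof -
  have root: "algebraic_int x" if "x ^ 2 + of_int s * x + of_int t = 0" for s t by (rule algebraic_int.intros[of "[:of_int t, of_int s, 1:]"])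
     (use that in \<open>auto simp: coeff_pCons power2_eq_square algebra_simps split: nat.splits\<close>)
  show ?thesis
  proof (cases "m mod 4 = 1")
   case True
   define k where "k = (1 - m) div 4"
   have "m = 1 - 4 * k" using True unfolding k_def by presburger
   then have w': "w ^ 2 = 1 - 4 * of_int k" using w by simp
   have om: "\<omega> ^ 2 = \<omega> - of_int k"
   proof -
    have o: "\<omega> = (1 + w) / 2" using True by (simp add: \<omega>_def)
    have "\<omega> ^ 2 = (1 + 2 * w + w ^ 2) / 4" unfolding o by (simp add: power_divide power2_sum)
    also have "... = (1 + 2 * w + (1 - 4 * of_int k)) / 4" unfolding w' ..
    also have "... = \<omega> - of_int k" unfolding o by (simp add: field_simps)
    finally show ?thesis .
   qed
   have "x ^ 2 + of_int (- (2 * i + j)) * x + of_int (i ^ 2 + i * j + j ^ 2 * k) = of_int j ^ 2 * (\<omega> ^ 2 - \<omega> + of_int k)"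
    by (simp add: x power2_eq_square algebra_simps)
   then show ?thesis using om root[of "- (2 * i + j)" "i ^ 2 + i * j + j ^ 2 * k"] by simp
  next
   case False
   have "x ^ 2 + of_int (- (2 * i)) * x + of_int (i ^ 2 - m * j ^ 2) = of_int j ^ 2 * (w ^ 2 - of_int m)"
    using False by (simp add: x \<omega>_def power2_eq_square algebra_simps)
   then show ?thesis using w root[of "- (2 * i)" "i ^ 2 - m * j ^ 2"] by simp
  qed
 qed
 ultimately show "x \<in> {x \<in> K. algebraic_int x}" by blast
qed

lemma disc_basis: "(1 * conj \<omega> - \<omega> * conj 1) ^ 2 = of_int disc"
proof (cases "m mod 4 = 1")
 case True
 have "\<omega> = 1 / 2 + 1 / 2 * w" using True by (simp add: \<omega>_def add_divide_distrib)
 then have "conj \<omega> = 1 / 2 - 1 / 2 * w" "\<omega> = 1 / 2 + 1 / 2 * w" using conj_eq[of "1 / 2" "1 / 2"] by simp_all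
 then have "1 * conj \<omega> - \<omega> * conj 1 = - w" using conj_Rats[of 1] by simp
 then show ?thesis using True w by (simp add: disc_def)
next
 case False
 then have "conj \<omega> = - w" "\<omega> = w" using conj_eq[of 0 1] by (simp_all add: \<omega>_def)
 then have "1 * conj \<omega> - \<omega> * conj 1 = - 2 * w" using conj_Rats[of 1] by simp
 then show ?thesis using False w by (simp add: disc_def power_mult_distrib)
qed

lemma disc_change:
 assumes "\<alpha> \<in> K" "\<beta> \<in> K" "\<alpha>' = of_int i * \<alpha> + of_int j * \<beta>" "\<beta>' = of_int k * \<alpha> + of_int l * \<beta>"
 shows "(\<alpha>' * conj \<beta>' - \<beta>' * conj \<alpha>') ^ 2 = of_int ((i * l - j * k) ^ 2) * (\<alpha> * conj \<beta> - \<beta> * conj \<alpha>) ^ 2"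
proof -
 have c: "conj (of_int i * \<alpha> + of_int j * \<beta>) = of_int i * conj \<alpha> + of_int j * conj \<beta>" for i j
  using conj_hom(1)[of "of_int i * \<alpha>" "of_int j * \<beta>"] conj_hom(2)[of "of_int i" \<alpha>] conj_hom(2)[of "of_int j" \<beta>]
   K_closed assms conj_Rats by simp
 have "\<alpha>' * conj \<beta>' - \<beta>' * conj \<alpha>' = of_int (i * l - j * k) * (\<alpha> * conj \<beta> - \<beta> * conj \<alpha>)"
  unfolding assms(3,4) c by (simp add: algebra_simps)
 then show ?thesis by (simp add: power_mult_distrib)
qed

text \<open>Two integral bases express each other with integer coefficients, so the discriminants
  differ by squares \<open>u\<close> and \<open>v\<close> of integers with \<open>v * u = 1\<close>.
  Hence the definite description has a unique candidate.\<close>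

theorem quadratic_disc_K: "quadratic_disc K = disc" unfolding quadratic_disc_def
proof (rule the_equality)
 have "w \<in> K" using KI[of 0 1] by simp
 have one: "1 \<in> K" using K_closed(3) by simp
 have om: "\<omega> \<in> K"
 proof (cases "m mod 4 = 1")
  case True
  then show ?thesis using KI[of "1/2" "1/2"] by (simp add: \<omega>_def add_divide_distrib)
 qed (use \<open>w \<in> K\<close> in \<open>simp add: \<omega>_def\<close>)
 show "\<exists>\<alpha> \<beta> \<tau>. {x \<in> K. algebraic_int x} = {of_int m * \<alpha> + of_int n * \<beta> | m n. True} \<and>
  \<tau> \<in> galois_group K \<and> \<tau> ~= (\<lambda>x\<in>K. x) \<and> of_int disc = (\<alpha> * \<tau> \<beta> - \<beta> * \<tau> \<alpha>)\<^sup>2"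
 proof (rule exI[of _ 1], rule exI[of _ \<omega>], rule exI[of _ "restrict conj K"], intro conjI)
  show "{x \<in> K. algebraic_int x} = {of_int m * 1 + of_int n * \<omega> | m n. True}" by (rule integers_eq)
  show "restrict conj K \<in> galois_group K" "restrict conj K ~= (\<lambda>x\<in>K. x)" using galois_group_K[of "restrict conj K"] by auto
  show "of_int disc = (1 * restrict conj K \<omega> - \<omega> * restrict conj K 1)\<^sup>2" using disc_basis one om by simp
 qed
 fix d assume "\<exists>\<alpha> \<beta> \<tau>. {x \<in> K. algebraic_int x} = {of_int m * \<alpha> + of_int n * \<beta> | m n. True} \<and>
  \<tau> \<in> galois_group K \<and> \<tau> ~= (\<lambda>x\<in>K. x) \<and> of_int d = (\<alpha> * \<tau> \<beta> - \<beta> * \<tau> \<alpha>)\<^sup>2"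
 then obtain \<alpha> \<beta> \<tau> where 1: "{x \<in> K. algebraic_int x} = {of_int m * \<alpha> + of_int n * \<beta> | m n. True}"
  "\<tau> \<in> galois_group K \<and> \<tau> ~= (\<lambda>x\<in>K. x)" "of_int d = (\<alpha> * \<tau> \<beta> - \<beta> * \<tau> \<alpha>)\<^sup>2" by blast
 have \<tau>: "\<tau> = restrict conj K" using 1(2) galois_group_K by blast
 let ?S = "{of_int m * \<alpha> + of_int n * \<beta> | m n. True}" and ?T = "{of_int i * 1 + of_int j * \<omega> | i j. True}"
 have ST: "?S = ?T" using 1(1) integers_eq by simp
 have "\<alpha> \<in> ?S" by (intro CollectI exI[of _ 1] exI[of _ 0]) auto
 moreover have "\<beta> \<in> ?S" by (intro CollectI exI[of _ 0] exI[of _ 1]) auto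
 ultimately obtain i j k l where ab: "\<alpha> = of_int i * 1 + of_int j * \<omega>" "\<beta> = of_int k * 1 + of_int l * \<omega>"
  unfolding ST by blast
 have "\<alpha> \<in> {x \<in> K. algebraic_int x}" "\<beta> \<in> {x \<in> K. algebraic_int x}"
  unfolding 1(1) using \<open>\<alpha> \<in> ?S\<close> \<open>\<beta> \<in> ?S\<close> by blast+
 then have abK: "\<alpha> \<in> K" "\<beta> \<in> K" by auto
 have "1 \<in> ?T" by (intro CollectI exI[of _ 1] exI[of _ 0]) auto
 moreover have "\<omega> \<in> ?T" by (intro CollectI exI[of _ 0] exI[of _ 1]) auto
 ultimately obtain i' j' k' l' where inv: "1 = of_int i' * \<alpha> + of_int j' * \<beta>" "\<omega> = of_int k' * \<alpha> + of_int l' * \<beta>"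
  unfolding ST[symmetric] by blast
 have d: "of_int d = (\<alpha> * conj \<beta> - \<beta> * conj \<alpha>) ^ 2" using 1(3) \<tau> abK by simp
 define u where "u = (i * l - j * k) ^ 2"
 define v where "v = (i' * l' - j' * k') ^ 2"
 have "of_int d = (of_int (u * disc) :: complex)" unfolding d disc_change[OF one om ab] disc_basis u_def by simp
 then have du: "d = u * disc" using of_int_eq_iff by blast
 have "of_int disc = (of_int (v * d) :: complex)" unfolding disc_basis[symmetric] disc_change[OF abK inv] d[symmetric] v_def by simp
 then have "disc = v * d" using of_int_eq_iff by blast
 then have "disc = (v * u) * disc" using du by simp
 moreover have "disc ~= 0" using m0 by (simp add: disc_def)
 ultimately have "v * u = 1" by simp
 moreover have "u \<ge> 0" by (simp add: u_def)
 ultimately have "u = 1" using zmult_eq_1_iff by auto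
 then show "d = disc" using du by simp
qed

end

text \<open>The square roots of the elements of the class are the nonzero rational multiples of
  \<open>w\<close>. Together with the nonzero rationals they form a radical group \<open>W\<close>,
  whose span is \<open>K\<close>.\<close>

theorem class_disc_squarefree:
 assumes m: "squarefree (m :: int)" "m ~= 1" shows "class_disc (pclass 2 (of_int m)) = (if m mod 4 = 1 then m else 4 * m)"
proof -
 define w where "w = csqrt (of_int m)"
 have w: "w ^ 2 = of_int m" by (simp add: w_def)
 interpret quadratic_field m w by unfold_locales (use m w in auto)
 let ?B = "{x. x\<^sup>2 \<in> pclass 2 (of_int m)}"
 have B: "?B = {q * w | q. q \<in> \<rat> - {0}}"
 proof (intro equalityI subsetI)
  fix x assume "x \<in> ?B"
  then obtain r where r: "r \<in> \<rat> - {0}" "x ^ 2 = r ^ 2 * of_int m" unfolding mem_Collect_eq pclass_eq by (auto simp: rat_powers_def)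
  then have "x ^ 2 = (r * w) ^ 2" using w by (simp add: power_mult_distrib)
  then have "x = r * w \<or> x = - (r * w)" by (rule square_eq_square)
  then show "x \<in> {q * w | q. q \<in> \<rat> - {0}}"
  proof
   assume "x = - (r * w)"
   then have "x = (- r) * w" "- r \<in> \<rat> - {0}" using r(1) by auto
   then show ?thesis by blast
  qed (use r(1) in blast)
 next
  fix x assume "x \<in> {q * w | q. q \<in> \<rat> - {0}}"
  then obtain q where q: "x = q * w" "q \<in> \<rat> - {0}" by blast
  then have "x ^ 2 = q ^ 2 * of_int m" using w by (simp add: power_mult_distrib)
  then show "x \<in> ?B" using q(2) unfolding mem_Collect_eq pclass_eq by (auto simp: rat_powers_def)
 qed
 define W where "W = (\<rat> - {0}) \<union> ?B"
 have W_iff: "x \<in> W \<longleftrightarrow> (\<exists>q\<in>\<rat> - {0}. x = q \<or> x = q * w)" for x unfolding W_def B by blast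
 have "mgrp W" unfolding mgrp_def
 proof (intro conjI ballI)
  show "1 \<in> W" by (simp add: W_def)
  show "0 \<notin> W" unfolding W_iff using w0 by auto
  fix x assume "x \<in> W"
  then obtain q where q: "q \<in> \<rat> - {0}" "x = q \<or> x = q * w" unfolding W_iff by blast
  have "inverse w = w / of_int m" using w w0 m0 by (simp add: field_simps power2_eq_square)
  then have "inverse x = inverse q \<or> inverse x = (inverse q / of_int m) * w" using q by auto
  moreover have "inverse q \<in> \<rat> - {0}" "inverse q / of_int m \<in> \<rat> - {0}" using q(1) m0 by auto
  ultimately show "inverse x \<in> W" unfolding W_iff by blast
  fix y assume "y \<in> W"
  then obtain r where r: "r \<in> \<rat> - {0}" "y = r \<or> y = r * w" unfolding W_iff by blast
  have "(q * w) * (r * w) = q * r * of_int m" using w by (simp add: power2_eq_square algebra_simps)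
  then have "x * y = q * r \<or> x * y = (q * r) * w \<or> x * y = q * r * of_int m" using q(2) r(2) by (auto simp: algebra_simps)
  moreover have "q * r \<in> \<rat> - {0}" "q * r * of_int m \<in> \<rat> - {0}" using q(1) r(1) m0 by auto
  ultimately show "x * y \<in> W" unfolding W_iff by blast
 qed
 moreover have "\<exists>n\<ge>1. x ^ n \<in> \<rat>" if x: "x \<in> W" for x
 proof -
  obtain q where "q \<in> \<rat>" "x = q \<or> x = q * w" using x unfolding W_iff by blast
  then have "x ^ 2 \<in> \<rat>" using w by (auto simp: power_mult_distrib)
  then show ?thesis by (intro exI[of _ 2]) auto
 qed
 ultimately have W: "radical_group W" by (simp add: radical_group_def)
 have "\<rat> \<union> ?B = \<rat> \<union> W" by (auto simp: W_def)
 then have "rat_adjoin ?B = qspan W" using rat_adjoin_radical_group[OF W] by (simp add: rat_adjoin_def)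
 also have "... = K"
 proof
  have Wg: "mgrp W" using W by (simp add: radical_group_def)
  show "K \<subseteq> qspan W"
  proof
   fix x assume "x \<in> K"
   then obtain a b where ab: "a \<in> \<rat>" "b \<in> \<rat>" "x = a + b * w" by (rule KE)
   have "w \<in> W" unfolding W_iff by (intro bexI[of _ 1]) auto
   then show "x \<in> qspan W" unfolding ab(3) using ab by (intro qspan_add qspan_smult qspan_Rats[OF Wg] qspan_base)
  qed
  have WK: "x \<in> K" if x: "x \<in> W" for x
  proof -
   obtain q where "q \<in> \<rat>" "x = q \<or> x = q * w" using x unfolding W_iff by blast
   then show ?thesis using KI[of q 0] KI[of 0 q] by auto
  qed
  have sums: "sum f A \<in> K" if "\<And>x. x \<in> A ==> f x \<in> K" for f and A :: "complex set"
   using that K_closed(3)[of 0] by (induction A rule: infinite_finite_induct) (auto simp: K_closed)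
  show "qspan W \<subseteq> K"
  proof
   fix x assume "x \<in> qspan W"
   then obtain A c where A: "finite A" "A \<subseteq> W" "\<And>x. x \<in> A ==> c x \<in> \<rat>" "x = (\<Sum>x\<in>A. c x * x)"
    by (rule qspanE) blast
   show "x \<in> K" unfolding A(4) by (rule sums, rule K_closed(2)) (use A WK K_closed(3) in auto)
  qed
 qed
 finally show ?thesis using quadratic_disc_K unfolding class_disc_def disc_def by simp
qed

section \<open>The product measure\<close>

lemma measurable_countable_range:
 fixes f :: "'a \<Rightarrow> complex"
 assumes "f \<in> borel_measurable M" "countable C" "\<And>x. x \<in> space M ==> f x \<in> C"
 shows "f \<in> measurable M (count_space UNIV)"
proof -
 have "f \<in> measurable M (count_space C)" unfolding measurable_count_space_eq_countable[OF assms(2)]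
  using assms(3) measurable_sets[OF assms(1), of "{a}" for a] by auto
 then have "(\<lambda>x. (\<lambda>y. y) (f x)) \<in> measurable M (count_space UNIV)" by (rule measurable_compose) simp
 then show ?thesis by simp
qed

locale kummer_setting =
 fixes \<Gamma> :: "complex set" and \<nu> :: "nat \<Rightarrow> (complex \<Rightarrow> complex) measure"
 assumes \<Gamma>: "mgrp \<Gamma>" "\<Gamma> \<subseteq> \<rat>" and fg: "finitely_generated \<Gamma>" and rank: "mult_rank \<Gamma> > 0"
  and haar: "\<And>p. p \<in> primes ==>
   haar_measure (Ap_group \<Gamma> p) (rat_aut_topology (p_root_closure \<Gamma> p)) (\<nu> p)"
  and total: "\<And>p. p \<in> primes ==> emeasure (\<nu> p) (carrier (Ap_group \<Gamma> p)) = 1"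
begin

abbreviation A :: "(complex \<Rightarrow> complex) set" where "A \<equiv> carrier (A_group \<Gamma>)"

lemma primes_ge: "p \<in> primes ==> p \<ge> 1" unfolding primes_def using prime_ge_1_nat by blast

lemma primary: "p \<in> primes ==> primary_part \<Gamma> p (\<nu> p)"
 using \<Gamma> haar total finite_power_classes_fg(1)[OF \<Gamma> fg primes_ge] by unfold_locales (auto simp: primes_def)

lemma prob_space_\<nu>: "p \<in> primes ==> prob_space (\<nu> p)"
proof -
 assume "p \<in> primes"
 then interpret q: primary_part \<Gamma> p "\<nu> p" by (rule primary)
 show ?thesis by (rule q.prob_space_axioms)
qed

lemma space_\<nu>: "p \<in> primes ==> space (\<nu> p) = carrier (Ap_group \<Gamma> p)"
proof -
 assume "p \<in> primes"
 then interpret q: primary_part \<Gamma> p "\<nu> p" by (rule primary)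
 show ?thesis by (simp add: q.space_eq Ap_group_def)
qed

text \<open>\<open>product_prob_space\<close> asks for a probability measure at every index, hence a
  Dirac measure where the index is not a prime.\<close>

definition \<nu>' :: "nat \<Rightarrow> (complex \<Rightarrow> complex) measure"
 where "\<nu>' p = (if p \<in> primes then \<nu> p else return (count_space UNIV) undefined)"

sublocale P: product_prob_space \<nu>' primes by (intro product_prob_spaceI) (simp add: \<nu>'_def prob_space_\<nu> prob_space_return)

abbreviation \<Omega> :: "(nat \<Rightarrow> complex \<Rightarrow> complex) measure"
 where "\<Omega> \<equiv> \<Pi>\<^sub>M p\<in>primes. \<nu> p"

lemma \<Omega>_eq: "\<Omega> = Pi\<^sub>M primes \<nu>'" by (rule PiM_cong) (simp_all add: \<nu>'_def)

sublocale prob_space \<Omega> unfolding \<Omega>_eq by (rule P.prob_space_axioms)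

lemma space_\<Omega>: "space \<Omega> = (\<Pi>\<^sub>E p\<in>primes. carrier (Ap_group \<Gamma> p))"
 unfolding space_PiM by (rule PiE_cong) (rule space_\<nu>)

lemma component_in: "\<omega> \<in> space \<Omega> ==> p \<in> primes ==> \<omega> p \<in> carrier (Ap_group \<Gamma> p)"
 unfolding space_\<Omega> by (rule PiE_mem)

text \<open>The map along which \<open>A_measure\<close> is transported; all integrals over
  \<open>A\<close> are computed on \<open>\<Omega>\<close> through it.\<close>

definition J :: "(nat \<Rightarrow> complex \<Rightarrow> complex) \<Rightarrow> complex \<Rightarrow> complex"
 where "J = the_inv_into A (A_to_product \<Gamma>)"

lemma J_in: "\<omega> \<in> space \<Omega> ==> J \<omega> \<in> A"
 and A_to_product_J: "\<omega> \<in> space \<Omega> ==> A_to_product \<Gamma> (J \<omega>) = \<omega>"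
 using A_to_product_bij[OF \<Gamma>] unfolding J_def space_\<Omega> by (auto simp: bij_betw_def the_inv_into_into f_the_inv_into_f)

lemma J_component:
 assumes "\<omega> \<in> space \<Omega>" "p \<in> primes" "x \<in> p_root_closure \<Gamma> p" shows "J \<omega> x = \<omega> p x"
 using fun_cong[OF fun_cong[OF A_to_product_J[OF assms(1)]], of p x] assms(2,3) by (simp add: A_to_product_def)

abbreviation R :: "complex set" where "R \<equiv> root_closure \<Gamma>"

abbreviation T :: "(complex \<Rightarrow> complex) topology" where "T \<equiv> rat_aut_topology R"

lemma mgrp_R: "mgrp R" by (rule saturated_mgrp[OF saturated_closures(1)[OF \<Gamma>, of 1]]) simp

lemma aut: "\<xi> \<in> A ==> mhom R \<xi>" "\<xi> \<in> A ==> x \<in> R ==> x \<in> \<rat> ==> \<xi> x = x" "\<xi> \<in> A ==> x \<in> R ==> \<xi> x \<in> R"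
 using rat_aut_carrier[OF mgrp_R] rat_aut_values[OF mgrp_R] by (auto simp: A_group_def)

lemma component_measurable:
 assumes "p \<in> primes" "f \<in> borel_measurable (\<nu> p)" shows "(\<lambda>\<omega>. f (\<omega> p)) \<in> borel_measurable \<Omega>"
 using measurable_component_singleton[OF assms(1), of \<nu>] assms(2) by (rule measurable_compose)

text \<open>By primary decomposition, a value \<open>J \<omega> x\<close> is a finite product of
  values of the components of \<omega>.\<close>

lemma J_measurable: "J \<in> measurable \<Omega> (borel_on T)"
proof (rule measurable_into_rat_aut[OF mgrp_R countable_root_closure[OF \<Gamma>(2)]])
 fix \<omega> assume "\<omega> \<in> space \<Omega>"
 then show "J \<omega> \<in> carrier (rat_aut_group R)" using J_in by (simp add: A_group_def)
next
 fix x assume x: "x \<in> R"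
 obtain K f where f: "finite K" "K \<subseteq> primes" "\<And>p. p \<in> K ==> f p \<in> p_root_closure \<Gamma> p" "x = (\<Prod>p\<in>K. f p)"
  using primary_decomposition[OF \<Gamma>(1) x] by metis
 have fR: "f p \<in> R" if "p \<in> K" for p using f(2,3) that p_root_closure_subset[OF primes_ge] by blast
 have "(\<lambda>\<omega>. \<Prod>p\<in>K. \<omega> p (f p)) \<in> borel_measurable \<Omega>"
 proof (rule borel_measurable_prod)
  fix p assume p: "p \<in> K"
  then interpret q: primary_part \<Gamma> p "\<nu> p" using f(2) by (intro primary) auto
  show "(\<lambda>\<omega>. \<omega> p (f p)) \<in> borel_measurable \<Omega>"
   using p f(2,3) by (intro component_measurable[of p "\<lambda>\<xi>. \<xi> (f p)"] q.eval_borel) auto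
 qed
 moreover have eq: "J \<omega> x = (\<Prod>p\<in>K. \<omega> p (f p))" if \<omega>: "\<omega> \<in> space \<Omega>" for \<omega>
 proof -
  have "J \<omega> x = (\<Prod>p\<in>K. J \<omega> (f p))" unfolding f(4) using mhom_prod[OF mgrp_R aut(1)[OF J_in[OF \<omega>]] fR] by simp
  also have "... = (\<Prod>p\<in>K. \<omega> p (f p))" using J_component[OF \<omega>] f(2,3) by (intro prod.cong) auto
  finally show ?thesis .
 qed
 ultimately have "(\<lambda>\<omega>. J \<omega> x) \<in> borel_measurable \<Omega>" by (simp cong: measurable_cong)
 then show "(\<lambda>\<omega>. J \<omega> x) \<in> measurable \<Omega> (count_space UNIV)"
  using aut(3)[OF J_in x] by (rule measurable_countable_range[OF _ countable_root_closure[OF \<Gamma>(2)]])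
qed

lemma A_measure_eq: "A_measure \<Gamma> \<nu> = distr \<Omega> (borel_on T) J" by (simp add: A_measure_def J_def)

lemma measure_A_measure:
 "B \<in> sets (borel_on T) ==> measure (A_measure \<Gamma> \<nu>) B = measure \<Omega> (J -` B \<inter> space \<Omega>)"
 unfolding A_measure_eq by (rule measure_distr[OF J_measurable])

lemma space_T: "space (borel_on T) = A" using topspace_rat_aut[OF mgrp_R] by (simp add: space_borel_on A_group_def)

lemma measure_A: "measure (A_measure \<Gamma> \<nu>) A = 1"
proof -
 have "A \<in> sets (borel_on T)" using sets.top[of "borel_on T"] space_T by simp
 moreover have "J -` A \<inter> space \<Omega> = space \<Omega>" using J_in by auto
 ultimately show ?thesis by (simp add: measure_A_measure prob_space)
qed

definition S' :: "(nat \<Rightarrow> complex \<Rightarrow> complex) set"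
 where "S' = (\<Pi>\<^sub>E p\<in>primes. Sp_set \<Gamma> p)"

lemma S_vimage: "J -` S_set \<Gamma> \<inter> space \<Omega> = S'"
proof -
 have "S' \<subseteq> space \<Omega>" unfolding S'_def space_\<Omega> by (rule PiE_mono) (auto simp: Sp_set_def)
 then show ?thesis unfolding S_set_def S'_def[symmetric] using J_in A_to_product_J by (auto simp: subset_iff)
qed

text \<open>\<open>U p\<close> consists of the automorphisms moving some \<open>p\<close>-th root of
  an element of \<Gamma> and is open; \<open>S_set \<Gamma>\<close> is the intersection of these
  countably many sets.\<close>

lemma S_sets: "S_set \<Gamma> \<in> sets (borel_on T)"
proof -
 define U where "U p = (\<Union>x\<in>p_roots \<Gamma> p. {\<xi> \<in> A. \<xi> x \<in> - {x}})" for p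
 have "U p \<in> sets (borel_on T)" if p: "p \<in> primes" for p
 proof -
  interpret q: primary_part \<Gamma> p "\<nu> p" using p by (rule primary)
  have "x \<in> R" if "x \<in> p_roots \<Gamma> p" for x using that q.p_roots_subset p_root_closure_subset[OF q.p_ge(1)] by blast
  then have "openin T {\<xi> \<in> A. \<xi> x \<in> - {x}}" if "x \<in> p_roots \<Gamma> p" for x
   using openin_eval[OF mgrp_R, of x "- {x}"] that by (simp only: A_group_def)
  then have "openin T (U p)" unfolding U_def by (intro openin_Union) blast
  then show ?thesis by (simp add: sets_borel_on sigma_sets.Basic)
 qed
 moreover have "countable primes" by simp
 moreover have "primes ~= {}" using two_is_prime_nat by (auto simp: primes_def)
 ultimately have "(\<Inter>p\<in>primes. U p) \<in> sets (borel_on T)" by (intro sets.countable_INT') auto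
 moreover have "S_set \<Gamma> = (\<Inter>p\<in>primes. U p)"
 proof -
  have *: "restrict \<xi> (p_root_closure \<Gamma> p) \<in> Sp_set \<Gamma> p \<longleftrightarrow> \<xi> \<in> U p" if p: "p \<in> primes" and \<xi>: "\<xi> \<in> A" for p \<xi>
  proof -
   interpret q: primary_part \<Gamma> p "\<nu> p" using p by (rule primary)
   have "restrict \<xi> q.D \<in> carrier (rat_aut_group q.D)"
    using rat_aut_restrict[OF saturated_closures(1)[OF \<Gamma> q.p_ge(1)] q.saturated p_root_closure_subset[OF q.p_ge(1)]] \<xi>
    by (simp add: A_group_def)
   then show ?thesis using \<xi> q.p_roots_subset unfolding q.Sp_set_eq q.Ker_def U_def by auto
  qed
  have **: "A_to_product \<Gamma> \<xi> \<in> (\<Pi>\<^sub>E p\<in>primes. Sp_set \<Gamma> p) \<longleftrightarrow> (\<forall>p\<in>primes. \<xi> \<in> U p)" if "\<xi> \<in> A" for \<xi>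
   using *[OF _ that] by (auto simp: A_to_product_def PiE_iff)
  have "S_set \<Gamma> = {\<xi> \<in> A. \<forall>p\<in>primes. \<xi> \<in> U p}"
   unfolding S_set_def by (intro Collect_cong conj_cong **) simp_all
  moreover have "U p \<subseteq> A" for p by (auto simp: U_def)
  ultimately show ?thesis using \<open>primes ~= {}\<close> by blast
 qed
 ultimately show ?thesis by simp
qed

lemma measure_S: "measure (A_measure \<Gamma> \<nu>) (S_set \<Gamma>) = measure \<Omega> S'" using measure_A_measure[OF S_sets] S_vimage by simp

lemma finite_product_integral:
 fixes f :: "nat \<Rightarrow> (complex \<Rightarrow> complex) \<Rightarrow> complex"
 assumes K: "finite K" "K \<subseteq> primes" and f: "\<And>p. p \<in> K ==> integrable (\<nu> p) (f p)"
 shows "(\<integral>\<omega>. (\<Prod>p\<in>K. f p (\<omega> p)) \<partial>\<Omega>) = (\<Prod>p\<in>K. \<integral>\<xi>. f p \<xi> \<partial>\<nu> p)"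
proof -
 have eq: "\<nu>' p = \<nu> p" if "p \<in> K" for p using that K(2) by (auto simp: \<nu>'_def)
 have "(\<integral>\<omega>. (\<Prod>p\<in>K. f p (\<omega> p)) \<partial>\<Omega>) = (\<integral>\<omega>. (\<Prod>p\<in>K. f p (restrict \<omega> K p)) \<partial>Pi\<^sub>M primes \<nu>')"
  unfolding \<Omega>_eq by (intro Bochner_Integration.integral_cong prod.cong) auto
 also have "... = (\<integral>\<omega>. (\<Prod>p\<in>K. f p (\<omega> p)) \<partial>distr (Pi\<^sub>M primes \<nu>') (Pi\<^sub>M K \<nu>') (\<lambda>\<omega>. restrict \<omega> K))"
 proof (rule integral_distr[symmetric])
  show "(\<lambda>\<omega>. restrict \<omega> K) \<in> measurable (Pi\<^sub>M primes \<nu>') (Pi\<^sub>M K \<nu>')"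
   by (rule measurable_restrict_subset[OF K(2)])
  have "(\<lambda>\<omega>. f p (\<omega> p)) \<in> borel_measurable (Pi\<^sub>M K \<nu>')" if p: "p \<in> K" for p
   by (rule measurable_compose[OF measurable_component_singleton[OF p]])
     (use f[OF p] eq[OF p] in simp)
  then show "(\<lambda>\<omega>. \<Prod>p\<in>K. f p (\<omega> p)) \<in> borel_measurable (Pi\<^sub>M K \<nu>')" by (rule borel_measurable_prod)
 qed
 also have "... = (\<integral>\<omega>. (\<Prod>p\<in>K. f p (\<omega> p)) \<partial>Pi\<^sub>M K \<nu>')"
  unfolding P.distr_PiM_restrict_finite[OF K] ..
 also have "... = (\<Prod>p\<in>K. \<integral>\<xi>. f p \<xi> \<partial>\<nu>' p)"
  by (rule P.product_integral_prod[OF K(1)]) (use f eq in simp)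
 also have "... = (\<Prod>p\<in>K. \<integral>\<xi>. f p \<xi> \<partial>\<nu> p)" using eq by (intro prod.cong) simp_all
 finally show ?thesis .
qed

definition local_integral :: "nat \<Rightarrow> ((complex \<Rightarrow> complex) \<Rightarrow> complex) \<Rightarrow> complex"
 where "local_integral p \<psi> = (\<integral>\<xi>. indicator (Sp_set \<Gamma> p) \<xi> * \<psi> \<xi> \<partial>\<nu> p)"

abbreviation (input) K :: "nat \<Rightarrow> nat set" where "K n \<equiv> primes \<inter> {..n}"

lemma local_integral_one:
 assumes "p \<in> primes" shows "local_integral p (\<lambda>_. 1) = complex_of_real (measure (\<nu> p) (Sp_set \<Gamma> p))"
proof -
 interpret q: primary_part \<Gamma> p "\<nu> p" using assms by (rule primary)
 show ?thesis using q.integral_indicator_complex[OF q.Sp_sets] by (simp add: local_integral_def)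
qed

text \<open>Dominated convergence along the finite subproducts.\<close>

lemma integral_S'_limit:
 fixes \<psi> :: "nat \<Rightarrow> (complex \<Rightarrow> complex) \<Rightarrow> complex"
 assumes L: "finite L" "L \<subseteq> primes"
  and meas: "\<And>p. p \<in> L ==> \<psi> p \<in> borel_measurable (\<nu> p)"
  and bound: "\<And>p \<xi>. p \<in> L ==> \<xi> \<in> carrier (Ap_group \<Gamma> p) ==> norm (\<psi> p \<xi>) \<le> 1"
 shows "(\<lambda>n. \<Prod>p\<in>K n. local_integral p (if p \<in> L then \<psi> p else (\<lambda>_. 1))) \<longlonglongrightarrow>
  (\<integral>\<omega>. indicator S' \<omega> * (\<Prod>p\<in>L. \<psi> p (\<omega> p)) \<partial>\<Omega>)"
proof -
 define g where "g p = (if p \<in> L then \<psi> p else (\<lambda>_. 1))" for p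
 define f where "f p \<xi> = indicator (Sp_set \<Gamma> p) \<xi> * g p \<xi>" for p \<xi>
 define F where "F n \<omega> = (\<Prod>p\<in>K n. f p (\<omega> p))" for n \<omega>
 have g: "g p \<in> borel_measurable (\<nu> p)" "\<And>\<xi>. \<xi> \<in> carrier (Ap_group \<Gamma> p) ==> norm (g p \<xi>) \<le> 1"
  if "p \<in> primes" for p using meas bound by (auto simp: g_def)
 have f_int: "integrable (\<nu> p) (f p)" if p: "p \<in> primes" for p
 proof -
  interpret q: primary_part \<Gamma> p "\<nu> p" using p by (rule primary)
  show ?thesis unfolding f_def using q.bounded_integrable[OF g(1)[OF p] _ q.Sp_sets] g(2)[OF p] by (simp add: Ap_group_def)
 qed
 have f_bound: "norm (f p \<xi>) \<le> 1" if "p \<in> primes" "\<xi> \<in> carrier (Ap_group \<Gamma> p)" for p \<xi>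
  using g(2)[OF that] by (simp add: f_def norm_mult indicator_def)
 \<comment> \<open>For fixed \<omega> the finite products are eventually constant: equal to the
   limit once all primes of \<open>L\<close> occur, and 0 once a prime \<open>q\<close> with
   \<open>\<omega> q\<close> outside \<open>Sp_set \<Gamma> q\<close> occurs.\<close>
 have limF: "(\<lambda>n. F n \<omega>) \<longlonglongrightarrow> indicator S' \<omega> * (\<Prod>p\<in>L. \<psi> p (\<omega> p))" if \<omega>: "\<omega> \<in> space \<Omega>" for \<omega>
 proof (rule tendsto_eventually)
  obtain n0 where n0: "\<And>p. p \<in> L ==> p \<le> n0" using L(1) by (metis finite_nat_set_iff_bounded_le)
  show "\<forall>\<^sub>F n in sequentially. F n \<omega> = indicator S' \<omega> * (\<Prod>p\<in>L. \<psi> p (\<omega> p))"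
  proof (cases "\<omega> \<in> S'")
   case True
   have "F n \<omega> = indicator S' \<omega> * (\<Prod>p\<in>L. \<psi> p (\<omega> p))" if n: "n \<ge> n0" for n
   proof -
    have "F n \<omega> = (\<Prod>p\<in>K n. g p (\<omega> p))" unfolding F_def f_def using True by (intro prod.cong) (auto simp: S'_def PiE_iff)
    also have "... = (\<Prod>p\<in>L. g p (\<omega> p))" using L(2) n0 n by (intro prod.mono_neutral_right) (auto simp: g_def intro: order_trans)
    also have "... = (\<Prod>p\<in>L. \<psi> p (\<omega> p))" by (intro prod.cong) (auto simp: g_def)
    finally show ?thesis using True by simp
   qed
   then show ?thesis by (auto simp: eventually_sequentially)
  next
   case False
   then obtain q where q: "q \<in> primes" "\<omega> q \<notin> Sp_set \<Gamma> q" using \<omega> by (auto simp: S'_def space_\<Omega> PiE_iff)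
   have "F n \<omega> = indicator S' \<omega> * (\<Prod>p\<in>L. \<psi> p (\<omega> p))" if "n \<ge> q" for n
   proof -
    have "F n \<omega> = 0" unfolding F_def using q that by (intro prod_zero) (auto simp: f_def intro!: bexI[of _ q])
    then show ?thesis using False by simp
   qed
   then show ?thesis by (auto simp: eventually_sequentially)
  qed
 qed
 have F_meas: "F n \<in> borel_measurable \<Omega>" for n unfolding F_def by (intro borel_measurable_prod component_measurable) (use f_int in auto)
 have "(\<lambda>n. \<integral>\<omega>. F n \<omega> \<partial>\<Omega>) \<longlonglongrightarrow> (\<integral>\<omega>. indicator S' \<omega> * (\<Prod>p\<in>L. \<psi> p (\<omega> p)) \<partial>\<Omega>)"
 proof (rule integral_dominated_convergence[where w = "\<lambda>_. 1"])
  show "(\<lambda>\<omega>. indicator S' \<omega> * (\<Prod>p\<in>L. \<psi> p (\<omega> p))) \<in> borel_measurable \<Omega>"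
   by (rule borel_measurable_LIMSEQ_metric[OF F_meas limF])
  show "AE \<omega> in \<Omega>. (\<lambda>n. F n \<omega>) \<longlonglongrightarrow> indicator S' \<omega> * (\<Prod>p\<in>L. \<psi> p (\<omega> p))"
   using limF by (rule AE_I2)
  show "AE \<omega> in \<Omega>. norm (F n \<omega>) \<le> 1" for n
  proof (rule AE_I2)
   fix \<omega> assume "\<omega> \<in> space \<Omega>"
   then show "norm (F n \<omega>) \<le> 1" unfolding F_def prod_norm[symmetric] using f_bound component_in by (intro prod_le_1) auto
  qed
 qed (use F_meas in auto)
 moreover have "(\<integral>\<omega>. F n \<omega> \<partial>\<Omega>) = (\<Prod>p\<in>K n. local_integral p (g p))" for n
  unfolding F_def using finite_product_integral[of "K n" f] f_int by (simp add: f_def local_integral_def)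
 ultimately show ?thesis by (simp add: g_def)
qed

lemma measure_S'_limit: "(\<lambda>n. \<Prod>p\<in>K n. measure (\<nu> p) (Sp_set \<Gamma> p)) \<longlonglongrightarrow> measure \<Omega> S'"
proof -
 have "S' \<in> sets \<Omega>" using measurable_sets[OF J_measurable S_sets] S_vimage by simp
 have "(\<integral>\<omega>. indicator S' \<omega> * 1 \<partial>\<Omega>) = complex_of_real (measure \<Omega> S')"
 proof -
  have "(\<lambda>\<omega>. indicator S' \<omega> :: complex) = (\<lambda>\<omega>. complex_of_real (indicator S' \<omega>))"
   by (auto simp: indicator_def)
  moreover have "(\<integral>\<omega>. (indicator S' \<omega> :: real) \<partial>\<Omega>) = measure \<Omega> S'"
   by (rule has_bochner_integral_integral_eq[OF has_bochner_integral_real_indicator[OF \<open>S' \<in> sets \<Omega>\<close>]])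
     (simp add: emeasure_finite less_top[symmetric])
  ultimately show ?thesis by simp
 qed
 moreover have "(\<Prod>p\<in>K n. local_integral p (\<lambda>_. 1)) =
   complex_of_real (\<Prod>p\<in>K n. measure (\<nu> p) (Sp_set \<Gamma> p))" for n by (simp add: local_integral_one)
 ultimately have "(\<lambda>n. complex_of_real (\<Prod>p\<in>K n. measure (\<nu> p) (Sp_set \<Gamma> p))) \<longlonglongrightarrow> complex_of_real (measure \<Omega> S')"
  using integral_S'_limit[of "{}" "\<lambda>_ _. 1"] by simp
 then show ?thesis by (simp only: tendsto_of_real_iff)
qed

text \<open>Only the finitely many primes of \<open>L\<close> have a modified factor, so eventually
  the partial products are a constant multiple of those for the measure of \<open>S'\<close>. By
  \<open>nz\<close> this constant can be written with quotients by the local masses.\<close>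

lemma integral_S':
 fixes \<psi> :: "nat \<Rightarrow> (complex \<Rightarrow> complex) \<Rightarrow> complex"
 assumes L: "finite L" "L \<subseteq> primes"
  and meas: "\<And>p. p \<in> L ==> \<psi> p \<in> borel_measurable (\<nu> p)"
  and bound: "\<And>p \<xi>. p \<in> L ==> \<xi> \<in> carrier (Ap_group \<Gamma> p) ==> norm (\<psi> p \<xi>) \<le> 1"
  and nz: "\<And>p. p \<in> L ==> measure (\<nu> p) (Sp_set \<Gamma> p) ~= 0"
 shows "(\<integral>\<omega>. indicator S' \<omega> * (\<Prod>p\<in>L. \<psi> p (\<omega> p)) \<partial>\<Omega>) =
  (\<Prod>p\<in>L. local_integral p (\<psi> p) / complex_of_real (measure (\<nu> p) (Sp_set \<Gamma> p))) *
  complex_of_real (measure \<Omega> S')"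
proof -
 let ?c = "\<lambda>p. complex_of_real (measure (\<nu> p) (Sp_set \<Gamma> p))"
 let ?g = "\<lambda>p. local_integral p (if p \<in> L then \<psi> p else (\<lambda>_. 1))"
 define a where "a = (\<Prod>p\<in>L. local_integral p (\<psi> p) / ?c p)"
 obtain n0 where n0: "\<And>p. p \<in> L ==> p \<le> n0" using L(1) by (metis finite_nat_set_iff_bounded_le)
 have eq: "(\<Prod>p\<in>K n. ?g p) = a * (\<Prod>p\<in>K n. ?c p)" if "n \<ge> n0" for n
 proof -
  have "L \<subseteq> K n" using L(2) n0 that by (auto intro: order_trans)
  have "(\<Prod>p\<in>K n. ?g p) = (\<Prod>p\<in>K n. (if p \<in> L then local_integral p (\<psi> p) / ?c p else 1) * ?c p)"
   by (rule prod.cong) (use nz in \<open>auto simp: local_integral_one\<close>)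
  also have "... = (\<Prod>p\<in>K n. if p \<in> L then local_integral p (\<psi> p) / ?c p else 1) * (\<Prod>p\<in>K n. ?c p)"
   by (rule prod.distrib)
  also have "(\<Prod>p\<in>K n. if p \<in> L then local_integral p (\<psi> p) / ?c p else 1) = a"
   unfolding a_def using \<open>L \<subseteq> K n\<close> by (intro prod.mono_neutral_cong_right) auto
  finally show ?thesis .
 qed
 have "(\<lambda>n. a * complex_of_real (\<Prod>p\<in>K n. measure (\<nu> p) (Sp_set \<Gamma> p))) \<longlonglongrightarrow> a * complex_of_real (measure \<Omega> S')"
  by (intro tendsto_mult tendsto_const tendsto_of_real measure_S'_limit)
 then have "(\<lambda>n. \<Prod>p\<in>K n. ?g p) \<longlonglongrightarrow> a * complex_of_real (measure \<Omega> S')"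
  by (rule Lim_transform_eventually) (unfold eventually_sequentially, intro exI[of _ n0] allI impI, simp only: eq of_real_prod)
 then show ?thesis using LIMSEQ_unique[OF integral_S'_limit[OF L meas bound]] by (simp add: a_def)
qed

end

section \<open>Local characters\<close>

lemma lext_fixed:
 assumes "\<And>x. x \<in> W ==> s x = x" "y \<in> qspan W" shows "lext W s y = y"
proof -
 have R: "relpres W s" unfolding relpres_def
 proof (intro allI impI)
  fix B c assume "B \<subseteq> W" "(\<Sum>x\<in>B. c x * x) = 0"
  moreover have "(\<Sum>x\<in>B. c x * s x) = (\<Sum>x\<in>B. c x * x)" by (rule sum.cong) (use assms(1) \<open>B \<subseteq> W\<close> in auto)
  ultimately show "(\<Sum>x\<in>B. c x * s x) = 0" by simp
 qed
 obtain B c where B: "finite B" "B \<subseteq> W" "\<And>x. x \<in> B ==> c x \<in> \<rat>" "y = (\<Sum>x\<in>B. c x * x)"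
  using assms(2) by (rule qspanE) blast
 have "lext W s (\<Sum>x\<in>B. c x * x) = (\<Sum>x\<in>B. c x * s x)" using B(1-3) by (intro lext_family[OF R]) auto
 also have "... = (\<Sum>x\<in>B. c x * x)" by (rule sum.cong) (use assms(1) B(2) in auto)
 finally show ?thesis using B(4) by simp
qed

context primary_part
begin

lemma integral_nontrivial:
 fixes \<psi> :: "(complex \<Rightarrow> complex) \<Rightarrow> complex"
 assumes "\<psi> \<in> borel_measurable \<mu>"
  and hom: "\<And>g \<xi>. g \<in> A ==> \<xi> \<in> A ==> \<psi> (compose D g \<xi>) = \<psi> g * \<psi> \<xi>"
  and g: "g \<in> A" "\<psi> g ~= 1" shows "(\<integral>\<xi>. \<psi> \<xi> \<partial>\<mu>) = 0"
proof -
 have "(\<integral>\<xi>. \<psi> \<xi> \<partial>\<mu>) = (\<integral>\<xi>. indicator A \<xi> * \<psi> \<xi> \<partial>\<mu>)"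
  by (rule Bochner_Integration.integral_cong) (simp_all add: space_eq)
 then show ?thesis using integral_A_nontrivial[where \<psi> = \<psi> and g = g, OF assms(1) hom g] by simp
qed

text \<open>The character is trivial on \<open>Ker\<close>, which fixes \<open>mu p\<close>. It is
  nontrivial on \<open>A\<close>, since otherwise all power maps would fix \<open>gauss p\<close>
  and it would be rational.\<close>

lemma gauss_character:
 assumes "odd p" shows "qchar p (gauss p) \<in> borel_measurable \<mu>"
  and "\<xi> \<in> A ==> norm (qchar p (gauss p) \<xi>) \<le> 1"
  and "(\<integral>\<xi>. qchar p (gauss p) \<xi> \<partial>\<mu>) = 0"
  and "(\<integral>\<xi>. indicator (Sp_set \<Gamma> p) \<xi> * qchar p (gauss p) \<xi> \<partial>\<mu>) = - complex_of_real (measure \<mu> Ker)"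
proof -
 have g0: "gauss p ~= 0" using gauss_not_Rats[OF p assms] by auto
 interpret q: qchar_data D p "gauss p" by unfold_locales (use mgrp p_ge mu_p_D gauss_in_qspan g0 gauss_square[OF assms] in auto)
 show meas: "qchar p (gauss p) \<in> borel_measurable \<mu>" by (rule qchar_measurable[OF q.n q.z(1)])
 show bound: "norm (qchar p (gauss p) \<xi>) \<le> 1" if "\<xi> \<in> A" for \<xi> using q.qchar_values[OF that] by auto
 have "\<exists>g\<in>A. qchar p (gauss p) g ~= 1"
 proof (rule ccontr)
  assume "\<not> ?thesis"
  then have all1: "qchar p (gauss p) g = 1" if "g \<in> A" for g using that by blast
  have "lext (mu p) (\<lambda>z. z ^ k) (gauss p) = gauss p" if k: "k < p" "Rings.coprime k p" for k
  proof -
   have "1 \<le> k" using k p_ge(2) by (cases k) auto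
   then obtain g where g: "g \<in> A" "\<And>z. z \<in> mu p ==> g z = z ^ k" using ex_aut_zeta_power[OF _ k(1)] by metis
   have "lext (mu p) (\<lambda>z. z ^ k) (gauss p) = lext (mu p) g (gauss p)"
    by (rule lext_subset[OF relpres_mu_of_aut(1)[OF mgrp q.n g(1)] subset_refl _ q.z(1)]) (simp add: g(2))
   then show ?thesis using q.lext_eq_qchar[of g] all1[OF g(1)] by simp
  qed
  then have "gauss p \<in> \<rat>" by (rule cyclotomic_fixed_Rats[OF q.n(1) q.z(1)])
  then show False using gauss_not_Rats[OF p assms] by simp
 qed
 then obtain g where g: "g \<in> A" "qchar p (gauss p) g ~= 1" by blast
 show "(\<integral>\<xi>. qchar p (gauss p) \<xi> \<partial>\<mu>) = 0"
  by (rule integral_nontrivial[where \<psi> = "qchar p (gauss p)" and g = g, OF meas q.qchar_compose g])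
 have triv: "qchar p (gauss p) \<xi> = 1" if "\<xi> \<in> Ker" for \<xi>
 proof -
  have "lext (mu p) \<xi> (gauss p) = gauss p" by (rule lext_fixed[OF _ q.z(1)]) (use that mu_roots in \<open>auto simp: Ker_def\<close>)
  then show ?thesis using g0 by (simp add: qchar_def)
 qed
 show "(\<integral>\<xi>. indicator (Sp_set \<Gamma> p) \<xi> * qchar p (gauss p) \<xi> \<partial>\<mu>) = - complex_of_real (measure \<mu> Ker)"
  by (rule integral_Sp_trivial_Ker[where \<psi> = "qchar p (gauss p)" and g = g, OF meas bound q.qchar_compose g triv])
qed

lemma sqrt_sign:
 assumes y: "y \<in> D" "y ^ 2 \<in> \<rat>" and \<xi>: "\<xi> \<in> A" shows "\<xi> y = y \<or> \<xi> y = - y"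
proof -
 have h: "mhom D \<xi>" "\<forall>x\<in>D \<inter> \<rat>. \<xi> x = x" using \<xi> carrier_iff by auto
 have "\<xi> y ^ 2 = \<xi> (y ^ 2)" using mhom_power[OF mgrp h(1) y(1)] by simp
 also have "... = y ^ 2" using h(2) y mgrp_power[OF mgrp y(1)] by simp
 finally show ?thesis by (rule square_eq_square)
qed

lemma sqrt_character:
 assumes y: "y \<in> D" "y ^ 2 \<in> \<rat>" shows "(\<lambda>\<xi>. \<xi> y / y) \<in> borel_measurable \<mu>"
  and "\<xi> \<in> A ==> norm (\<xi> y / y) \<le> 1"
  and "g \<in> A ==> \<xi> \<in> A ==> compose D g \<xi> y / y = (g y / y) * (\<xi> y / y)"
proof -
 have y0: "y ~= 0" using mgrp_nonzero[OF mgrp y(1)] .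
 show "(\<lambda>\<xi>. \<xi> y / y) \<in> borel_measurable \<mu>" by (rule borel_measurable_divide[OF eval_borel[OF y(1)]]) simp
 show "norm (\<xi> y / y) \<le> 1" if "\<xi> \<in> A" using sqrt_sign[OF y that] y0 by (auto simp: norm_divide)
 show "compose D g \<xi> y / y = (g y / y) * (\<xi> y / y)" if g: "g \<in> A" and \<xi>: "\<xi> \<in> A"
 proof -
  have h: "mhom D g" "\<forall>x\<in>D \<inter> \<rat>. g x = x" using g carrier_iff by auto
  have w: "\<xi> y / y \<in> D" by (rule mgrp_divide[OF mgrp aut_values[OF \<xi> y(1)] y(1)])
  have "\<xi> y / y = 1 \<or> \<xi> y / y = - 1" using sqrt_sign[OF y \<xi>] y0 by auto
  then have "\<xi> y / y \<in> \<rat>" by auto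
  then have "g (\<xi> y / y) = \<xi> y / y" using h(2) w by blast
  moreover have "g (\<xi> y) = g (\<xi> y / y) * g y" using mhom_mult[OF h(1) w y(1)] y0 by simp
  ultimately show ?thesis using y(1) by (simp add: compose_def)
 qed
qed

text \<open>For \<open>p = 2\<close> the group \<open>mu p\<close> consists of rational numbers, so
  a homomorphism fixing the rationals satisfies the criterion \<open>aut_of_hom\<close>.\<close>

lemma fixing_automorphism:
 assumes p2: "p = 2" and B: "mgrp B" "\<rat> - {0} \<subseteq> B" and y: "y ~= 0" "y \<notin> B"
 obtains g where "mhom (- {0}) g" "\<And>b. b \<in> B ==> g b = b" "g y ~= y" "restrict g D \<in> A"
proof -
 obtain g where g: "mhom (- {0}) g" "\<And>b. b \<in> B ==> g b = b" "g y ~= y"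
  using mhom_extend_avoiding[OF B(1) mhom_id[OF B(1)] y] by metis
 have "restrict g D \<in> A"
 proof (rule aut_of_hom[OF g(1)])
  show "g x = x" if "x \<in> \<rat> - {0}" for x using that g(2) B(2) by blast
  fix z assume z: "z \<in> mu p" "g z = 1"
  then have "z ^ 2 = 1 ^ 2" using p2 by (simp add: mu_def)
  then have "z = 1 \<or> z = - 1" by (rule square_eq_square)
  then have "z \<in> \<rat> - {0}" by auto
  then show "z = 1" using g(2) B(2) z(2) by (metis subsetD)
 qed
 then show thesis using g by (intro that) auto
qed

text \<open>For rational \<open>y\<close> the character is trivial. For irrational \<open>y\<close>
  it is trivial on \<open>Ker\<close> if \<open>y\<close> is a rational multiple of a square root of
  an element of \<Gamma>; otherwise \<open>y\<close> is not in the group generated by such roots and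
  the rationals, and some element of \<open>Ker\<close> moves it.\<close>

lemma sqrt_character_integral:
 assumes p2: "p = 2" and y: "y \<in> D" "y ^ 2 \<in> \<rat>"
 shows "(\<integral>\<xi>. \<xi> y / y \<partial>\<mu>) = (if y \<in> \<rat> then 1 else 0)" (is ?I)
  and "(\<integral>\<xi>. indicator (Sp_set \<Gamma> p) \<xi> * (\<xi> y / y) \<partial>\<mu>) =
   (if y \<in> \<rat> then complex_of_real (measure \<mu> (Sp_set \<Gamma> p))
    else if pclass 2 (y ^ 2) \<in> power_classes \<Gamma> 2 then - complex_of_real (measure \<mu> Ker) else 0)" (is ?II)
proof -
 note ch = sqrt_character[OF y]
 have y0: "y ~= 0" using mgrp_nonzero[OF mgrp y(1)] .
 have "?I \<and> ?II"
 proof (cases "y \<in> \<rat>")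
  case True
  have one: "\<xi> y / y = 1" if "\<xi> \<in> A" for \<xi> using that carrier_iff True y(1) y0 by auto
  have "(\<integral>\<xi>. \<xi> y / y \<partial>\<mu>) = (\<integral>\<xi>. 1 \<partial>\<mu>)"
   by (rule Bochner_Integration.integral_cong) (simp_all add: space_eq one)
  moreover have "(\<integral>\<xi>. indicator (Sp_set \<Gamma> p) \<xi> * (\<xi> y / y) \<partial>\<mu>) = (\<integral>\<xi>. indicator (Sp_set \<Gamma> p) \<xi> \<partial>\<mu>)"
   by (rule Bochner_Integration.integral_cong) (simp_all add: space_eq one)
  ultimately show ?thesis using True integral_indicator_complex[OF Sp_sets] prob_space by simp
 next
  case False
  obtain g where g: "mhom (- {0}) g" "g y ~= y" "restrict g D \<in> A"
   using fixing_automorphism[OF p2 mgrp_Rats subset_refl y0] False by (metis Diff_iff)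
  have gy: "restrict g D y / y ~= 1" using g(2) y(1) y0 by simp
  have "(\<integral>\<xi>. \<xi> y / y \<partial>\<mu>) = 0"
   by (rule integral_nontrivial[where \<psi> = "\<lambda>\<xi>. \<xi> y / y" and g = "restrict g D"]) (rule ch g(3) gy; assumption)+
  then have I: ?I using False by simp
  show ?thesis
  proof (cases "pclass 2 (y ^ 2) \<in> power_classes \<Gamma> 2")
   case True
   then obtain c where c: "c \<in> \<Gamma>" "pclass 2 (y ^ 2) = pclass 2 c" by (auto simp: power_classes_def)
   have "y ^ 2 / c \<in> rat_powers 2" using c(2) pclass_eq_iff y0 mgrp_nonzero[OF \<Gamma>(1) c(1)] by simp
   then obtain q where q: "q \<in> \<rat> - {0}" "y ^ 2 / c = q ^ 2" by (auto simp: rat_powers_def)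
   have "(y / q) ^ 2 = c" using q mgrp_nonzero[OF \<Gamma>(1) c(1)] by (simp add: power_divide field_simps)
   then have yq: "y / q \<in> p_roots \<Gamma> p" using c(1) q(1) y0 p2 by (simp add: p_roots_def)
   have "\<xi> y / y = 1" if \<xi>: "\<xi> \<in> Ker" for \<xi>
   proof -
    have h: "mhom D \<xi>" "\<forall>x\<in>D \<inter> \<rat>. \<xi> x = x" using \<xi> carrier_iff by (auto simp: Ker_def)
    have "y / q \<in> D" using yq p_roots_subset by blast
    then have "y / (y / q) \<in> D" by (rule mgrp_divide[OF mgrp y(1)])
    then have qD: "q \<in> D" using y0 by simp
    have "\<xi> (y / q) = y / q" using \<xi> yq by (simp add: Ker_def)
    moreover have "\<xi> q = q" using h(2) qD q(1) by blast
    moreover have "\<xi> (y / q) = \<xi> y / \<xi> q" by (rule mhom_divide[OF mgrp h(1) y(1) qD])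
    ultimately show ?thesis using q(1) y0 by simp
   qed
   then have triv: "\<And>\<xi>. \<xi> \<in> Ker ==> \<xi> y / y = 1" .
   have "(\<integral>\<xi>. indicator (Sp_set \<Gamma> p) \<xi> * (\<xi> y / y) \<partial>\<mu>) = - complex_of_real (measure \<mu> Ker)"
    by (rule integral_Sp_trivial_Ker[where \<psi> = "\<lambda>\<xi>. \<xi> y / y" and g = "restrict g D"]) (rule ch g(3) gy triv; assumption)+
   then show ?thesis using I False True by simp
  next
   case nc: False
   define B where "B = {u * q | u q. u \<in> p_roots \<Gamma> p \<and> q \<in> \<rat> - {0}}"
   have B: "mgrp B" unfolding mgrp_def
   proof (intro conjI ballI)
    show "1 \<in> B" unfolding B_def using mgrp_one[OF mgrp_roots] by (intro CollectI exI[of _ 1]) auto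
    show "0 \<notin> B" using mgrp_nonzero[OF mgrp_roots] by (auto simp: B_def)
    fix x assume "x \<in> B"
    then obtain u q where x: "x = u * q" "u \<in> p_roots \<Gamma> p" "q \<in> \<rat> - {0}" by (auto simp: B_def)
    have "inverse x = inverse u * inverse q" "inverse u \<in> p_roots \<Gamma> p" "inverse q \<in> \<rat> - {0}"
     using x mgrp_inverse[OF mgrp_roots] by auto
    then show "inverse x \<in> B" unfolding B_def by blast
    fix z assume "z \<in> B"
    then obtain v r where z: "z = v * r" "v \<in> p_roots \<Gamma> p" "r \<in> \<rat> - {0}" by (auto simp: B_def)
    have "x * z = (u * v) * (q * r)" "u * v \<in> p_roots \<Gamma> p" "q * r \<in> \<rat> - {0}" using x z mgrp_mult[OF mgrp_roots] by auto
    then show "x * z \<in> B" unfolding B_def by blast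
   qed
   have ratB: "\<rat> - {0} \<subseteq> B"
   proof
    fix q :: complex assume "q \<in> \<rat> - {0}"
    moreover have "q = 1 * q" by simp
    ultimately show "q \<in> B" unfolding B_def using mgrp_one[OF mgrp_roots] by blast
   qed
   have rootsB: "p_roots \<Gamma> p \<subseteq> B"
   proof
    fix u assume "u \<in> p_roots \<Gamma> p"
    moreover have "u = u * 1" "1 \<in> \<rat> - {0 :: complex}" by auto
    ultimately show "u \<in> B" unfolding B_def by blast
   qed
   have "y \<notin> B"
   proof
    assume "y \<in> B"
    then obtain u q where yu: "y = u * q" "u \<in> p_roots \<Gamma> p" "q \<in> \<rat> - {0}" by (auto simp: B_def)
    have u: "u ^ 2 \<in> \<Gamma>" "u ~= 0" using yu(2) p2 by (auto simp: p_roots_def)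
    have "y ^ 2 / u ^ 2 = q ^ 2" using yu(1) u(2) by (simp add: power_mult_distrib)
    then have "y ^ 2 / u ^ 2 \<in> rat_powers 2" using yu(3) by (auto simp: rat_powers_def)
    then have "pclass 2 (y ^ 2) = pclass 2 (u ^ 2)" using pclass_eq_iff[of "y ^ 2" "u ^ 2" 2] y0 u(2) by simp
    then show False using nc u(1) by (auto simp: power_classes_def)
   qed
   then obtain f where f: "mhom (- {0}) f" "\<And>b. b \<in> B ==> f b = b" "f y ~= y" "restrict f D \<in> A"
    using fixing_automorphism[OF p2 B ratB y0] by metis
   have "restrict f D \<in> Ker" unfolding Ker_def using f(2,4) rootsB p_roots_subset by (auto simp: subset_iff)
   note fK = this
   have fy: "restrict f D y / y ~= 1" using f(3) y(1) y0 by simp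
   have "(\<integral>\<xi>. indicator (Sp_set \<Gamma> p) \<xi> * (\<xi> y / y) \<partial>\<mu>) = 0"
    by (rule integral_Sp_nontrivial_Ker[where \<psi> = "\<lambda>\<xi>. \<xi> y / y" and g = "restrict f D"]) (rule ch fK fy; assumption)+
   then show ?thesis using I False nc by simp
  qed
 qed
 then show ?I ?II by blast+
qed

text \<open>A group automorphism can fix all square roots of rational numbers as radicals and still
  send \<open>zeta 8\<close> to \<open>- zeta 8\<close>. The sum of roots of unity defining
  \<open>sqrt_two\<close> then changes sign under \<open>lext\<close>, while \<open>y\<close> stays
  fixed. Such an automorphism lies in \<open>Ker\<close>, so both integrals vanish; even squarefree
  numbers therefore contribute nothing.\<close>

lemma sqrt_two_character_integral:
 assumes p2: "p = 2" and y: "y \<in> D" "y ^ 2 \<in> \<rat>" and z: "z = sqrt_two \<or> z = \<i> * sqrt_two"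
 defines "\<psi> \<equiv> \<lambda>\<xi>. (\<xi> y / y) * qchar 8 z \<xi>"
 shows "\<psi> \<in> borel_measurable \<mu>" "\<xi> \<in> A ==> norm (\<psi> \<xi>) \<le> 1"
  "(\<integral>\<xi>. \<psi> \<xi> \<partial>\<mu>) = 0" "(\<integral>\<xi>. indicator (Sp_set \<Gamma> p) \<xi> * \<psi> \<xi> \<partial>\<mu>) = 0"
proof -
 have y0: "y ~= 0" using mgrp_nonzero[OF mgrp y(1)] .
 have mu8: "mgrp (mu 8)" by (rule mgrp_mu) simp
 have z8: "zeta 8 \<in> mu 8" by (rule zeta_in_mu) simp
 have st: "sqrt_two \<in> qspan (mu 8)" unfolding sqrt_two_def by (intro qspan_add qspan_base mgrp_inverse[OF mu8] z8)
 have ii: "\<i> \<in> mu 8" using zeta_8_square mgrp_power[OF mu8 z8, of 2] by simp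
 have zq: "z \<in> qspan (mu 8)" using z st qspan_mult[OF mu8 qspan_base[OF ii] st] by auto
 have st0: "sqrt_two ~= 0" using sqrt_two_square by auto
 have zz: "z ~= 0" "z ^ 2 \<in> \<rat>" using z st0 sqrt_two_square by (auto simp: power_mult_distrib)
 have muD: "mu 8 \<subseteq> D" using mu_D[of 3] p2 by simp
 interpret q: qchar_data D 8 z by unfold_locales (use mgrp muD zq zz in auto)
 note ch = sqrt_character[OF y]
 show meas: "\<psi> \<in> borel_measurable \<mu>" unfolding \<psi>_def by (intro borel_measurable_times ch(1) qchar_measurable[OF q.n q.z(1)])
 show bound: "norm (\<psi> \<xi>) \<le> 1" if "\<xi> \<in> A" for \<xi>
  using ch(2)[OF that] q.qchar_values[OF that] by (auto simp: \<psi>_def norm_mult)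
 have hom: "\<psi> (compose D g \<xi>) = \<psi> g * \<psi> \<xi>" if "g \<in> A" "\<xi> \<in> A" for g \<xi>
  unfolding \<psi>_def ch(3)[OF that] q.qchar_compose[OF that] by simp
 define B where "B = {x :: complex. x ~= 0 \<and> x ^ 2 \<in> \<rat>}"
 have B: "mgrp B" by (auto simp: mgrp_def B_def power_mult_distrib power_inverse)
 have "zeta 8 \<notin> B"
 proof
  assume "zeta 8 \<in> B"
  then have "\<i> \<in> \<rat>" using zeta_8_square by (simp add: B_def)
  then have "\<i> \<in> \<real>" by (rule Rats_imp_Reals)
  then show False by (simp add: complex_is_Real_iff)
 qed
 moreover have "\<rat> - {0} \<subseteq> B" by (auto simp: B_def)
 ultimately obtain g where g: "mhom (- {0}) g" "\<And>b. b \<in> B ==> g b = b" "g (zeta 8) ~= zeta 8" "restrict g D \<in> A"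
  using fixing_automorphism[OF p2 B _ zeta_nonzero] by metis
 let ?g = "restrict g D"
 have rootsB: "p_roots \<Gamma> p \<subseteq> B" using \<Gamma>(2) p2 by (auto simp: p_roots_def B_def)
 have Ker: "?g \<in> Ker" unfolding Ker_def using g(2,4) rootsB p_roots_subset by (auto simp: subset_iff)
 have C: "mgrp (- {0})" by (auto simp: mgrp_def)
 have iB: "\<i> \<in> B" by (simp add: B_def)
 have "g (zeta 8) ^ 2 = g (zeta 8 ^ 2)" using mhom_power[OF C g(1), of "zeta 8" 2] zeta_nonzero by simp
 also have "... = zeta 8 ^ 2" unfolding zeta_8_square by (rule g(2)[OF iB])
 finally have gz: "g (zeta 8) = - zeta 8" using square_eq_square g(3) by blast
 have gz': "g (inverse (zeta 8)) = - inverse (zeta 8)" using mhom_inverse[OF C g(1), of "zeta 8"] gz zeta_nonzero by simp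
 note R = relpres_mu_of_aut[OF mgrp q.n g(4)]
 have "lext (mu 8) ?g sqrt_two = lext (mu 8) ?g (zeta 8) + lext (mu 8) ?g (inverse (zeta 8))"
  unfolding sqrt_two_def by (rule lext_add[OF R(1)]; intro qspan_base mgrp_inverse[OF mu8] z8)
 also have "... = - sqrt_two" using lext_base[OF R(1)] z8 mgrp_inverse[OF mu8 z8] muD gz gz' by (auto simp: sqrt_two_def subset_iff)
 finally have lst: "lext (mu 8) ?g sqrt_two = - sqrt_two" .
 moreover have "lext (mu 8) ?g (\<i> * sqrt_two) = - (\<i> * sqrt_two)"
  using lext_mult[OF R(1) mu8 R(2) qspan_base[OF ii] st] lext_base[OF R(1) ii] g(2)[OF iB] ii muD lst by auto
 ultimately have "lext (mu 8) ?g z = - z" using z by blast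
 then have "qchar 8 z ?g = - 1" using zz(1) by (simp add: qchar_def)
 moreover have "?g y / y = 1" using g(2) y y0 by (simp add: B_def)
 ultimately have gpsi: "\<psi> ?g ~= 1" by (simp add: \<psi>_def)
 show "(\<integral>\<xi>. \<psi> \<xi> \<partial>\<mu>) = 0"
  by (rule integral_nontrivial[where \<psi> = \<psi> and g = ?g, OF meas hom g(4) gpsi])
 show "(\<integral>\<xi>. indicator (Sp_set \<Gamma> p) \<xi> * \<psi> \<xi> \<partial>\<mu>) = 0"
  by (rule integral_Sp_nontrivial_Ker[where \<psi> = \<psi> and g = ?g, OF meas bound hom Ker gpsi])
qed

end

text \<open>The sign is chosen so that each odd prime contributes a factor congruent to 1 modulo 4.\<close>

lemma squarefree_pstar_decomposition:
 assumes m: "squarefree (m :: int)"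
 defines "P \<equiv> {p. Factorial_Ring.prime p \<and> odd p \<and> int p dvd m}"
 obtains e where "e \<in> {1, -1, 2, -2}" "m = e * (\<Prod>p\<in>P. pstar p)" "finite P"
  "(\<Prod>p\<in>P. pstar p) mod 4 = 1"
proof -
 have m0: "m ~= 0" using m by auto
 have fin: "finite P"
 proof (rule finite_subset)
  show "P \<subseteq> {..nat \<bar>m\<bar>}"
  proof
   fix p assume "p \<in> P"
   then have "int p \<le> \<bar>m\<bar>" using dvd_imp_le_int[OF m0, of "int p"] by (simp add: P_def)
   then show "p \<in> {..nat \<bar>m\<bar>}" by simp
  qed
 qed simp
 have ps4: "pstar p mod 4 = 1" if "odd p" for p
 proof -
  obtain k where k: "p = 2 * k + 1" using \<open>odd p\<close> by (rule oddE)
  show ?thesis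
  proof (cases "even k")
   case True
   then have "pstar p = int p" using k by (simp add: pstar_def)
   moreover have "int p mod 4 = 1" using k True by (auto elim!: evenE)
   ultimately show ?thesis by simp
  next
   case False
   then have "pstar p = - int p" using k by (simp add: pstar_def)
   moreover obtain l where "k = 2 * l + 1" using False by (rule oddE)
   then have "- int p = 4 * (- int l - 1) + 1" using k by simp
   ultimately show ?thesis by presburger
  qed
 qed
 have prod4: "prod pstar Q mod 4 = 1" if "finite Q" "Q \<subseteq> P" for Q using that
 proof (induction Q rule: finite_induct)
  case (insert q Q)
  then have "pstar q mod 4 = 1" using ps4 by (auto simp: P_def)
  moreover have "prod pstar Q mod 4 = 1" using insert by simp
  ultimately have "(pstar q mod 4 * (prod pstar Q mod 4)) mod 4 = 1" by simp
  then show ?case unfolding mod_mult_eq using insert(1,2) by simp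
 qed simp
 have ps_abs: "\<bar>pstar p\<bar> = int p" for p by (simp add: pstar_def abs_mult power_abs)
 have "prod pstar Q dvd m" if "finite Q" "Q \<subseteq> P" for Q using that
 proof (induction Q rule: finite_induct)
  case (insert q Q)
  have "Rings.coprime (pstar q) (prod pstar Q)"
  proof (rule prod_coprime_right)
   fix r assume "r \<in> Q"
   then have "Rings.coprime q r" using insert by (intro primes_coprime) (auto simp: P_def)
   then have "Rings.coprime \<bar>pstar q\<bar> \<bar>pstar r\<bar>" unfolding ps_abs by simp
   then show "Rings.coprime (pstar q) (pstar r)" by simp
  qed
  moreover have "pstar q dvd m"
  proof -
   have "int q dvd m" using insert(4) by (simp add: P_def)
   then have "\<bar>pstar q\<bar> dvd m" unfolding ps_abs .
   then show ?thesis by simp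
  qed
  moreover have "prod pstar Q dvd m" using insert by simp
  ultimately have "pstar q * prod pstar Q dvd m" by (intro divides_mult)
  then show ?case using insert by simp
 qed simp
 then have "prod pstar P dvd m" using fin by blast
 then obtain e where e: "m = prod pstar P * e" by (rule dvdE)
 have "e ~= 0" using e m0 by auto
 \<comment> \<open>An odd prime dividing the cofactor \<open>e\<close> would divide \<open>m\<close>
   twice, as its \<open>pstar\<close> is already split off.\<close>
 have odd_div: False if q: "Factorial_Ring.prime q" "odd q" "int q dvd e" for q :: nat
 proof -
  have "int q dvd m" using e q(3) by simp
  then have "q \<in> P" using q by (simp add: P_def)
  then have "pstar q dvd prod pstar P" using fin by (intro dvd_prodI) auto
  then have "int q dvd prod pstar P" using ps_abs[of q] by (metis abs_dvd_iff)
  then have "int q * int q dvd m" unfolding e using q(3) by (rule mult_dvd_mono)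
  then have "int q dvd 1" using m by (auto simp: squarefree_def power2_eq_square)
  then show False using q(1) prime_gt_1_nat by force
 qed
 have "\<not> 4 dvd e"
 proof
  assume "4 dvd e"
  then have "2 ^ 2 dvd m" using e by simp
  then have "(2 :: int) dvd 1" using m unfolding squarefree_def by blast
  then show False by simp
 qed
 define f where "f = nat \<bar>e\<bar>"
 have f0: "f ~= 0" "\<not> 4 dvd f" using \<open>e ~= 0\<close> \<open>\<not> 4 dvd e\<close> by (auto simp: f_def dvd_nat_abs_iff nat_dvd_iff)
 have fodd: "\<not> (Factorial_Ring.prime q \<and> odd q \<and> q dvd f)" for q
 proof
  assume q: "Factorial_Ring.prime q \<and> odd q \<and> q dvd f"
  then have "int q dvd int f" by simp
  then have "int q dvd e" by (simp add: f_def)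
  then show False using q odd_div by blast
 qed
 have odd1: "h = 1" if h: "odd h" "h dvd f" for h
 proof (rule ccontr)
  assume "h ~= 1"
  then obtain q where q: "Factorial_Ring.prime q" "q dvd h" using prime_factor_nat by blast
  then have "odd q" "q dvd f" using h by (auto dest: dvd_trans)
  then show False using fodd q(1) by blast
 qed
 have "f = 1 \<or> f = 2"
 proof (cases "even f")
  case True
  then obtain h where h: "f = 2 * h" by (rule evenE)
  have "odd h" using f0(2) h by (auto elim!: evenE)
  then have "h = 1" using odd1 h by simp
  then show ?thesis using h by simp
 next
  case False
  then have "f = 1" by (rule odd1) simp
  then show ?thesis by simp
 qed
 then have "e \<in> {1, -1, 2, -2}" unfolding f_def by auto
 then show thesis using that[of e] e fin prod4[OF fin subset_refl] by (simp add: mult.commute)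
qed

section \<open>The characters of the Galois group relation\<close>

text \<open>For \<open>\<bar>e\<bar> = 1\<close> this is a root of unity, on which an automorphism
  and its linear extension agree; for \<open>\<bar>e\<bar> = 2\<close> it is only a combination of
  roots of unity.\<close>

definition small_root :: "int \<Rightarrow> complex"
 where "small_root e = (if e = 1 then 1 else if e = - 1 then \<i> else if e = 2 then sqrt_two else \<i> * sqrt_two)"

lemma small_root:
 assumes "e \<in> {1, -1, 2, -2}" shows "small_root e \<in> qspan (mu 8)" "small_root e ^ 2 = of_int e" "small_root e ~= 0"
  "\<bar>e\<bar> = 1 ==> small_root e \<in> mu 8"
proof -
 have mu8: "mgrp (mu 8)" by (rule mgrp_mu) simp
 have z8: "zeta 8 \<in> mu 8" by (rule zeta_in_mu) simp
 have st: "sqrt_two \<in> qspan (mu 8)" unfolding sqrt_two_def by (intro qspan_add qspan_base mgrp_inverse[OF mu8] z8)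
 have ii: "\<i> \<in> mu 8" using zeta_8_square mgrp_power[OF mu8 z8, of 2] by simp
 show "small_root e \<in> qspan (mu 8)" using st qspan_mult[OF mu8 qspan_base[OF ii] st] qspan_base[OF ii] qspan_base[OF mgrp_one[OF mu8]]
  by (auto simp: small_root_def)
 show sq: "small_root e ^ 2 = of_int e" using assms sqrt_two_square by (auto simp: small_root_def power_mult_distrib)
 show "small_root e ~= 0"
 proof
  assume "small_root e = 0"
  then have "(of_int e :: complex) = 0" using sq by simp
  then show False using assms by auto
 qed
 show "small_root e \<in> mu 8" if "\<bar>e\<bar> = 1" using that ii mgrp_one[OF mu8] by (auto simp: small_root_def abs_if split: if_splits)
qed

definition odd_primes_of :: "int \<Rightarrow> nat set"
 where "odd_primes_of m = {p. Factorial_Ring.prime p \<and> odd p \<and> int p dvd m}"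

context kummer_setting
begin

text \<open>The radicands to be tested: their square roots lie in the 2-primary part, and by
  \<open>G_iff\<close> they suffice to recognize the Galois group.\<close>

definition H :: "complex set"
 where "H = p_root_closure \<Gamma> 2 \<inter> (\<rat> - {0})"

lemma two_prime: "2 \<in> primes" by (simp add: primes_def)

lemma mgrp_D2: "mgrp (p_root_closure \<Gamma> 2)" by (rule saturated_mgrp[OF saturated_closures(2)[OF \<Gamma>]]) simp

lemma D2_subset: "p_root_closure \<Gamma> 2 \<subseteq> R" by (rule p_root_closure_subset) simp

lemma mgrp_H: "mgrp H" unfolding H_def by (rule mgrp_Int[OF mgrp_D2 mgrp_Rats])

lemma square_in_D2: "x ^ 2 \<in> H ==> x \<in> p_root_closure \<Gamma> 2"
proof -
 assume x: "x ^ 2 \<in> H"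
 then obtain n where "n \<ge> 1" "(x ^ 2) ^ (2 ^ n) \<in> \<Gamma>" by (auto simp: H_def p_root_closure_def)
 then have "x ^ (2 ^ Suc n) \<in> \<Gamma>" by (simp flip: power_mult)
 moreover have "x ~= 0" using x by (auto simp: H_def)
 ultimately show ?thesis unfolding p_root_closure_def by (intro CollectI conjI exI[of _ "Suc n"]) auto
qed

lemma csqrt_H:
 assumes "b \<in> H" shows "csqrt b \<in> p_root_closure \<Gamma> 2" "csqrt b \<in> R" "csqrt b ^ 2 \<in> \<rat>" "csqrt b ~= 0"
 using assms square_in_D2[of "csqrt b"] D2_subset by (auto simp: H_def)

lemma \<Gamma>_subset_H: "\<Gamma> \<subseteq> H"
proof
 fix c assume c: "c \<in> \<Gamma>"
 then have "c ^ (2 ^ 1) \<in> \<Gamma>" by (intro mgrp_power[OF \<Gamma>(1)])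
 then show "c \<in> H" unfolding H_def p_root_closure_def using c \<Gamma>(2) mgrp_nonzero[OF \<Gamma>(1) c] by blast
qed

lemma minus_one_H: "- 1 \<in> H"
proof -
 have "(- 1 :: complex) ^ (2 ^ 1) \<in> \<Gamma>" using mgrp_one[OF \<Gamma>(1)] by simp
 then show ?thesis unfolding H_def p_root_closure_def by (auto intro!: exI[of _ 1])
qed

definition V :: "complex set set"
 where "V = power_classes H 2"

lemma finite_V: "finite V" unfolding V_def
proof (rule finite_power_classes_saturated[OF \<Gamma> fg])
 show "H \<subseteq> \<rat> - {0}" by (auto simp: H_def)
 fix b assume "b \<in> H"
 then obtain n where "n \<ge> 1" "b ^ (2 ^ n) \<in> \<Gamma>" by (auto simp: H_def p_root_closure_def)
 then show "\<exists>n\<ge>1. b ^ n \<in> \<Gamma>" by (intro exI[of _ "2 ^ n"]) auto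
qed

text \<open>
 The sign measuring whether \<open>\<xi>\<close> respects the expression of the square root \<open>x\<close> by roots of unity.
\<close>

definition chi :: "complex \<Rightarrow> (complex \<Rightarrow> complex) \<Rightarrow> complex"
 where "chi x \<xi> = (\<xi> x / x) * (lext mu_inf \<xi> x / x)"

lemma mu_inf_R: "mu_inf \<subseteq> R" by (rule mu_inf_subset_root_closure[OF \<Gamma>(1)])

lemma relp:
 assumes "\<xi> \<in> A" shows "relpres mu_inf \<xi>" "mhom mu_inf \<xi>"
 using relpres_mu_inf_of_aut[OF mgrp_R mu_inf_R] mhom_subset[OF aut(1) mu_inf_R] assms by (auto simp: A_group_def)

lemma chi_mult:
 assumes \<xi>: "\<xi> \<in> A" and x: "x \<in> R" "x ^ 2 \<in> \<rat>" and y: "y \<in> R" "y ^ 2 \<in> \<rat>"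
 shows "chi (x * y) \<xi> = chi x \<xi> * chi y \<xi>"
proof -
 have "lext mu_inf \<xi> (x * y) = lext mu_inf \<xi> x * lext mu_inf \<xi> y"
  by (rule lext_mult[OF relp(1)[OF \<xi>] mgrp_mu_inf relp(2)[OF \<xi>] sqrt_Rats_cyclotomic[OF x(2)] sqrt_Rats_cyclotomic[OF y(2)]])
 then show ?thesis using mhom_mult[OF aut(1)[OF \<xi>] x(1) y(1)] by (simp add: chi_def mult_ac)
qed

lemma chi_Rats:
 assumes \<xi>: "\<xi> \<in> A" and x: "x \<in> R" "x \<in> \<rat>" shows "chi x \<xi> = 1"
 using aut(2)[OF \<xi> x] lext_Rats[OF relp(1)[OF \<xi>] mgrp_mu_inf relp(2)[OF \<xi>] x(2)] mgrp_nonzero[OF mgrp_R x(1)]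
 by (simp add: chi_def)

lemma chi_values:
 assumes \<xi>: "\<xi> \<in> A" and x: "x \<in> R" "x ^ 2 \<in> \<rat>"
 shows "chi x \<xi> = 1 \<or> chi x \<xi> = - 1" "chi x \<xi> = 1 \<longleftrightarrow> \<xi> x = lext mu_inf \<xi> x"
proof -
 have x0: "x ~= 0" using mgrp_nonzero[OF mgrp_R x(1)] .
 have "\<xi> x ^ 2 = \<xi> (x ^ 2)" using mhom_power[OF mgrp_R aut(1)[OF \<xi>] x(1)] by simp
 also have "... = x ^ 2" by (rule aut(2)[OF \<xi> mgrp_power[OF mgrp_R x(1)] x(2)])
 finally have 1: "\<xi> x = x \<or> \<xi> x = - x" by (rule square_eq_square)
 have "lext mu_inf \<xi> x ^ 2 = lext mu_inf \<xi> (x ^ 2)"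
  by (rule lext_power[OF relp(1)[OF \<xi>] mgrp_mu_inf relp(2)[OF \<xi>] sqrt_Rats_cyclotomic[OF x(2)], symmetric])
 also have "... = x ^ 2" by (rule lext_Rats[OF relp(1)[OF \<xi>] mgrp_mu_inf relp(2)[OF \<xi>] x(2)])
 finally have 2: "lext mu_inf \<xi> x = x \<or> lext mu_inf \<xi> x = - x" by (rule square_eq_square)
 have neq: "- x ~= x" using x0 by simp
 show "chi x \<xi> = 1 \<or> chi x \<xi> = - 1" using 1 2 x0 by (auto simp: chi_def)
 show "chi x \<xi> = 1 \<longleftrightarrow> \<xi> x = lext mu_inf \<xi> x" using 1 2 x0 neq by (elim disjE) (simp_all add: chi_def)
qed

lemma minus_one_R: "- 1 \<in> R" using minus_one_H D2_subset by (auto simp: H_def)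

text \<open>The sign depends on the radicand only, so that \<open>csqrt\<close> is a harmless choice
  of root.\<close>

lemma chi_uminus:
 assumes \<xi>: "\<xi> \<in> A" and x: "x \<in> R" "x ^ 2 \<in> \<rat>" shows "chi (- x) \<xi> = chi x \<xi>"
 using chi_mult[OF \<xi> minus_one_R _ x] chi_Rats[OF \<xi> minus_one_R] by simp

lemma chi_cong_square:
 assumes "\<xi> \<in> A" "x \<in> R" "x ^ 2 \<in> \<rat>" "y ^ 2 = x ^ 2" shows "chi y \<xi> = chi x \<xi>"
 using square_eq_square[OF assms(4)] chi_uminus[OF assms(1-3)] by auto

lemma chi_odd_power:
 assumes \<xi>: "\<xi> \<in> A" and x: "x \<in> R" "x ^ 2 \<in> \<rat>" and n: "odd n" shows "chi (x ^ n) \<xi> = chi x \<xi>"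
proof -
 obtain k where k: "n = 2 * k + 1" using n by (rule oddE)
 have q: "(x ^ 2) ^ k \<in> R" "(x ^ 2) ^ k \<in> \<rat>" using mgrp_power[OF mgrp_R mgrp_power[OF mgrp_R x(1)]] x(2) by auto
 have "chi (x ^ n) \<xi> = chi ((x ^ 2) ^ k * x) \<xi>" by (simp add: k mult.commute flip: power_mult)
 also have "... = chi ((x ^ 2) ^ k) \<xi> * chi x \<xi>" using q(2) by (intro chi_mult[OF \<xi> q(1) _ x]) simp
 finally show ?thesis using chi_Rats[OF \<xi> q] by simp
qed

lemma chi_measurable:
 assumes x: "x \<in> R" "x ^ 2 \<in> \<rat>" shows "chi x \<in> borel_measurable (borel_on T)"
proof -
 have ev: "(\<lambda>\<xi>. \<xi> y) \<in> borel_measurable (borel_on T)" if "y \<in> R" for y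
  by (rule measurable_compose[OF eval_measurable[OF mgrp_R that refl]]) simp_all
 obtain B c where B: "finite B" "B \<subseteq> mu_inf" "\<And>y. y \<in> B ==> c y \<in> \<rat>" "x = (\<Sum>y\<in>B. c y * y)"
  using sqrt_Rats_cyclotomic[OF x(2)] by (rule qspanE) blast
 have "(\<lambda>\<xi>. (\<xi> x / x) * ((\<Sum>y\<in>B. c y * \<xi> y) / x)) \<in> borel_measurable (borel_on T)" using x(1) B(2) mu_inf_R
  by (intro borel_measurable_times borel_measurable_divide borel_measurable_sum ev) auto
 moreover have "chi x \<xi> = (\<xi> x / x) * ((\<Sum>y\<in>B. c y * \<xi> y) / x)" if "\<xi> \<in> space (borel_on T)" for \<xi>
 proof -
  have "\<xi> \<in> A" using that space_T by simp
  then have "lext mu_inf \<xi> (\<Sum>y\<in>B. c y * y) = (\<Sum>y\<in>B. c y * \<xi> y)" using B(1-3) by (intro lext_family[OF relp(1)]) auto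
  then show ?thesis using B(4) by (simp add: chi_def)
 qed
 ultimately show ?thesis by (simp cong: measurable_cong)
qed

text \<open>Let \<open>l\<close> be the odd part of an exponent \<open>n\<close> with
  \<open>x ^ n \<in> \<Gamma>\<close>. The square of \<open>x ^ l\<close> lies in \<open>H\<close>,
  and an odd power has the same \<open>chi\<close> as \<open>x\<close>.\<close>

lemma G_iff:
 assumes \<xi>: "\<xi> \<in> A" shows "\<xi> \<in> G_subgroup \<Gamma> \<longleftrightarrow> (\<forall>b\<in>H. chi (csqrt b) \<xi> = 1)"
proof
 assume "\<xi> \<in> G_subgroup \<Gamma>"
 then show "\<forall>b\<in>H. chi (csqrt b) \<xi> = 1" unfolding G_subgroup_eq[OF \<Gamma>] using chi_values(2)[OF \<xi>] csqrt_H(2,3) by auto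
next
 assume one: "\<forall>b\<in>H. chi (csqrt b) \<xi> = 1"
 have "\<xi> x = lext mu_inf \<xi> x" if x: "x \<in> R" "x ^ 2 \<in> \<rat>" for x
 proof -
  obtain n where n: "n \<ge> 1" "x ^ n \<in> \<Gamma>" "x ~= 0" using x(1) by (auto simp: root_closure_def)
  obtain k l where kl: "odd l" "n = 2 ^ k * l"
   using multiplicity_decompose'[of n 2] n(1) by (metis not_one_le_zero not_prime_unit prime_imp_prime_elem two_is_prime_nat odd_one even_numeral dvd_refl)
  define y where "y = x ^ l"
  have "y ^ 2 = (x ^ 2) ^ l" by (simp add: y_def mult.commute flip: power_mult)
  then have y2: "y ^ 2 \<in> \<rat> - {0}" using x(2) n(3) by simp
  \<comment> \<open>\<open>p_root_closure\<close> demands a positive exponent of 2, so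
    \<open>Suc k\<close> is taken to cover odd \<open>n\<close>; this is where the fourth power
    comes from.\<close>
  have "(y ^ 2) ^ (2 ^ Suc k) = (x ^ n) ^ 4" by (simp add: y_def kl(2) mult_ac flip: power_mult)
  also have "... \<in> \<Gamma>" by (rule mgrp_power[OF \<Gamma>(1) n(2)])
  finally have "y ^ 2 \<in> p_root_closure \<Gamma> 2" unfolding p_root_closure_def using y2 by (intro CollectI conjI exI[of _ "Suc k"]) auto
  then have yH: "y ^ 2 \<in> H" using y2 by (simp add: H_def)
  have yR: "y \<in> R" unfolding y_def by (rule mgrp_power[OF mgrp_R x(1)])
  have "chi (csqrt (y ^ 2)) \<xi> = chi y \<xi>" using y2 by (intro chi_cong_square[OF \<xi> yR]) auto
  then have "chi y \<xi> = 1" using one yH by simp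
  then have "chi x \<xi> = 1" using chi_odd_power[OF \<xi> x kl(1)] by (simp add: y_def)
  then show ?thesis using chi_values(2)[OF \<xi> x] by simp
 qed
 then show "\<xi> \<in> G_subgroup \<Gamma>" unfolding G_subgroup_eq[OF \<Gamma>] using \<xi> by blast
qed

abbreviation rep :: "complex set \<Rightarrow> complex" where "rep \<equiv> class_rep H 2"

text \<open>For fixed \<xi> the sign is a homomorphism in the radicand, trivial on rational squares,
  so orthogonality over the square classes applies. This is the indicator function of the Galois
  group.\<close>

lemma sum_chi:
 assumes \<xi>: "\<xi> \<in> A"
 shows "(\<Sum>v\<in>V. chi (csqrt (rep v)) \<xi>) = (if \<xi> \<in> G_subgroup \<Gamma> then of_nat (card V) else 0)"
proof -
 have "mhom H (\<lambda>b. chi (csqrt b) \<xi>)" unfolding mhom_def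
 proof (intro conjI ballI)
  fix a assume a: "a \<in> H"
  show "chi (csqrt a) \<xi> ~= 0" using chi_values(1)[OF \<xi> csqrt_H(2,3)[OF a]] by auto
  fix b assume b: "b \<in> H"
  have "csqrt a * csqrt b \<in> R" by (rule mgrp_mult[OF mgrp_R csqrt_H(2)[OF a] csqrt_H(2)[OF b]])
  then have "chi (csqrt (a * b)) \<xi> = chi (csqrt a * csqrt b) \<xi>"
   using a b by (intro chi_cong_square[OF \<xi>]) (auto simp: power_mult_distrib H_def)
  then show "chi (csqrt (a * b)) \<xi> = chi (csqrt a) \<xi> * chi (csqrt b) \<xi>"
   using chi_mult[OF \<xi> csqrt_H(2,3)[OF a] csqrt_H(2,3)[OF b]] by simp
 qed
 moreover have "chi (csqrt d) \<xi> = 1" if d: "d \<in> H" "d \<in> rat_powers 2" for d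
 proof -
  obtain q where q: "q \<in> \<rat>" "d = q ^ 2" using d(2) by (auto simp: rat_powers_def)
  then have "csqrt d = q \<or> csqrt d = - q" by (intro square_eq_square) simp
  then have "csqrt d \<in> \<rat>" using q(1) by auto
  then show ?thesis by (rule chi_Rats[OF \<xi> csqrt_H(2)[OF d(1)]])
 qed
 ultimately show ?thesis
  using class_orthogonality[OF mgrp_H, where p = 2 and \<phi> = "\<lambda>b. chi (csqrt b) \<xi>"] finite_V G_iff[OF \<xi>] by (simp add: V_def)
qed

lemma rep_H: "v \<in> V ==> rep v \<in> H" unfolding V_def by (rule class_rep(1))

lemma card_V: "card V > 0" using finite_V mgrp_one[OF mgrp_H] by (auto simp: V_def power_classes_def card_gt_0_iff)

lemma G_sets: "G_subgroup \<Gamma> \<in> sets (borel_on T)"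
proof -
 let ?F = "\<lambda>\<xi>. \<Sum>v\<in>V. chi (csqrt (rep v)) \<xi>"
 have "?F \<in> borel_measurable (borel_on T)" by (rule borel_measurable_sum) (rule chi_measurable[OF csqrt_H(2,3)[OF rep_H]])
 then have "?F -` {of_nat (card V)} \<inter> space (borel_on T) \<in> sets (borel_on T)" by (rule measurable_sets) simp
 moreover have "?F -` {of_nat (card V)} \<inter> space (borel_on T) = G_subgroup \<Gamma>"
  using sum_chi card_V G_subgroup_eq[OF \<Gamma>] by (auto simp: space_T split: if_splits)
 ultimately show ?thesis by simp
qed

lemma chi_J_measurable:
 assumes "b \<in> H" shows "(\<lambda>\<omega>. chi (csqrt b) (J \<omega>)) \<in> borel_measurable \<Omega>"
 using J_measurable chi_measurable[OF csqrt_H(2,3)[OF assms]] by (rule measurable_compose)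

lemma measure_G_eq_sum:
 assumes U: "U \<in> sets (borel_on T)"
 shows "of_nat (card V) * complex_of_real (measure (A_measure \<Gamma> \<nu>) (G_subgroup \<Gamma> \<inter> U)) =
  (\<Sum>v\<in>V. \<integral>\<omega>. indicator (J -` U \<inter> space \<Omega>) \<omega> * chi (csqrt (rep v)) (J \<omega>) \<partial>\<Omega>)"
proof -
 let ?U = "J -` U \<inter> space \<Omega>" and ?G = "J -` (G_subgroup \<Gamma> \<inter> U) \<inter> space \<Omega>"
 have GU: "G_subgroup \<Gamma> \<inter> U \<in> sets (borel_on T)" using G_sets U by (rule sets.Int)
 have U': "?U \<in> sets \<Omega>" and G': "?G \<in> sets \<Omega>" using measurable_sets[OF J_measurable U] measurable_sets[OF J_measurable GU] .
 have int: "integrable \<Omega> (\<lambda>\<omega>. indicator ?U \<omega> * chi (csqrt (rep v)) (J \<omega>))" if v: "v \<in> V" for v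
 proof (rule integrable_const_bound[where B = 1])
  show "(\<lambda>\<omega>. indicator ?U \<omega> * chi (csqrt (rep v)) (J \<omega>)) \<in> borel_measurable \<Omega>"
   by (rule borel_measurable_times[OF borel_measurable_indicator[OF U'] chi_J_measurable[OF rep_H[OF v]]])
  show "AE \<omega> in \<Omega>. norm (indicator ?U \<omega> * chi (csqrt (rep v)) (J \<omega>)) \<le> 1"
  proof (rule AE_I2)
   fix \<omega> assume "\<omega> \<in> space \<Omega>"
   from chi_values(1)[OF J_in[OF this] csqrt_H(2,3)[OF rep_H[OF v]]]
   show "norm (indicator ?U \<omega> * chi (csqrt (rep v)) (J \<omega>)) \<le> 1" by (auto simp: norm_mult indicator_def)
  qed
 qed
 have "(\<Sum>v\<in>V. \<integral>\<omega>. indicator ?U \<omega> * chi (csqrt (rep v)) (J \<omega>) \<partial>\<Omega>) =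
   (\<integral>\<omega>. (\<Sum>v\<in>V. indicator ?U \<omega> * chi (csqrt (rep v)) (J \<omega>)) \<partial>\<Omega>)"
  by (rule Bochner_Integration.integral_sum[OF int, symmetric])
 also have "... = (\<integral>\<omega>. complex_of_real (real (card V) * indicator ?G \<omega>) \<partial>\<Omega>)"
 proof (rule Bochner_Integration.integral_cong[OF refl])
  fix \<omega> assume \<omega>: "\<omega> \<in> space \<Omega>"
  have "(\<Sum>v\<in>V. indicator ?U \<omega> * chi (csqrt (rep v)) (J \<omega>)) =
    indicator ?U \<omega> * (\<Sum>v\<in>V. chi (csqrt (rep v)) (J \<omega>))" by (rule sum_distrib_left[symmetric])
  also have "... = complex_of_real (real (card V) * indicator ?G \<omega>)"
   unfolding sum_chi[OF J_in[OF \<omega>]] using \<omega> by (auto simp: indicator_def)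
  finally show "(\<Sum>v\<in>V. indicator ?U \<omega> * chi (csqrt (rep v)) (J \<omega>)) =
   complex_of_real (real (card V) * indicator ?G \<omega>)" .
 qed
 also have "... = complex_of_real (real (card V) * measure \<Omega> ?G)"
 proof -
  have "(\<integral>\<omega>. (indicator ?G \<omega> :: real) \<partial>\<Omega>) = measure \<Omega> ?G"
   by (rule has_bochner_integral_integral_eq[OF has_bochner_integral_real_indicator[OF G']])
     (simp add: emeasure_finite less_top[symmetric])
  then show ?thesis by simp
 qed
 finally show ?thesis using measure_A_measure[OF GU] by simp
qed

lemma M_degree:
 assumes "p \<in> primes" shows "real (M_degree \<Gamma> p) = (real p - 1) * real (card (power_classes \<Gamma> p))"
  "measure (\<nu> p) (Sp_set \<Gamma> p) = 1 - 1 / real (M_degree \<Gamma> p)" "M_degree \<Gamma> p > 0"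
proof -
 interpret q: primary_part \<Gamma> p "\<nu> p" by (rule primary[OF assms])
 have M: "M_degree \<Gamma> p = (p - 1) * card (power_classes \<Gamma> p)" by (rule M_degree_eq[OF \<Gamma> q.p q.finite_classes])
 have "power_classes \<Gamma> p ~= {}" using mgrp_one[OF \<Gamma>(1)] by (auto simp: power_classes_def)
 then show "M_degree \<Gamma> p > 0" using M q.p_ge(2) q.finite_classes by (auto simp: card_gt_0_iff)
 show "real (M_degree \<Gamma> p) = (real p - 1) * real (card (power_classes \<Gamma> p))" using M q.p_ge(1) by (simp add: of_nat_diff)
 then show "measure (\<nu> p) (Sp_set \<Gamma> p) = 1 - 1 / real (M_degree \<Gamma> p)" using q.measure_Sp q.measure_Ker by simp
qed

text \<open>The radical sign of \<open>x\<close> belongs to the prime 2, since \<open>x\<close> lies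
  in the 2-primary part; the cyclotomic sign is distributed over 2 and the odd primes. The argument
  \<open>e\<close> matters at 2 only.\<close>

definition local_factor :: "complex \<Rightarrow> int \<Rightarrow> nat \<Rightarrow> (complex \<Rightarrow> complex) \<Rightarrow> complex"
 where "local_factor x e p = (if p = 2 then (\<lambda>\<xi>. (\<xi> x / x) * qchar 8 (small_root e) \<xi>) else qchar p (gauss p))"

lemma mu8_D2: "mu 8 \<subseteq> p_root_closure \<Gamma> 2"
proof -
 interpret q: primary_part \<Gamma> 2 "\<nu> 2" by (rule primary[OF two_prime])
 show ?thesis using q.mu_D[of 3] by simp
qed

lemma qchar_data_small_root: "e \<in> {1, -1, 2, -2} ==> qchar_data (p_root_closure \<Gamma> 2) 8 (small_root e)"
 by unfold_locales (use mgrp_D2 mu8_D2 small_root in auto)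

lemma qchar_data_gauss:
 assumes "p \<in> primes" "odd p" shows "qchar_data (p_root_closure \<Gamma> p) p (gauss p)"
proof -
 interpret q: primary_part \<Gamma> p "\<nu> p" by (rule primary[OF assms(1)])
 have "gauss p ~= 0" using gauss_not_Rats[OF q.p assms(2)] by auto
 then show ?thesis by unfold_locales (use q.mgrp q.p_ge q.mu_p_D gauss_in_qspan gauss_square[OF assms(2)] in auto)
qed

text \<open>Up to sign the square root of \<open>b\<close> is \<open>w\<close>, a rational multiple
  of \<open>small_root e\<close> times Gauss products. The cyclotomic sign of each of these factors
  is seen by a single component of \<omega>.\<close>

lemma chi_J:
 assumes b: "b \<in> H" and P: "finite P" "P \<subseteq> primes" "\<And>p. p \<in> P ==> odd p" and e: "e \<in> {1, -1, 2, -2}"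
  and beq: "b = of_int (e * (\<Prod>p\<in>P. pstar p)) * s ^ 2" "s \<in> \<rat> - {0}" and \<omega>: "\<omega> \<in> space \<Omega>"
 shows "chi (csqrt b) (J \<omega>) = (\<Prod>p\<in>insert 2 P. local_factor (csqrt b) e p (\<omega> p))"
proof -
 define x where "x = csqrt b"
 define w where "w = small_root e * (\<Prod>p\<in>P. gauss p) * s"
 let ?L = "lext mu_inf (J \<omega>)"
 have \<xi>: "J \<omega> \<in> A" by (rule J_in[OF \<omega>])
 note R = relp[OF \<xi>]
 have R': "J \<omega> \<in> carrier (rat_aut_group R)" using \<xi> by (simp add: A_group_def)
 have x0: "x ~= 0" and xD: "x \<in> p_root_closure \<Gamma> 2" using csqrt_H[OF b] by (auto simp: x_def)
 have "(\<Prod>p\<in>P. gauss p) ^ 2 = (\<Prod>p\<in>P. of_int (pstar p))"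
  unfolding prod_power_distrib by (rule prod.cong) (use gauss_square P(3) in auto)
 then have "w ^ 2 = x ^ 2" using beq small_root(2)[OF e] by (simp add: w_def x_def power_mult_distrib)
 then have w: "w = x \<or> w = - x" by (rule square_eq_square)
 have w0: "w ~= 0" using w x0 by auto
 have nz: "gauss p ~= 0" if "p \<in> P" for p using qchar_data.z(2)[OF qchar_data_gauss] P that by blast
 have Lz: "?L (small_root e) = qchar 8 (small_root e) (\<omega> 2) * small_root e"
 proof (rule qchar_data.qchar_mu_inf[OF qchar_data_small_root[OF e] mgrp_R mu_inf_R R'])
  show "\<omega> 2 \<in> carrier (rat_aut_group (p_root_closure \<Gamma> 2))" using component_in[OF \<omega> two_prime] by (simp add: Ap_group_def)
  show "\<omega> 2 y = J \<omega> y" if "y \<in> mu 8" for y using J_component[OF \<omega> two_prime] mu8_D2 that by auto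
 qed
 have Lg: "?L (gauss p) = qchar p (gauss p) (\<omega> p) * gauss p" if p: "p \<in> P" for p
 proof -
  have pp: "p \<in> primes" "odd p" using p P by auto
  interpret q: primary_part \<Gamma> p "\<nu> p" by (rule primary[OF pp(1)])
  show ?thesis
  proof (rule qchar_data.qchar_mu_inf[OF qchar_data_gauss[OF pp] mgrp_R mu_inf_R R'])
   show "\<omega> p \<in> carrier (rat_aut_group (p_root_closure \<Gamma> p))" using component_in[OF \<omega> pp(1)] by (simp add: Ap_group_def)
   show "\<omega> p y = J \<omega> y" if "y \<in> mu p" for y using J_component[OF \<omega> pp(1)] q.mu_p_D that by auto
  qed
 qed
 have mem1: "small_root e \<in> qspan mu_inf" using small_root(1)[OF e] qspan_mono[OF mu_subset_mu_inf[of 8]] by auto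
 have mem: "gauss p \<in> qspan mu_inf" if "p \<in> P" for p
 proof -
  have "p \<ge> 1" using that P(2) primes_ge by blast
  then show ?thesis using gauss_in_qspan qspan_mono[OF mu_subset_mu_inf] by blast
 qed
 have memp: "(\<Prod>p\<in>P. gauss p) \<in> qspan mu_inf" by (rule qspan_prod[OF mgrp_mu_inf mem])
 have "?L w = ?L (s * (small_root e * (\<Prod>p\<in>P. gauss p)))" by (simp add: w_def mult_ac)
 also have "... = s * ?L (small_root e * (\<Prod>p\<in>P. gauss p))"
  by (rule lext_smult[OF R(1) mgrp_mu_inf R(2) _ qspan_mult[OF mgrp_mu_inf mem1 memp]]) (use beq(2) in simp)
 also have "?L (small_root e * (\<Prod>p\<in>P. gauss p)) = ?L (small_root e) * ?L (\<Prod>p\<in>P. gauss p)"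
  by (rule lext_mult[OF R(1) mgrp_mu_inf R(2) mem1 memp])
 also have "?L (\<Prod>p\<in>P. gauss p) = (\<Prod>p\<in>P. ?L (gauss p))" by (rule lext_prod[OF R(1) mgrp_mu_inf R(2) mem])
 also have "... = (\<Prod>p\<in>P. qchar p (gauss p) (\<omega> p)) * (\<Prod>p\<in>P. gauss p)" using Lg by (simp add: prod.distrib)
 finally have "?L w = (qchar 8 (small_root e) (\<omega> 2) * (\<Prod>p\<in>P. qchar p (gauss p) (\<omega> p))) * w"
  unfolding Lz by (simp add: w_def mult_ac)
 then have Lw: "?L w / w = qchar 8 (small_root e) (\<omega> 2) * (\<Prod>p\<in>P. qchar p (gauss p) (\<omega> p))" using w0 by simp
 have xq: "x \<in> qspan mu_inf" using csqrt_H(3)[OF b] by (intro sqrt_Rats_cyclotomic) (simp add: x_def)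
 have "?L (- x) = - ?L x" using lext_smult[OF R(1) mgrp_mu_inf R(2) _ xq, of "- 1"] by simp
 then have Lx: "?L x / x = ?L w / w" using w by auto
 have Jx: "J \<omega> x = \<omega> 2 x" by (rule J_component[OF \<omega> two_prime xD])
 have P2: "2 \<notin> P" using P(3)[of 2] by auto
 then have "(\<Prod>p\<in>P. qchar p (gauss p) (\<omega> p)) = (\<Prod>p\<in>P. local_factor x e p (\<omega> p))"
  by (intro prod.cong) (auto simp: local_factor_def)
 then have "chi x (J \<omega>) = local_factor x e 2 (\<omega> 2) * (\<Prod>p\<in>P. local_factor x e p (\<omega> p))"
  unfolding chi_def Lx Lw Jx by (simp add: local_factor_def[of x e 2] mult.assoc)
 then show ?thesis using P(1) P2 by (simp add: x_def)
qed

text \<open>For \<open>\<bar>e\<bar> = 1\<close> the number \<open>z = small_root e\<close> is a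
  root of unity in the 2-primary part, so the factor is the radical character of
  \<open>y = x * z\<close>. As \<open>y ^ 2 = of_int m * s ^ 2\<close>, the sign \<open>e\<close>
  has disappeared. For \<open>\<bar>e\<bar> = 2\<close> both integrals vanish by
  \<open>sqrt_two_character_integral\<close>.\<close>

lemma local_two:
 assumes b: "b \<in> H" and e: "e \<in> {1, -1, 2, -2}" and m: "squarefree m" "odd m"
  and beq: "b = of_int (e * m) * s ^ 2" "s \<in> \<rat> - {0}" shows "local_factor (csqrt b) e 2 \<in> borel_measurable (\<nu> 2)"
  and "\<xi> \<in> carrier (Ap_group \<Gamma> 2) ==> norm (local_factor (csqrt b) e 2 \<xi>) \<le> 1"
  and "(\<integral>\<xi>. local_factor (csqrt b) e 2 \<xi> \<partial>\<nu> 2) = (if \<bar>e\<bar> = 1 \<and> m = 1 then 1 else 0)"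
  and "local_integral 2 (local_factor (csqrt b) e 2) =
   (if \<bar>e\<bar> ~= 1 then 0 else if m = 1 then complex_of_real (measure (\<nu> 2) (Sp_set \<Gamma> 2))
    else if pclass 2 (of_int m) \<in> power_classes \<Gamma> 2 then - complex_of_real (1 / real (M_degree \<Gamma> 2)) else 0)"
proof -
 interpret q: primary_part \<Gamma> 2 "\<nu> 2" by (rule primary[OF two_prime])
 define x where "x = csqrt b"
 define z where "z = small_root e"
 have x: "x \<in> q.D" "x ^ 2 \<in> \<rat>" using csqrt_H[OF b] by (auto simp: x_def)
 define F where "F \<xi> = (\<xi> x / x) * qchar 8 z \<xi>" for \<xi>
 have lf: "local_factor (csqrt b) e 2 = F" unfolding local_factor_def F_def x_def z_def by (rule ext) simp
 have "F \<in> borel_measurable (\<nu> 2) \<and> (\<forall>\<xi>\<in>q.A. norm (F \<xi>) \<le> 1) \<and>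
  (\<integral>\<xi>. F \<xi> \<partial>\<nu> 2) = (if \<bar>e\<bar> = 1 \<and> m = 1 then 1 else 0) \<and>
  (\<integral>\<xi>. indicator (Sp_set \<Gamma> 2) \<xi> * F \<xi> \<partial>\<nu> 2) =
   (if \<bar>e\<bar> ~= 1 then 0 else if m = 1 then complex_of_real (measure (\<nu> 2) (Sp_set \<Gamma> 2))
    else if pclass 2 (of_int m) \<in> power_classes \<Gamma> 2 then - complex_of_real (1 / real (M_degree \<Gamma> 2)) else 0)"
 proof (cases "\<bar>e\<bar> = 1")
  case False
  then have "z = sqrt_two \<or> z = \<i> * sqrt_two" using e by (auto simp: z_def small_root_def)
  note I = q.sqrt_two_character_integral[OF refl x this, folded F_def]
  have "F = (\<lambda>\<xi>. \<xi> x / x * qchar 8 z \<xi>)" by (simp add: F_def fun_eq_iff)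
  then show ?thesis using I False by simp
 next
  case True
  have z8: "z \<in> mu 8" and z0: "z ~= 0" and z2: "z ^ 2 = of_int e" using small_root[OF e] True by (auto simp: z_def)
  have zD: "z \<in> q.D" using z8 mu8_D2 by blast
  define y where "y = x * z"
  have yD: "y \<in> q.D" unfolding y_def by (rule mgrp_mult[OF q.mgrp x(1) zD])
  have "(of_int e * of_int e :: complex) = 1" using e True by auto
  then have y2: "y ^ 2 = of_int m * s ^ 2" using beq(1) by (simp add: y_def x_def z2 power_mult_distrib mult_ac)
  have y2r: "y ^ 2 \<in> \<rat>" unfolding y2 using beq(2) by auto
  have Fy: "F \<xi> = \<xi> y / y" if \<xi>: "\<xi> \<in> q.A" for \<xi>
  proof -
   have "lext (mu 8) \<xi> z = \<xi> z" by (rule lext_base[OF relpres_mu_of_aut(1)[OF q.mgrp _ mu8_D2 \<xi>] z8]) simp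
   moreover have "\<xi> y = \<xi> x * \<xi> z" unfolding y_def by (rule mhom_mult[OF _ x(1) zD]) (use \<xi> q.carrier_iff in blast)
   ultimately show ?thesis by (simp add: F_def qchar_def y_def)
  qed
  note I = q.sqrt_character[OF yD y2r] q.sqrt_character_integral[OF refl yD y2r]
  have meas: "F \<in> borel_measurable (\<nu> 2)" using I(1) by (rule measurable_cong[THEN iffD1, rotated]) (simp add: q.space_eq Fy)
  have yrat: "y \<in> \<rat> \<longleftrightarrow> m = 1"
  proof
   assume "y \<in> \<rat>"
   then have "y / s \<in> \<rat>" using beq(2) by auto
   moreover have "(y / s) ^ 2 = of_int m" using y2 beq(2) by (simp add: power_divide)
   ultimately show "m = 1" by (rule squarefree_rat_square[OF m(1)])
  next
   assume "m = 1"
   then have "y = s \<or> y = - s" using y2 by (intro square_eq_square) simp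
   then show "y \<in> \<rat>" using beq(2) by auto
  qed
  have cl: "pclass 2 (y ^ 2) = pclass 2 (of_int m)" by (rule pclass_squarefree[OF m(1) beq(2) y2])
  have i1: "(\<integral>\<xi>. F \<xi> \<partial>\<nu> 2) = (\<integral>\<xi>. \<xi> y / y \<partial>\<nu> 2)"
   by (rule Bochner_Integration.integral_cong) (simp_all add: q.space_eq Fy)
  have i2: "(\<integral>\<xi>. indicator (Sp_set \<Gamma> 2) \<xi> * F \<xi> \<partial>\<nu> 2) = (\<integral>\<xi>. indicator (Sp_set \<Gamma> 2) \<xi> * (\<xi> y / y) \<partial>\<nu> 2)"
   by (rule Bochner_Integration.integral_cong) (simp_all add: q.space_eq Fy)
  have K: "measure (\<nu> 2) q.Ker = 1 / real (M_degree \<Gamma> 2)" using M_degree(2)[OF two_prime] q.measure_Sp by simp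
  show ?thesis using meas I(2) Fy i1 i2 I(4,5) True by (simp add: yrat cl K)
 qed
 then show "local_factor (csqrt b) e 2 \<in> borel_measurable (\<nu> 2)"
  "\<xi> \<in> carrier (Ap_group \<Gamma> 2) ==> norm (local_factor (csqrt b) e 2 \<xi>) \<le> 1"
  "(\<integral>\<xi>. local_factor (csqrt b) e 2 \<xi> \<partial>\<nu> 2) = (if \<bar>e\<bar> = 1 \<and> m = 1 then 1 else 0)"
  "local_integral 2 (local_factor (csqrt b) e 2) =
   (if \<bar>e\<bar> ~= 1 then 0 else if m = 1 then complex_of_real (measure (\<nu> 2) (Sp_set \<Gamma> 2))
    else if pclass 2 (of_int m) \<in> power_classes \<Gamma> 2 then - complex_of_real (1 / real (M_degree \<Gamma> 2)) else 0)"
  unfolding lf local_integral_def by (auto simp: Ap_group_def)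
qed

lemma local_odd:
 assumes "p \<in> primes" "odd p" shows "local_factor x e p \<in> borel_measurable (\<nu> p)"
  and "\<xi> \<in> carrier (Ap_group \<Gamma> p) ==> norm (local_factor x e p \<xi>) \<le> 1"
  and "(\<integral>\<xi>. local_factor x e p \<xi> \<partial>\<nu> p) = 0"
  and "local_integral p (local_factor x e p) = - complex_of_real (1 / real (M_degree \<Gamma> p))"
proof -
 interpret q: primary_part \<Gamma> p "\<nu> p" by (rule primary[OF assms(1)])
 have lf: "local_factor x e p = qchar p (gauss p)" using assms(2) by (auto simp: local_factor_def)
 have K: "measure (\<nu> p) q.Ker = 1 / real (M_degree \<Gamma> p)" using M_degree(2)[OF assms(1)] q.measure_Sp by simp
 note I = q.gauss_character[OF assms(2), unfolded K]
 show "local_factor x e p \<in> borel_measurable (\<nu> p)" "(\<integral>\<xi>. local_factor x e p \<xi> \<partial>\<nu> p) = 0"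
  "local_integral p (local_factor x e p) = - complex_of_real (1 / real (M_degree \<Gamma> p))" unfolding lf local_integral_def by (rule I)+
 show "\<xi> \<in> carrier (Ap_group \<Gamma> p) ==> norm (local_factor x e p \<xi>) \<le> 1"
  unfolding lf by (rule I(2)) (simp add: Ap_group_def)
qed

end

section \<open>The density formula\<close>

context kummer_setting
begin

definition sf :: "complex set \<Rightarrow> int"
 where "sf v = (SOME m. squarefree m \<and> v = pclass 2 (of_int m))"

lemma sf:
 assumes "v \<in> V" shows "squarefree (sf v)" "v = pclass 2 (of_int (sf v))"
proof -
 obtain b where b: "b \<in> H" "v = pclass 2 b" using assms by (auto simp: V_def power_classes_def)
 obtain m s where "squarefree m" "s \<in> \<rat> - {0}" "b = of_int m * s ^ 2" using squarefree_representative[of b] b(1) by (auto simp: H_def)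
 then have "squarefree m \<and> v = pclass 2 (of_int m)" using pclass_squarefree b(2) by blast
 then have "squarefree (sf v) \<and> v = pclass 2 (of_int (sf v))" unfolding sf_def by (rule someI)
 then show "squarefree (sf v)" "v = pclass 2 (of_int (sf v))" by blast+
qed

lemma sf_pclass:
 assumes "squarefree m" "pclass 2 (of_int m) \<in> V" shows "sf (pclass 2 (of_int m)) = m"
 using pclass_squarefree_eq_iff[OF sf(1)[OF assms(2)] assms(1)] sf(2)[OF assms(2)] by simp

lemma rep_eq:
 assumes v: "v \<in> V"
 obtains s where "s \<in> \<rat> - {0}" "rep v = of_int (sf v) * s ^ 2"
proof -
 have m0: "(of_int (sf v) :: complex) ~= 0" using sf(1)[OF v] by auto
 have "pclass 2 (rep v) = pclass 2 (of_int (sf v))" using class_rep(2)[of v H 2] v sf(2)[OF v] by (simp add: V_def)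
 moreover have "rep v ~= 0" using rep_H[OF v] by (simp add: H_def)
 ultimately have "rep v / of_int (sf v) \<in> rat_powers 2" using pclass_eq_iff m0 by blast
 then obtain s where "s \<in> \<rat> - {0}" "rep v / of_int (sf v) = s ^ 2" by (auto simp: rat_powers_def)
 then show thesis using m0 by (intro that[of s]) (auto simp: field_simps)
qed

lemma power_classes_subset_V: "power_classes \<Gamma> 2 \<subseteq> V" unfolding V_def power_classes_def using \<Gamma>_subset_H by blast

text \<open>Meant for \<open>m\<close> congruent to 1 modulo 4, where \<open>m ~= 1\<close> is its
  own discriminant; the value at \<open>m = 1\<close> is the main term 1 of the formula.\<close>

definition weight :: "int \<Rightarrow> real"
 where "weight m = (if m = 1 then 1 else \<Prod>p | p \<in> primes \<and> int p dvd 2 * m. - 1 / (real (M_degree \<Gamma> p) - 1))"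

text \<open>For odd squarefree \<open>m\<close> this is the product of \<open>pstar p\<close> over
  the primes \<open>p\<close> dividing \<open>m\<close>.\<close>

definition one_mod_four :: "int \<Rightarrow> int"
 where "one_mod_four m = (if m mod 4 = 1 then m else - m)"

text \<open>The normalized integral over \<open>S\<close> of the character of \<open>v\<close>.
  Membership in the classes of \<Gamma> is asked of \<open>one_mod_four (sf v)\<close> and not of
  \<open>sf v\<close>, because a sign is absorbed by a root of unity.\<close>

definition class_weight :: "complex set \<Rightarrow> real"
 where "class_weight v = (if odd (sf v) \<and> pclass 2 (of_int (one_mod_four (sf v))) \<in> power_classes \<Gamma> 2
  then weight (one_mod_four (sf v)) else 0)"

text \<open>Over the whole group a single odd prime, or a factor 2, makes the product of local
  integrals vanish, so only the classes of 1 and -1 survive. Over \<open>S\<close> each odd prime of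
  the squarefree part contributes a nonzero factor, and the prime 2 decides whether the class
  counts.\<close>

lemma character_integrals:
 assumes v: "v \<in> V" and nondeg: "\<And>p. p \<in> primes ==> M_degree \<Gamma> p ~= 1"
 shows "(\<integral>\<omega>. chi (csqrt (rep v)) (J \<omega>) \<partial>\<Omega>) = (if \<bar>sf v\<bar> = 1 then 1 else 0)"
  and "(\<integral>\<omega>. indicator S' \<omega> * chi (csqrt (rep v)) (J \<omega>) \<partial>\<Omega>) =
   complex_of_real (class_weight v * measure \<Omega> S')"
proof -
 define m where "m = sf v"
 define b where "b = rep v"
 have m: "squarefree m" using sf(1)[OF v] by (simp add: m_def)
 have b: "b \<in> H" using rep_H[OF v] by (simp add: b_def)
 obtain s where s: "s \<in> \<rat> - {0}" "b = of_int m * s ^ 2" using rep_eq[OF v] by (metis b_def m_def)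
 define P where "P = odd_primes_of m"
 obtain e where e: "e \<in> {1, -1, 2, -2}" "m = e * (\<Prod>p\<in>P. pstar p)" "finite P" "(\<Prod>p\<in>P. pstar p) mod 4 = 1"
  using squarefree_pstar_decomposition[OF m] by (metis P_def odd_primes_of_def)
 have P: "P \<subseteq> primes" "\<And>p. p \<in> P ==> odd p" by (auto simp: P_def odd_primes_of_def primes_def)
 have P2: "2 \<notin> P" using P(2) by fastforce
 define m' where "m' = (\<Prod>p\<in>P. pstar p)"
 have m': "m = e * m'" "m' mod 4 = 1" using e by (auto simp: m'_def)
 have sqf: "squarefree m'" using m m'(1) by (metis dvd_triv_right squarefree_mono)
 have oddm': "odd m'" using m'(2) by presburger
 have beq: "b = of_int (e * m') * s ^ 2" using s(2) m'(1) by simp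
 have P_empty: "P = {}" if "m' = 1"
 proof (rule ccontr)
  assume "P ~= {}"
  then obtain q where q: "q \<in> P" by blast
  then have "pstar q dvd m'" unfolding m'_def using e(3) by (intro dvd_prodI) auto
  then have "\<bar>pstar q\<bar> = 1" using \<open>m' = 1\<close> by simp
  moreover have "\<bar>pstar q\<bar> = int q" by (simp add: pstar_def abs_mult power_abs)
  ultimately show False using P(1) q prime_gt_1_nat by (force simp: primes_def)
 qed
 let ?f = "local_factor (csqrt b) e"
 note two = local_two[OF b e(1) sqf oddm' beq s(1)]
 have L: "finite (insert 2 P)" "insert 2 P \<subseteq> primes" using e(3) P(1) two_prime by auto
 have cases: "p = 2 \<or> p \<in> primes \<and> odd p" if "p \<in> insert 2 P" for p using that P by auto
 have meas: "?f p \<in> borel_measurable (\<nu> p)" if "p \<in> insert 2 P" for p using cases[OF that] two(1) local_odd(1) by blast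
 have bound: "norm (?f p \<xi>) \<le> 1" if "p \<in> insert 2 P" "\<xi> \<in> carrier (Ap_group \<Gamma> p)" for p \<xi>
  using cases[OF that(1)] two(2) local_odd(2) that(2) by blast
 have chi: "chi (csqrt b) (J \<omega>) = (\<Prod>p\<in>insert 2 P. ?f p (\<omega> p))" if "\<omega> \<in> space \<Omega>" for \<omega>
  by (rule chi_J[OF b e(3) P e(1) beq[unfolded m'_def] s(1) that])
 have int: "integrable (\<nu> p) (?f p)" if p: "p \<in> insert 2 P" for p
 proof -
  have pp: "p \<in> primes" using p L(2) by blast
  interpret q: primary_part \<Gamma> p "\<nu> p" by (rule primary[OF pp])
  show ?thesis
  proof (rule q.integrable_const_bound[where B = 1])
   show "AE \<xi> in \<nu> p. norm (?f p \<xi>) \<le> 1" using bound[OF p] space_\<nu>[OF pp] by (intro AE_I2) simp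
  qed (rule meas[OF p])
 qed
 have "(\<integral>\<omega>. chi (csqrt b) (J \<omega>) \<partial>\<Omega>) = (\<integral>\<omega>. (\<Prod>p\<in>insert 2 P. ?f p (\<omega> p)) \<partial>\<Omega>)"
  by (rule Bochner_Integration.integral_cong[OF refl chi])
 also have "... = (\<Prod>p\<in>insert 2 P. \<integral>\<xi>. ?f p \<xi> \<partial>\<nu> p)" by (rule finite_product_integral[OF L int])
 also have "... = (if \<bar>e\<bar> = 1 \<and> m' = 1 then 1 else 0) * (\<Prod>p\<in>P. 0)"
  using e(3) P2 two(3) local_odd(3) P by (simp add: subset_iff)
 also have "... = (if \<bar>m\<bar> = 1 then 1 else 0)"
 proof -
  have "\<bar>m\<bar> = 1 \<longleftrightarrow> \<bar>e\<bar> = 1 \<and> m' = 1"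
   unfolding m'(1) abs_mult using m'(2) by (auto simp: zmult_eq_1_iff abs_if split: if_splits)
  moreover have "(\<Prod>p\<in>P. 0 :: complex) = 1" if "m' = 1" using P_empty[OF that] by simp
  ultimately show ?thesis by simp
 qed
 finally show "(\<integral>\<omega>. chi (csqrt (rep v)) (J \<omega>) \<partial>\<Omega>) = (if \<bar>sf v\<bar> = 1 then 1 else 0)"
  by (simp add: b_def m_def)
 let ?c = "\<lambda>p. measure (\<nu> p) (Sp_set \<Gamma> p)" and ?d = "\<lambda>p. real (M_degree \<Gamma> p)"
 have dne: "?d p ~= 0" "?d p ~= 1" if "p \<in> primes" for p using M_degree(3)[OF that] nondeg[OF that] by auto
 have cnz: "?c p ~= 0" if "p \<in> primes" for p using M_degree(2)[OF that] dne[OF that] by simp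
 \<comment> \<open>Here the denominators [M_p:Q] - 1 arise, from dividing -1/[M_p:Q] by the local
   mass 1 - 1/[M_p:Q].\<close>
 have quot: "- (1 / ?d p) / ?c p = - 1 / (?d p - 1)" if "p \<in> primes" for p using M_degree(2)[OF that] dne[OF that] by (simp add: field_simps)
 have "(\<integral>\<omega>. indicator S' \<omega> * chi (csqrt b) (J \<omega>) \<partial>\<Omega>) =
   (\<integral>\<omega>. indicator S' \<omega> * (\<Prod>p\<in>insert 2 P. ?f p (\<omega> p)) \<partial>\<Omega>)"
  by (rule Bochner_Integration.integral_cong[OF refl]) (simp only: chi)
 also have "... = (\<Prod>p\<in>insert 2 P. local_integral p (?f p) / complex_of_real (?c p)) * complex_of_real (measure \<Omega> S')"
  by (rule integral_S'[OF L meas bound]) (use cnz L(2) in auto)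
 also have "(\<Prod>p\<in>insert 2 P. local_integral p (?f p) / complex_of_real (?c p)) =
   local_integral 2 (?f 2) / complex_of_real (?c 2) * (\<Prod>p\<in>P. local_integral p (?f p) / complex_of_real (?c p))" using e(3) P2 by simp
 also have "(\<Prod>p\<in>P. local_integral p (?f p) / complex_of_real (?c p)) =
   complex_of_real (\<Prod>p\<in>P. - 1 / (?d p - 1))" unfolding of_real_prod
 proof (rule prod.cong[OF refl])
  fix p assume "p \<in> P"
  then have p: "p \<in> primes" "odd p" using P by auto
  have "local_integral p (?f p) / complex_of_real (?c p) = complex_of_real (- (1 / ?d p) / ?c p)" unfolding local_odd(4)[OF p] by simp
  then show "local_integral p (?f p) / complex_of_real (?c p) = complex_of_real (- 1 / (?d p - 1))" unfolding quot[OF p(1)] .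
 qed
 also have "local_integral 2 (?f 2) / complex_of_real (?c 2) =
   complex_of_real (if \<bar>e\<bar> ~= 1 then 0 else if m' = 1 then 1
    else if pclass 2 (of_int m') \<in> power_classes \<Gamma> 2 then - 1 / (?d 2 - 1) else 0)"
  unfolding two(4) quot[OF two_prime, symmetric] using cnz[OF two_prime] by simp
 finally have I: "(\<integral>\<omega>. indicator S' \<omega> * chi (csqrt b) (J \<omega>) \<partial>\<Omega>) =
  complex_of_real ((if \<bar>e\<bar> ~= 1 then 0 else if m' = 1 then 1
    else if pclass 2 (of_int m') \<in> power_classes \<Gamma> 2 then - 1 / (?d 2 - 1) else 0) *
   (\<Prod>p\<in>P. - 1 / (?d p - 1)) * measure \<Omega> S')" by simp
 have one_class: "pclass 2 1 \<in> power_classes \<Gamma> 2" using mgrp_one[OF \<Gamma>(1)] by (auto simp: power_classes_def)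
 have "class_weight v = (if \<bar>e\<bar> ~= 1 then 0 else if m' = 1 then 1
    else if pclass 2 (of_int m') \<in> power_classes \<Gamma> 2 then - 1 / (?d 2 - 1) else 0) * (\<Prod>p\<in>P. - 1 / (?d p - 1))"
 proof (cases "\<bar>e\<bar> = 1")
  case False
  then have "even m" using e(1) m'(1) by auto
  then show ?thesis using False by (simp add: class_weight_def flip: m_def)
 next
  case True
  then have e1: "e = 1 \<or> e = - 1" by auto
  have "odd m" using e1 oddm' m'(1) by auto
  have om: "one_mod_four m = m'"
  proof (cases "e = 1")
   case True
   then show ?thesis using m' by (simp add: one_mod_four_def)
  next
   case False
   then have "m = - m'" using e1 m'(1) by simp
   moreover have "(- m') mod 4 ~= 1" using m'(2) by presburger
   ultimately show ?thesis by (simp add: one_mod_four_def)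
  qed
  have "{p. p \<in> primes \<and> int p dvd 2 * m'} = insert 2 P"
  proof (intro equalityI subsetI)
   fix p assume "p \<in> {p. p \<in> primes \<and> int p dvd 2 * m'}"
   then have p: "Factorial_Ring.prime p" "int p dvd 2 * m'" by (auto simp: primes_def)
   show "p \<in> insert 2 P"
   proof (cases "p = 2")
    case False
    then have "odd p" using p(1) primes_dvd_imp_eq two_is_prime_nat by blast
    moreover have "int p dvd 2 \<or> int p dvd m'" using p prime_dvd_mult_iff[of "int p"] by simp
    moreover have "\<not> int p dvd 2"
    proof
     assume "int p dvd 2"
     then have "p dvd 2" by (metis int_dvd_int_iff of_nat_numeral)
     then show False using False p(1) primes_dvd_imp_eq two_is_prime_nat by blast
    qed
    ultimately have "odd p" "int p dvd m" using m'(1) by auto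
    then show ?thesis using p(1) by (simp add: P_def odd_primes_of_def)
   qed simp
  next
   fix p assume p: "p \<in> insert 2 P"
   have "int p dvd 2 * m'" if "p \<in> P"
   proof -
    have "int p dvd m" using that by (simp add: P_def odd_primes_of_def)
    then have "int p dvd m'" using e1 m'(1) by auto
    then show ?thesis by simp
   qed
   then show "p \<in> {p. p \<in> primes \<and> int p dvd 2 * m'}" using p L(2) by auto
  qed
  then have "weight m' = (if m' = 1 then 1 else - 1 / (?d 2 - 1) * (\<Prod>p\<in>P. - 1 / (?d p - 1)))" using e(3) P2 by (simp add: weight_def)
  then show ?thesis using True \<open>odd m\<close> om one_class P_empty by (simp add: class_weight_def flip: m_def)
 qed
 then show "(\<integral>\<omega>. indicator S' \<omega> * chi (csqrt (rep v)) (J \<omega>) \<partial>\<Omega>) =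
   complex_of_real (class_weight v * measure \<Omega> S')" using I by (simp only: b_def)
qed

lemma uminus_class_V:
 assumes "v \<in> V" shows "pclass 2 (of_int (- sf v)) \<in> V"
proof -
 obtain s where s: "s \<in> \<rat> - {0}" "rep v = of_int (sf v) * s ^ 2" using rep_eq[OF assms] .
 have "- 1 * rep v \<in> H" by (rule mgrp_mult[OF mgrp_H minus_one_H rep_H[OF assms]])
 moreover have "pclass 2 (- 1 * rep v) = pclass 2 (of_int (- sf v))" using sf(1)[OF assms] s by (intro pclass_squarefree) auto
 ultimately show ?thesis unfolding V_def power_classes_def by (metis imageI)
qed

definition N :: "complex set set"
 where "N = {v \<in> power_classes \<Gamma> 2. sf v mod 4 = 1}"

text \<open>The classes of \<open>m\<close> and \<open>- m\<close> carry the same weight, which accounts for the factor 2.\<close>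

lemma sum_class_weight: "(\<Sum>v\<in>V. class_weight v) = 2 * (\<Sum>v\<in>N. weight (sf v))"
proof -
 define V1 where "V1 = {v \<in> V. sf v mod 4 = 1}"
 define V3 where "V3 = {v \<in> V. sf v mod 4 ~= 1}"
 define N' where "N' = {v \<in> V. sf v mod 4 = 3 \<and> pclass 2 (of_int (- sf v)) \<in> power_classes \<Gamma> 2}"
 have "(\<Sum>v\<in>V. class_weight v) = (\<Sum>v\<in>V1. class_weight v) + (\<Sum>v\<in>V3. class_weight v)"
  using finite_V by (subst sum.union_disjoint[symmetric]) (auto simp: V1_def V3_def intro!: sum.cong)
 also have "(\<Sum>v\<in>V1. class_weight v) = (\<Sum>v\<in>N. weight (sf v))"
 proof (rule sum.mono_neutral_cong_right)
  show "finite V1" using finite_V by (simp add: V1_def)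
  show "N \<subseteq> V1" using power_classes_subset_V by (auto simp: N_def V1_def)
  show "\<forall>v\<in>V1 - N. class_weight v = 0" using sf(2) by (auto simp: V1_def N_def class_weight_def one_mod_four_def)
  fix v assume "v \<in> N"
  then have v: "v \<in> power_classes \<Gamma> 2" "sf v mod 4 = 1" by (auto simp: N_def)
  then have "odd (sf v)" by presburger
  then show "class_weight v = weight (sf v)" using v sf(2)[of v] power_classes_subset_V by (auto simp: class_weight_def one_mod_four_def)
 qed
 also have "(\<Sum>v\<in>V3. class_weight v) = (\<Sum>v\<in>N'. weight (- sf v))"
 proof (rule sum.mono_neutral_cong_right)
  show "finite V3" using finite_V by (simp add: V3_def)
  show "N' \<subseteq> V3" by (auto simp: N'_def V3_def)
  show "\<forall>v\<in>V3 - N'. class_weight v = 0"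
  proof
   fix v assume v: "v \<in> V3 - N'"
   show "class_weight v = 0"
   proof (cases "odd (sf v)")
    case True
    then have "sf v mod 4 = 3" using v by (auto simp: V3_def) presburger
    then show ?thesis using v by (auto simp: V3_def N'_def class_weight_def one_mod_four_def)
   qed (simp add: class_weight_def)
  qed
  fix v assume "v \<in> N'"
  then have v: "sf v mod 4 = 3" "pclass 2 (of_int (- sf v)) \<in> power_classes \<Gamma> 2" by (auto simp: N'_def)
  then have "odd (sf v)" by presburger
  then show "class_weight v = weight (- sf v)" using v by (simp add: class_weight_def one_mod_four_def)
 qed
 also have "(\<Sum>v\<in>N'. weight (- sf v)) = (\<Sum>v\<in>N. weight (sf v))"
 proof -
  define neg where "neg v = pclass 2 (of_int (- sf v) :: complex)" for v
  have neg: "neg v \<in> V" "sf (neg v) = - sf v" "neg (neg v) = v" if "v \<in> V" for v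
  proof -
   show "neg v \<in> V" unfolding neg_def by (rule uminus_class_V[OF that])
   then show "sf (neg v) = - sf v" unfolding neg_def using sf(1)[OF that] by (intro sf_pclass) simp_all
   then show "neg (neg v) = v" using sf(2)[OF that] unfolding neg_def[of "neg v"] by simp
  qed
  have NV: "N \<subseteq> V" using power_classes_subset_V by (auto simp: N_def)
  have N'V: "N' \<subseteq> V" by (auto simp: N'_def)
  show ?thesis
  proof (rule sum.reindex_bij_witness[where i = neg and j = neg])
   fix v assume v: "v \<in> N'"
   then have vV: "v \<in> V" using N'V by blast
   show "neg (neg v) = v" by (rule neg(3)[OF vV])
   have "sf v mod 4 = 3" using v by (simp add: N'_def)
   then have "(- sf v) mod 4 = 1" by presburger
   then show "neg v \<in> N" using v neg(2)[OF vV] by (simp add: N_def N'_def neg_def)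
   show "weight (sf (neg v)) = weight (- sf v)" using neg(2)[OF vV] by simp
  next
   fix v assume v: "v \<in> N"
   then have vV: "v \<in> V" using NV by blast
   show "neg (neg v) = v" by (rule neg(3)[OF vV])
   have "sf v mod 4 = 1" using v by (simp add: N_def)
   then have "(- sf v) mod 4 = 3" by presburger
   moreover have "pclass 2 (of_int (- sf (neg v))) \<in> power_classes \<Gamma> 2" using v sf(2)[OF vV] neg(2)[OF vV] by (simp add: N_def)
   ultimately show "neg v \<in> N'" using neg(1,2)[OF vV] by (simp add: N'_def)
  qed
 qed
 finally show ?thesis by simp
qed

text \<open>Only the classes of 1 and -1 count; thus the measure of the Galois group is 2 divided by
  the number of square classes in \<open>V\<close>.\<close>

lemma sum_trivial_classes: "(\<Sum>v\<in>V. if \<bar>sf v\<bar> = 1 then 1 else 0 :: complex) = 2"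
proof -
 let ?u = "pclass 2 (of_int 1)" and ?v = "pclass 2 (of_int (- 1))"
 have u: "?u \<in> V" unfolding V_def power_classes_def using mgrp_one[OF mgrp_H] by simp
 have v: "?v \<in> V" unfolding V_def power_classes_def using minus_one_H by simp
 have sq: "squarefree (1 :: int)" "squarefree (- 1 :: int)" by simp_all
 have "?u ~= ?v" using pclass_squarefree_eq_iff[OF sq] by simp
 have "{v \<in> V. \<bar>sf v\<bar> = 1} = {?u, ?v}"
 proof (intro equalityI subsetI)
  fix w assume "w \<in> {v \<in> V. \<bar>sf v\<bar> = 1}"
  then have w: "w \<in> V" "sf w = 1 \<or> sf w = - 1" by auto
  from w(2) show "w \<in> {?u, ?v}"
  proof
   assume s: "sf w = 1"
   show ?thesis using sf(2)[OF w(1)] unfolding s by (simp only: insert_iff simp_thms)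
  next
   assume s: "sf w = - 1"
   show ?thesis using sf(2)[OF w(1)] unfolding s by (simp only: insert_iff simp_thms)
  qed
 next
  fix w assume "w \<in> {?u, ?v}"
  then have "w = ?u \<or> w = ?v" by (simp only: insert_iff empty_iff simp_thms)
  then show "w \<in> {v \<in> V. \<bar>sf v\<bar> = 1}"
  proof
   assume w: "w = ?u"
   show ?thesis unfolding w mem_Collect_eq sf_pclass[OF sq(1) u] using u by simp
  next
   assume w: "w = ?v"
   show ?thesis unfolding w mem_Collect_eq sf_pclass[OF sq(2) v] using v by simp
  qed
 qed
 moreover have "(\<Sum>v\<in>V. if \<bar>sf v\<bar> = 1 then 1 else 0 :: complex) = of_nat (card {v \<in> V. \<bar>sf v\<bar> = 1})"
  using finite_V by (simp add: sum.If_cases Int_def)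
 ultimately show ?thesis using \<open>?u ~= ?v\<close> by simp
qed

text \<open>The degree \<open>(p - 1) * card (power_classes \<Gamma> p)\<close> is 1 only if
  \<open>p = 2\<close> and all of \<Gamma> lies in one square class, that of 1.\<close>

lemma M_degree_nondegenerate:
 assumes "\<not> \<Gamma> \<subseteq> rat_powers 2" "p \<in> primes" shows "M_degree \<Gamma> p ~= 1"
proof -
 interpret q: primary_part \<Gamma> p "\<nu> p" by (rule primary[OF assms(2)])
 have M: "M_degree \<Gamma> p = (p - 1) * card (power_classes \<Gamma> p)" by (rule M_degree_eq[OF \<Gamma> q.p q.finite_classes])
 show ?thesis
 proof (cases "p = 2")
  case True
  obtain c where c: "c \<in> \<Gamma>" "c \<notin> rat_powers 2" using assms(1) by blast
  then have "pclass 2 c ~= pclass 2 1" using pclass_eq_iff[of c 1 2] mgrp_nonzero[OF \<Gamma>(1) c(1)] by simp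
  moreover have "{pclass 2 c, pclass 2 1} \<subseteq> power_classes \<Gamma> 2" using c(1) mgrp_one[OF \<Gamma>(1)] by (auto simp: power_classes_def)
  ultimately have "card (power_classes \<Gamma> 2) ~= 1"
   using card_mono[of "power_classes \<Gamma> 2" "{pclass 2 c, pclass 2 1}"] q.finite_classes True by auto
  then show ?thesis using M True by simp
 next
  case False
  then have "p - 1 ~= 1" using q.p_ge(2) by simp
  then show ?thesis using M by simp
 qed
qed

lemma one_class: "\<one>\<^bsub>rat_units Mod rat_powers 2\<^esub> = pclass 2 (of_int 1)" by (simp add: FactGroup_def pclass_eq)

text \<open>The factors 2 from \<open>sum_class_weight\<close> and
  \<open>sum_trivial_classes\<close> cancel. For squarefree \<open>m ~= 1\<close> the discriminant
  is \<open>m\<close> or \<open>4 * m\<close>, so the congruence condition on it selects the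
  \<open>m\<close> congruent to 1 modulo 4, where it equals \<open>m\<close>.\<close>

theorem density_G:
 assumes nt: "\<not> \<Gamma> \<subseteq> rat_powers 2"
 shows "measure (A_measure \<Gamma> \<nu>) (G_subgroup \<Gamma> \<inter> S_set \<Gamma>) / measure (A_measure \<Gamma> \<nu>) (G_subgroup \<Gamma>) =
  (1 + (\<Sum>b | b \<in> power_classes \<Gamma> 2 - {\<one>\<^bsub>rat_units Mod rat_powers 2\<^esub>} \<and> class_disc b mod 4 = 1.
    \<Prod>p | p \<in> primes \<and> int p dvd 2 * class_disc b. - 1 / (real (M_degree \<Gamma> p) - 1))) *
  measure (A_measure \<Gamma> \<nu>) (S_set \<Gamma>)"
proof -
 note I = character_integrals[OF _ M_degree_nondegenerate[OF nt]]
 let ?\<mu> = "measure (A_measure \<Gamma> \<nu>)"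
 have A: "A \<in> sets (borel_on T)" using sets.top[of "borel_on T"] space_T by simp
 have GA: "G_subgroup \<Gamma> \<inter> A = G_subgroup \<Gamma>" using G_subgroup_eq[OF \<Gamma>] by blast
 have JA: "J -` A \<inter> space \<Omega> = space \<Omega>" using J_in by auto
 have "of_nat (card V) * complex_of_real (?\<mu> (G_subgroup \<Gamma>)) =
   (\<Sum>v\<in>V. \<integral>\<omega>. indicator (space \<Omega>) \<omega> * chi (csqrt (rep v)) (J \<omega>) \<partial>\<Omega>)"
  using measure_G_eq_sum[OF A] unfolding GA JA .
 also have "... = (\<Sum>v\<in>V. if \<bar>sf v\<bar> = 1 then 1 else 0)"
 proof (rule sum.cong[OF refl])
  fix v assume v: "v \<in> V"
  have "(\<integral>\<omega>. indicator (space \<Omega>) \<omega> * chi (csqrt (rep v)) (J \<omega>) \<partial>\<Omega>) = (\<integral>\<omega>. chi (csqrt (rep v)) (J \<omega>) \<partial>\<Omega>)"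
   by (rule Bochner_Integration.integral_cong) simp_all
  then show "(\<integral>\<omega>. indicator (space \<Omega>) \<omega> * chi (csqrt (rep v)) (J \<omega>) \<partial>\<Omega>) = (if \<bar>sf v\<bar> = 1 then 1 else 0)"
   using I(1)[OF v] by simp
 qed
 also have "... = 2" by (rule sum_trivial_classes)
 finally have "complex_of_real (real (card V) * ?\<mu> (G_subgroup \<Gamma>)) = complex_of_real 2" by simp
 then have 1: "real (card V) * ?\<mu> (G_subgroup \<Gamma>) = 2" by (simp only: of_real_eq_iff)
 have "of_nat (card V) * complex_of_real (?\<mu> (G_subgroup \<Gamma> \<inter> S_set \<Gamma>)) =
   (\<Sum>v\<in>V. \<integral>\<omega>. indicator S' \<omega> * chi (csqrt (rep v)) (J \<omega>) \<partial>\<Omega>)"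
  using measure_G_eq_sum[OF S_sets] unfolding S_vimage .
 also have "... = (\<Sum>v\<in>V. complex_of_real (class_weight v * measure \<Omega> S'))" by (rule sum.cong[OF refl]) (rule I(2))
 also have "... = complex_of_real ((\<Sum>v\<in>V. class_weight v) * measure \<Omega> S')" by (simp add: sum_distrib_right)
 finally have "complex_of_real (real (card V) * ?\<mu> (G_subgroup \<Gamma> \<inter> S_set \<Gamma>)) =
  complex_of_real ((\<Sum>v\<in>V. class_weight v) * measure \<Omega> S')" by simp
 then have 2: "real (card V) * ?\<mu> (G_subgroup \<Gamma> \<inter> S_set \<Gamma>) = 2 * (\<Sum>v\<in>N. weight (sf v)) * ?\<mu> (S_set \<Gamma>)"
  unfolding of_real_eq_iff sum_class_weight measure_S .
 have card0: "real (card V) ~= 0" using card_V by simp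
 have "?\<mu> (G_subgroup \<Gamma> \<inter> S_set \<Gamma>) / ?\<mu> (G_subgroup \<Gamma>) =
   (real (card V) * ?\<mu> (G_subgroup \<Gamma> \<inter> S_set \<Gamma>)) / (real (card V) * ?\<mu> (G_subgroup \<Gamma>))" using card0 by simp
 also have "... = (\<Sum>v\<in>N. weight (sf v)) * ?\<mu> (S_set \<Gamma>)" unfolding 1 2 by simp
 also have "(\<Sum>v\<in>N. weight (sf v)) = 1 + (\<Sum>b | b \<in> power_classes \<Gamma> 2 - {\<one>\<^bsub>rat_units Mod rat_powers 2\<^esub>} \<and> class_disc b mod 4 = 1.
    \<Prod>p | p \<in> primes \<and> int p dvd 2 * class_disc b. - 1 / (real (M_degree \<Gamma> p) - 1))"
 proof -
  let ?u = "pclass 2 (of_int 1)"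
  have uG: "?u \<in> power_classes \<Gamma> 2" using mgrp_one[OF \<Gamma>(1)] by (auto simp: power_classes_def)
  have "squarefree (1 :: int)" by simp
  then have sfu: "sf ?u = 1" using uG power_classes_subset_V by (intro sf_pclass) auto
  have uN: "?u \<in> N" using uG sfu by (simp add: N_def)
  have finN: "finite N" using finite_V power_classes_subset_V by (auto simp: N_def intro: finite_subset)
  have disc: "sf v ~= 1 \<and> class_disc v = (if sf v mod 4 = 1 then sf v else 4 * sf v)"
   if v: "v \<in> power_classes \<Gamma> 2 - {?u}" for v
  proof -
   have vV: "v \<in> V" using v power_classes_subset_V by blast
   have "sf v ~= 1" using sf(2)[OF vV] v by (metis DiffD2 singletonI)
   then show ?thesis using class_disc_squarefree[OF sf(1)[OF vV]] sf(2)[OF vV] by simp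
  qed
  have set_eq: "{b. b \<in> power_classes \<Gamma> 2 - {?u} \<and> class_disc b mod 4 = 1} = N - {?u}"
  proof (rule Set.set_eqI)
   fix b
   show "b \<in> {b. b \<in> power_classes \<Gamma> 2 - {?u} \<and> class_disc b mod 4 = 1} \<longleftrightarrow> b \<in> N - {?u}"
   proof (cases "b \<in> power_classes \<Gamma> 2 - {?u}")
    case True
    then show ?thesis using disc[OF True] by (cases "sf b mod 4 = 1") (simp_all add: N_def)
   next
    case False
    then show ?thesis unfolding N_def by blast
   qed
  qed
  have "(\<Sum>v\<in>N. weight (sf v)) = weight (sf ?u) + (\<Sum>v\<in>N - {?u}. weight (sf v))" by (rule sum.remove[OF finN uN])
  moreover have "(\<Sum>v\<in>N - {?u}. weight (sf v)) = (\<Sum>b\<in>N - {?u}.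
    \<Prod>p | p \<in> primes \<and> int p dvd 2 * class_disc b. - 1 / (real (M_degree \<Gamma> p) - 1))"
  proof (rule sum.cong[OF refl])
   fix b assume b: "b \<in> N - {?u}"
   then have "sf b ~= 1" "class_disc b = sf b" using disc[of b] by (auto simp: N_def)
   then show "weight (sf b) = (\<Prod>p | p \<in> primes \<and> int p dvd 2 * class_disc b. - 1 / (real (M_degree \<Gamma> p) - 1))"
    by (simp add: weight_def)
  qed
  ultimately show ?thesis unfolding one_class set_eq by (simp add: weight_def sfu[simplified] cong: if_cong)
 qed
 finally show ?thesis .
qed

lemma S_nonempty:
 assumes nt: "\<not> \<Gamma> \<subseteq> rat_powers 2" shows "S_set \<Gamma> ~= {}"
proof -
 have "Sp_set \<Gamma> p ~= {}" if p: "p \<in> primes" for p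
 proof
  assume "Sp_set \<Gamma> p = {}"
  then have "1 - 1 / real (M_degree \<Gamma> p) = 0" using M_degree(2)[OF p] by simp
  then show False using M_degree(3)[OF p] M_degree_nondegenerate[OF nt p] by (simp add: field_simps)
 qed
 then have "S' ~= {}" by (simp add: S'_def PiE_eq_empty_iff)
 then show ?thesis using S_vimage by auto
qed

text \<open>Positive rank gives at least \<open>p\<close> power classes for all large primes, so
  [M_p:Q] is at least \<open>(p - 1) * p\<close>, hence at least \<open>p ^ 2 / 2\<close>, and the
  product converges absolutely. Its value is the limit of the finite products, which is the measure
  of \<open>S'\<close>.\<close>

theorem density_S: "(\<lambda>p. if p \<in> primes then 1 - 1 / real (M_degree \<Gamma> p) else 1) has_prod
 measure (A_measure \<Gamma> \<nu>) (S_set \<Gamma>)"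
proof -
 define f where "f p = (if p \<in> primes then 1 - 1 / real (M_degree \<Gamma> p) else 1)" for p
 obtain x q where x: "x \<in> \<Gamma>" "Factorial_Ring.prime q" "rat_val q x ~= 0" using ex_nontrivial_valuation[OF \<Gamma> rank] by blast
 define n0 where "n0 = nat \<bar>rat_val q x\<bar> + 1"
 have small: "norm (f p - 1) \<le> 2 * inverse (real p ^ 2)" if p: "p \<ge> n0" for p
 proof (cases "p \<in> primes")
  case True
  interpret q: primary_part \<Gamma> p "\<nu> p" by (rule primary[OF True])
  have "int p > \<bar>rat_val q x\<bar>" using p by (simp add: n0_def)
  then have card: "card (power_classes \<Gamma> p) \<ge> p" by (rule card_power_classes_ge[OF \<Gamma> x q.p _ q.finite_classes])
  have p2: "real p \<ge> 2" using q.p_ge(2) by simp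
  have "real p ^ 2 / 2 \<le> (real p - 1) * real p"
  proof -
   have "0 \<le> real p * (real p - 2)" using p2 by simp
   then show ?thesis unfolding power2_eq_square left_diff_distrib right_diff_distrib by linarith
  qed
  also have "... \<le> real (M_degree \<Gamma> p)" unfolding M_degree(1)[OF True] using p2 card by (intro mult_left_mono) auto
  finally have le: "real p ^ 2 / 2 \<le> real (M_degree \<Gamma> p)" .
  have "norm (f p - 1) = 1 / real (M_degree \<Gamma> p)" using True by (simp add: f_def)
  also have "... \<le> 1 / (real p ^ 2 / 2)" by (rule frac_le) (use le p2 in auto)
  also have "... = 2 * inverse (real p ^ 2)" by (simp add: field_simps)
  finally show ?thesis .
 qed (simp add: f_def)
 have "summable (\<lambda>p. 2 * inverse (real p ^ 2))" by (intro summable_mult inverse_power_summable) simp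
 then have "summable (\<lambda>p. norm (f p - 1))"
  by (rule summable_comparison_test_ev[rotated]) (use small in \<open>auto simp: eventually_sequentially\<close>)
 then have conv: "convergent_prod f" by (intro abs_convergent_prod_imp_convergent_prod summable_imp_abs_convergent_prod)
 have "(\<Prod>p\<le>n. f p) = (\<Prod>p\<in>primes \<inter> {..n}. measure (\<nu> p) (Sp_set \<Gamma> p))" for n
 proof -
  have "(\<Prod>p\<le>n. f p) = (\<Prod>p\<in>primes \<inter> {..n}. f p)" by (rule prod.mono_neutral_right) (auto simp: f_def)
  also have "... = (\<Prod>p\<in>primes \<inter> {..n}. measure (\<nu> p) (Sp_set \<Gamma> p))" by (rule prod.cong) (auto simp: f_def M_degree(2))
  finally show ?thesis .
 qed
 then have "prodinf f = measure \<Omega> S'" using LIMSEQ_unique[OF convergent_prod_LIMSEQ[OF conv]] measure_S'_limit by simp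
 then have "f has_prod measure (A_measure \<Gamma> \<nu>) (S_set \<Gamma>)" using convergent_prod_has_prod[OF conv] measure_S by simp
 then show ?thesis by (simp add: f_def[abs_def])
qed

end

theorem theorem4p6:
  fixes \<Gamma> :: "complex set"
    and \<nu>\<^sub>p :: "nat \<Rightarrow> (complex \<Rightarrow> complex) measure"
  assumes "subgroup \<Gamma> rat_units"
    and "finitely_generated \<Gamma>"
    and "mult_rank \<Gamma> > 0"
    and "\<And>p. p \<in> primes \<Longrightarrow>
      haar_measure (Ap_group \<Gamma> p) (rat_aut_topology (p_root_closure \<Gamma> p)) (\<nu>\<^sub>p p)"
    and "\<And>p. p \<in> primes \<Longrightarrow> emeasure (\<nu>\<^sub>p p) (carrier (Ap_group \<Gamma> p)) = 1"
  shows
    "(\<lambda>p. if p \<in> primes then 1 - 1 / real (M_degree \<Gamma> p) else 1) has_prod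
        (measure (A_measure \<Gamma> \<nu>\<^sub>p) (S_set \<Gamma>) /
         measure (A_measure \<Gamma> \<nu>\<^sub>p) (carrier (A_group \<Gamma>)))
     \<and> (\<lambda>p. if p \<in> primes then 1 - 1 / ((real p - 1) * real (card (power_classes \<Gamma> p))) else 1) has_prod
        (measure (A_measure \<Gamma> \<nu>\<^sub>p) (S_set \<Gamma>) /
         measure (A_measure \<Gamma> \<nu>\<^sub>p) (carrier (A_group \<Gamma>)))
     \<and> (\<not> \<Gamma> \<subseteq> rat_powers 2 \<longrightarrow>
          S_set \<Gamma> \<noteq> {} \<and>
          measure (A_measure \<Gamma> \<nu>\<^sub>p) (G_subgroup \<Gamma> \<inter> S_set \<Gamma>) /
            measure (A_measure \<Gamma> \<nu>\<^sub>p) (G_subgroup \<Gamma>) =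
          (1 + (\<Sum>b | b \<in> power_classes \<Gamma> 2 - {\<one>\<^bsub>rat_units Mod rat_powers 2\<^esub>} \<and>
                      class_disc b mod 4 = 1.
                 \<Prod>p | p \<in> primes \<and> int p dvd 2 * class_disc b.
                   -1 / (real (M_degree \<Gamma> p) - 1))) *
          (measure (A_measure \<Gamma> \<nu>\<^sub>p) (S_set \<Gamma>) /
           measure (A_measure \<Gamma> \<nu>\<^sub>p) (carrier (A_group \<Gamma>))))"
proof -
  interpret kummer_setting \<Gamma> \<nu>\<^sub>p
    by unfold_locales (use assms mgrp_of_subgroup in auto)
  have "(\<lambda>p. if p \<in> primes then 1 - 1 / ((real p - 1) * real (card (power_classes \<Gamma> p))) else 1) =
      (\<lambda>p. if p \<in> primes then 1 - 1 / real (M_degree \<Gamma> p) else 1)"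
    using M_degree(1) by (intro ext) (simp cong: if_cong)
  then show ?thesis using density_S density_G S_nonempty measure_A by simp
qed

end
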